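(* Consider a functional differential-algebraic system $$\begin{pmatrix} y_1^{(r_1)}(t) \\ \vdots \\ y_q^{(r_q)}(t) \end{pmatrix}=f_1\big(d_1(t),T_1(Y)(t)\big)+\Gamma_I\big(d_2(t),T_1(Y)(t)\big)u_I(t),$$ $$0=f_2\big(Y(t)\big)+f_3\big(d_3(t),(T_2y)(t)\big)+\Gamma_{II}\big(d_4(t),(T_2y)(t)\big)u_I(t)+f_4\big(d_5(t),(T_2y)(t)\big)u_{II}(t),\qquad y|_{[-h,0]}=y^0,$$ where $Y:=(y_1,\dots,y_1^{(r_1-1)},\dots,y_q,\dots,y_q^{(r_q-1)},y_{q+1},\dots,y_m)$, satisfying the system assumptions (A1)-(A5) listed in the context. Let the reference signal $y_{\rm ref}=(y_{{\rm ref},1},\dots,y_{{\rm ref},m})^\top$ satisfy $y_{{\rm ref},i}\in W^{r_i,\infty}(\mathbb{R}_{\ge0}\to\mathbb{R})$ for $i=1,\dots,q$ and $y_{{\rm ref},i}\in W^{1,\infty}(\mathbb{R}_{\ge0}\to\mathbb{R})$ for $i=q+1,\dots,m$, let $\varphi_I,\varphi_{II}\in\Phi_1$ and $\varphi_{ij}\in\Phi_{r_i-j}$ for $i=1,\dots,q$, $j=0,\dots,r_i-2$, and let $\hat k>0$ be such that $$\hat k>\alpha^{-1}\sup_{Z\in\mathbb{R}^{\bar r+m-q}}\left\|f_2'(Z)\begin{bmatrix} 0 \\ I_{m-q} \end{bmatrix}\right\|.$$ Then for any consistent initial value $y^0=(y_1^0,\dots,y_m^0)^\top$ with $y_i^0\in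 C^{r_i-1}([-h,0]\to\mathbb{R})$ for $i=1,\dots,q$ and $y_i^0\in C([-h,0]\to\mathbb{R})$ for $i=q+1,\dots,m$, such that the signals $e_I,e_{II},e_{ij}$ of the funnel controller (defined in the context) satisfy $$\varphi_I(0)\|e_I(0)\|<1,\quad \varphi_{II}(0)\|e_{II}(0)\|<1,\quad \varphi_{ij}(0)|e_{ij}(0)|<1\ \ (i=1,\dots,q,\ j=0,\dots,r_i-2),$$ the application of the funnel controller to the system yields a closed-loop initial value problem that has a solution, and every solution can be extended to a global solution. Furthermore, for every global solution $y(\cdot)$: 1. the input $u:\mathbb{R}_{\ge0}\to\mathbb{R}^m$ and the gain functions $k_I,k_{II},k_{ij}:\mathbb{R}_{\ge0}\to\mathbb{R}$, $i=1,\dots,q$, $j=0,\dots,r_i-2$, are bounded; 2. the functions $e_I:\mathbb{R}_{\ge0}\to\mathbb{R}^q$, $e_{II}:\mathbb{R}_{\ge0}\to\mathbb{R}^{m-q}$ and $e_{ij}:\mathbb{R}_{\ge0}\to\mathbb{R}$, $i=1,\dots,q$, $j=0,\dots,r_i-2$, evolve in their respective performance funnels, i.e. for all $i=1,\dots,q$, $j=0,\dots,r_i-2$ and all $t\ge0$, $$(t,e_I(t))\in\mathcal{F}^q_{\varphi_I},\quad (t,e_{II}(t))\in\mathcal{F}^{m-q}_{\varphi_{II}},\quad (t,e_{ij}(t))\in\mathcal{F}^1_{\varphi_{ij}}.$$ Furthermore, these signals are uniformly bounded away from the funnel boundaries in the following sense: $$\exists\,\varepsilon_I>0\ \forall\,t>0:\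 \|e_I(t)\|\le\varphi_I(t)^{-1}-\varepsilon_I,$$ $$\exists\,\varepsilon_{II}>0\ \forall\,t>0:\ \|e_{II}(t)\|\le\varphi_{II}(t)^{-1}-\varepsilon_{II},$$ $$\forall\,i=1,\dots,q,\ j=0,\dots,r_i-2\ \exists\,\varepsilon_{ij}>0\ \forall\,t>0:\ |e_{ij}(t)|\le\varphi_{ij}(t)^{-1}-\varepsilon_{ij}.$$ In particular, each error component $e_i(t)=y_i(t)-y_{{\rm ref},i}(t)$ evolves in the funnel $\mathcal{F}^1_{\varphi_{i0}}$ for $i=1,\dots,q$ (where $\varphi_{i0}:=\varphi_I$ if $r_i=1$), or $\mathcal{F}^1_{\varphi_{II}}$ for $i=q+1,\dots,m$, respectively, and stays uniformly away from its boundary.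
   Context: Notation: $\|\cdot\|$ is the Euclidean norm (and induced matrix norm). $W^{k,\infty}$ is the space of essentially bounded functions whose first $k$ weak derivatives exist and are essentially bounded. $h\ge0$, $m,k,s\in\mathbb{N}$, $q\in\{0,\dots,m\}$, $r_1,\dots,r_q\in\mathbb{N}$ (all $\ge1$), $\bar r:=r_1+\dots+r_q$. The output is $y=(y_1,\dots,y_m)^\top$, the input is $u=(u_I^\top,u_{II}^\top)^\top$ with $u_I=(u_1,\dots,u_q)^\top$, $u_{II}=(u_{q+1},\dots,u_m)^\top$. If $h=0$, the initial data are understood as prescribing $y_i(0),\dots,y_i^{(r_i-1)}(0)$ for $i\le q$ and $y_i(0)$ for $i>q$. Operator classes: $\mathbb{T}_{m,k,h}$ is the set of operators $T:C([-h,\infty)\to\mathbb{R}^m)\to L^\infty_{loc}(\mathbb{R}_{\ge0}\to\mathbb{R}^k)$ such that (i) $T$ is causal: for all $t\ge0$ and all $\zeta,\xi\in C([-h,\infty)\to\mathbb{R}^m)$, $\zeta|_{[-h,t)}=\xi|_{[-h,t)}$ implies $T(\zeta)|_{[0,t)}=T(\xi)|_{[0,t)}$; (ii) $T$ is locally Lipschitz: for all $t\ge0$ and $\xi\in C([-h,t]\to\mathbb{R}^m)$ there exist $\tau,\delta,c>0$ such that for all $\zeta_1,\zeta_2\in C([-h,\infty)\to\mathbb{R}^m)$ with $\zeta_i|_{[-h,t]}=\xi$ and $\|\zeta_i(\sigma)-\xi(t)\|<\delta$ for all $\sigma\in[t,t+\tau]$, $i=1,2$, one has $\|(T(\zeta_1)-T(\zeta_2))|_{[t,t+\tau]}\|_\infty\le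 c\|(\zeta_1-\zeta_2)|_{[t,t+\tau]}\|_\infty$; (iii) for all $c_1>0$ there exists $c_2>0$ such that for all $\zeta\in C([-h,\infty)\to\mathbb{R}^m)$: $\|\zeta|_{[-h,\infty)}\|_\infty\le c_1$ implies $\|T(\zeta)|_{[0,\infty)}\|_\infty\le c_2$. $\mathbb{T}^{\rm DAE}_{m,k,h}$ is the subclass of those $T\in\mathbb{T}_{m,k,h}$ mapping into $C^1(\mathbb{R}_{\ge0}\to\mathbb{R}^k)$ for which, additionally, (iv) there exist $z\in C(\mathbb{R}^m\times\mathbb{R}^k\to\mathbb{R}^k)$ and $\tilde T\in\mathbb{T}_{m,k,h}$ such that $\frac{d}{dt}(T\zeta)(t)=z(\zeta(t),(\tilde T\zeta)(t))$ for all $\zeta\in C([-h,\infty)\to\mathbb{R}^m)$ and all $t\ge0$. By causality such operators localize to operators on functions defined on $[-h,\omega)$ or $[-h,\omega]$ only; the same symbol is used for the localization. In particular, for $\omega=0$, $T_2$ localizes to a map $C([-h,0]\to\mathbb{R}^m)\to\mathbb{R}^k$, $y^0\mapsto T_2(y^0)$ (the value at $t=0$). System assumptions: (A1) $\Gamma_I\in C(\mathbb{R}^s\times\mathbb{R}^k\to\mathbb{R}^{q\times q})$ satisfies $\Gamma_I(d,\eta)+\Gamma_I(d,\eta)^\top>0$ (positive definite) for all $(d,\eta)\in\mathbb{R}^s\times\mathbb{R}^k$, and $\Gamma_{II}\in C^1(\mathbb{R}^s\times\mathbb{R}^k\to\mathbb{R}^{(m-q)\times q})$. (A2) $d_1,d_2\in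 L^\infty(\mathbb{R}_{\ge0}\to\mathbb{R}^s)$ and $d_3,d_4,d_5\in W^{1,\infty}(\mathbb{R}_{\ge0}\to\mathbb{R}^s)$. (A3) $f_1\in C(\mathbb{R}^s\times\mathbb{R}^k\to\mathbb{R}^q)$, $f_2\in C^1(\mathbb{R}^{\bar r+m-q}\to\mathbb{R}^{m-q})$, $f_3\in C^1(\mathbb{R}^s\times\mathbb{R}^k\to\mathbb{R}^{m-q})$, and $f_2'\begin{bmatrix} 0 \\ I_{m-q} \end{bmatrix}$ (the Jacobian of $f_2$ with respect to its last $m-q$ arguments) is bounded. (A4) $f_4\in C^1(\mathbb{R}^s\times\mathbb{R}^k\to\mathbb{R})$ and there exists $\alpha>0$ such that $f_4(d,v)\ge\alpha$ for all $(d,v)\in\mathbb{R}^s\times\mathbb{R}^k$; this $\alpha$ is the one used in the condition on $\hat k$. (A5) $T_1\in\mathbb{T}_{\bar r+m-q,k,h}$ and $T_2\in\mathbb{T}^{\rm DAE}_{m,k,h}$. Funnels: $\Phi_k$ is the set of $\varphi\in C^k(\mathbb{R}_{\ge0}\to\mathbb{R})$ such that $\varphi,\dot\varphi,\dots,\varphi^{(k)}$ are bounded, $\varphi(\tau)>0$ for all $\tau>0$, and $\liminf_{\tau\to\infty}\varphi(\tau)>0$ ($\varphi(0)=0$ is allowed). The performance funnel is $\mathcal{F}^d_\varphi:=\{(t,e)\in\mathbb{R}_{\ge0}\times\mathbb{R}^d:\varphi(t)\|e\|<1\}$, with boundary $\varphi(t)^{-1}$. Funnel controller: for $i=1,\dots,q$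 set $e_{i0}(t)=e_i(t)=y_i(t)-y_{{\rm ref},i}(t)$ and recursively $e_{i,j+1}(t)=\dot e_{ij}(t)+k_{ij}(t)e_{ij}(t)$ with $k_{ij}(t)=\dfrac{1}{1-\varphi_{ij}(t)^2|e_{ij}(t)|^2}$ for $j=0,\dots,r_i-2$. For $i=q+1,\dots,m$ set $e_i(t)=y_i(t)-y_{{\rm ref},i}(t)$. Put $e_I(t)=(e_{1,r_1-1}(t),\dots,e_{q,r_q-1}(t))^\top$, $e_{II}(t)=(e_{q+1}(t),\dots,e_m(t))^\top$, $$k_I(t)=\frac{1}{1-\varphi_I(t)^2\|e_I(t)\|^2},\qquad k_{II}(t)=\frac{\hat k}{1-\varphi_{II}(t)^2\|e_{II}(t)\|^2},$$ and $u_I(t)=-k_I(t)e_I(t)$, $u_{II}(t)=-k_{II}(t)e_{II}(t)$. Consistent initial value: $y^0$ is consistent for the closed-loop system if $$f_2\big(y_1^0(0),\dots,(\tfrac{d}{dt})^{r_1-1}y_1^0(0),\dots,(\tfrac{d}{dt})^{r_q-1}y_q^0(0),y_{q+1}^0(0),\dots,y_m^0(0)\big)+f_3(d_3(0),T_2(y^0))+\Gamma_{II}(d_4(0),T_2(y^0))u_I(0)+f_4(d_5(0),T_2(y^0))u_{II}(0)=0,$$ where $u_I(0),u_{II}(0)$ are given by the funnel controller evaluated at $t=0$ with the data $y^0$. Solutions: a solution of the closed-loop system on $[-h,\omega)$, $\omega\in(0,\infty]$, is a function $y=(y_1,\dots,y_m)^\top$ with $y|_{[-h,0]}=y^0$ such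 that $y_i\in C^{r_i-1}([-h,\omega)\to\mathbb{R})$ and $y_i^{(r_i-1)}|_{[0,\omega)}$ is weakly differentiable for $i=1,\dots,q$, $y_i\in C([-h,\omega)\to\mathbb{R})$ and $y_i|_{[0,\omega)}$ is weakly differentiable for $i=q+1,\dots,m$, and $y$ satisfies the differential-algebraic equations of the system, with $u$ given by the funnel controller, in the weak sense. It is global if $\omega=\infty$. *)

theory Defs
  imports "HOL-Analysis.Analysis"
begin

section \<open>Function spaces on half-open time intervals\<close>

text \<open>
  Signals on \<open>[a, \<omega>)\<close> with \<open>\<omega> \<in> (a, \<infinity>]\<close> are modelled by total functions on the reals whose
  values outside \<open>[a, \<omega>)\<close> are irrelevant.  Derivatives are taken within the half-line \<open>[a, \<infinity>)\<close>, hence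
  one-sided at \<open>a\<close>; at \<open>t < \<omega>\<close> this depends only on the values of the signal on \<open>[a, \<omega>)\<close>.
\<close>

definition tdom :: "real \<Rightarrow> ereal \<Rightarrow> real set" where
  "tdom a \<omega> = {t. a \<le> t \<and> ereal t < \<omega>}"

primrec nderiv :: "real \<Rightarrow> nat \<Rightarrow> (real \<Rightarrow> real) \<Rightarrow> real \<Rightarrow> real" where
  "nderiv a 0 f = f"
| "nderiv a (Suc j) f = (\<lambda>t. vector_derivative (nderiv a j f) (at t within {a..}))"

definition Ck_on :: "nat \<Rightarrow> real \<Rightarrow> ereal \<Rightarrow> (real \<Rightarrow> real) \<Rightarrow> bool" where
  "Ck_on n a \<omega> f \<longleftrightarrow>
     (\<forall>j<n. \<forall>t\<in>tdom a \<omega>. nderiv a j f differentiable (at t within {a..})) \<and>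
     continuous_on (tdom a \<omega>) (nderiv a n f)"

definition Linf_loc :: "(real \<Rightarrow> 'a::euclidean_space) \<Rightarrow> bool" where
  "Linf_loc f \<longleftrightarrow> f \<in> borel_measurable (lebesgue_on {0..}) \<and>
     (\<forall>b\<ge>0. \<exists>c. AE t in lebesgue_on {0..b}. norm (f t) \<le> c)"

definition Linf :: "(real \<Rightarrow> 'a::euclidean_space) \<Rightarrow> bool" where
  "Linf f \<longleftrightarrow> f \<in> borel_measurable (lebesgue_on {0..}) \<and>
     (\<exists>c. AE t in lebesgue_on {0..}. norm (f t) \<le> c)"

text \<open>
  \<open>g\<close> is the weak derivative of \<open>f\<close> on \<open>[a, \<omega>)\<close>: both are integrable on compact subintervals of
  \<open>[a, \<omega>)\<close>, and integration by parts holds against all continuously differentiable test functions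
  \<open>\<theta>\<close> with compact support in the open interval \<open>(a, \<omega>)\<close>.
\<close>

definition weak_deriv :: "real \<Rightarrow> ereal \<Rightarrow> (real \<Rightarrow> 'a::euclidean_space) \<Rightarrow> (real \<Rightarrow> 'a) \<Rightarrow> bool" where
  "weak_deriv a \<omega> f g \<longleftrightarrow>
     (\<forall>b. a \<le> b \<and> ereal b < \<omega> \<longrightarrow>
        f absolutely_integrable_on {a..b} \<and> g absolutely_integrable_on {a..b}) \<and>
     (\<forall>\<theta> \<theta>'. (\<forall>t. (\<theta> has_real_derivative \<theta>' t) (at t)) \<and> continuous_on UNIV \<theta>' \<and>
              (\<exists>c d. a < c \<and> ereal d < \<omega> \<and> (\<forall>t. t \<notin> {c..d} \<longrightarrow> \<theta> t = 0)) \<longrightarrow>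
        integral (tdom a \<omega>) (\<lambda>t. \<theta>' t *\<^sub>R f t) = - integral (tdom a \<omega>) (\<lambda>t. \<theta> t *\<^sub>R g t))"

text \<open>
  The Sobolev space of order \<open>n \<ge> 1\<close> over \<open>L\<^sup>\<infinity>\<close> on \<open>[0, \<infinity>)\<close>.  Its elements are represented by their
  continuous representative, since point values at time 0 are used.
\<close>

definition Winf :: "nat \<Rightarrow> (real \<Rightarrow> 'a::euclidean_space) \<Rightarrow> bool" where
  "Winf n f \<longleftrightarrow> continuous_on {0..} f \<and>
     (\<exists>F. F 0 = f \<and> (\<forall>j<n. weak_deriv 0 \<infinity> (F j) (F (Suc j))) \<and> (\<forall>j\<le>n. Linf (F j)))"

definition C1 :: "('a::euclidean_space \<Rightarrow> 'b::euclidean_space) \<Rightarrow> bool" where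
  "C1 f \<longleftrightarrow> (\<exists>f' :: 'a \<Rightarrow> 'a \<Rightarrow>\<^sub>L 'b.
     (\<forall>x. (f has_derivative blinfun_apply (f' x)) (at x)) \<and> continuous_on UNIV f')"


section \<open>Operator classes\<close>

text \<open>
  An operator from \<open>C([-h,\<infinity>))\<close> to \<open>L\<^sup>\<infinity>\<^sub>l\<^sub>o\<^sub>c([0,\<infinity>))\<close> is modelled on representatives; equality of values
  in \<open>L\<^sup>\<infinity>\<^sub>l\<^sub>o\<^sub>c\<close> is equality almost everywhere.  Causality makes the operator independent of the values
  of its argument on \<open>(-\<infinity>, -h)\<close>.
\<close>

definition causal :: "real \<Rightarrow> ((real \<Rightarrow> 'a::euclidean_space) \<Rightarrow> real \<Rightarrow> 'b::euclidean_space) \<Rightarrow> bool" where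
  "causal h T \<longleftrightarrow>
     (\<forall>t\<ge>0. \<forall>\<zeta> \<xi>. continuous_on {-h..} \<zeta> \<and> continuous_on {-h..} \<xi> \<and> (\<forall>\<sigma>\<in>{-h..<t}. \<zeta> \<sigma> = \<xi> \<sigma>) \<longrightarrow>
        (AE \<sigma> in lebesgue_on {0..<t}. T \<zeta> \<sigma> = T \<xi> \<sigma>))"

definition loc_lipschitz :: "real \<Rightarrow> ((real \<Rightarrow> 'a::euclidean_space) \<Rightarrow> real \<Rightarrow> 'b::euclidean_space) \<Rightarrow> bool" where
  "loc_lipschitz h T \<longleftrightarrow>
     (\<forall>t\<ge>0. \<forall>\<xi>. continuous_on {-h..t} \<xi> \<longrightarrow>
        (\<exists>\<tau>>0. \<exists>\<delta>>0. \<exists>c>0. \<forall>\<zeta>1 \<zeta>2.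
           continuous_on {-h..} \<zeta>1 \<and> continuous_on {-h..} \<zeta>2 \<and>
           (\<forall>\<sigma>\<in>{-h..t}. \<zeta>1 \<sigma> = \<xi> \<sigma> \<and> \<zeta>2 \<sigma> = \<xi> \<sigma>) \<and>
           (\<forall>\<sigma>\<in>{t..t+\<tau>}. norm (\<zeta>1 \<sigma> - \<xi> t) < \<delta> \<and> norm (\<zeta>2 \<sigma> - \<xi> t) < \<delta>) \<longrightarrow>
           (AE \<sigma> in lebesgue_on {t..t+\<tau>}.
              norm (T \<zeta>1 \<sigma> - T \<zeta>2 \<sigma>) \<le> c * (SUP s\<in>{t..t+\<tau>}. norm (\<zeta>1 s - \<zeta>2 s)))))"

definition bibo :: "real \<Rightarrow> ((real \<Rightarrow> 'a::euclidean_space) \<Rightarrow> real \<Rightarrow> 'b::euclidean_space) \<Rightarrow> bool" where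
  "bibo h T \<longleftrightarrow>
     (\<forall>c1>0. \<exists>c2>0. \<forall>\<zeta>. continuous_on {-h..} \<zeta> \<and> (\<forall>t\<ge>-h. norm (\<zeta> t) \<le> c1) \<longrightarrow>
        (AE t in lebesgue_on {0..}. norm (T \<zeta> t) \<le> c2))"

definition op_class :: "real \<Rightarrow> ((real \<Rightarrow> 'a::euclidean_space) \<Rightarrow> real \<Rightarrow> 'b::euclidean_space) \<Rightarrow> bool" where
  "op_class h T \<longleftrightarrow>
     (\<forall>\<zeta>. continuous_on {-h..} \<zeta> \<longrightarrow> Linf_loc (T \<zeta>)) \<and>
     causal h T \<and> loc_lipschitz h T \<and> bibo h T"

text \<open>
  For the subclass below, \<open>T \<zeta>\<close> is itself (not just almost everywhere) continuously differentiable
  on \<open>[0,\<infinity>)\<close>.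
\<close>

definition op_class_DAE :: "real \<Rightarrow> ((real \<Rightarrow> 'a::euclidean_space) \<Rightarrow> real \<Rightarrow> 'b::euclidean_space) \<Rightarrow> bool" where
  "op_class_DAE h T \<longleftrightarrow> op_class h T \<and>
     (\<forall>\<zeta>. continuous_on {-h..} \<zeta> \<longrightarrow>
        (\<exists>D. continuous_on {0..} D \<and> (\<forall>t\<ge>0. (T \<zeta> has_vector_derivative D t) (at t within {0..})))) \<and>
     (\<exists>(z :: 'a \<times> 'b \<Rightarrow> 'b) (T' :: (real \<Rightarrow> 'a) \<Rightarrow> real \<Rightarrow> 'b).
        continuous_on UNIV z \<and> op_class h T' \<and>
        (\<forall>\<zeta>. continuous_on {-h..} \<zeta> \<longrightarrow>
           (\<forall>t\<ge>0. (T \<zeta> has_vector_derivative z (\<zeta> t, T' \<zeta> t)) (at t within {0..}))))"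

text \<open>
  \<open>w\<close> represents the value of the localization of \<open>T\<close> at a function \<open>y\<close> defined on \<open>[-h, \<omega>)\<close> only:
  on each \<open>[0, b)\<close> with \<open>b < \<omega>\<close> it agrees with \<open>T \<zeta>\<close> for every continuous \<open>\<zeta>\<close> extending the
  restriction of \<open>y\<close> to \<open>[-h, b)\<close>.
\<close>

definition localizes :: "real \<Rightarrow> ((real \<Rightarrow> 'a::euclidean_space) \<Rightarrow> real \<Rightarrow> 'b::euclidean_space) \<Rightarrow>
    ereal \<Rightarrow> (real \<Rightarrow> 'a) \<Rightarrow> (real \<Rightarrow> 'b) \<Rightarrow> bool" where
  "localizes h T \<omega> y w \<longleftrightarrow>
     (\<forall>b>0. ereal b < \<omega> \<longrightarrow>
        (\<forall>\<zeta>. continuous_on {-h..} \<zeta> \<and> (\<forall>t\<in>{-h..<b}. \<zeta> t = y t) \<longrightarrow>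
           (AE t in lebesgue_on {0..<b}. T \<zeta> t = w t)))"

text \<open>
  The localization to \<open>\<omega> = 0\<close>.  The value at time 0 is computed with the constant continuation of
  the history; for an operator in \<open>op_class_DAE\<close>, every continuous continuation gives the same value.
\<close>

definition localize0 :: "((real \<Rightarrow> 'a) \<Rightarrow> real \<Rightarrow> 'b) \<Rightarrow> (real \<Rightarrow> 'a) \<Rightarrow> 'b" where
  "localize0 T y = T (\<lambda>t. y (min t 0)) 0"


section \<open>Functional differential-algebraic systems\<close>

text \<open>
  The outputs are indexed by a finite type \<open>'m\<close>, and \<open>idxI\<close> is the set of indices of the first block
  (so \<open>q = card idxI\<close>, and either block may be empty).  The spaces of dimension \<open>q\<close> and \<open>m - q\<close> are the
  coordinate subspaces \<open>coords idxI\<close> and \<open>coords (- idxI)\<close> of \<open>real ^ 'm\<close>, and \<open>m\<close>-vectors are sums of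
  their two blocks.  \<open>pos (i, j)\<close> is the coordinate of \<open>y\<^sub>i\<^sup>(\<^sup>j\<^sup>)\<close> in the vector \<open>Y\<close>, which has index
  type \<open>'n\<close>.
\<close>

record ('m, 's, 'k, 'n) fdae =
  delay :: real
  idxI :: "'m set"
  rdeg :: "'m \<Rightarrow> nat"
  pos :: "'m \<times> nat \<Rightarrow> 'n"
  f1 :: "(real ^ 's::finite) \<times> (real ^ 'k::finite) \<Rightarrow> real ^ 'm::finite"
  f2 :: "real ^ 'n::finite \<Rightarrow> real ^ 'm"
  f3 :: "(real ^ 's) \<times> (real ^ 'k) \<Rightarrow> real ^ 'm"
  f4 :: "(real ^ 's) \<times> (real ^ 'k) \<Rightarrow> real"
  GammaI :: "(real ^ 's) \<times> (real ^ 'k) \<Rightarrow> real ^ 'm ^ 'm"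
  GammaII :: "(real ^ 's) \<times> (real ^ 'k) \<Rightarrow> real ^ 'm ^ 'm"
  d1 :: "real \<Rightarrow> real ^ 's"
  d2 :: "real \<Rightarrow> real ^ 's"
  d3 :: "real \<Rightarrow> real ^ 's"
  d4 :: "real \<Rightarrow> real ^ 's"
  d5 :: "real \<Rightarrow> real ^ 's"
  T1 :: "(real \<Rightarrow> real ^ 'n) \<Rightarrow> real \<Rightarrow> real ^ 'k"
  T2 :: "(real \<Rightarrow> real ^ 'm) \<Rightarrow> real \<Rightarrow> real ^ 'k"

definition coords :: "'m set \<Rightarrow> (real ^ 'm::finite) set" where
  "coords J = {x. \<forall>i. i \<notin> J \<longrightarrow> x $ i = 0}"

definition block_mats :: "'m set \<Rightarrow> 'm set \<Rightarrow> (real ^ 'm::finite ^ 'm) set" where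
  "block_mats J K = {A. \<forall>i j. \<not> (i \<in> J \<and> j \<in> K) \<longrightarrow> A $ i $ j = 0}"

text \<open>The number of derivatives \<open>y\<^sub>i, y\<^sub>i', \<dots>\<close> of the \<open>i\<close>-th output that occur in \<open>Y\<close>.\<close>

definition ord :: "('m::finite, 's::finite, 'k::finite, 'n::finite) fdae \<Rightarrow> 'm \<Rightarrow> nat" where
  "ord S i = (if i \<in> idxI S then rdeg S i else 1)"

definition Yidx :: "('m::finite, 's::finite, 'k::finite, 'n::finite) fdae \<Rightarrow> ('m \<times> nat) set" where
  "Yidx S = {(i, j). j < ord S i}"

definition Yvec :: "('m::finite, 's::finite, 'k::finite, 'n::finite) fdae \<Rightarrow> ('m \<Rightarrow> nat \<Rightarrow> real) \<Rightarrow> real ^ 'n" where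
  "Yvec S v = (\<chi> n. case inv_into (Yidx S) (pos S) n of (i, j) \<Rightarrow> v i j)"

definition Ysig :: "('m::finite, 's::finite, 'k::finite, 'n::finite) fdae \<Rightarrow> (real \<Rightarrow> real ^ 'm) \<Rightarrow> real \<Rightarrow> real ^ 'n" where
  "Ysig S y t = Yvec S (\<lambda>i j. nderiv (- delay S) j (\<lambda>\<sigma>. y \<sigma> $ i) t)"

definition fdae_format :: "('m::finite, 's::finite, 'k::finite, 'n::finite) fdae \<Rightarrow> bool" where
  "fdae_format S \<longleftrightarrow> delay S \<ge> 0 \<and> (\<forall>i\<in>idxI S. rdeg S i \<ge> 1) \<and> bij_betw (pos S) (Yidx S) UNIV"

definition assmA1 :: "('m::finite, 's::finite, 'k::finite, 'n::finite) fdae \<Rightarrow> bool" where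
  "assmA1 S \<longleftrightarrow>
     continuous_on UNIV (GammaI S) \<and> range (GammaI S) \<subseteq> block_mats (idxI S) (idxI S) \<and>
     (\<forall>p. \<forall>x\<in>coords (idxI S). x \<noteq> 0 \<longrightarrow>
        x \<bullet> ((GammaI S p + transpose (GammaI S p)) *v x) > 0) \<and>
     C1 (GammaII S) \<and> range (GammaII S) \<subseteq> block_mats (- idxI S) (idxI S)"

definition assmA2 :: "('m::finite, 's::finite, 'k::finite, 'n::finite) fdae \<Rightarrow> bool" where
  "assmA2 S \<longleftrightarrow> Linf (d1 S) \<and> Linf (d2 S) \<and> Winf 1 (d3 S) \<and> Winf 1 (d4 S) \<and> Winf 1 (d5 S)"

text \<open>\<open>[0; I]\<close>, selecting the coordinates of \<open>Y\<close> that belong to the second block of outputs.\<close>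

definition lastcols :: "('m::finite, 's::finite, 'k::finite, 'n::finite) fdae \<Rightarrow> real ^ 'm ^ 'n" where
  "lastcols S = (\<chi> n i. if i \<notin> idxI S \<and> n = pos S (i, 0) then 1 else 0)"

definition jac2_norm :: "('m::finite, 's::finite, 'k::finite, 'n::finite) fdae \<Rightarrow> real ^ 'n \<Rightarrow> real" where
  "jac2_norm S Z =
     onorm (\<lambda>v. (matrix (frechet_derivative (f2 S) (at Z)) ** lastcols S) *v v)"

definition assmA3 :: "('m::finite, 's::finite, 'k::finite, 'n::finite) fdae \<Rightarrow> bool" where
  "assmA3 S \<longleftrightarrow>
     continuous_on UNIV (f1 S) \<and> range (f1 S) \<subseteq> coords (idxI S) \<and>
     C1 (f2 S) \<and> range (f2 S) \<subseteq> coords (- idxI S) \<and>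
     C1 (f3 S) \<and> range (f3 S) \<subseteq> coords (- idxI S) \<and>
     bdd_above (range (jac2_norm S))"

definition assmA4 :: "('m::finite, 's::finite, 'k::finite, 'n::finite) fdae \<Rightarrow> real \<Rightarrow> bool" where
  "assmA4 S \<alpha> \<longleftrightarrow> C1 (f4 S) \<and> \<alpha> > 0 \<and> (\<forall>p. f4 S p \<ge> \<alpha>)"

definition assmA5 :: "('m::finite, 's::finite, 'k::finite, 'n::finite) fdae \<Rightarrow> bool" where
  "assmA5 S \<longleftrightarrow> op_class (delay S) (T1 S) \<and> op_class_DAE (delay S) (T2 S)"


section \<open>The funnel controller\<close>

definition Phi :: "nat \<Rightarrow> (real \<Rightarrow> real) set" where
  "Phi n = {\<phi>. Ck_on n 0 \<infinity> \<phi> \<and> (\<forall>j\<le>n. bounded (nderiv 0 j \<phi> ` {0..})) \<and>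
     (\<forall>\<tau>>0. \<phi> \<tau> > 0) \<and> Liminf at_top (\<lambda>\<tau>. ereal (\<phi> \<tau>)) > 0}"

definition funnel :: "(real \<Rightarrow> real) \<Rightarrow> (real \<times> 'a::real_normed_vector) set" where
  "funnel \<phi> = {(t, e). t \<ge> 0 \<and> \<phi> t * norm e < 1}"

record 'm funnel_controller =
  yref :: "real \<Rightarrow> real ^ 'm::finite"
  phiI :: "real \<Rightarrow> real"
  phiII :: "real \<Rightarrow> real"
  phi :: "'m \<Rightarrow> nat \<Rightarrow> real \<Rightarrow> real"
  khat :: real

definition gain_denom :: "(real \<Rightarrow> real) \<Rightarrow> (real \<Rightarrow> 'a::real_normed_vector) \<Rightarrow> real \<Rightarrow> real" where
  "gain_denom \<phi> e t = 1 - (\<phi> t)\<^sup>2 * (norm (e t))\<^sup>2"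

primrec err_rec :: "(nat \<Rightarrow> real \<Rightarrow> real) \<Rightarrow> (real \<Rightarrow> real) \<Rightarrow> nat \<Rightarrow> real \<Rightarrow> real" where
  "err_rec \<phi> e 0 = e"
| "err_rec \<phi> e (Suc j) = (\<lambda>t. nderiv 0 1 (err_rec \<phi> e j) t +
     1 / gain_denom (\<phi> j) (err_rec \<phi> e j) t * err_rec \<phi> e j t)"

definition err :: "'m::finite funnel_controller \<Rightarrow> (real \<Rightarrow> real ^ 'm) \<Rightarrow> 'm \<Rightarrow> nat \<Rightarrow> real \<Rightarrow> real" where
  "err C y i = err_rec (phi C i) (\<lambda>t. y t $ i - yref C t $ i)"

definition gain :: "'m::finite funnel_controller \<Rightarrow> (real \<Rightarrow> real ^ 'm) \<Rightarrow> 'm \<Rightarrow> nat \<Rightarrow> real \<Rightarrow> real" where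
  "gain C y i j t = 1 / gain_denom (phi C i j) (err C y i j) t"

definition errI :: "('m::finite, 's::finite, 'k::finite, 'n::finite) fdae \<Rightarrow> 'm funnel_controller \<Rightarrow>
    (real \<Rightarrow> real ^ 'm) \<Rightarrow> real \<Rightarrow> real ^ 'm" where
  "errI S C y t = (\<chi> i. if i \<in> idxI S then err C y i (rdeg S i - 1) t else 0)"

definition errII :: "('m::finite, 's::finite, 'k::finite, 'n::finite) fdae \<Rightarrow> 'm funnel_controller \<Rightarrow>
    (real \<Rightarrow> real ^ 'm) \<Rightarrow> real \<Rightarrow> real ^ 'm" where
  "errII S C y t = (\<chi> i. if i \<in> idxI S then 0 else y t $ i - yref C t $ i)"

definition gainI :: "('m::finite, 's::finite, 'k::finite, 'n::finite) fdae \<Rightarrow> 'm funnel_controller \<Rightarrow>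
    (real \<Rightarrow> real ^ 'm) \<Rightarrow> real \<Rightarrow> real" where
  "gainI S C y t = 1 / gain_denom (phiI C) (errI S C y) t"

definition gainII :: "('m::finite, 's::finite, 'k::finite, 'n::finite) fdae \<Rightarrow> 'm funnel_controller \<Rightarrow>
    (real \<Rightarrow> real ^ 'm) \<Rightarrow> real \<Rightarrow> real" where
  "gainII S C y t = khat C / gain_denom (phiII C) (errII S C y) t"

definition inputI :: "('m::finite, 's::finite, 'k::finite, 'n::finite) fdae \<Rightarrow> 'm funnel_controller \<Rightarrow>
    (real \<Rightarrow> real ^ 'm) \<Rightarrow> real \<Rightarrow> real ^ 'm" where
  "inputI S C y t = - (gainI S C y t *\<^sub>R errI S C y t)"

definition inputII :: "('m::finite, 's::finite, 'k::finite, 'n::finite) fdae \<Rightarrow> 'm funnel_controller \<Rightarrow>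
    (real \<Rightarrow> real ^ 'm) \<Rightarrow> real \<Rightarrow> real ^ 'm" where
  "inputII S C y t = - (gainII S C y t *\<^sub>R errII S C y t)"


section \<open>Initial data and solutions\<close>

text \<open>
  Initial data are given together with their derivatives: \<open>y0 i j\<close> is the \<open>j\<close>-th derivative of
  \<open>y\<^sub>i\<^sup>0\<close> on \<open>[-h, 0]\<close>, for \<open>j < ord S i\<close>.  If \<open>h > 0\<close>, the condition below says that these are indeed
  the derivatives and that they are continuous.  If \<open>h = 0\<close>, the differentiability condition is void
  (the filter \<open>at 0 within {0}\<close> is trivial), and \<open>y0 i j 0\<close> are freely prescribed numbers.
\<close>

definition initial_data :: "('m::finite, 's::finite, 'k::finite, 'n::finite) fdae \<Rightarrow>
    ('m \<Rightarrow> nat \<Rightarrow> real \<Rightarrow> real) \<Rightarrow> bool" where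
  "initial_data S y0 \<longleftrightarrow> (\<forall>i.
     (\<forall>j. Suc j < ord S i \<longrightarrow> (\<forall>t\<in>{- delay S..0}.
        (y0 i j has_real_derivative y0 i (Suc j) t) (at t within {- delay S..0}))) \<and>
     (\<forall>j < ord S i. continuous_on {- delay S..0} (y0 i j)))"

text \<open>
  The signals of the controller at time 0 depend on \<open>y\<close> only through \<open>y\<^sub>i\<^sup>(\<^sup>j\<^sup>)(0)\<close>, \<open>j < ord S i\<close> (as
  long as the gains are finite at 0).  To evaluate the controller at time 0 with the data \<open>y0\<close>, it is
  applied to the polynomial with these derivatives at 0.
\<close>

definition init_poly :: "('m::finite, 's::finite, 'k::finite, 'n::finite) fdae \<Rightarrow>
    ('m \<Rightarrow> nat \<Rightarrow> real \<Rightarrow> real) \<Rightarrow> real \<Rightarrow> real ^ 'm" where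
  "init_poly S y0 t = (\<chi> i. \<Sum>j<ord S i. y0 i j 0 / fact j * t ^ j)"

definition consistent :: "('m::finite, 's::finite, 'k::finite, 'n::finite) fdae \<Rightarrow> 'm funnel_controller \<Rightarrow>
    ('m \<Rightarrow> nat \<Rightarrow> real \<Rightarrow> real) \<Rightarrow> bool" where
  "consistent S C y0 \<longleftrightarrow>
     (let w = localize0 (T2 S) (\<lambda>t. \<chi> i. y0 i 0 t) in
      f2 S (Yvec S (\<lambda>i j. y0 i j 0)) + f3 S (d3 S 0, w)
        + GammaII S (d4 S 0, w) *v inputI S C (init_poly S y0) 0
        + f4 S (d5 S 0, w) *\<^sub>R inputII S C (init_poly S y0) 0 = 0)"

text \<open>
  Solutions on \<open>[-h, \<omega>)\<close>.  The initial condition \<open>y = y\<^sup>0\<close> on \<open>[-h, 0]\<close> is stated for all derivatives,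
  which is needed only if \<open>h = 0\<close>.  As division by zero yields zero, it has to be required explicitly
  that all gains are defined.  \<open>w1\<close> and \<open>w2\<close> represent \<open>T\<^sub>1(Y)\<close> and \<open>T\<^sub>2(y)\<close>.
\<close>

definition solution :: "('m::finite, 's::finite, 'k::finite, 'n::finite) fdae \<Rightarrow> 'm funnel_controller \<Rightarrow>
    ('m \<Rightarrow> nat \<Rightarrow> real \<Rightarrow> real) \<Rightarrow> ereal \<Rightarrow> (real \<Rightarrow> real ^ 'm) \<Rightarrow> bool" where
  "solution S C y0 \<omega> y \<longleftrightarrow> \<omega> > 0 \<and>
     (\<forall>i. Ck_on (ord S i - 1) (- delay S) \<omega> (\<lambda>t. y t $ i)) \<and>
     (\<forall>i. \<forall>j < ord S i. \<forall>t\<in>{- delay S..0}. nderiv (- delay S) j (\<lambda>\<sigma>. y \<sigma> $ i) t = y0 i j t) \<and>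
     (\<forall>t\<in>tdom 0 \<omega>. gain_denom (phiI C) (errI S C y) t \<noteq> 0 \<and>
        gain_denom (phiII C) (errII S C y) t \<noteq> 0 \<and>
        (\<forall>i\<in>idxI S. \<forall>j. j + 2 \<le> rdeg S i \<longrightarrow> gain_denom (phi C i j) (err C y i j) t \<noteq> 0)) \<and>
     (\<exists>w1 w2. localizes (delay S) (T1 S) \<omega> (Ysig S y) w1 \<and>
        localizes (delay S) (T2 S) \<omega> y w2 \<and>
        (\<forall>i\<in>idxI S. weak_deriv 0 \<omega> (nderiv (- delay S) (rdeg S i - 1) (\<lambda>\<sigma>. y \<sigma> $ i))
           (\<lambda>t. (f1 S (d1 S t, w1 t) + GammaI S (d2 S t, w1 t) *v inputI S C y t) $ i)) \<and>
        (\<forall>i. i \<notin> idxI S \<longrightarrow> (\<exists>v. weak_deriv 0 \<omega> (\<lambda>t. y t $ i) v)) \<and>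
        (AE t in lebesgue_on (tdom 0 \<omega>).
           0 = f2 S (Ysig S y t) + f3 S (d3 S t, w2 t)
             + GammaII S (d4 S t, w2 t) *v inputI S C y t
             + f4 S (d5 S t, w2 t) *\<^sub>R inputII S C y t))"

end

theory Submission
  imports Defs "HOL-Complex_Analysis.Great_Picard" "HOL-Real_Asymp.Real_Asymp"
begin

text \<open>In terms of the errors \<open>e\<^sub>i\<^sub>j\<close> the closed loop consists of a functional differential equation for the first block and an
  algebraic equation for \<open>e\<^sub>I\<^sub>I\<close>. Resolving the feedback \<open>k\<^sub>I\<^sub>I e\<^sub>I\<^sub>I = V\<close> for \<open>e\<^sub>I\<^sub>I\<close> turns the latter into a fixed point
  equation whose right-hand side depends on \<open>e\<^sub>I\<^sub>I\<close> with Lipschitz constant \<open>\<rho> = \<alpha>\<^sup>-\<^sup>1 sup \<parallel>f\<^sub>2' [0; I]\<parallel> / k < 1\<close> (here \<open>k\<close> is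
  the constant of the gain \<open>k\<^sub>I\<^sub>I\<close>) and on everything else Lipschitz continuously in time. Hence the Tonelli approximations
  stay equi-Lipschitz, and the Arzela--Ascoli theorem yields local solutions although the right-hand side is only continuous
  in the state.

  As long as a solution exists, the errors are bounded by the funnels and the gains \<open>k\<^sub>i\<^sub>j\<close> are bounded, because
  \<open>\<phi>\<^sub>i\<^sub>j\<^sup>2 e\<^sub>i\<^sub>j\<^sup>2\<close> decreases when it is close to 1. Therefore \<open>Y\<close> and the operator values are bounded, and the same
  argument applies to \<open>k\<^sub>I\<close> by the positive definiteness of \<open>\<Gamma>\<^sub>I\<close>; the algebraic equation bounds \<open>k\<^sub>I\<^sub>I\<close>. These bounds
  do not depend on the interval of existence, so every solution can be continued indefinitely.\<close>

section \<open>Absolutely continuous functions with bounded derivative\<close>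

text \<open>Differentiating the algebraic equation would be the classical way to an explicit
  equation for the second block of errors. Here it is kept undifferentiated: its data are Lipschitz
  in time because, by clause (iv), the derivative of \<open>T2\<close> is bounded on bounded inputs.
  The condition \<open>rho < 1\<close> is used twice, for approximants and for solutions, each time
  to absorb the increment of the second block on the right-hand side.

  As \<open>f1\<close> and \<open>GammaI\<close> are only continuous, solutions need not be unique.
  A given solution is therefore continued itself and never compared with a constructed one.

  Weak derivatives require a translation in both directions. A continuous function with essentially
  bounded weak derivative is the integral of the latter. Conversely, the second block is only known
  to be Lipschitz, and its weak derivative comes from a Radon-Nikodym density.

  Since funnel functions may vanish at 0, the funnels give no bound near time 0. Every estimate by a
  funnel is split at a small \<open>\<delta>\<close>, with compactness in charge before it.\<close>

lemma AE_lebesgue_on_subset: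
  assumes "AE x in lebesgue_on S. P x" "T \<subseteq> S" "S \<in> sets lebesgue" "T \<in> sets lebesgue"
  shows "AE x in lebesgue_on T. P x"
proof -
  have "AE x in lebesgue. x \<in> S \<longrightarrow> P x"
    using assms by (simp add: AE_restrict_space_iff)
  then have "AE x in lebesgue. x \<in> T \<longrightarrow> P x"
    using assms(2) by (auto elim: eventually_mono)
  then show ?thesis using assms by (simp add: AE_restrict_space_iff)
qed

lemma AE_lebesgue_on_iff_negligible:
  assumes "S \<in> sets lebesgue"
  shows "(AE x in lebesgue_on S. P x) \<longleftrightarrow> negligible {x \<in> S. \<not> P x}"
proof -
  have "(AE x in lebesgue_on S. P x) \<longleftrightarrow> (AE x in lebesgue. x \<in> S \<longrightarrow> P x)"
    using assms by (simp add: AE_restrict_space_iff)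
  also have "\<dots> \<longleftrightarrow> {x \<in> S. \<not> P x} \<in> null_sets lebesgue"
    by (simp add: completion.AE_iff_null_sets)
  finally show ?thesis by (simp add: negligible_iff_null_sets)
qed

lemma AE_lebesgue_on_atLeastLessThan:
  "(AE x in lebesgue_on {a..<b::real}. P x) \<longleftrightarrow> (AE x in lebesgue_on {a..b}. P x)"
proof -
  have "negligible {x \<in> {a..<b}. \<not> P x} \<longleftrightarrow> negligible {x \<in> {a..b}. \<not> P x}"
    (is "negligible ?A \<longleftrightarrow> negligible ?B")
  proof
    assume "negligible ?A"
    moreover have "?B \<subseteq> ?A \<union> {b}" by auto
    ultimately show "negligible ?B"
      by (meson negligible_Un negligible_sing negligible_subset)
  next
    assume "negligible ?B"
    then show "negligible ?A" by (rule negligible_subset) auto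
  qed
  then show ?thesis by (simp add: AE_lebesgue_on_iff_negligible)
qed

text \<open>Inside the interval the set where the bound fails is open, hence empty or of positive
  measure; the end points follow by closure. This is how almost-everywhere information becomes
  pointwise for continuous signals.\<close>

lemma AE_lebesgue_on_continuous_le:
  fixes f :: "real \<Rightarrow> real"
  assumes "AE x in lebesgue_on {a..b}. f x \<le> c" "continuous_on {a..b} f" "a < b" "x \<in> {a..b}"
  shows "f x \<le> c"
proof -
  have ope: "f x \<le> c" if "x \<in> {a<..<b}" for x
  proof (rule ccontr)
    assume n: "\<not> f x \<le> c"
    have "continuous_on {a<..<b} f" by (rule continuous_on_subset[OF assms(2)]) auto
    then have "open {x\<in>{a<..<b}. f x > c}"
      using continuous_open_preimage[of "{a<..<b}" f "{c<..}"]
      by (simp add: vimage_def Int_def)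
    moreover have "negligible {x\<in>{a..b}. \<not> f x \<le> c}"
      using assms(1) by (simp add: AE_lebesgue_on_iff_negligible)
    then have "negligible {x\<in>{a<..<b}. f x > c}" by (rule negligible_subset) auto
    ultimately show False using n that open_not_negligible by fastforce
  qed
  have "closure {a<..<b} = {a..b}" using assms by simp
  then show ?thesis
    using continuous_le_on_closure[of "{a<..<b}" f x c] ope assms(2,4) by metis
qed

text \<open>The bound is an explicit argument so that one constant can serve a whole family of
  right-hand sides and intervals; the Lipschitz constants of the approximants come from it.\<close>

definition ebd :: "real \<Rightarrow> real \<Rightarrow> real \<Rightarrow> (real \<Rightarrow> 'a::euclidean_space) \<Rightarrow> bool" where
  "ebd M a b g \<longleftrightarrow> g \<in> borel_measurable (lebesgue_on {a..b}) \<and>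
     (AE t in lebesgue_on {a..b}. norm (g t) \<le> M)"

lemma borel_measurable_lebesgue_on_subset:
  assumes "g \<in> borel_measurable (lebesgue_on S)" "T \<subseteq> S" "T \<in> sets lebesgue"
  shows "g \<in> borel_measurable (lebesgue_on T)"
  using assms measurable_restrict_mono by blast

lemma ebd_subset:
  assumes "ebd M a b g" "a \<le> c" "d \<le> b"
  shows "ebd M c d g"
  using assms unfolding ebd_def
  by (auto intro: borel_measurable_lebesgue_on_subset AE_lebesgue_on_subset[where S="{a..b}"])

lemma ebd_mono: "ebd M a b g \<Longrightarrow> M \<le> M' \<Longrightarrow> ebd M' a b g"
  unfolding ebd_def by (auto elim: eventually_mono)

lemma ebd_abs_int:
  assumes "ebd M a b g"
  shows "g absolutely_integrable_on {a..b}"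
proof -
  define N where "N = {t\<in>{a..b}. \<not> norm (g t) \<le> M}"
  have N: "negligible N" using assms by (simp add: ebd_def N_def AE_lebesgue_on_iff_negligible)
  define g' where "g' t = (if t \<in> N then 0 else g t)" for t
  have "N \<in> sets lebesgue" using N by (simp add: negligible_imp_sets)
  then have "g' \<in> borel_measurable (lebesgue_on {a..b})"
    unfolding g'_def using assms unfolding ebd_def
    by (intro measurable_If_set) (auto simp: sets_restrict_space)
  moreover have "norm (g' x) \<le> \<bar>M\<bar>" if "x \<in> {a..b}" for x
    using that by (auto simp: g'_def N_def)
  moreover have "(\<lambda>x. \<bar>M\<bar>) integrable_on {a..b}" by (rule integrable_const_ivl)
  ultimately have "g' absolutely_integrable_on {a..b}"
    by (intro measurable_bounded_by_integrable_imp_absolutely_integrable) auto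
  then show ?thesis
    by (rule absolutely_integrable_spike[OF _ N]) (auto simp: g'_def)
qed

lemma ebd_integrable: "ebd M a b g \<Longrightarrow> g integrable_on {a..b}"
  using ebd_abs_int set_lebesgue_integral_eq_integral(1) by blast

lemma AE_integral_bound:
  fixes f :: "real \<Rightarrow> 'a::euclidean_space"
  assumes "f integrable_on {a..b}" "AE t in lebesgue_on {a..b}. norm (f t) \<le> M" "a \<le> b"
  shows "norm (integral {a..b} f) \<le> M * (b - a)"
proof -
  define N where "N = {t\<in>{a..b}. \<not> norm (f t) \<le> M}"
  have N: "negligible N" using assms by (simp add: N_def AE_lebesgue_on_iff_negligible)
  show ?thesis
  proof (cases "a = b")
    case False
    then have "a < b" using assms by simp
    \<comment> \<open>The modified integrand is 0 on \<open>N\<close>, so its pointwise bound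
      requires a nonnegative \<open>M\<close>; a negative one would make \<open>N\<close> the whole
      interval.\<close>
    have "0 \<le> M"
    proof (rule ccontr)
      assume "\<not> 0 \<le> M"
      have "M < norm (f t)" for t using \<open>\<not> 0 \<le> M\<close> norm_ge_zero[of "f t"] by linarith
      then have "N = cbox a b" unfolding N_def by (auto simp: not_le)
      then show False using N \<open>a<b\<close> negligible_interval(1)[of a b] by (simp del: cbox_interval)
    qed
    define f' where "f' t = (if t \<in> N then 0 else f t)" for t
    have "f' integrable_on {a..b}"
      using assms(1) by (rule integrable_spike[OF _ N]) (auto simp: f'_def)
    moreover have "\<And>x. x\<in>{a..b} \<Longrightarrow> norm (f' x) \<le> M" using \<open>0\<le>M\<close> by (auto simp: f'_def N_def)
    ultimately have "norm (integral {a..b} f') \<le> M * measure lborel (cbox a b)"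
      using \<open>0 \<le> M\<close> by (intro has_integral_bound[of M f' _ a b]) (auto intro: integrable_integral)
    then have "norm (integral {a..b} f') \<le> M * (b - a)" using assms(3) by simp
    moreover have "integral {a..b} f' = integral {a..b} f"
      by (rule integral_spike[OF N]) (auto simp: f'_def)
    ultimately show ?thesis by simp
  qed auto
qed

lemma ebd_integral_bound:
  assumes "ebd M a b g" "a \<le> s" "s \<le> t" "t \<le> b"
  shows "norm (integral {s..t} g) \<le> M * (t - s)"
  using ebd_subset[OF assms(1,2,4)] ebd_integrable[OF ebd_subset[OF assms(1,2,4)]] assms
  by (intro AE_integral_bound) (auto simp: ebd_def)

text \<open>Absolute continuity with essentially bounded derivative, encoded by the integral
  formula. No pointwise derivative is involved, and \<open>f'\<close> may be exchanged for a
  function equal to it almost everywhere.\<close>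

definition acb :: "real \<Rightarrow> real \<Rightarrow> (real \<Rightarrow> 'a::euclidean_space) \<Rightarrow> (real \<Rightarrow> 'a) \<Rightarrow> bool" where
  "acb a b f f' \<longleftrightarrow> (\<exists>M. ebd M a b f') \<and> (\<forall>t\<in>{a..b}. f t = f a + integral {a..t} f')"

lemma acbD:
  assumes "acb a b f f'"
  shows "\<exists>M. ebd M a b f'" "t \<in> {a..b} \<Longrightarrow> f t = f a + integral {a..t} f'"
  using assms unfolding acb_def by blast+

lemma acb_diff:
  assumes "acb a b f f'" "a \<le> s" "s \<le> t" "t \<le> b"
  shows "f t - f s = integral {s..t} f'"
proof -
  obtain M where "ebd M a b f'" using acbD(1)[OF assms(1)] by blast
  then have "f' integrable_on {a..t}" using ebd_integrable[OF ebd_subset[of M a b f' a t]] assms by auto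
  then have "integral {a..s} f' + integral {s..t} f' = integral {a..t} f'"
    using Henstock_Kurzweil_Integration.integral_combine assms by blast
  moreover have "f t = f a + integral {a..t} f'" "f s = f a + integral {a..s} f'"
    using acbD(2)[OF assms(1), of t] acbD(2)[OF assms(1), of s] assms(2-) by auto
  ultimately show ?thesis by (simp add: algebra_simps)
qed

lemma acb_lip_ebd:
  assumes "acb a b f f'" "ebd M a b f'" "s \<in> {a..b}" "t \<in> {a..b}"
  shows "norm (f t - f s) \<le> M * \<bar>t - s\<bar>"
proof -
  have *: "norm (f t - f s) \<le> M * \<bar>t - s\<bar>" if "s \<le> t" "s \<in> {a..b}" "t \<in> {a..b}" for s t
    using that acb_diff[OF assms(1), of s t] ebd_integral_bound[OF assms(2), of s t] by auto
  show ?thesis using *[of s t] *[of t s] assms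
    by (cases "s \<le> t") (auto simp: norm_minus_commute abs_minus_commute)
qed

lemma lipschitz_imp_continuous_on:
  fixes f :: "real \<Rightarrow> 'a::real_normed_vector"
  assumes "\<And>s t. s \<in> S \<Longrightarrow> t \<in> S \<Longrightarrow> norm (f t - f s) \<le> L * \<bar>t - s\<bar>"
  shows "continuous_on S f"
proof -
  have "(max L 0)-lipschitz_on S f"
  proof (rule lipschitz_onI)
    fix x y assume "x \<in> S" "y \<in> S"
    then have "norm (f x - f y) \<le> L * \<bar>x - y\<bar>" using assms by blast
    also have "\<dots> \<le> max L 0 * \<bar>x - y\<bar>" by (intro mult_right_mono) auto
    finally show "dist (f x) (f y) \<le> max L 0 * dist x y" by (simp add: dist_norm)
  qed auto
  then show ?thesis by (rule lipschitz_on_continuous_on)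
qed

lemma acb_cont:
  assumes "acb a b f f'"
  shows "continuous_on {a..b} f"
proof -
  obtain M where "ebd M a b f'" using acbD(1)[OF assms(1)] by blast
  then show ?thesis using acb_lip_ebd[OF assms] by (intro lipschitz_imp_continuous_on) auto
qed

lemma acbI:
  assumes "ebd M a b f'" "\<And>t. t \<in> {a..b} \<Longrightarrow> f t = f a + integral {a..t} f'"
  shows "acb a b f f'"
  using assms unfolding acb_def by blast

lemma acb_subset:
  assumes "acb a b f f'" "a \<le> c" "d \<le> b"
  shows "acb c d f f'"
proof -
  obtain M where M: "ebd M a b f'" using acbD(1)[OF assms(1)] by blast
  show ?thesis
  proof (rule acbI[OF ebd_subset[OF M assms(2,3)]])
    fix t assume "t \<in> {c..d}"
    then show "f t = f c + integral {c..t} f'" using acb_diff[OF assms(1), of c t] assms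
      by (auto simp: algebra_simps)
  qed
qed

lemma ebd_add:
  assumes "ebd M a b f" "ebd N a b g"
  shows "ebd (M + N) a b (\<lambda>t. f t + g t)"
proof -
  have "AE t in lebesgue_on {a..b}. norm (f t) \<le> M" "AE t in lebesgue_on {a..b}. norm (g t) \<le> N"
    using assms by (auto simp: ebd_def)
  then have "AE t in lebesgue_on {a..b}. norm (f t + g t) \<le> M + N"
    by eventually_elim (rule norm_triangle_mono)
  then show ?thesis using assms by (auto simp: ebd_def)
qed

lemma continuous_ebd:
  assumes "continuous_on {a..b} f" shows "\<exists>M\<ge>0. ebd M a b f"
proof -
  obtain M where "\<And>t. t \<in> {a..b} \<Longrightarrow> norm (f t) \<le> M"
    by (metis (no_types, lifting) assms atLeastAtMost_iff bounded_iff compact_Icc compact_continuous_image compact_imp_bounded imageI)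
  then have "AE t in lebesgue_on {a..b}. norm (f t) \<le> \<bar>M\<bar>"
    by (intro AE_I2) (force simp: space_restrict_space)
  moreover have "f \<in> borel_measurable (lebesgue_on {a..b})"
    using assms by (intro continuous_imp_measurable_on_sets_lebesgue) auto
  ultimately show ?thesis unfolding ebd_def by (intro exI[of _ "\<bar>M\<bar>"]) auto
qed

lemma acb_add: "acb a b f f' \<Longrightarrow> acb a b g g' \<Longrightarrow> acb a b (\<lambda>t. f t + g t) (\<lambda>t. f' t + g' t)"
proof -
  assume f: "acb a b f f'" and g: "acb a b g g'"
  obtain M N where MN: "ebd M a b f'" "ebd N a b g'" using acbD(1)[OF f] acbD(1)[OF g] by blast
  show ?thesis
  proof (rule acbI[OF ebd_add[OF MN]])
    fix t assume t: "t \<in> {a..b}"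
    have "f' integrable_on {a..t}" "g' integrable_on {a..t}"
      using MN t by (auto intro!: ebd_integrable[OF ebd_subset])
    then show "f t + g t = f a + g a + integral {a..t} (\<lambda>t. f' t + g' t)"
      using acbD(2)[OF f t] acbD(2)[OF g t] by (simp add: Henstock_Kurzweil_Integration.integral_add)
  qed
qed

lemma acb_minus:
  assumes "acb a b f f'" shows "acb a b (\<lambda>t. - f t) (\<lambda>t. - f' t)"
proof -
  obtain M where M: "ebd M a b f'" using acbD(1)[OF assms(1)] by blast
  then have "ebd M a b (\<lambda>t. - f' t)" by (auto simp: ebd_def)
  then show ?thesis
  proof (rule acbI)
    fix t assume "t \<in> {a..b}"
    from acbD(2)[OF assms this] show "- f t = - f a + integral {a..t} (\<lambda>t. - f' t)"
      by simp
  qed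
qed

lemma has_vector_derivative_imp_acb:
  assumes "\<And>t. t \<in> {a..b} \<Longrightarrow> (f has_vector_derivative f' t) (at t within {a..b})"
    and "continuous_on {a..b} f'"
  shows "acb a b f f'"
proof -
  obtain M where "ebd M a b f'" using continuous_ebd[OF assms(2)] by auto
  then show ?thesis
  proof (rule acbI)
    fix t assume t: "t \<in> {a..b}"
    have "(f' has_integral (f t - f a)) {a..t}"
      using t by (intro fundamental_theorem_of_calculus)
        (auto intro: has_vector_derivative_within_subset[OF assms(1)])
    then show "f t = f a + integral {a..t} f'" by (simp add: integral_unique)
  qed
qed

text \<open>The increment of the defect is \<open>O((t - s)\<^sup>2)\<close>, so the defect is constant.\<close>

lemma acb_bilinear:
  fixes f :: "real \<Rightarrow> 'a::euclidean_space" and g :: "real \<Rightarrow> 'b::euclidean_space"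
    and prod :: "'a \<Rightarrow> 'b \<Rightarrow> 'c::euclidean_space"
  assumes bl: "bounded_bilinear prod"
    and f: "acb a b f f'" and g: "acb a b g g'"
  shows "acb a b (\<lambda>t. prod (f t) (g t)) (\<lambda>t. prod (f' t) (g t) + prod (f t) (g' t))"
proof -
  interpret bounded_bilinear prod by (rule bl)
  obtain M0 N0 where MN0: "ebd M0 a b f'" "ebd N0 a b g'" using acbD(1)[OF f] acbD(1)[OF g] by blast
  define M where "M = max M0 0"
  define N where "N = max N0 0"
  have MN: "ebd M a b f'" "ebd N a b g'" "M \<ge> 0" "N \<ge> 0"
    using MN0 ebd_mono unfolding M_def N_def by force+
  obtain K where K: "K \<ge> 0" "\<And>x y. norm (prod x y) \<le> norm x * norm y * K"
    using nonneg_bounded by blast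
  have cf: "continuous_on {a..b} f" and cg: "continuous_on {a..b} g" using f g acb_cont by auto
  have mf: "f \<in> borel_measurable (lebesgue_on {a..b})" "g \<in> borel_measurable (lebesgue_on {a..b})"
    using cf cg by (auto intro!: continuous_imp_measurable_on_sets_lebesgue)
  have mprod: "(\<lambda>t. prod (p t) (q t)) \<in> borel_measurable (lebesgue_on {a..b})"
    if "p \<in> borel_measurable (lebesgue_on {a..b})" "q \<in> borel_measurable (lebesgue_on {a..b})" for p q
  proof -
    have "continuous_on UNIV (\<lambda>z. prod (fst z) (snd z))"
      by (intro bounded_bilinear.continuous_on[OF bl] continuous_intros)
    then show ?thesis
      using borel_measurable_continuous_on[of "\<lambda>z. prod (fst z) (snd z)" "\<lambda>t. (p t, q t)"] that
      by (simp add: borel_measurable_Pair)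
  qed
  obtain F G where FG: "ebd F a b f" "ebd G a b g" "F \<ge> 0" "G \<ge> 0"
    using continuous_ebd[OF cf] continuous_ebd[OF cg] by blast
  have e1: "ebd (P * Q * K) a b (\<lambda>t. prod (p t) (q t))" if "ebd P a b p" "ebd Q a b q" "P \<ge> 0" "Q \<ge> 0"
    for p q P Q
    unfolding ebd_def
  proof (intro conjI mprod)
    have "AE t in lebesgue_on {a..b}. norm (p t) \<le> P" "AE t in lebesgue_on {a..b}. norm (q t) \<le> Q"
      using that by (auto simp: ebd_def)
    then show "AE t in lebesgue_on {a..b}. norm (prod (p t) (q t)) \<le> P * Q * K"
    proof eventually_elim
      case (elim t)
      have "norm (prod (p t) (q t)) \<le> norm (p t) * norm (q t) * K" by (rule K)
      also have "\<dots> \<le> P * Q * K" using elim K that by (intro mult_mono) auto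
      finally show ?case .
    qed
  qed (use that in \<open>auto simp: ebd_def\<close>)
  let ?d = "\<lambda>t. prod (f' t) (g t) + prod (f t) (g' t)"
  have ed: "ebd (M * G * K + F * N * K) a b ?d"
    using e1 MN FG by (intro ebd_add) auto
  define D where "D t = prod (f t) (g t) - integral {a..t} ?d" for t
  have key: "norm (D t - D s) \<le> (2 * M * N * K) * (t - s) * (t - s)" if st: "a \<le> s" "s \<le> t" "t \<le> b" for s t
  proof -
    have i: "f' integrable_on {s..t}" "g' integrable_on {s..t}" "?d integrable_on {s..t}" "?d integrable_on {a..t}"
      using ebd_integrable[OF ebd_subset[OF MN(1)]] ebd_integrable[OF ebd_subset[OF MN(2)]]
        ebd_integrable[OF ebd_subset[OF ed]] st by auto
    \<comment> \<open>With \<open>g\<close> frozen at \<open>s\<close> and \<open>f\<close> at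
      \<open>t\<close>, the two integrals are exactly the increments in the telescoped difference of
      products. Freezing changes the integrand only by a term of order \<open>t - s\<close>.\<close>
    have p1: "((\<lambda>\<tau>. prod (f' \<tau>) (g s)) has_integral prod (f t - f s) (g s)) {s..t}"
      using has_integral_linear[OF integrable_integral[OF i(1)] bounded_linear_left[of "g s"]] acb_diff[OF f st]
      by (simp add: o_def)
    have p2: "((\<lambda>\<tau>. prod (f t) (g' \<tau>)) has_integral prod (f t) (g t - g s)) {s..t}"
      using has_integral_linear[OF integrable_integral[OF i(2)] bounded_linear_right[of "f t"]] acb_diff[OF g st]
      by (simp add: o_def)
    have "integral {a..s} ?d + integral {s..t} ?d = integral {a..t} ?d"
      using Henstock_Kurzweil_Integration.integral_combine i st by blast
    then have DD: "D t - D s = prod (f t - f s) (g s) + prod (f t) (g t - g s) - integral {s..t} ?d"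
      by (simp add: D_def diff_left diff_right algebra_simps)
    have hi: "((\<lambda>\<tau>. prod (f' \<tau>) (g s) + prod (f t) (g' \<tau>) - ?d \<tau>) has_integral (D t - D s)) {s..t}"
      unfolding DD by (intro has_integral_diff has_integral_add p1 p2 integrable_integral i)
    have "AE \<tau> in lebesgue_on {s..t}. norm (f' \<tau>) \<le> M" "AE \<tau> in lebesgue_on {s..t}. norm (g' \<tau>) \<le> N"
      using MN ebd_subset st unfolding ebd_def by blast+
    then have "AE \<tau> in lebesgue_on {s..t}. norm (prod (f' \<tau>) (g s) + prod (f t) (g' \<tau>) - ?d \<tau>) \<le> 2 * M * N * K * (t - s)"
      using AE_space
    proof eventually_elim
      case (elim \<tau>)
      then have \<tau>: "\<tau> \<in> {s..t}" by (simp add: space_restrict_space)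
      have g1: "norm (g s - g \<tau>) \<le> N * (t - s)"
      proof -
        have "norm (g s - g \<tau>) \<le> N * \<bar>s - \<tau>\<bar>" using acb_lip_ebd[OF g MN(2), of \<tau> s] \<tau> st by auto
        also have "\<dots> \<le> N * (t - s)" using \<tau> MN by (intro mult_left_mono) auto
        finally show ?thesis .
      qed
      have f1: "norm (f t - f \<tau>) \<le> M * (t - s)"
      proof -
        have "norm (f t - f \<tau>) \<le> M * \<bar>t - \<tau>\<bar>" using acb_lip_ebd[OF f MN(1), of \<tau> t] \<tau> st by auto
        also have "\<dots> \<le> M * (t - s)" using \<tau> MN by (intro mult_left_mono) auto
        finally show ?thesis .
      qed
      have "prod (f' \<tau>) (g s) + prod (f t) (g' \<tau>) - ?d \<tau> = prod (f' \<tau>) (g s - g \<tau>) + prod (f t - f \<tau>) (g' \<tau>)"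
        by (simp add: diff_left diff_right)
      also have "norm \<dots> \<le> norm (f' \<tau>) * norm (g s - g \<tau>) * K + norm (f t - f \<tau>) * norm (g' \<tau>) * K"
        by (meson K(2) add_mono norm_triangle_le)
      also have "\<dots> \<le> M * (N * (t - s)) * K + (M * (t - s)) * N * K"
        using elim g1 f1 MN K st by (intro add_mono mult_mono mult_nonneg_nonneg) auto
      finally show ?case by (simp add: algebra_simps)
    qed
    then have "norm (integral {s..t} (\<lambda>\<tau>. prod (f' \<tau>) (g s) + prod (f t) (g' \<tau>) - ?d \<tau>)) \<le> 2 * M * N * K * (t - s) * (t - s)"
      using hi st by (intro AE_integral_bound) (auto simp: has_integral_integrable)
    then show ?thesis using hi by (simp add: integral_unique)
  qed
  have key': "norm (D t - D s) \<le> (2 * M * N * K) * \<bar>t - s\<bar> * \<bar>t - s\<bar>" if "s \<in> {a..b}" "t \<in> {a..b}" for s t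
    using key[of s t] key[of t s] that by (cases "s \<le> t") (auto simp: norm_minus_commute algebra_simps)
  have "\<exists>c. \<forall>t\<in>{a..b}. D t = c"
  proof (rule has_derivative_zero_constant)
    fix s assume s: "s \<in> {a..b}"
    show "(D has_derivative (\<lambda>h. 0)) (at s within {a..b})"
      unfolding has_derivative_iff_norm
    proof (intro conjI bounded_linear_zero)
      have "((\<lambda>y. (2 * M * N * K) * \<bar>y - s\<bar>) \<longlongrightarrow> (2 * M * N * K) * \<bar>s - s\<bar>) (at s within {a..b})"
        by (intro tendsto_intros)
      then have lim: "((\<lambda>y. (2 * M * N * K) * \<bar>y - s\<bar>) \<longlongrightarrow> 0) (at s within {a..b})" by simp
      show "((\<lambda>y. norm (D y - D s - 0) / norm (y - s)) \<longlongrightarrow> 0) (at s within {a..b})"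
      proof (rule tendsto_sandwich[OF _ _ tendsto_const lim])
        show "\<forall>\<^sub>F y in at s within {a..b}. norm (D y - D s - 0) / norm (y - s) \<le> (2 * M * N * K) * \<bar>y - s\<bar>"
          unfolding eventually_at using key'[OF s]
          by (intro exI[of _ 1]) (auto simp: field_simps)
      qed auto
    qed
  qed auto
  then obtain c where c: "\<And>t. t\<in>{a..b} \<Longrightarrow> D t = c" by blast
  show ?thesis
  proof (rule acbI[OF ed])
    fix t assume t: "t \<in> {a..b}"
    then have "D t = D a" using c[of t] c[of a] by auto
    then show "prod (f t) (g t) = prod (f a) (g a) + integral {a..t} ?d"
      by (simp add: D_def algebra_simps)
  qed
qed

lemma acb_nonincreasing:
  fixes f :: "real \<Rightarrow> real"
  assumes "acb a b f f'" "a \<le> b" "AE t in lebesgue_on {a..b}. f' t \<le> 0"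
  shows "f b \<le> f a"
proof -
  obtain M where M: "ebd M a b f'" using acbD(1)[OF assms(1)] by blast
  have N: "negligible {t\<in>{a..b}. \<not> f' t \<le> 0}"
    using assms(3) by (simp add: AE_lebesgue_on_iff_negligible)
  have "integral {a..b} f' = integral {a..b} (\<lambda>t. min (f' t) 0)"
    by (rule integral_spike[OF N]) auto
  moreover have "(\<lambda>t. min (f' t) 0) integrable_on {a..b}"
    using ebd_integrable[OF M] by (rule integrable_spike[OF _ N]) auto
  then have "integral {a..b} (\<lambda>t. min (f' t) 0) \<le> integral {a..b} (\<lambda>t. 0)"
    by (intro integral_le) auto
  ultimately show ?thesis using acb_diff[OF assms(1), of a b] assms(2) by auto
qed

section \<open>Weak derivatives\<close>

text \<open>Truncated powers: their second differences give a hat function and its primitives in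
  closed form, and from exponent 2 on they are continuously differentiable, as test functions have
  to be.\<close>

definition tp :: "nat \<Rightarrow> real \<Rightarrow> real" where
  "tp k x = (max 0 x) ^ k"

lemma tp_deriv:
  assumes "k \<ge> 1"
  shows "(tp (Suc k) has_real_derivative (real (Suc k) * tp k x)) (at x)"
proof -
  consider "x < 0" | "x > 0" | "x = 0" by linarith
  then show ?thesis
  proof cases
    case 1
    have "((\<lambda>x. 0) has_real_derivative 0) (at x)" by simp
    then have "(tp (Suc k) has_real_derivative 0) (at x)"
      by (rule has_field_derivative_transform_within_open[of _ _ _ "{..<0}"]) (use 1 in \<open>auto simp: tp_def\<close>)
    then show ?thesis using 1 assms by (simp add: tp_def zero_power)
  next
    case 2
    have "((\<lambda>x. x ^ Suc k) has_real_derivative (real (Suc k) * x ^ k)) (at x)"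
      using DERIV_pow[of "Suc k" x] by simp
    then have "(tp (Suc k) has_real_derivative (real (Suc k) * x ^ k)) (at x)"
      by (rule has_field_derivative_transform_within_open[of _ _ _ "{0<..}"]) (use 2 in \<open>auto simp: tp_def\<close>)
    then show ?thesis using 2 by (simp add: tp_def)
  next
    case 3
    have "((\<lambda>h. \<bar>h\<bar> ^ k) \<longlongrightarrow> \<bar>0\<bar> ^ k) (at (0::real))" by (intro tendsto_intros)
    moreover have "\<bar>0::real\<bar> ^ k = 0" using assms by simp
    ultimately have l: "((\<lambda>h. \<bar>h\<bar> ^ k) \<longlongrightarrow> 0) (at (0::real))" by metis
    have "((\<lambda>h. (tp (Suc k) h - tp (Suc k) 0) / (h - 0)) \<longlongrightarrow> 0) (at 0)"
      by (rule Lim_null_comparison[OF _ l])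
        (auto simp: tp_def eventually_at abs_mult max_def power_abs intro!: exI[of _ 1])
    moreover have "real (Suc k) * tp k x = 0" using 3 assms by (simp add: tp_def zero_power)
    ultimately show ?thesis using 3 unfolding has_field_derivative_iff by metis
  qed
qed

lemma continuous_on_tp [continuous_intros]:
  "continuous_on S f \<Longrightarrow> continuous_on S (\<lambda>x. tp k (f x))"
  unfolding tp_def by (intro continuous_intros)

text \<open>For \<open>k = 1\<close> the hat function of integral 1 supported on \<open>[-\<delta>, \<delta>]\<close>; for \<open>k = 2, 3\<close> its iterated primitives.\<close>

definition hat :: "nat \<Rightarrow> real \<Rightarrow> real \<Rightarrow> real" where
  "hat k \<delta> x = (tp k (x + \<delta>) - 2 * tp k x + tp k (x - \<delta>)) / (fact k * \<delta>\<^sup>2)"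

lemma hat_deriv:
  assumes "k \<ge> 1"
  shows "(hat (Suc k) \<delta> has_real_derivative hat k \<delta> x) (at x)"
proof -
  note d = DERIV_chain2[OF tp_deriv[OF assms]]
  have "((\<lambda>x. (tp (Suc k) (x + \<delta>) - 2 * tp (Suc k) x + tp (Suc k) (x - \<delta>)) / (fact (Suc k) * \<delta>\<^sup>2)) has_real_derivative
     (real (Suc k) * tp k (x + \<delta>) * 1 - 2 * (real (Suc k) * tp k x) + real (Suc k) * tp k (x - \<delta>) * 1) / (fact (Suc k) * \<delta>\<^sup>2)) (at x)"
    by (intro DERIV_cdivide DERIV_add DERIV_diff DERIV_cmult d tp_deriv[OF assms])
      (auto intro!: derivative_eq_intros)
  also have "(real (Suc k) * tp k (x + \<delta>) * 1 - 2 * (real (Suc k) * tp k x) + real (Suc k) * tp k (x - \<delta>) * 1) / (fact (Suc k) * \<delta>\<^sup>2)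
     = (real (Suc k) * (tp k (x + \<delta>) - 2 * tp k x + tp k (x - \<delta>))) / (real (Suc k) * (fact k * \<delta>\<^sup>2))"
    by (simp only: fact_Suc) (simp add: algebra_simps)
  also have "\<dots> = hat k \<delta> x" unfolding hat_def by (subst mult_divide_mult_cancel_left) auto
  finally show ?thesis unfolding hat_def .
qed

lemma continuous_on_hat [continuous_intros]:
  "continuous_on S f \<Longrightarrow> continuous_on S (\<lambda>x. hat k \<delta> (f x))"
  unfolding hat_def divide_inverse by (intro continuous_intros)

lemma hat_left: "\<delta> > 0 \<Longrightarrow> x \<le> - \<delta> \<Longrightarrow> k \<ge> 1 \<Longrightarrow> hat k \<delta> x = 0"
  by (simp add: hat_def tp_def max.absorb1 zero_power)

text \<open>Right of the support the truncated powers are plain powers, and the second difference of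
  a power of degree 1, 2, 3 is zero, constant, linear. Combinations of translates that cancel
  constants and linear functions therefore have compactly supported primitives.\<close>

lemma hat_right:
  assumes "\<delta> > 0" "x \<ge> \<delta>"
  shows "hat 1 \<delta> x = 0" "hat 2 \<delta> x = 1" "hat 3 \<delta> x = x"
proof -
  have m: "max 0 x = x" "max 0 (x+\<delta>) = x+\<delta>" "max 0 (x-\<delta>) = x-\<delta>" using assms by auto
  show "hat 1 \<delta> x = 0" using assms by (simp add: hat_def tp_def m)
  have "(x+\<delta>)^2 - 2*x^2 + (x-\<delta>)^2 = 2*\<delta>^2" by algebra
  then show "hat 2 \<delta> x = 1" using assms by (simp add: hat_def tp_def m fact_numeral)
  have "(x+\<delta>)^3 - 2*x^3 + (x-\<delta>)^3 = 6*x*\<delta>^2" by algebra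
  then show "hat 3 \<delta> x = x" using assms by (simp add: hat_def tp_def m fact_numeral)
qed

lemma hat1_nonneg: "\<delta> > 0 \<Longrightarrow> hat 1 \<delta> x \<ge> 0"
  unfolding hat_def tp_def by (intro divide_nonneg_nonneg) (auto simp: max_def)

lemma hat1_integral:
  assumes "\<delta> > 0" "a \<le> p - \<delta>" "p + \<delta> \<le> b"
  shows "((\<lambda>t. hat 1 \<delta> (t - p)) has_integral 1) {a..b}"
proof -
  have "((\<lambda>t. hat 1 \<delta> (t - p)) has_integral (hat 2 \<delta> (b - p) - hat 2 \<delta> (a - p))) {a..b}"
  proof (rule fundamental_theorem_of_calculus)
    fix t
    have "((\<lambda>t. hat 2 \<delta> (t - p)) has_real_derivative hat 1 \<delta> (t - p) * 1) (at t)"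
      by (rule DERIV_chain2[where f="hat 2 \<delta>"])
        (use hat_deriv[of 1 \<delta>] in \<open>auto intro!: derivative_eq_intros simp: numeral_2_eq_2\<close>)
    then show "((\<lambda>t. hat 2 \<delta> (t - p)) has_vector_derivative hat 1 \<delta> (t - p)) (at t within {a..b})"
      by (simp add: has_real_derivative_iff_has_vector_derivative has_vector_derivative_at_within)
  qed (use assms in auto)
  then show ?thesis using assms hat_left[of \<delta> "a - p" 2] hat_right(2)[of \<delta> "b - p"] by simp
qed

text \<open>The hats form an approximate identity: they are nonnegative, have integral 1 and shrink
  to \<open>p\<close>.\<close>

lemma hat1_average:
  fixes f :: "real \<Rightarrow> 'a::euclidean_space"
  assumes "continuous_on {a..b} f" "a < p" "p < b" "\<epsilon> > 0"
  shows "\<exists>\<eta>>0. \<forall>\<delta>. 0 < \<delta> \<and> \<delta> < \<eta> \<longrightarrow> norm (integral {a..b} (\<lambda>t. hat 1 \<delta> (t - p) *\<^sub>R f t) - f p) \<le> \<epsilon>"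
proof -
  obtain d where d: "d > 0" "\<And>t. t \<in> {a..b} \<Longrightarrow> dist t p < d \<Longrightarrow> dist (f t) (f p) < \<epsilon>"
    using assms by (metis continuous_on_iff atLeastAtMost_iff less_imp_le)
  \<comment> \<open>Keeps the support of the hat inside \<open>[a, b]\<close> and inside the region
    where \<open>f\<close> is \<open>\<epsilon>\<close>-close to \<open>f p\<close>.\<close>
  define \<eta> where "\<eta> = min d (min (p - a) (b - p))"
  have "norm (integral {a..b} (\<lambda>t. hat 1 \<delta> (t - p) *\<^sub>R f t) - f p) \<le> \<epsilon>" if \<delta>: "0 < \<delta>" "\<delta> < \<eta>" for \<delta>
  proof -
    have h1: "((\<lambda>t. hat 1 \<delta> (t - p)) has_integral 1) {a..b}"
      using \<delta> unfolding \<eta>_def by (intro hat1_integral) auto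
    have c: "continuous_on {a..b} (\<lambda>t. hat 1 \<delta> (t - p) *\<^sub>R f t)" by (intro continuous_intros assms)
    have h2: "((\<lambda>t. hat 1 \<delta> (t - p) *\<^sub>R f t - hat 1 \<delta> (t - p) *\<^sub>R f p) has_integral
        (integral {a..b} (\<lambda>t. hat 1 \<delta> (t - p) *\<^sub>R f t) - 1 *\<^sub>R f p)) {a..b}"
      by (intro has_integral_diff integrable_integral integrable_continuous_interval c has_integral_scaleR_left h1)
    have "norm (integral {a..b} (\<lambda>t. hat 1 \<delta> (t - p) *\<^sub>R f t - hat 1 \<delta> (t - p) *\<^sub>R f p))
       \<le> integral {a..b} (\<lambda>t. \<epsilon> * hat 1 \<delta> (t - p))"
    proof (rule integral_norm_bound_integral)
      fix t assume t: "t \<in> {a..b}"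
      show "norm (hat 1 \<delta> (t - p) *\<^sub>R f t - hat 1 \<delta> (t - p) *\<^sub>R f p) \<le> \<epsilon> * hat 1 \<delta> (t - p)"
      proof (cases "dist t p < d")
        case True
        then have "norm (f t - f p) \<le> \<epsilon>" using d(2)[OF t] by (simp add: dist_norm)
        then show ?thesis using hat1_nonneg[OF \<delta>(1)]
          by (simp add: scaleR_right_diff_distrib[symmetric] mult.commute mult_right_mono)
      next
        case False
        then have "\<delta> \<le> \<bar>t - p\<bar>" using \<delta> by (auto simp: dist_real_def \<eta>_def)
        then have "hat 1 \<delta> (t - p) = 0" using hat_left[of \<delta> "t-p" 1] hat_right(1)[of \<delta> "t-p"] \<delta> by linarith
        then show ?thesis by simp
      qed
    next
      show "(\<lambda>t. hat 1 \<delta> (t - p) *\<^sub>R f t - hat 1 \<delta> (t - p) *\<^sub>R f p) integrable_on {a..b}"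
        using h2 by (rule has_integral_integrable)
      show "(\<lambda>t. \<epsilon> * hat 1 \<delta> (t - p)) integrable_on {a..b}"
        using has_integral_mult_right[OF h1] by (rule has_integral_integrable)
    qed
    also have "\<dots> = \<epsilon> * 1" by (rule integral_unique[OF has_integral_mult_right[OF h1]])
    finally show ?thesis unfolding integral_unique[OF h2] by simp
  qed
  moreover have "\<eta> > 0" using d assms by (auto simp: \<eta>_def)
  ultimately show ?thesis by blast
qed

lemma hat1_average_lim:
  fixes f :: "real \<Rightarrow> 'a::euclidean_space"
  assumes "continuous_on {a..b} f" "a < p" "p < b"
  shows "((\<lambda>\<delta>. integral {a..b} (\<lambda>t. hat 1 \<delta> (t - p) *\<^sub>R f t)) \<longlongrightarrow> f p) (at_right 0)"
proof (rule tendstoI)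
  fix e :: real assume "e > 0"
  then obtain \<eta> where "\<eta> > 0" "\<forall>\<delta>. 0 < \<delta> \<and> \<delta> < \<eta> \<longrightarrow> norm (integral {a..b} (\<lambda>t. hat 1 \<delta> (t - p) *\<^sub>R f t) - f p) \<le> e/2"
    using hat1_average[OF assms, of "e/2"] by auto
  then show "\<forall>\<^sub>F \<delta> in at_right 0. dist (integral {a..b} (\<lambda>t. hat 1 \<delta> (t - p) *\<^sub>R f t)) (f p) < e"
    unfolding eventually_at_right_field dist_norm using \<open>e > 0\<close>
    by (intro exI[of _ \<eta>]) fastforce
qed

section \<open>Testing weak derivatives on half-open intervals\<close>

lemma tdom_infinity [simp]: "tdom a \<infinity> = {a..}"
  by (auto simp: tdom_def)

lemma tdom_Icc: "ereal b < \<omega> \<Longrightarrow> {a..b} \<subseteq> tdom a \<omega>"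
  by (auto simp: tdom_def) (meson ereal_less_eq(3) le_less_trans)

lemma tdom_Icc_subset: "b \<in> tdom a \<omega> \<Longrightarrow> {a..b} \<subseteq> tdom a \<omega>"
  using tdom_Icc by (simp add: tdom_def)

lemma integral_tdom:
  fixes F :: "real \<Rightarrow> 'a::banach"
  assumes "ereal d < \<omega>" "\<And>t. t \<in> tdom a \<omega> \<Longrightarrow> t > d \<Longrightarrow> F t = 0"
  shows "integral (tdom a \<omega>) F = integral {a..d} F"
proof (rule integral_spike_set)
  have "{x \<in> tdom a \<omega> - {a..d}. F x \<noteq> 0} = {}" using assms(2) by (force simp: tdom_def)
  then show "negligible {x \<in> tdom a \<omega> - {a..d}. F x \<noteq> 0}" by (simp only: negligible_empty)
  have "{x \<in> {a..d} - tdom a \<omega>. F x \<noteq> 0} = {}" using tdom_Icc[OF assms(1), of a] by auto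
  then show "negligible {x \<in> {a..d} - tdom a \<omega>. F x \<noteq> 0}" by (simp only: negligible_empty)
qed

lemma ereal_less_obtain:
  assumes "ereal d < \<omega>" obtains d' where "d < d'" "ereal d' < \<omega>"
  using ereal_dense2[OF assms] by auto

lemma vanishing_deriv:
  assumes "\<And>t. (\<theta> has_real_derivative \<theta>' t) (at t)" "\<And>t. t > d \<Longrightarrow> \<theta> t = 0" "t > d"
  shows "\<theta>' t = 0"
proof -
  have "((\<lambda>t. 0) has_real_derivative 0) (at t)" by simp
  then have "(\<theta> has_real_derivative 0) (at t)"
    by (rule has_field_derivative_transform_within_open[of _ _ _ "{d<..}"]) (use assms in auto)
  then show ?thesis using assms(1) DERIV_unique by blast
qed

text \<open>Integrating the product rule for \<open>\<theta> *\<^sub>R f\<close> over an interval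
  beyond which \<open>\<theta>\<close> vanishes leaves no boundary terms.\<close>

lemma acb_imp_weak_deriv:
  fixes f :: "real \<Rightarrow> 'a::euclidean_space"
  assumes acb: "\<And>b. a \<le> b \<Longrightarrow> ereal b < \<omega> \<Longrightarrow> acb a b f f'" and a: "ereal a < \<omega>"
  shows "weak_deriv a \<omega> f f'"
  unfolding weak_deriv_def
proof (intro conjI allI impI)
  fix b assume b: "a \<le> b \<and> ereal b < \<omega>"
  show "f absolutely_integrable_on {a..b}"
    using acb_cont[OF acb] b absolutely_integrable_continuous_real by blast
  show "f' absolutely_integrable_on {a..b}"
    using acbD(1)[OF acb] b ebd_abs_int by blast
next
  fix \<theta> \<theta>' :: "real \<Rightarrow> real"
  assume *: "(\<forall>t. (\<theta> has_real_derivative \<theta>' t) (at t)) \<and> continuous_on UNIV \<theta>' \<and>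
              (\<exists>c d. a < c \<and> ereal d < \<omega> \<and> (\<forall>t. t \<notin> {c..d} \<longrightarrow> \<theta> t = 0))"
  then obtain c d where cd: "a < c" "ereal d < \<omega>" "\<And>t. t \<notin> {c..d} \<Longrightarrow> \<theta> t = 0" by blast
  \<comment> \<open>\<open>d\<close> may lie left of \<open>a\<close>, in which case
    \<open>\<theta>\<close> is zero; going on to \<open>d'\<close> makes \<open>\<theta>\<close>
    vanish at the right end point.\<close>
  have "ereal (max a d) < \<omega>" using cd a by (auto simp: max_def)
  then obtain d' where d': "max a d < d'" "ereal d' < \<omega>" by (rule ereal_less_obtain)
  have D: "\<And>t. (\<theta> has_real_derivative \<theta>' t) (at t)" and C: "continuous_on UNIV \<theta>'" using * by auto
  have z: "\<theta>' t = 0" if "t > d" for t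
    using vanishing_deriv[OF D _ that] cd by force
  have "acb a d' \<theta> \<theta>'"
    using D C by (intro has_vector_derivative_imp_acb)
      (auto simp: has_real_derivative_iff_has_vector_derivative has_vector_derivative_at_within
        intro: continuous_on_subset)
  moreover have F: "acb a d' f f'" using acb d' by auto
  ultimately have P: "acb a d' (\<lambda>t. \<theta> t *\<^sub>R f t) (\<lambda>t. \<theta>' t *\<^sub>R f t + \<theta> t *\<^sub>R f' t)"
    by (rule acb_bilinear[OF bounded_bilinear_scaleR])
  have i: "(\<lambda>t. \<theta>' t *\<^sub>R f t) integrable_on {a..d'}"
    using acb_cont[OF F] C by (intro integrable_continuous_interval continuous_intros) (auto intro: continuous_on_subset)
  obtain M where "ebd M a d' (\<lambda>t. \<theta>' t *\<^sub>R f t + \<theta> t *\<^sub>R f' t)" using acbD(1)[OF P] by blast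
  then have "(\<lambda>t. \<theta>' t *\<^sub>R f t + \<theta> t *\<^sub>R f' t) integrable_on {a..d'}" by (rule ebd_integrable)
  from integrable_diff[OF this i] have j: "(\<lambda>t. \<theta> t *\<^sub>R f' t) integrable_on {a..d'}" by simp
  have "0 = integral {a..d'} (\<lambda>t. \<theta>' t *\<^sub>R f t + \<theta> t *\<^sub>R f' t)"
    using acbD(2)[OF P, of d'] d' cd(3)[of a] cd(3)[of d'] cd(1) by auto
  also have "\<dots> = integral {a..d'} (\<lambda>t. \<theta>' t *\<^sub>R f t) + integral {a..d'} (\<lambda>t. \<theta> t *\<^sub>R f' t)"
    using i j by (rule Henstock_Kurzweil_Integration.integral_add)
  finally have e: "0 = integral {a..d'} (\<lambda>t. \<theta>' t *\<^sub>R f t) + integral {a..d'} (\<lambda>t. \<theta> t *\<^sub>R f' t)" .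
  have "integral (tdom a \<omega>) (\<lambda>t. \<theta>' t *\<^sub>R f t) = integral {a..d'} (\<lambda>t. \<theta>' t *\<^sub>R f t)"
    using d' z by (intro integral_tdom) auto
  moreover have "integral (tdom a \<omega>) (\<lambda>t. \<theta> t *\<^sub>R f' t) = integral {a..d'} (\<lambda>t. \<theta> t *\<^sub>R f' t)"
    using d' cd(3) by (intro integral_tdom) auto
  ultimately show "integral (tdom a \<omega>) (\<lambda>t. \<theta>' t *\<^sub>R f t) = - integral (tdom a \<omega>) (\<lambda>t. \<theta> t *\<^sub>R f' t)"
    using e by (simp add: eq_neg_iff_add_eq_0)
qed

lemma weak_deriv_test:
  assumes "weak_deriv a \<omega> f g" "\<And>t. (\<theta> has_real_derivative \<theta>' t) (at t)" "continuous_on UNIV \<theta>'"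
    "a < c" "ereal d < \<omega>" "\<And>t. t < c \<or> t > d \<Longrightarrow> \<theta> t = 0"
  shows "integral {a..d} (\<lambda>t. \<theta>' t *\<^sub>R f t) = - integral {a..d} (\<lambda>t. \<theta> t *\<^sub>R g t)"
proof -
  have z: "\<theta>' t = 0" if "t > d" for t
    using vanishing_deriv[OF assms(2) _ that] assms(6) by force
  have "integral (tdom a \<omega>) (\<lambda>t. \<theta>' t *\<^sub>R f t) = integral {a..d} (\<lambda>t. \<theta>' t *\<^sub>R f t)"
    using assms(5) z by (intro integral_tdom) auto
  moreover have "integral (tdom a \<omega>) (\<lambda>t. \<theta> t *\<^sub>R g t) = integral {a..d} (\<lambda>t. \<theta> t *\<^sub>R g t)"
    using assms(5,6) by (intro integral_tdom) auto
  moreover have "\<forall>t. t \<notin> {c..d} \<longrightarrow> \<theta> t = 0" using assms(6) by (auto simp: not_le)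
  then have "(\<forall>t. (\<theta> has_real_derivative \<theta>' t) (at t)) \<and> continuous_on UNIV \<theta>' \<and>
       (\<exists>c d. a < c \<and> ereal d < \<omega> \<and> (\<forall>t. t \<notin> {c..d} \<longrightarrow> \<theta> t = 0))"
    using assms(2-5) by blast
  then have "integral (tdom a \<omega>) (\<lambda>t. \<theta>' t *\<^sub>R f t) = - integral (tdom a \<omega>) (\<lambda>t. \<theta> t *\<^sub>R g t)"
    using assms(1) unfolding weak_deriv_def by blast
  ultimately show ?thesis by simp
qed

lemma hat_deriv_shift:
  assumes "k \<ge> 1" shows "((\<lambda>t. hat (Suc k) \<delta> (t - p)) has_real_derivative hat k \<delta> (t - p)) (at t)"
proof -
  have "((\<lambda>t. t - p) has_real_derivative 1) (at t)" by (auto intro!: derivative_eq_intros)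
  from DERIV_chain2[OF hat_deriv[OF assms] this] show ?thesis by simp
qed

lemma hat2_deriv_shift: "((\<lambda>t. hat 2 \<delta> (t - p)) has_real_derivative hat 1 \<delta> (t - p)) (at t)"
  and hat3_deriv_shift: "((\<lambda>t. hat 3 \<delta> (t - p)) has_real_derivative hat 2 \<delta> (t - p)) (at t)"
  using hat_deriv_shift[of 1 \<delta>] hat_deriv_shift[of 2 \<delta>] by (simp_all add: eval_nat_numeral)

text \<open>As \<open>\<delta>\<close> tends to 0, the weighted integrals become point values of
  \<open>K\<close>.\<close>

lemma hat_increment_zero:
  fixes K :: "real \<Rightarrow> 'a::euclidean_space"
  assumes K: "continuous_on {a..d} K" and pq: "a < p" "p < d" "a < q" "q < d" and \<eta>: "\<eta> > 0"
    and zero: "\<And>\<delta>. 0 < \<delta> \<Longrightarrow> \<delta> < \<eta> \<Longrightarrow> integral {a..d} (\<lambda>t. (hat 1 \<delta> (t - p) - hat 1 \<delta> (t - q)) *\<^sub>R K t) = 0"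
  shows "K p = K q"
proof -
  let ?A = "\<lambda>q \<delta>. integral {a..d} (\<lambda>t. hat 1 \<delta> (t - q) *\<^sub>R K t)"
  have "(\<lambda>t. hat 1 \<delta> (t - p) *\<^sub>R K t) integrable_on {a..d}" for p \<delta>
    by (intro integrable_continuous_interval continuous_intros K)
  then have "?A p \<delta> - ?A q \<delta> = 0" if "0 < \<delta>" "\<delta> < \<eta>" for \<delta>
    using zero[OF that] by (simp add: scaleR_left_diff_distrib Henstock_Kurzweil_Integration.integral_diff)
  then have "\<forall>\<^sub>F \<delta> in at_right 0. ?A p \<delta> - ?A q \<delta> = 0"
    unfolding eventually_at_right_field using \<eta> by (intro exI[of _ \<eta>]) auto
  then have "((\<lambda>\<delta>. ?A p \<delta> - ?A q \<delta>) \<longlongrightarrow> 0) (at_right 0)" by (rule tendsto_eventually)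
  moreover have "((\<lambda>\<delta>. ?A p \<delta> - ?A q \<delta>) \<longlongrightarrow> K p - K q) (at_right 0)"
    by (intro tendsto_diff hat1_average_lim K pq)
  ultimately show ?thesis using tendsto_unique trivial_limit_at_right_real by fastforce
qed

text \<open>\<open>f - \<integral>g\<close> has weak derivative 0, so its averages with hat functions do not depend on their centre.\<close>

lemma weak_deriv_imp_acb:
  fixes f :: "real \<Rightarrow> 'a::euclidean_space"
  assumes w: "weak_deriv a \<omega> f g" and c: "continuous_on (tdom a \<omega>) f"
    and b: "ereal b < \<omega>" and g: "ebd M a b g"
  shows "acb a b f g"
proof (rule acbI[OF g])
  fix t assume t: "t \<in> {a..b}"
  define F where "F t = integral {a..t} g" for t
  define K where "K t = f t - F t" for t
  have F: "acb a b F g" using g by (auto simp: acb_def F_def)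
  have cf: "continuous_on {a..b} f" using continuous_on_subset[OF c tdom_Icc[OF b]] .
  have cK: "continuous_on {a..b} K" unfolding K_def by (intro continuous_intros cf acb_cont[OF F])
  have eq: "K p = K q" if pq: "a < p" "p < q" "q < b" for p q
  proof -
    obtain d where d: "q < d" "d < b" using dense pq(3) by blast
    have wF: "weak_deriv a (ereal b) F g" using pq by (intro acb_imp_weak_deriv acb_subset[OF F]) auto
    have dw: "ereal d < \<omega>" using d(2) b less_trans[of "ereal d" "ereal b" \<omega>] by simp
    have cd: "continuous_on {a..d} f" "continuous_on {a..d} F"
      using continuous_on_subset[OF cf] continuous_on_subset[OF acb_cont[OF F]] d(2) by auto
    define \<eta> where "\<eta> = min (p - a) (d - q)"
    \<comment> \<open>A single \<open>hat 2\<close> is constantly 1 on the right; only the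
      difference of two of them has compact support.\<close>
    define Th where "Th j \<delta> t = hat j \<delta> (t - p) - hat j \<delta> (t - q)" for j \<delta> t
    have cTh: "continuous_on S (Th j \<delta>)" for S j \<delta> unfolding Th_def by (intro continuous_intros)
    have test: "integral {a..d} (\<lambda>t. Th 1 \<delta> t *\<^sub>R X t) = - integral {a..d} (\<lambda>t. Th 2 \<delta> t *\<^sub>R g t)"
      if \<delta>: "0 < \<delta>" "\<delta> < \<eta>" and X: "weak_deriv a w X g" "ereal d < w" for \<delta> X w
    proof (rule weak_deriv_test[OF X(1) _ cTh _ X(2), where c="p - \<delta>"])
      show "(Th 2 \<delta> has_real_derivative Th 1 \<delta> t) (at t)" for t
        unfolding Th_def by (intro derivative_intros hat2_deriv_shift)
      show "a < p - \<delta>" using \<delta> by (simp add: \<eta>_def)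
      show "Th 2 \<delta> t = 0" if "t < p - \<delta> \<or> t > d" for t
        using hat_left[of \<delta> "t - p" 2] hat_left[of \<delta> "t - q" 2] hat_right(2)[of \<delta> "t - p"] hat_right(2)[of \<delta> "t - q"] pq \<delta> that
        by (cases "t < p - \<delta>") (simp_all add: Th_def \<eta>_def)
    qed
    have "integral {a..d} (\<lambda>t. Th 1 \<delta> t *\<^sub>R K t) = 0" if \<delta>: "0 < \<delta>" "\<delta> < \<eta>" for \<delta>
    proof -
      have "integral {a..d} (\<lambda>t. Th 1 \<delta> t *\<^sub>R K t) = integral {a..d} (\<lambda>t. Th 1 \<delta> t *\<^sub>R f t) - integral {a..d} (\<lambda>t. Th 1 \<delta> t *\<^sub>R F t)"
        unfolding K_def scaleR_right_diff_distrib
        by (intro Henstock_Kurzweil_Integration.integral_diff integrable_continuous_interval continuous_intros cTh cd)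
      then show ?thesis using test[OF \<delta> w dw] test[OF \<delta> wF] d(2) by simp
    qed
    then have "integral {a..d} (\<lambda>t. (hat 1 \<delta> (t - p) - hat 1 \<delta> (t - q)) *\<^sub>R K t) = 0" if "0 < \<delta>" "\<delta> < \<eta>" for \<delta>
      using that unfolding Th_def by blast
    moreover have "continuous_on {a..d} K" by (rule continuous_on_subset[OF cK]) (use d in auto)
    moreover have "a < q" "p < d" "\<eta> > 0" using pq d by (simp_all add: \<eta>_def)
    ultimately show ?thesis using hat_increment_zero[of a d K p q \<eta>] pq d by blast
  qed
  show "f t = f a + integral {a..t} g"
  proof (cases "a < t")
    case True
    then have ab: "a < b" using t by simp
    define m where "m = (a + b) / 2"
    have m: "a < m" "m < b" using ab by (auto simp: m_def)
    have "K s = K m" if "s \<in> {a<..<b}" for s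
      using that m eq by (metis greaterThanLessThan_iff linorder_less_linear)
    then have "K s = K m" if "s \<in> {a..b}" for s
      using continuous_constant_on_closure[of "{a<..<b}" K "K m" s] cK ab that by simp
    from this[of t] this[of a] have "K t = K a" using t ab by simp
    then show ?thesis by (simp add: K_def F_def algebra_simps)
  qed (use t in auto)
qed

text \<open>\<open>g\<close> is not assumed continuous, so the previous lemma does not apply to the
  pair \<open>g\<close>, \<open>k\<close>. Instead, \<open>f\<close> minus the double integral of
  \<open>k\<close> has vanishing second weak derivative and hence is affine. Its slope plus the
  integral of \<open>k\<close> is the representative that replaces \<open>g\<close>.\<close>

lemma weak_deriv_twice:
  fixes f :: "real \<Rightarrow> 'a::euclidean_space"
  assumes w1: "weak_deriv a \<omega> f g" and w2: "weak_deriv a \<omega> g k"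
    and c: "continuous_on (tdom a \<omega>) f" and a: "ereal a < \<omega>"
    and kb: "\<And>b. ereal b < \<omega> \<Longrightarrow> \<exists>M. ebd M a b k"
  shows "\<exists>G. \<forall>b. a \<le> b \<longrightarrow> ereal b < \<omega> \<longrightarrow> acb a b f G \<and> acb a b G k"
proof -
  define K0 where "K0 t = integral {a..t} k" for t
  define K1 where "K1 t = integral {a..t} K0" for t
  have K0: "acb a b K0 k" if "ereal b < \<omega>" for b
    using kb[OF that] by (auto simp: acb_def K0_def)
  have K1: "acb a b K1 K0" if "ereal b < \<omega>" for b
    using continuous_ebd[OF acb_cont[OF K0[OF that]]] by (auto simp: acb_def K1_def)
  note wK = acb_imp_weak_deriv[OF K1 a] acb_imp_weak_deriv[OF K0 a]
  define K where "K t = f t - K1 t" for t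
  have cf: "continuous_on {a..d} f" if "ereal d < \<omega>" for d
    using continuous_on_subset[OF c tdom_Icc[OF that]] .
  have cK1: "continuous_on {a..d} K1" if "ereal d < \<omega>" for d
    using acb_cont[OF K1[OF that]] .
  have cK: "continuous_on {a..d} K" if "ereal d < \<omega>" for d
    unfolding K_def by (intro continuous_intros cf cK1 that)
  \<comment> \<open>Affinity in three-point form. It results from testing with a second divided
    difference of hats and letting the hats shrink.\<close>
  have aff: "(r - p) *\<^sub>R K m = (r - m) *\<^sub>R K p + (m - p) *\<^sub>R K r"
    if pmr: "a < p" "p < m" "m < r" "ereal r < \<omega>" for p m r
  proof -
    obtain d where d: "r < d" "ereal d < \<omega>" using ereal_less_obtain pmr(4) by blast
    define \<eta> where "\<eta> = min (p - a) (d - r)"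
    have \<eta>: "\<eta> > 0" using pmr d by (auto simp: \<eta>_def)
    \<comment> \<open>The coefficients have zero sum and zero first moment, so to the right of all
      three hats the contributions to \<open>Th 2\<close> and \<open>Th 3\<close> cancel.\<close>
    define Th where "Th j \<delta> t = (r - m) * hat j \<delta> (t - p) - (r - p) * hat j \<delta> (t - m) + (m - p) * hat j \<delta> (t - r)" for j \<delta> t
    have Th3: "(Th 3 \<delta> has_real_derivative Th 2 \<delta> t) (at t)" for \<delta> t
      unfolding Th_def by (intro DERIV_add DERIV_diff DERIV_cmult hat3_deriv_shift)
    have Th2: "(Th 2 \<delta> has_real_derivative Th 1 \<delta> t) (at t)" for \<delta> t
      unfolding Th_def by (intro DERIV_add DERIV_diff DERIV_cmult hat2_deriv_shift)
    have cTh: "continuous_on S (Th j \<delta>)" for S j \<delta>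
      unfolding Th_def by (intro continuous_intros)
    have van: "Th 3 \<delta> t = 0" "Th 2 \<delta> t = 0" if \<delta>: "0 < \<delta>" "\<delta> < \<eta>" and t: "t < p - \<delta> \<or> t > d" for \<delta> t
    proof -
      have "Th 3 \<delta> t = 0 \<and> Th 2 \<delta> t = 0"
      proof (cases "t < p - \<delta>")
        case True
        then show ?thesis using hat_left[of \<delta> "t - p"] hat_left[of \<delta> "t - m"] hat_left[of \<delta> "t - r"] pmr \<delta>
          by (simp add: Th_def)
      next
        case False
        then have "t - p \<ge> \<delta>" "t - m \<ge> \<delta>" "t - r \<ge> \<delta>" using pmr \<delta> t by (auto simp: \<eta>_def)
        then have "Th 3 \<delta> t = (r - m) * (t - p) - (r - p) * (t - m) + (m - p) * (t - r)"
          "Th 2 \<delta> t = (r - m) - (r - p) + (m - p)"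
          using hat_right[OF \<delta>(1)] by (simp_all add: Th_def)
        then show ?thesis by (simp add: algebra_simps)
      qed
      then show "Th 3 \<delta> t = 0" "Th 2 \<delta> t = 0" by auto
    qed
    have two: "integral {a..d} (\<lambda>t. Th 1 \<delta> t *\<^sub>R F t) = integral {a..d} (\<lambda>t. Th 3 \<delta> t *\<^sub>R k t)"
      if \<delta>: "0 < \<delta>" "\<delta> < \<eta>" and W: "weak_deriv a \<omega> F F'" "weak_deriv a \<omega> F' k" for \<delta> F F'
    proof -
      have ap: "a < p - \<delta>" using \<delta> by (auto simp: \<eta>_def)
      show ?thesis
        using weak_deriv_test[OF W(1) Th2 cTh ap d(2) van(2)[OF \<delta>]]
          weak_deriv_test[OF W(2) Th3 cTh ap d(2) van(1)[OF \<delta>]] by simp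
    qed
    have zero: "integral {a..d} (\<lambda>t. Th 1 \<delta> t *\<^sub>R K t) = 0" if \<delta>: "0 < \<delta>" "\<delta> < \<eta>" for \<delta>
    proof -
      have "integral {a..d} (\<lambda>t. Th 1 \<delta> t *\<^sub>R K t) = integral {a..d} (\<lambda>t. Th 1 \<delta> t *\<^sub>R f t) - integral {a..d} (\<lambda>t. Th 1 \<delta> t *\<^sub>R K1 t)"
        unfolding K_def scaleR_right_diff_distrib
        by (intro Henstock_Kurzweil_Integration.integral_diff integrable_continuous_interval continuous_intros cTh cf cK1 d(2))
      also have "\<dots> = 0" using two[OF \<delta> w1 w2] two[OF \<delta> wK] by simp
      finally show ?thesis .
    qed
    let ?A = "\<lambda>q \<delta>. integral {a..d} (\<lambda>t. hat 1 \<delta> (t - q) *\<^sub>R K t)"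
    have lim: "((\<lambda>\<delta>. (r - m) *\<^sub>R ?A p \<delta> - (r - p) *\<^sub>R ?A m \<delta> + (m - p) *\<^sub>R ?A r \<delta>) \<longlongrightarrow>
        (r - m) *\<^sub>R K p - (r - p) *\<^sub>R K m + (m - p) *\<^sub>R K r) (at_right 0)"
      by (intro tendsto_intros hat1_average_lim cK d(2)) (use pmr d in auto)
    have ex: "integral {a..d} (\<lambda>t. Th 1 \<delta> t *\<^sub>R K t) = (r - m) *\<^sub>R ?A p \<delta> - (r - p) *\<^sub>R ?A m \<delta> + (m - p) *\<^sub>R ?A r \<delta>" for \<delta>
    proof -
      have i: "((\<lambda>t. hat 1 \<delta> (t - q) *\<^sub>R K t) has_integral ?A q \<delta>) {a..d}" for q
        by (intro integrable_integral integrable_continuous_interval continuous_intros cK d(2))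
      have "((\<lambda>t. (r - m) *\<^sub>R (hat 1 \<delta> (t - p) *\<^sub>R K t) - (r - p) *\<^sub>R (hat 1 \<delta> (t - m) *\<^sub>R K t) + (m - p) *\<^sub>R (hat 1 \<delta> (t - r) *\<^sub>R K t))
        has_integral ((r - m) *\<^sub>R ?A p \<delta> - (r - p) *\<^sub>R ?A m \<delta> + (m - p) *\<^sub>R ?A r \<delta>)) {a..d}"
        by (intro has_integral_add has_integral_diff has_integral_cmul i)
      then show ?thesis by (simp add: Th_def scaleR_left_distrib scaleR_left_diff_distrib integral_unique)
    qed
    have "\<forall>\<^sub>F \<delta> in at_right 0. (r - m) *\<^sub>R ?A p \<delta> - (r - p) *\<^sub>R ?A m \<delta> + (m - p) *\<^sub>R ?A r \<delta> = 0"
      unfolding eventually_at_right_field using zero ex \<eta> by (intro exI[of _ \<eta>]) auto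
    then have "((\<lambda>\<delta>. (r - m) *\<^sub>R ?A p \<delta> - (r - p) *\<^sub>R ?A m \<delta> + (m - p) *\<^sub>R ?A r \<delta>) \<longlongrightarrow> 0) (at_right 0)"
      by (rule tendsto_eventually)
    then have "(r - m) *\<^sub>R K p - (r - p) *\<^sub>R K m + (m - p) *\<^sub>R K r = 0"
      using lim tendsto_unique trivial_limit_at_right_real by blast
    then show ?thesis by (simp add: algebra_simps)
  qed
  \<comment> \<open>Test functions do not reach the end point \<open>a\<close>; continuity of
    \<open>K\<close> lets \<open>p\<close> tend to it.\<close>
  have affa: "(r - a) *\<^sub>R (K m - K a) = (m - a) *\<^sub>R (K r - K a)" if mr: "a < m" "m < r" "ereal r < \<omega>" for m r
  proof -
    let ?h = "\<lambda>p. (r - p) *\<^sub>R K m - ((r - m) *\<^sub>R K p + (m - p) *\<^sub>R K r)"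
    have cl: "closure {a<..<m} = {a..m}" using mr by simp
    have "continuous_on {a..m} K" using cK[OF mr(3)] by (rule continuous_on_subset) (use mr in auto)
    then have "continuous_on {a..m} ?h" by (intro continuous_intros)
    then have "?h a = 0"
      using continuous_constant_on_closure[of "{a<..<m}" ?h 0 a] aff[OF _ _ mr(2,3)] cl mr by auto
    then show ?thesis by (simp add: algebra_simps)
  qed
  \<comment> \<open>The slope is read off at one fixed point, which makes \<open>c0\<close>
    independent of \<open>b\<close>.\<close>
  obtain r0 where r0: "a < r0" "ereal r0 < \<omega>" using ereal_less_obtain a by blast
  define c0 where "c0 = (1 / (r0 - a)) *\<^sub>R (K r0 - K a)"
  have K: "K t = K a + (t - a) *\<^sub>R c0" if "a \<le> t" "ereal t < \<omega>" for t
  proof -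
    consider "t = a" | "a < t" "t < r0" | "t = r0" | "r0 < t" using \<open>a \<le> t\<close> by linarith
    then have "(r0 - a) *\<^sub>R (K t - K a) = (t - a) *\<^sub>R (K r0 - K a)"
      using affa[of t r0] affa[of r0 t] r0 that by cases auto
    then have "(r0 - a) *\<^sub>R (K t - K a) = (r0 - a) *\<^sub>R ((t - a) *\<^sub>R c0)"
      using r0 by (simp add: c0_def)
    then have "K t - K a = (t - a) *\<^sub>R c0" using r0(1) scaleR_cancel_left[of "r0 - a"]
      by (metis eq_iff_diff_eq_0 less_irrefl)
    then show ?thesis by (simp add: algebra_simps)
  qed
  have "acb a b f (\<lambda>t. c0 + K0 t) \<and> acb a b (\<lambda>t. c0 + K0 t) k" if b: "a \<le> b" "ereal b < \<omega>" for b
  proof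
    obtain M where "ebd M a b k" using kb b by blast
    then show "acb a b (\<lambda>t. c0 + K0 t) k"
      by (rule acbI) (simp add: K0_def)
    have cK0: "continuous_on {a..b} K0" using acb_cont[OF K0] b by auto
    then have "continuous_on {a..b} (\<lambda>t. c0 + K0 t)" by (intro continuous_intros)
    then obtain M where "ebd M a b (\<lambda>t. c0 + K0 t)" using continuous_ebd by blast
    then show "acb a b f (\<lambda>t. c0 + K0 t)"
    proof (rule acbI)
      fix t assume t: "t \<in> {a..b}"
      have i: "K0 integrable_on {a..t}"
        by (rule integrable_continuous_interval, rule continuous_on_subset[OF cK0]) (use t in auto)
      have tw: "ereal t < \<omega>" using t b by (meson ereal_less_eq(3) le_less_trans atLeastAtMost_iff)
      have "integral {a..t} (\<lambda>t. c0 + K0 t) = (t - a) *\<^sub>R c0 + K1 t"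
        using t i by (subst Henstock_Kurzweil_Integration.integral_add) (auto simp: K1_def)
      moreover have "K t = K a + (t - a) *\<^sub>R c0" using K[of t] t tw by simp
      moreover have "f t = K t + K1 t" "f a = K a" by (simp_all add: K_def K1_def)
      ultimately show "f t = f a + integral {a..t} (\<lambda>t. c0 + K0 t)" by simp
    qed
  qed
  then show ?thesis by blast
qed

section \<open>Continuous representatives of Sobolev functions\<close>

lemma has_vector_derivative_within_Ici:
  assumes "(f has_vector_derivative D) (at t within {a..b})" "t < b"
  shows "(f has_vector_derivative D) (at t within {a..})"
proof -
  have "at t within {a..b} = at t within {a..}"
    using assms(2) by (intro at_within_nhd[of t "{..<b}"]) auto
  then show ?thesis using assms by simp
qed

lemma acb_has_vector_derivative:
  assumes "acb a b f f'" "continuous_on {a..b} f'" "t \<in> {a..b}"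
  shows "(f has_vector_derivative f' t) (at t within {a..b})"
proof -
  have "((\<lambda>u. f a + integral {a..u} f') has_vector_derivative 0 + f' t) (at t within {a..b})"
    by (intro has_vector_derivative_add has_vector_derivative_const integral_has_vector_derivative assms)
  then have "((\<lambda>u. f a + integral {a..u} f') has_vector_derivative f' t) (at t within {a..b})" by simp
  from has_vector_derivative_transform[OF assms(3) acbD(2)[OF assms(1)] this]
  show ?thesis by blast
qed

lemma has_vector_derivative_norm_le:
  fixes f :: "real \<Rightarrow> 'a::euclidean_space"
  assumes "(f has_vector_derivative D) (at t within {a..})" "a \<le> t"
    and lip: "\<And>s t. a \<le> s \<Longrightarrow> a \<le> t \<Longrightarrow> norm (f t - f s) \<le> M * \<bar>t - s\<bar>"
  shows "norm D \<le> M"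
proof (rule field_le_epsilon)
  fix e :: real assume "e > 0"
  then obtain d where d: "d > 0" "\<And>y. y \<in> {a..} \<Longrightarrow> norm (y - t) < d \<Longrightarrow> norm (f y - f t - (y - t) *\<^sub>R D) \<le> e * norm (y - t)"
    using assms(1) unfolding has_vector_derivative_def has_derivative_within_alt by blast
  define y where "y = t + d / 2"
  have y: "y \<in> {a..}" "norm (y - t) < d" "y - t = d / 2" using d assms(2) by (auto simp: y_def)
  have "norm ((y - t) *\<^sub>R D) \<le> norm (f y - f t - (y - t) *\<^sub>R D) + norm (f y - f t)"
    by (metis norm_minus_commute norm_triangle_sub add.commute)
  also have "\<dots> \<le> e * norm (y - t) + M * \<bar>y - t\<bar>"
    using d(2)[OF y(1,2)] lip[of t y] y(1) assms(2) by (intro add_mono) (simp_all add: abs_minus_commute)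
  finally have "(d/2) * norm D \<le> (d/2) * (M + e)" using y(3) d by (simp add: algebra_simps)
  then show "norm D \<le> M + e" using d(1) by simp
qed

lemma Linf_ebd:
  assumes "Linf f" shows "\<exists>M\<ge>0. \<forall>b. ebd M 0 b f"
proof -
  obtain c where c: "f \<in> borel_measurable (lebesgue_on {0..})" "AE t in lebesgue_on {0..}. norm (f t) \<le> c"
    using assms by (auto simp: Linf_def)
  have "ebd c 0 b f" for b
    unfolding ebd_def
    using borel_measurable_lebesgue_on_subset[OF c(1), of "{0..b}"] AE_lebesgue_on_subset[OF c(2), of "{0..b}"] by auto
  then show ?thesis using ebd_mono[of c 0 _ f "\<bar>c\<bar>"] by (intro exI[of _ "\<bar>c\<bar>"]) auto
qed

lemma ebd_continuous_bound:
  assumes "\<And>b. ebd M 0 b f" "continuous_on {0..} f" "t \<ge> 0"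
  shows "norm (f t) \<le> M"
proof (rule AE_lebesgue_on_continuous_le[where a=0 and b="t+1" and f="\<lambda>t. norm (f t)"])
  show "AE x in lebesgue_on {0..t + 1}. norm (f x) \<le> M" using assms(1)[of "t+1"] by (simp add: ebd_def)
  show "continuous_on {0..t + 1} (\<lambda>a. norm (f a))"
    by (intro continuous_intros continuous_on_subset[OF assms(2)]) auto
qed (use assms in auto)

lemma continuous_on_Ici:
  assumes "\<And>b. a \<le> b \<Longrightarrow> continuous_on {a..b} f"
  shows "continuous_on {a..(b::real)} f" "continuous_on {a..} f"
proof -
  show *: "continuous_on {a..b} f" for b using assms[of b] by (cases "a \<le> b") auto
  show "continuous_on {a..} f"
    unfolding continuous_on_eq_continuous_within
  proof
    fix x assume "x \<in> {a..}"
    then have "continuous (at x within {a..x+1}) f" using *[of "x+1"] by (auto simp: continuous_on_eq_continuous_within)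
    moreover have "at x within {a..x+1} = at x within {a..}"
      by (intro at_within_nhd[of x "{..<x+1}"]) auto
    ultimately show "continuous (at x within {a..}) f" by simp
  qed
qed

text \<open>Only the first member of a chain of weak derivatives is assumed to be continuous; the intermediate
  members are replaced by continuous representatives one after the other.\<close>

lemma Winf_rep:
  fixes f :: "real \<Rightarrow> 'a::euclidean_space"
  assumes "Winf n f" "n \<ge> 1"
  shows "\<exists>G. G 0 = f \<and> (\<forall>j<n. \<forall>b\<ge>0. acb 0 b (G j) (G (Suc j))) \<and>
    (\<forall>j<n. continuous_on {0..} (G j) \<and> bounded (G j ` {0..})) \<and> (\<exists>M\<ge>0. \<forall>b. ebd M 0 b (G n))"
proof -
  obtain F where F: "F 0 = f" "\<And>j. j < n \<Longrightarrow> weak_deriv 0 \<infinity> (F j) (F (Suc j))" "\<And>j. j \<le> n \<Longrightarrow> Linf (F j)"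
    and cf: "continuous_on {0..} f" using assms by (auto simp: Winf_def)
  have main: "j < n \<Longrightarrow> \<exists>G. G 0 = f \<and> (\<forall>i<j. \<forall>b\<ge>0. acb 0 b (G i) (G (Suc i))) \<and>
      (\<forall>i\<le>j. continuous_on {0..} (G i) \<and> bounded (G i ` {0..})) \<and> weak_deriv 0 \<infinity> (G j) (F (Suc j))" for j
  proof (induction j)
    case 0
    obtain M where "M \<ge> 0" "\<And>b. ebd M 0 b f" using Linf_ebd F(1,3) by (metis le0)
    then have "bounded (f ` {0..})" using ebd_continuous_bound[OF _ cf] by (auto simp: bounded_iff)
    then show ?case using F(1) F(2)[of 0] cf 0 by (intro exI[of _ "\<lambda>_. f"]) auto
  next
    case (Suc j)
    then obtain G where G: "G 0 = f" "\<And>i b. i < j \<Longrightarrow> b \<ge> 0 \<Longrightarrow> acb 0 b (G i) (G (Suc i))"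
      "\<And>i. i \<le> j \<Longrightarrow> continuous_on {0..} (G i) \<and> bounded (G i ` {0..})" "weak_deriv 0 \<infinity> (G j) (F (Suc j))"
      by (meson Suc_lessD)
    have W2: "weak_deriv 0 \<infinity> (F (Suc j)) (F (Suc (Suc j)))" using F(2) Suc.prems by blast
    have eb: "\<exists>M. ebd M 0 b (F (Suc (Suc j)))" for b using Linf_ebd[OF F(3)] Suc.prems by (meson Suc_leI)
    have "continuous_on (tdom 0 \<infinity>) (G j)" using G(3) by simp
    from weak_deriv_twice[OF G(4) W2 this _ eb] obtain H where
      H: "\<And>b. b \<ge> 0 \<Longrightarrow> acb 0 b (G j) H" "\<And>b. b \<ge> 0 \<Longrightarrow> acb 0 b H (F (Suc (Suc j)))" by auto
    have cH: "continuous_on {0..} H" "\<And>b. continuous_on {0..b} H"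
      using continuous_on_Ici[OF acb_cont[OF H(2)]] by auto
    \<comment> \<open>Boundedness is known for \<open>F (Suc j)\<close>, not for the new
      representative \<open>H\<close>. It is transferred through the Lipschitz constant of
      \<open>G j\<close>, whose derivative is \<open>H\<close>.\<close>
    obtain M where M: "\<And>b. ebd M 0 b (F (Suc j))" using Linf_ebd[OF F(3)] Suc.prems by (meson Suc_leI less_imp_le)
    have acG: "acb 0 b (G j) (F (Suc j))" for b
      using weak_deriv_imp_acb[OF G(4) _ _ M] G(3) by simp
    have lip: "norm (G j t - G j s) \<le> M * \<bar>t - s\<bar>" if "0 \<le> s" "0 \<le> t" for s t
      using acb_lip_ebd[OF acG M, of s "max s t" t] that by auto
    have "norm (H t) \<le> M" if "t \<ge> 0" for t
    proof (rule has_vector_derivative_norm_le[OF _ that lip])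
      have "(G j has_vector_derivative H t) (at t within {0..t+1})"
        using that by (intro acb_has_vector_derivative[OF H(1) cH(2)]) auto
      then show "(G j has_vector_derivative H t) (at t within {0..})"
        by (rule has_vector_derivative_within_Ici) auto
    qed
    then have bH: "bounded (H ` {0..})" by (auto simp: bounded_iff)
    have wH: "weak_deriv 0 \<infinity> H (F (Suc (Suc j)))" using H(2) by (intro acb_imp_weak_deriv) auto
    show ?case
      by (rule exI[of _ "G(Suc j := H)"])
        (use G H cH bH wH in \<open>auto simp: less_Suc_eq le_Suc_eq\<close>)
  qed
  from assms have n: "n - 1 < n" "Suc (n - 1) = n" by auto
  obtain G where G: "G 0 = f" "\<And>i b. i < n - 1 \<Longrightarrow> b \<ge> 0 \<Longrightarrow> acb 0 b (G i) (G (Suc i))"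
      "\<And>i. i \<le> n - 1 \<Longrightarrow> continuous_on {0..} (G i) \<and> bounded (G i ` {0..})" "weak_deriv 0 \<infinity> (G (n - 1)) (F n)"
    using main[OF n(1)] n(2) by auto
  obtain M where M: "M \<ge> 0" "\<And>b. ebd M 0 b (F n)" using Linf_ebd[OF F(3)] by blast
  have acG: "acb 0 b (G (n - 1)) (F n)" for b
    using weak_deriv_imp_acb[OF G(4) _ _ M(2)] G(3)[of "n-1"] by simp
  show ?thesis
  proof (intro exI[of _ "G(n := F n)"] conjI allI impI)
    show "(G(n := F n)) 0 = f" using G(1) assms(2) by auto
    fix j assume j: "j < n"
    show "continuous_on {0..} ((G(n := F n)) j)" "bounded ((G(n := F n)) j ` {0..})" using G(3)[of j] j by auto
    fix b :: real assume b: "b \<ge> 0"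
    show "acb 0 b ((G(n := F n)) j) ((G(n := F n)) (Suc j))"
    proof (cases "j = n - 1")
      case True
      then have "(G(n := F n)) j = G (n - 1)" "(G(n := F n)) (Suc j) = F n" using n by auto
      then show ?thesis using acG by simp
    next
      case False
      then show ?thesis using G(2)[of j b] b j by auto
    qed
  qed (use M in auto)
qed

text \<open>The map \<open>F x = f x + (L + 1) x\<close> is bi-Lipschitz, so the image of Lebesgue measure under its inverse is
  absolutely continuous.\<close>

lemma lipschitz_imp_acb:
  fixes f :: "real \<Rightarrow> real"
  assumes lip: "\<And>s t. \<bar>f t - f s\<bar> \<le> L * \<bar>t - s\<bar>"
  shows "\<exists>f'. \<forall>a b. acb a b f f'"
proof -
  have L: "L \<ge> 0" using lip[of 1 0] by auto
  \<comment> \<open>The added slope puts all difference quotients between 1 and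
    \<open>2 * L + 1\<close>.\<close>
  define F where "F x = f x + (L + 1) * x" for x
  have F1: "t - s \<le> F t - F s" "F t - F s \<le> (2 * L + 1) * (t - s)" if "s \<le> t" for s t
    using lip[of t s] that by (auto simp: F_def algebra_simps abs_le_iff)
  have sm: "F s < F t" if "s < t" for s t using F1(1)[of s t] that by linarith
  have inj: "inj F" by (rule linorder_injI) (use sm in \<open>metis less_irrefl\<close>)
  have Flip: "\<bar>F t - F s\<bar> \<le> (2 * L + 1) * \<bar>t - s\<bar>" for s t
    using F1(1,2)[of s t] F1(1,2)[of t s] by (cases "s \<le> t") auto
  have cF: "continuous_on S F" for S
    using Flip by (intro lipschitz_imp_continuous_on[of S F "2*L+1"]) auto
  have "\<exists>x. F x = y" for y
  proof -
    define n where "n = \<bar>y - F 0\<bar>"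
    have "F (- n) \<le> y" "y \<le> F n" "- n \<le> n" using F1(1)[of "-n" 0] F1(1)[of 0 n] by (auto simp: n_def)
    then show ?thesis using IVT'[of F "-n" y n] cF by blast
  qed
  then have surj: "surj F" by (metis surjI)
  define H where "H = inv F"
  have HF: "H (F x) = x" and FH: "F (H x) = x" for x
    using inj surj by (simp_all add: H_def surj_f_inv_f)
  have "norm (H t - H s) \<le> 1 * \<bar>t - s\<bar>" for s t
    using F1(1)[of "H s" "H t"] F1(1)[of "H t" "H s"] FH by (cases "H s \<le> H t") auto
  then have "continuous_on UNIV H" by (rule lipschitz_imp_continuous_on)
  then have mH[measurable]: "H \<in> borel_measurable borel" by (rule borel_measurable_continuous_onI)
  have vim: "H -` A = F ` A" for A by (auto simp: HF) (metis FH image_eqI)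
  \<comment> \<open>The Stieltjes measure of \<open>F\<close>: a set has the Lebesgue measure of its
    image under \<open>F\<close>.\<close>
  define \<mu> where "\<mu> = distr lborel borel H"
  have em: "emeasure \<mu> A = emeasure lborel (F ` A)" if "A \<in> sets borel" for A
    using that by (simp add: \<mu>_def emeasure_distr vim)
  have "absolutely_continuous lborel \<mu>"
    unfolding absolutely_continuous_def
  proof
    fix A :: "real set" assume A: "A \<in> null_sets lborel"
    then have "negligible A" by (simp add: negligible_iff_null_sets null_sets_completionI)
    then have "negligible (F ` A)"
    proof (rule negligible_locally_Lipschitz_image[rotated])
      fix x show "\<exists>T B. open T \<and> x \<in> T \<and> (\<forall>y\<in>A \<inter> T. norm (F y - F x) \<le> B * norm (y - x))"
        using Flip by (intro exI[of _ UNIV] exI[of _ "2*L+1"]) auto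
    qed auto
    moreover have Ab: "A \<in> sets borel" using A by (auto simp: null_sets_def)
    then have "F ` A \<in> sets borel" using measurable_sets_borel[OF mH Ab] by (simp add: vim)
    ultimately have "emeasure lborel (F ` A) = 0"
      by (simp add: negligible_iff_null_sets null_sets_completion_iff null_sets_def)
    then show "A \<in> null_sets \<mu>" using em[OF Ab] Ab by (simp add: null_sets_def \<mu>_def)
  qed
  then obtain g where g[measurable]: "g \<in> borel_measurable lborel" and dg: "density lborel g = \<mu>"
    using sigma_finite_measure.Radon_Nikodym[OF sigma_finite_lborel, of \<mu>] by (auto simp: \<mu>_def)
  \<comment> \<open>The density is finite almost everywhere on every bounded interval, so its
    real-valued version has the same integrals there.\<close>
  define k where "k x = enn2real (g x)" for x
  have km[measurable]: "k \<in> borel_measurable borel" unfolding k_def using g by measurable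
  have hk: "(k has_integral (F b - F a)) {a..b}" if "a \<le> b" for a b
  proof -
    have img: "F ` {a..b} = {F a..F b}"
    proof
      show "F ` {a..b} \<subseteq> {F a..F b}" using F1(1) by force
      show "{F a..F b} \<subseteq> F ` {a..b}" using IVT'[of F a _ b] that cF by fastforce
    qed
    have Fab: "F a \<le> F b" using F1(1)[OF that] that by linarith
    have "(\<integral>\<^sup>+x. g x * indicator {a..b} x \<partial>lborel) = emeasure \<mu> {a..b}"
      unfolding dg[symmetric] by (subst emeasure_density) auto
    also have "\<dots> = ennreal (F b - F a)" using em[of "{a..b}"] img Fab by simp
    finally have I: "(\<integral>\<^sup>+x. g x * indicator {a..b} x \<partial>lborel) = ennreal (F b - F a)" .
    then have "AE x in lborel. g x * indicator {a..b} x \<noteq> \<infinity>"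
      by (intro nn_integral_PInf_AE) auto
    then have "(\<integral>\<^sup>+x. ennreal (indicator {a..b} x * k x) \<partial>lborel) = (\<integral>\<^sup>+x. g x * indicator {a..b} x \<partial>lborel)"
      by (intro nn_integral_cong_AE) (auto elim!: eventually_mono simp: k_def indicator_def ennreal_enn2real top.not_eq_extremum)
    with I have "(\<integral>\<^sup>+x. ennreal (indicator {a..b} x * k x) \<partial>lborel) = ennreal (F b - F a)" by simp
    then have "integrable lborel (\<lambda>x. indicator {a..b} x * k x) \<and> integral\<^sup>L lborel (\<lambda>x. indicator {a..b} x * k x) = F b - F a"
      using Fab by (subst (asm) nn_integral_eq_integrable) (auto simp: k_def)
    then have "((\<lambda>x. indicator {a..b} x * k x) has_integral (F b - F a)) UNIV"
      using has_integral_integral_lborel by metis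
    then have "((\<lambda>x. if x \<in> {a..b} then k x else 0) has_integral (F b - F a)) UNIV"
      by (rule has_integral_eq[rotated]) (auto simp: indicator_def)
    then show ?thesis by (simp only: has_integral_restrict_UNIV)
  qed
  have "k integrable_on cbox a b" for a b
    using hk[of a b] by (cases "a \<le> b") auto
  then obtain N where N: "negligible N" "\<And>x e. x \<notin> N \<Longrightarrow> 0 < e \<Longrightarrow>
      \<exists>d>0. \<forall>h. 0 < h \<and> h < d \<longrightarrow> norm (integral (cbox x (x + h *\<^sub>R One)) k /\<^sub>R h ^ DIM(real) - k x) < e"
    using integrable_ccontinuous_explicit[of k] by metis
  \<comment> \<open>Lebesgue differentiation: off a null set the density is a limit of difference
    quotients of \<open>F\<close>.\<close>
  have kb: "k x \<le> 2 * L + 1" if nx: "x \<notin> N" for x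
  proof (rule field_le_epsilon)
    fix e :: real assume "e > 0"
    obtain d where d: "d > 0" "\<forall>h. 0 < h \<and> h < d \<longrightarrow> norm (integral (cbox x (x + h *\<^sub>R One)) k /\<^sub>R h ^ DIM(real) - k x) < e"
      using N(2)[OF nx \<open>e > 0\<close>] by blast
    define h where "h = d / 2"
    have h: "0 < h" "h < d" using d by (auto simp: h_def)
    have "integral {x..x+h} k = F (x+h) - F x" using hk[of x "x+h"] h by (simp add: integral_unique)
    moreover have "norm (integral (cbox x (x + h *\<^sub>R One)) k /\<^sub>R h ^ DIM(real) - k x) < e" using d h by blast
    ultimately have "\<bar>(F (x+h) - F x) / h - k x\<bar> < e" by (simp add: divide_inverse mult.commute)
    moreover have "(F (x+h) - F x) / h \<le> 2 * L + 1" using F1(2)[of x "x+h"] h by (simp add: field_simps)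
    ultimately show "k x \<le> 2 * L + 1 + e" by linarith
  qed
  have "acb a b f (\<lambda>x. k x - (L + 1))" for a b
  proof (rule acbI)
    have "AE x in lebesgue_on {a..b}. norm (k x - (L + 1)) \<le> 3 * L + 2"
    proof -
      have "negligible {x \<in> {a..b}. \<not> norm (k x - (L + 1)) \<le> 3 * L + 2}"
      proof (rule negligible_subset[OF N(1)], rule subsetI, rule ccontr)
        fix x assume x: "x \<in> {x \<in> {a..b}. \<not> norm (k x - (L + 1)) \<le> 3 * L + 2}" "x \<notin> N"
        have "k x \<ge> 0" by (simp add: k_def)
        then show False using kb[OF x(2)] x(1) L by (auto simp: abs_le_iff)
      qed
      then show ?thesis by (simp add: AE_lebesgue_on_iff_negligible)
    qed
    moreover have "(\<lambda>x. k x - (L + 1)) \<in> borel_measurable (lebesgue_on {a..b})"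
    proof -
      have "(\<lambda>x. k x - (L + 1)) \<in> borel_measurable borel" by measurable
      then have "(\<lambda>x. k x - (L + 1)) \<in> borel_measurable lebesgue"
        by (intro measurable_completion) (simp add: measurable_lborel1)
      then show ?thesis by (rule measurable_restrict_space1)
    qed
    ultimately show "ebd (3 * L + 2) a b (\<lambda>x. k x - (L + 1))" by (simp add: ebd_def)
    fix t assume t: "t \<in> {a..b}"
    have "((\<lambda>x. k x - (L + 1)) has_integral (F t - F a - (t - a) *\<^sub>R (L + 1))) {a..t}"
      using t has_integral_const_real[of "L + 1" a t] by (intro has_integral_diff hk) auto
    then show "f t = f a + integral {a..t} (\<lambda>x. k x - (L + 1))"
      by (simp add: integral_unique F_def algebra_simps)
  qed
  then show ?thesis by blast
qed

section \<open>A fixed point theorem for causal operators\<close>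

text \<open>Tonelli's method: the approximants solve \<open>u t = G u (t - 1/n)\<close>, which causality allows to construct by
  iteration. The gauge \<open>R\<close> describes a family of equi-Lipschitz functions.\<close>

lemma tonelli_fixed_point:
  fixes G :: "(real \<Rightarrow> 'a::euclidean_space) \<Rightarrow> real \<Rightarrow> 'a" and R :: "'a \<Rightarrow> real"
  assumes ab: "a < b" and R: "continuous_on UNIV R" "R 0 = 0" "\<And>x. norm x \<le> c * R x" and c: "c \<ge> 0"
    and K: "K = {u. u a = x0 \<and> (\<forall>s t. a \<le> s \<longrightarrow> s \<le> t \<longrightarrow> t \<le> b \<longrightarrow> R (u t - u s) \<le> t - s)}"
    and maps: "\<And>u. u \<in> K \<Longrightarrow> G u \<in> K"
    and causal: "\<And>u v t. u \<in> K \<Longrightarrow> v \<in> K \<Longrightarrow> t \<in> {a..b} \<Longrightarrow> (\<And>s. s \<in> {a..t} \<Longrightarrow> u s = v s) \<Longrightarrow> G u t = G v t"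
    and cont: "\<And>U u t. (\<And>n. U n \<in> K) \<Longrightarrow> u \<in> K \<Longrightarrow> uniform_limit {a..b} U u sequentially \<Longrightarrow> t \<in> {a..b} \<Longrightarrow>
        (\<lambda>n. G (U n) t) \<longlonglongrightarrow> G u t"
  shows "\<exists>u\<in>K. \<forall>t\<in>{a..b}. G u t = u t"
proof -
  have KR: "R (u t - u s) \<le> t - s" if "u \<in> K" "a \<le> s" "s \<le> t" "t \<le> b" for u s t using that by (auto simp: K)
  have Ka: "u a = x0" if "u \<in> K" for u using that by (auto simp: K)
  have lip: "norm (u t - u s) \<le> c * \<bar>t - s\<bar>" if "u \<in> K" "s \<in> {a..b}" "t \<in> {a..b}" for u s t
  proof -
    have *: "norm (u t - u s) \<le> c * (t - s)" if "a \<le> s" "s \<le> t" "t \<le> b" for s t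
      using R(3)[of "u t - u s"] mult_left_mono[OF KR[OF \<open>u \<in> K\<close> that] c] by linarith
    show ?thesis using *[of s t] *[of t s] that by (cases "s \<le> t") (auto simp: norm_minus_commute)
  qed
  \<comment> \<open>The delay preserves \<open>K\<close> because
    \<open>t \<mapsto> max a (t - \<epsilon>)\<close> is nondecreasing, nonexpansive and fixes
    \<open>a\<close>.\<close>
  define sh where "sh \<epsilon> w t = w (max a (t - \<epsilon>))" for \<epsilon> and w :: "real \<Rightarrow> 'a" and t
  have shK: "sh \<epsilon> w \<in> K" if "w \<in> K" "\<epsilon> > 0" for \<epsilon> w
  proof -
    have "R (sh \<epsilon> w t - sh \<epsilon> w s) \<le> t - s" if st: "a \<le> s" "s \<le> t" "t \<le> b" for s t
    proof -
      have "R (w (max a (t - \<epsilon>)) - w (max a (s - \<epsilon>))) \<le> max a (t - \<epsilon>) - max a (s - \<epsilon>)"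
        using st \<open>\<epsilon> > 0\<close> ab by (intro KR \<open>w \<in> K\<close>) auto
      also have "\<dots> \<le> t - s" using st \<open>\<epsilon> > 0\<close> by (auto simp: max_def)
      finally show ?thesis by (simp add: sh_def)
    qed
    moreover have "sh \<epsilon> w a = x0" using Ka that by (simp add: sh_def max_def)
    ultimately show ?thesis by (simp add: K)
  qed
  have ex: "\<exists>V\<in>K. \<forall>t\<in>{a..b}. V t = G V (max a (t - \<epsilon>))" if e: "\<epsilon> > 0" for \<epsilon>
  proof -
    \<comment> \<open>The delay makes the iteration exact after finitely many rounds:
      \<open>Z k\<close> no longer changes on \<open>[a, a + k * \<epsilon>]\<close>, since a new
      value at \<open>t\<close> uses the past only up to \<open>t - \<epsilon>\<close>.\<close>
    define Z where "Z k = ((\<lambda>w. sh \<epsilon> (G w)) ^^ k) (\<lambda>_. x0)" for k :: nat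
    have Z0: "Z 0 = (\<lambda>_. x0)" and ZS: "Z (Suc k) = sh \<epsilon> (G (Z k))" for k by (simp_all add: Z_def)
    have ZK: "Z k \<in> K" for k
    proof (induction k)
      case 0 show ?case using R(2) by (auto simp: Z0 K)
    qed (auto simp: ZS intro!: shK maps e)
    have st: "\<forall>t. a \<le> t \<longrightarrow> t \<le> b \<longrightarrow> t \<le> a + real k * \<epsilon> \<longrightarrow> Z k t = Z (Suc k) t" for k
    proof (induction k)
      case 0
      show ?case using Ka[OF ZK[of 1]] Ka[OF ZK[of 0]] by (auto intro: order_antisym)
    next
      case (Suc k)
      show ?case
      proof (intro allI impI)
        fix t assume t: "a \<le> t" "t \<le> b" "t \<le> a + real (Suc k) * \<epsilon>"
        have "G (Z k) (max a (t - \<epsilon>)) = G (Z (Suc k)) (max a (t - \<epsilon>))"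
        proof (rule causal[OF ZK ZK])
          fix s assume s: "s \<in> {a..max a (t - \<epsilon>)}"
          have "0 \<le> real k * \<epsilon>" using e by simp
          then have "s \<le> a + real k * \<epsilon>" "s \<le> b" using s t e ab by (auto simp: algebra_simps max_def split: if_splits)
          then show "Z k s = Z (Suc k) s" using Suc.IH s by auto
        qed (use t e ab in auto)
        then show "Z (Suc k) t = Z (Suc (Suc k)) t" by (simp add: ZS sh_def)
      qed
    qed
    obtain k :: nat where k: "(b - a) / \<epsilon> < real k" using reals_Archimedean2 by blast
    then have "b \<le> a + real k * \<epsilon>" using e by (simp add: field_simps)
    then have "Z k t = Z (Suc k) t" if "t \<in> {a..b}" for t using st[of k] that by auto
    then show ?thesis using ZK[of k] by (intro bexI[of _ "Z k"]) (auto simp: ZS sh_def)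
  qed
  define \<epsilon> where "\<epsilon> n = 1 / real (Suc n)" for n
  have \<epsilon>: "\<epsilon> n > 0" for n by (simp add: \<epsilon>_def)
  have "\<forall>n. \<exists>V\<in>K. \<forall>t\<in>{a..b}. V t = G V (max a (t - \<epsilon> n))" using ex \<epsilon> by blast
  then obtain V where V: "\<And>n. V n \<in> K" "\<And>n t. t \<in> {a..b} \<Longrightarrow> V n t = G (V n) (max a (t - \<epsilon> n))"
    by metis
  have bnd: "norm (V n x) \<le> norm x0 + c * (b - a)" if "x \<in> {a..b}" for n x
  proof -
    have "norm (V n x - V n a) \<le> c * \<bar>x - a\<bar>" using lip[OF V(1), of a x] that ab by auto
    also have "\<dots> \<le> c * (b - a)" using that c by (intro mult_left_mono) auto
    finally show ?thesis using Ka[OF V(1)] norm_triangle_sub[of "V n x" "V n a"] by simp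
  qed
  have equi: "\<exists>d>0. \<forall>n y. y \<in> {a..b} \<and> norm (x - y) < d \<longrightarrow> norm (V n x - V n y) < e"
    if x: "x \<in> {a..b}" "e > 0" for x e
  proof (intro exI[of _ "e / (c + 1)"] conjI allI impI)
    show "0 < e / (c + 1)" using x c by simp
    fix n y assume y: "y \<in> {a..b} \<and> norm (x - y) < e / (c + 1)"
    have "norm (V n x - V n y) \<le> c * \<bar>x - y\<bar>" using lip[OF V(1), of y x] y x by auto
    also have "\<dots> \<le> (c + 1) * \<bar>x - y\<bar>" by (simp add: mult_right_mono)
    also have "\<dots> < e" using y c by (simp add: field_simps)
    finally show "norm (V n x - V n y) < e" .
  qed
  obtain g k where g: "continuous_on {a..b} g" "strict_mono (k :: nat \<Rightarrow> nat)"
    "\<And>e. 0 < e \<Longrightarrow> \<exists>N. \<forall>n x. n \<ge> N \<and> x \<in> {a..b} \<longrightarrow> norm (V (k n) x - g x) < e"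
    using Arzela_Ascoli[of "{a..b}" V "norm x0 + c * (b - a)"] bnd equi by (metis compact_Icc)
  have ul: "uniform_limit {a..b} (\<lambda>n. V (k n)) g sequentially"
    unfolding uniform_limit_sequentially_iff dist_norm using g(3) by blast
  have pl: "(\<lambda>n. V (k n) t) \<longlonglongrightarrow> g t" if "t \<in> {a..b}" for t
    using tendsto_uniform_limitI[OF ul that] .
  have gK: "g \<in> K"
  proof -
    have "(\<lambda>n. V (k n) a) \<longlonglongrightarrow> x0" using Ka[OF V(1)] by simp
    then have "g a = x0" using pl[of a] ab LIMSEQ_unique by auto
    moreover have "R (g t - g s) \<le> t - s" if st: "a \<le> s" "s \<le> t" "t \<le> b" for s t
    proof (rule LIMSEQ_le_const2)
      have "(\<lambda>n. V (k n) t - V (k n) s) \<longlonglongrightarrow> g t - g s" using st by (intro tendsto_diff pl) auto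
      then show "(\<lambda>n. R (V (k n) t - V (k n) s)) \<longlonglongrightarrow> R (g t - g s)"
        using R(1) by (auto simp: continuous_on_eq_continuous_at intro: isCont_tendsto_compose)
    qed (use KR[OF V(1) st] in auto)
    ultimately show ?thesis by (simp add: K)
  qed
  have "G g t = g t" if t: "t \<in> {a..b}" for t
  proof -
    have l1: "(\<lambda>n. G (V (k n)) t) \<longlonglongrightarrow> G g t" using cont[OF V(1) gK ul t] .
    \<comment> \<open>\<open>V t\<close> is the value of \<open>G V\<close> at a time at most
      \<open>\<epsilon>\<close> earlier, and \<open>G V\<close> is Lipschitz with the common
      constant \<open>c\<close>.\<close>
    have "(\<lambda>n. G (V (k n)) t - V (k n) t) \<longlonglongrightarrow> 0"
    proof (rule Lim_null_comparison)
      show "\<forall>\<^sub>F n in sequentially. norm (G (V (k n)) t - V (k n) t) \<le> c * \<epsilon> (k n)"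
      proof (intro always_eventually allI)
        fix n
        have "norm (G (V (k n)) t - G (V (k n)) (max a (t - \<epsilon> (k n)))) \<le> c * \<bar>t - max a (t - \<epsilon> (k n))\<bar>"
          using t \<epsilon>[of "k n"] by (intro lip maps V) auto
        also have "\<dots> \<le> c * \<epsilon> (k n)" using t \<epsilon>[of "k n"] c by (intro mult_left_mono) auto
        finally show "norm (G (V (k n)) t - V (k n) t) \<le> c * \<epsilon> (k n)" using V(2)[OF t, of "k n"] by simp
      qed
      have "\<epsilon> \<longlonglongrightarrow> 0" unfolding \<epsilon>_def by real_asymp
      then have "(\<lambda>n. \<epsilon> (k n)) \<longlonglongrightarrow> 0" using LIMSEQ_subseq_LIMSEQ[OF _ g(2)] by (auto simp: o_def)
      then show "(\<lambda>n. c * \<epsilon> (k n)) \<longlonglongrightarrow> 0" using tendsto_mult_right_zero by blast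
    qed
    then have "(\<lambda>n. G (V (k n)) t - (G (V (k n)) t - V (k n) t)) \<longlonglongrightarrow> G g t - 0" by (intro tendsto_diff l1)
    then have "(\<lambda>n. V (k n) t) \<longlonglongrightarrow> G g t" by simp
    then show ?thesis using pl[OF t] LIMSEQ_unique by blast
  qed
  then show ?thesis using gK by blast
qed

section \<open>Continuation\<close>

text \<open>Each step of the continuation is at least half as long as the longest possible one (capped at 1), so the
  steps cannot accumulate at a finite time.\<close>

lemma extend_to_all:
  fixes P :: "real \<Rightarrow> (real \<Rightarrow> 'a) \<Rightarrow> bool"
  assumes nonneg: "\<And>a u. P a u \<Longrightarrow> 0 \<le> a"
    and cong: "\<And>a u v. P a u \<Longrightarrow> (\<And>t. t \<in> {0..a} \<Longrightarrow> v t = u t) \<Longrightarrow> P a v"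
    and mono: "\<And>a b u. P a u \<Longrightarrow> 0 \<le> b \<Longrightarrow> b \<le> a \<Longrightarrow> P b u"
    and closed: "\<And>a u. 0 < a \<Longrightarrow> (\<And>b. 0 \<le> b \<Longrightarrow> b < a \<Longrightarrow> P b u) \<Longrightarrow> \<exists>v. P a v \<and> (\<forall>t\<in>{0..<a}. v t = u t)"
    and step: "\<And>a u. P a u \<Longrightarrow> \<exists>b>a. \<exists>v. P b v \<and> (\<forall>t\<in>{0..a}. v t = u t)"
    and start: "P a0 u0"
  shows "\<exists>u. (\<forall>b\<ge>0. P b u) \<and> (\<forall>t\<in>{0..a0}. u t = u0 t)"
proof -
  define Ext where "Ext p q \<longleftrightarrow> fst p < fst q \<and> P (fst q) (snd q) \<and> (\<forall>t\<in>{0..fst p}. snd q t = snd p t)"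
    for p q :: "real \<times> (real \<Rightarrow> 'a)"
  define Q where "Q p q \<longleftrightarrow> Ext p q \<and> (\<forall>r. Ext p r \<and> fst r \<le> fst p + 1 \<longrightarrow> fst r - fst p \<le> 2 * (fst q - fst p))" for p q
  have exQ: "\<exists>q. Q p q" if p: "P (fst p) (snd p)" for p
  proof -
    define S where "S = {fst r | r. Ext p r \<and> fst r \<le> fst p + 1}"
    obtain b v where bv: "b > fst p" "P b v" "\<forall>t\<in>{0..fst p}. v t = snd p t" using step[OF p] by blast
    define b' where "b' = min b (fst p + 1)"
    have b': "fst p < b'" "b' \<le> b" "b' \<le> fst p + 1" using bv by (auto simp: b'_def)
    have "Ext p (b', v)" using b' bv mono[OF bv(2), of b'] nonneg[OF p] by (auto simp: Ext_def)
    then have S: "b' \<in> S" using b' by (force simp: S_def)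
    \<comment> \<open>The cap 1 keeps the set of reachable end points bounded even if there are
      arbitrarily long extensions.\<close>
    have bdd: "bdd_above S" unfolding S_def by (intro bdd_aboveI[of _ "fst p + 1"]) auto
    have le: "x \<le> Sup S" if "x \<in> S" for x using cSup_upper[OF that bdd] .
    have "Sup S > fst p" using le[OF S] b' by linarith
    then have "(fst p + Sup S) / 2 < Sup S" by simp
    then obtain x where x: "x \<in> S" "(fst p + Sup S) / 2 < x" using less_cSupE S by (metis empty_iff)
    then obtain q where q: "Ext p q" "fst q = x" by (auto simp: S_def)
    have "fst r - fst p \<le> 2 * (fst q - fst p)" if "Ext p r" "fst r \<le> fst p + 1" for r
    proof -
      have "fst r \<in> S" unfolding S_def using that by blast
      then have "fst r \<le> Sup S" by (rule le)
        moreover have "Sup S - fst p \<le> 2 * (x - fst p)" using x(2) by simp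
        ultimately show ?thesis using q(2) by simp
    qed
    then show ?thesis using q unfolding Q_def by blast
  qed
  have "\<exists>f. f 0 = (a0, u0) \<and> (\<forall>n. P (fst (f n)) (snd (f n))) \<and> (\<forall>n. Q (f n) (f (Suc n)))"
  proof -
    have QP: "P (fst q) (snd q)" if "Q p q" for p q
      using that unfolding Q_def Ext_def by (elim conjE)
    define PP where "PP n x \<longleftrightarrow> P (fst x) (snd x) \<and> (n = 0 \<longrightarrow> x = (a0, u0))" for n :: nat and x
    have "PP 0 (a0, u0)" by (simp add: PP_def start)
    moreover have "\<exists>y. PP (Suc n) y \<and> Q x y" if "PP n x" for x n
    proof -
      have "P (fst x) (snd x)" using that by (simp add: PP_def)
      then obtain y where y: "Q x y" using exQ by (elim exE[OF exQ])
      have "PP (Suc n) y" using QP[OF y] by (simp add: PP_def)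
      with y show ?thesis by (intro exI conjI)
    qed
    ultimately obtain f where "\<And>n. PP n (f n)" "\<And>n. Q (f n) (f (Suc n))"
      using dependent_nat_choice[of PP "\<lambda>_. Q"] by metis
    then show ?thesis by (intro exI[of _ f]) (auto simp: PP_def)
  qed
  then obtain f where f: "f 0 = (a0, u0)" "\<And>n. P (fst (f n)) (snd (f n))" "\<And>n. Q (f n) (f (Suc n))" by blast
  define a where "a n = fst (f n)" for n
  define w where "w n = snd (f n)" for n
  have Pn: "P (a n) (w n)" for n using f(2) by (simp add: a_def w_def)
  have a0: "a 0 = a0" "w 0 = u0" using f(1) by (auto simp: a_def w_def)
  have an: "a n \<ge> 0" for n using nonneg[OF Pn] .
  have inc: "a n < a (Suc n)" for n using f(3) by (auto simp: Q_def Ext_def a_def)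
  have mon: "a m \<le> a n" if "m \<le> n" for m n using lift_Suc_mono_le[of a] inc that by (meson less_imp_le)
  have agree: "w n t = w m t" if "m \<le> n" "t \<in> {0..a m}" for m n t
    using that(1)
  proof (induction n rule: dec_induct)
    case (step n)
    have "t \<in> {0..a n}" using that(2) mon[OF step(1)] by simp
    then have "w (Suc n) t = w n t" using f(3)[of n] by (simp add: Q_def Ext_def a_def w_def)
    then show ?case using step by simp
  qed simp
  define u where "u t = w (LEAST n. t \<le> a n) t" for t
  have u: "u t = w n t" if "t \<in> {0..a n}" for n t
  proof -
    have "(LEAST n. t \<le> a n) \<le> n" using that by (intro Least_le[of "\<lambda>n. t \<le> a n"]) simp
    moreover have "t \<le> a (LEAST n. t \<le> a n)" using that by (intro LeastI[of "\<lambda>n. t \<le> a n" n]) simp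
    ultimately show ?thesis unfolding u_def using agree[of "LEAST n. t \<le> a n" n t] that by auto
  qed
  have Pu: "P b u" if "0 \<le> b" "b \<le> a n" for b n
  proof -
    have "P (a n) u" by (rule cong[OF Pn[of n] u])
    then show ?thesis using that by (rule mono)
  qed
  \<comment> \<open>At a finite limit \<open>l\<close> the function could be closed and then
    prolonged, to a total of at least \<open>d\<close> beyond each \<open>a n\<close>. This
    extension was available at every step, so every step would have length at least
    \<open>d / 2\<close>.\<close>
  have unb: "\<exists>n. b \<le> a n" for b
  proof (rule ccontr)
    assume "\<nexists>n. b \<le> a n"
    then have "bounded (range a)" using an by (intro boundedI[of _ b]) (auto simp: not_le less_imp_le)
    moreover have "incseq a" using mon by (simp add: incseq_def)
    ultimately obtain l where l: "a \<longlonglongrightarrow> l" "\<And>n. a n \<le> l"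
      using incseq_convergent[of a b] \<open>\<nexists>n. b \<le> a n\<close> by (metis linear not_le less_imp_le)
    have al: "a n < l" for n using inc[of n] l(2)[of "Suc n"] by linarith
    have "0 < l" using al[of 0] an[of 0] by linarith
    moreover have "P b u" if b: "0 \<le> b" "b < l" for b
    proof -
      obtain n where "b < a n" using order_tendstoD(1)[OF l(1) b(2)] by (auto simp: eventually_sequentially)
      then show ?thesis using Pu[OF b(1), of n] by simp
    qed
    ultimately obtain v where v: "P l v" "\<forall>t\<in>{0..<l}. v t = u t" using closed by blast
    then obtain b' v' where b': "b' > l" "P b' v'" "\<forall>t\<in>{0..l}. v' t = v t" using step by blast
    define d where "d = min (b' - l) 1"
    have "d \<le> 2 * (a (Suc n) - a n)" for n
    proof -
      define r where "r = (min b' (a n + 1), v')"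
      have "P (min b' (a n + 1)) v'" using b'(1) al[of n] an[of n] by (intro mono[OF b'(2)]) auto
      moreover have "v' t = w n t" if "t \<in> {0..a n}" for t using that b'(3) v(2) u[OF that] al[of n] by auto
      ultimately have "Ext (f n) r" using b'(1) al[of n] by (auto simp: Ext_def r_def a_def w_def)
      moreover have "fst r \<le> fst (f n) + 1" by (simp add: r_def a_def)
      ultimately have "fst r - a n \<le> 2 * (a (Suc n) - a n)"
        using f(3)[of n] unfolding Q_def a_def by blast
      moreover have "d \<le> fst r - a n" using al[of n] by (auto simp: d_def r_def)
      ultimately show ?thesis by linarith
    qed
    moreover have "(\<lambda>n. 2 * (a (Suc n) - a n)) \<longlonglongrightarrow> 2 * (l - l)" by (intro tendsto_intros LIMSEQ_Suc l(1))
    ultimately have "d \<le> 0" using LIMSEQ_le_const[of "\<lambda>n. 2 * (a (Suc n) - a n)" 0 d] by auto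
    then show False using b' by (auto simp: d_def)
  qed
  show ?thesis
  proof (intro exI[of _ u] conjI allI impI ballI)
    show "P b u" if "0 \<le> b" for b using unb[of b] Pu that by blast
    show "u t = u0 t" if "t \<in> {0..a0}" for t using u[of t 0] that a0 by simp
  qed
qed

section \<open>The algebraic feedback equation\<close>

text \<open>\<open>Pm \<phi> a V\<close> is the unique solution \<open>e\<close> of \<open>a / (1 - \<phi>\<^sup>2 |e|\<^sup>2) e = V\<close> with \<open>\<phi>\<^sup>2 |e|\<^sup>2 < 1\<close>.\<close>

definition Pm :: "real \<Rightarrow> real \<Rightarrow> 'a::real_inner \<Rightarrow> 'a" where
  "Pm \<phi> a V = (2 / (a + sqrt (a\<^sup>2 + 4 * \<phi>\<^sup>2 * (norm V)\<^sup>2))) *\<^sub>R V"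

text \<open>Put \<open>w = \<phi>\<^sup>2 * (norm e)\<^sup>2\<close>. Taking norms, the gain
  \<open>k = a / (1 - w)\<close> satisfies
  \<open>k\<^sup>2 - a * k = \<phi>\<^sup>2 * (norm V)\<^sup>2\<close>, and \<open>Pm\<close> is
  \<open>V\<close> divided by the positive root. This form includes \<open>\<phi> = 0\<close>, where
  it is \<open>V / a\<close>.\<close>

lemma Pm_iff:
  assumes a: "a > 0"
  shows "e = Pm \<phi> a V \<longleftrightarrow> \<phi>\<^sup>2 * (norm e)\<^sup>2 < 1 \<and> (a / (1 - \<phi>\<^sup>2 * (norm e)\<^sup>2)) *\<^sub>R e = V"
proof
  assume r: "\<phi>\<^sup>2 * (norm e)\<^sup>2 < 1 \<and> (a / (1 - \<phi>\<^sup>2 * (norm e)\<^sup>2)) *\<^sub>R e = V"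
  define w where "w = \<phi>\<^sup>2 * (norm e)\<^sup>2"
  have w: "0 \<le> w" "w < 1" using r by (auto simp: w_def)
  have V: "V = (a / (1 - w)) *\<^sub>R e" using r by (simp add: w_def)
  have "(norm V)\<^sup>2 = (a / (1 - w))\<^sup>2 * (norm e)\<^sup>2" by (simp add: V power_mult_distrib power_divide)
  then have "4 * \<phi>\<^sup>2 * (norm V)\<^sup>2 = 4 * (a / (1 - w))\<^sup>2 * w" by (simp add: w_def)
  moreover define k where "k = a / (1 - w)"
  have "a = k * (1 - w)" using w by (simp add: k_def)
  then have "a\<^sup>2 + 4 * k\<^sup>2 * w = (k * (1 + w))\<^sup>2" by (simp only: power2_eq_square) (simp add: algebra_simps)
  ultimately have "a\<^sup>2 + 4 * \<phi>\<^sup>2 * (norm V)\<^sup>2 = (a * (1 + w) / (1 - w))\<^sup>2"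
    by (simp add: k_def)
  then have "sqrt (a\<^sup>2 + 4 * \<phi>\<^sup>2 * (norm V)\<^sup>2) = a * (1 + w) / (1 - w)" using w a by simp
  then have "a + sqrt (a\<^sup>2 + 4 * \<phi>\<^sup>2 * (norm V)\<^sup>2) = 2 * a / (1 - w)" using w by (simp add: field_simps)
  then show "e = Pm \<phi> a V" using w a by (simp add: Pm_def V)
next
  assume e: "e = Pm \<phi> a V"
  define q where "q = sqrt (a\<^sup>2 + 4 * \<phi>\<^sup>2 * (norm V)\<^sup>2)"
  have q2: "q\<^sup>2 = a\<^sup>2 + 4 * \<phi>\<^sup>2 * (norm V)\<^sup>2" by (simp add: q_def)
  have q0: "q \<ge> 0" by (simp add: q_def)
  have e': "e = (2 / (a + q)) *\<^sub>R V" using e by (simp add: Pm_def q_def)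
  have "\<phi>\<^sup>2 * (norm e)\<^sup>2 = (4 * \<phi>\<^sup>2 * (norm V)\<^sup>2) / (a + q)\<^sup>2"
    by (simp add: e' power_mult_distrib power_divide)
  also have "\<dots> = (q\<^sup>2 - a\<^sup>2) / (a + q)\<^sup>2" using q2 by simp
  also have "\<dots> = ((q - a) * (q + a)) / ((q + a) * (q + a))" by (simp add: power2_eq_square algebra_simps)
  also have "\<dots> = (q - a) / (q + a)" using a q0 by simp
  finally have w: "\<phi>\<^sup>2 * (norm e)\<^sup>2 = (q - a) / (q + a)" .
  moreover have "(q - a) / (q + a) < 1" using a q0 by (simp add: field_simps)
  moreover have "1 - (q - a) / (q + a) = 2 * a / (a + q)"
    using a q0 add_pos_nonneg[of a q] by (simp add: field_simps)
  then have "a / (1 - (q - a) / (q + a)) = (a + q) / 2" using a q0 by simp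
  ultimately show "\<phi>\<^sup>2 * (norm e)\<^sup>2 < 1 \<and> (a / (1 - \<phi>\<^sup>2 * (norm e)\<^sup>2)) *\<^sub>R e = V"
    using a q0 by (simp add: e')
qed

text \<open>The feedback map is \<open>a\<close> times the identity plus a radial map whose factor
  does not decrease with the norm. The radial part is monotone, so the sum is strongly monotone with
  constant \<open>a\<close>, and its inverse is Lipschitz with constant
  \<open>1 / a\<close>.\<close>

lemma Pm_lipschitz:
  assumes a: "a > 0"
  shows "norm (Pm \<phi> a V - Pm \<phi> a V') \<le> norm (V - V') / a"
proof -
  define e where "e = Pm \<phi> a V"
  define e' where "e' = Pm \<phi> a V'"
  define k where "k = 1 / (1 - \<phi>\<^sup>2 * (norm e)\<^sup>2) - 1"
  define k' where "k' = 1 / (1 - \<phi>\<^sup>2 * (norm e')\<^sup>2) - 1"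
  have w: "\<phi>\<^sup>2 * (norm e)\<^sup>2 < 1" "V = (a / (1 - \<phi>\<^sup>2 * (norm e)\<^sup>2)) *\<^sub>R e" using iffD1[OF Pm_iff[OF a] e_def] by auto
  have w': "\<phi>\<^sup>2 * (norm e')\<^sup>2 < 1" "V' = (a / (1 - \<phi>\<^sup>2 * (norm e')\<^sup>2)) *\<^sub>R e'" using iffD1[OF Pm_iff[OF a] e'_def] by auto
  have V: "V = (a * (k + 1)) *\<^sub>R e" "V' = (a * (k' + 1)) *\<^sub>R e'" using w w' by (simp_all add: k_def k'_def)
  have kk: "k \<ge> 0" "k' \<ge> 0" using w(1) w'(1) by (auto simp: k_def k'_def field_simps)
  have mono: "0 \<le> (k * norm e - k' * norm e') * (norm e - norm e')"
  proof (cases "norm e \<ge> norm e'")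
    case True
    then have "\<phi>\<^sup>2 * (norm e')\<^sup>2 \<le> \<phi>\<^sup>2 * (norm e)\<^sup>2" by (intro mult_left_mono power_mono) auto
    then have "k' \<le> k" using w(1) by (simp add: k_def k'_def frac_le)
    then have "k' * norm e' \<le> k * norm e" using True kk by (intro mult_mono) auto
    then show ?thesis using True by simp
  next
    case False
    then have "\<phi>\<^sup>2 * (norm e)\<^sup>2 \<le> \<phi>\<^sup>2 * (norm e')\<^sup>2" by (intro mult_left_mono power_mono) auto
    then have "k \<le> k'" using w'(1) by (simp add: k_def k'_def frac_le)
    then have "k * norm e \<le> k' * norm e'" using False kk by (intro mult_mono) auto
    then show ?thesis using False by (simp add: mult_nonpos_nonpos)
  qed
  \<comment> \<open>Cauchy-Schwarz reduces monotonicity of the radial map to that of the scalar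
    function treated in \<open>mono\<close>.\<close>
  have "(k + k') * (e \<bullet> e') \<le> (k + k') * (norm e * norm e')"
    using kk by (intro mult_left_mono) (auto simp: norm_cauchy_schwarz)
  then have "0 \<le> (k *\<^sub>R e - k' *\<^sub>R e') \<bullet> (e - e')"
    using mono by (simp add: inner_diff_left inner_diff_right dot_square_norm power2_eq_square algebra_simps inner_commute)
  then have "a * (norm (e - e'))\<^sup>2 \<le> a * ((k *\<^sub>R e - k' *\<^sub>R e') \<bullet> (e - e')) + a * ((e - e') \<bullet> (e - e'))"
    using a by (simp add: dot_square_norm)
  also have "\<dots> = (V - V') \<bullet> (e - e')" unfolding V by (simp add: inner_diff_left inner_diff_right algebra_simps)
  also have "\<dots> \<le> norm (V - V') * norm (e - e')" by (rule norm_cauchy_schwarz)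
  finally have "(a * norm (e - e')) * norm (e - e') \<le> norm (V - V') * norm (e - e')" by (simp add: power2_eq_square)
  then have "a * norm (e - e') \<le> norm (V - V')"
    by (cases "e = e'") auto
  then show ?thesis using a by (simp add: e_def e'_def field_simps)
qed

section \<open>Uniformly bounded and Lipschitz families\<close>

text \<open>The constants are common to all members of the family, and the closure rules below
  preserve this for all operations in the right-hand sides. Uniformity in \<open>v\<close> is what
  yields equi-Lipschitz bounds for the approximants.\<close>

definition ubl :: "'i set \<Rightarrow> real set \<Rightarrow> ('i \<Rightarrow> real \<Rightarrow> 'b::real_normed_vector) \<Rightarrow> bool" where
  "ubl A I f \<longleftrightarrow> (\<exists>B\<ge>0. \<forall>v\<in>A. \<forall>t\<in>I. norm (f v t) \<le> B) \<and>
     (\<exists>L\<ge>0. \<forall>v\<in>A. \<forall>s\<in>I. \<forall>t\<in>I. norm (f v t - f v s) \<le> L * \<bar>t - s\<bar>)"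

lemma ublI:
  assumes "\<And>v t. v \<in> A \<Longrightarrow> t \<in> I \<Longrightarrow> norm (f v t) \<le> B"
    and "\<And>v s t. v \<in> A \<Longrightarrow> s \<in> I \<Longrightarrow> t \<in> I \<Longrightarrow> norm (f v t - f v s) \<le> L * \<bar>t - s\<bar>"
  shows "ubl A I f"
  unfolding ubl_def
proof (intro conjI)
  show "\<exists>B\<ge>0. \<forall>v\<in>A. \<forall>t\<in>I. norm (f v t) \<le> B" using assms(1) by (intro exI[of _ "max B 0"]) (auto simp: le_max_iff_disj)
  show "\<exists>L\<ge>0. \<forall>v\<in>A. \<forall>s\<in>I. \<forall>t\<in>I. norm (f v t - f v s) \<le> L * \<bar>t - s\<bar>"
  proof (intro exI[of _ "max L 0"] conjI ballI)
    fix v s t assume "v \<in> A" "s \<in> I" "t \<in> I"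
    then have "norm (f v t - f v s) \<le> L * \<bar>t - s\<bar>" by (rule assms(2))
    also have "\<dots> \<le> max L 0 * \<bar>t - s\<bar>" by (rule mult_right_mono) auto
    finally show "norm (f v t - f v s) \<le> max L 0 * \<bar>t - s\<bar>" .
  qed auto
qed

lemma ublD:
  assumes "ubl A I f"
  obtains B L where "B \<ge> 0" "L \<ge> 0" "\<And>v t. v \<in> A \<Longrightarrow> t \<in> I \<Longrightarrow> norm (f v t) \<le> B"
    "\<And>v s t. v \<in> A \<Longrightarrow> s \<in> I \<Longrightarrow> t \<in> I \<Longrightarrow> norm (f v t - f v s) \<le> L * \<bar>t - s\<bar>"
  using assms unfolding ubl_def by blast

lemma ubl_const: "(\<And>v. v \<in> A \<Longrightarrow> norm (c v) \<le> B) \<Longrightarrow> ubl A I (\<lambda>v t. c v)"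
  by (rule ublI[where B=B and L=0]) auto

lemma ubl_cong: "ubl A I f \<Longrightarrow> (\<And>v t. v \<in> A \<Longrightarrow> t \<in> I \<Longrightarrow> f v t = g v t) \<Longrightarrow> ubl A I g"
  by (simp add: ubl_def)

lemma ubl_reindex:
  assumes "ubl A I f" "\<And>x. x \<in> A' \<Longrightarrow> h x \<in> A" "I' \<subseteq> I"
  shows "ubl A' I' (\<lambda>x. f (h x))"
proof -
  have "h ` A' \<subseteq> A" using assms(2) by blast
  then show ?thesis using assms(1,3) unfolding ubl_def by (meson image_subset_iff subsetD)
qed

text \<open>A Lipschitz condition on bounded parts of \<open>D\<close> suffices, since the inner
  family stays in one ball; a single reference value then bounds the outer family.\<close>

lemma ubl_compose:
  assumes f: "ubl A I f" and D: "\<And>v t. v \<in> A \<Longrightarrow> t \<in> I \<Longrightarrow> f v t \<in> D"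
    and g: "\<And>B. \<exists>K\<ge>0. \<forall>x\<in>D. \<forall>y\<in>D. norm x \<le> B \<longrightarrow> norm y \<le> B \<longrightarrow> norm (g x - g y) \<le> K * norm (x - y)"
  shows "ubl A I (\<lambda>v t. g (f v t))"
proof (cases "A = {} \<or> I = {}")
  case True then show ?thesis by (auto simp: ubl_def intro!: exI[of _ 0])
next
  case False
  then obtain v0 t0 where v0: "v0 \<in> A" "t0 \<in> I" by blast
  obtain B L where B: "B \<ge> 0" "L \<ge> 0" and fB: "\<And>v t. v \<in> A \<Longrightarrow> t \<in> I \<Longrightarrow> norm (f v t) \<le> B"
    and fL: "\<And>v s t. v \<in> A \<Longrightarrow> s \<in> I \<Longrightarrow> t \<in> I \<Longrightarrow> norm (f v t - f v s) \<le> L * \<bar>t - s\<bar>" using ublD[OF f] by blast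
  obtain K where K: "K \<ge> 0" "\<forall>x\<in>D. \<forall>y\<in>D. norm x \<le> B \<longrightarrow> norm y \<le> B \<longrightarrow> norm (g x - g y) \<le> K * norm (x - y)" using g by blast
  have lip: "norm (g (f v t) - g (f w s)) \<le> K * norm (f v t - f w s)" if "v \<in> A" "w \<in> A" "s \<in> I" "t \<in> I" for v w s t
    using K(2) fB D that by simp
  show ?thesis
  proof (rule ublI)
    show "norm (g (f v t)) \<le> norm (g (f v0 t0)) + K * (B + B)" if "v \<in> A" "t \<in> I" for v t
    proof -
      have "norm (f v t - f v0 t0) \<le> B + B" using norm_triangle_ineq4[of "f v t" "f v0 t0"] fB[OF that] fB[OF v0] by linarith
      from mult_left_mono[OF this K(1)] show ?thesis
        using lip[OF that(1) v0(1) v0(2) that(2)] norm_triangle_sub[of "g (f v t)" "g (f v0 t0)"] by linarith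
    qed
    show "norm (g (f v t) - g (f v s)) \<le> (K * L) * \<bar>t - s\<bar>" if "v \<in> A" "s \<in> I" "t \<in> I" for v s t
      using lip[of v v s t] mult_left_mono[OF fL[OF that] K(1)] that by (simp add: mult.assoc)
  qed
qed

lemma ubl_bounded_linear:
  assumes "bounded_linear h" "ubl A I f" shows "ubl A I (\<lambda>v t. h (f v t))"
proof (rule ubl_compose[OF assms(2) UNIV_I])
  obtain K where "K \<ge> 0" "\<And>x. norm (h x) \<le> norm x * K" using bounded_linear.nonneg_bounded[OF assms(1)] by blast
  then show "\<exists>K\<ge>0. \<forall>x\<in>UNIV. \<forall>y\<in>UNIV. norm x \<le> B \<longrightarrow> norm y \<le> B \<longrightarrow> norm (h x - h y) \<le> K * norm (x - y)" for B
    by (intro exI[of _ K]) (simp add: linear_diff[OF bounded_linear.linear[OF assms(1)], symmetric] mult.commute)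
qed

lemma ubl_add:
  assumes "ubl A I f" "ubl A I g" shows "ubl A I (\<lambda>v t. f v t + g v t)"
proof -
  obtain B L where f0: "B \<ge> 0" "L \<ge> 0" "\<And>v t. v \<in> A \<Longrightarrow> t \<in> I \<Longrightarrow> norm (f v t) \<le> B"
    "\<And>v s t. v \<in> A \<Longrightarrow> s \<in> I \<Longrightarrow> t \<in> I \<Longrightarrow> norm (f v t - f v s) \<le> L * \<bar>t - s\<bar>" using ublD[OF assms(1)] by blast
  note f = f0(3,4)
  obtain B' L' where g0: "B' \<ge> 0" "L' \<ge> 0" "\<And>v t. v \<in> A \<Longrightarrow> t \<in> I \<Longrightarrow> norm (g v t) \<le> B'"
    "\<And>v s t. v \<in> A \<Longrightarrow> s \<in> I \<Longrightarrow> t \<in> I \<Longrightarrow> norm (g v t - g v s) \<le> L' * \<bar>t - s\<bar>" using ublD[OF assms(2)] by blast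
  note g = g0(3,4)
  show ?thesis
  proof (rule ublI)
    show "norm (f v t + g v t) \<le> B + B'" if "v \<in> A" "t \<in> I" for v t
      using f(1)[OF that] g(1)[OF that] norm_triangle_mono by blast
    show "norm (f v t + g v t - (f v s + g v s)) \<le> (L + L') * \<bar>t - s\<bar>" if "v \<in> A" "s \<in> I" "t \<in> I" for v s t
      using norm_triangle_mono[OF f(2)[OF that] g(2)[OF that]] by (simp add: algebra_simps)
  qed
qed

lemma ubl_Pair:
  assumes "ubl A I f" "ubl A I g" shows "ubl A I (\<lambda>v t. (f v t, g v t))"
proof -
  have "bounded_linear (\<lambda>x::'b. (x, 0::'c))" "bounded_linear (\<lambda>x::'c. (0::'b, x))"
    by (auto intro!: bounded_linear_Pair bounded_linear_ident bounded_linear_zero)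
  from ubl_add[OF ubl_bounded_linear[OF this(1) assms(1)] ubl_bounded_linear[OF this(2) assms(2)]]
  show ?thesis by simp
qed

lemma ubl_bilinear:
  assumes bl: "bounded_bilinear h" and "ubl A I f" "ubl A I g" shows "ubl A I (\<lambda>v t. h (f v t) (g v t))"
proof -
  interpret bounded_bilinear h by (rule bl)
  obtain K where K: "K \<ge> 0" "\<And>x y. norm (h x y) \<le> norm x * norm y * K" using nonneg_bounded by blast
  have "norm (h (fst z) (snd z) - h (fst z') (snd z')) \<le> (2 * \<bar>B\<bar> * K) * norm (z - z')" if "norm z \<le> B" "norm z' \<le> B" for z z' B
  proof -
    have fs: "norm (fst w) \<le> norm w" "norm (snd w) \<le> norm w" for w :: "'a \<times> 'b"
      using norm_fst_le[of "fst w" "snd w"] norm_snd_le[of "snd w" "fst w"] by simp_all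
    have n: "norm (snd z) \<le> \<bar>B\<bar>" "norm (fst z') \<le> \<bar>B\<bar>" "norm (fst z - fst z') \<le> norm (z - z')" "norm (snd z - snd z') \<le> norm (z - z')"
      using fs(2)[of z] fs(1)[of z'] fs[of "z - z'"] that by auto
    have "h (fst z) (snd z) - h (fst z') (snd z') = h (fst z - fst z') (snd z) + h (fst z') (snd z - snd z')"
      by (simp add: diff_left diff_right)
    also have "norm \<dots> \<le> norm (fst z - fst z') * norm (snd z) * K + norm (fst z') * norm (snd z - snd z') * K"
      using K(2) by (meson add_mono norm_triangle_le)
    also have "\<dots> \<le> norm (z - z') * \<bar>B\<bar> * K + \<bar>B\<bar> * norm (z - z') * K"
      using n K(1) by (intro add_mono mult_mono) auto
    finally show ?thesis by (simp add: algebra_simps)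
  qed
  then have "\<exists>K\<ge>0. \<forall>z\<in>UNIV. \<forall>z'\<in>UNIV. norm z \<le> B \<longrightarrow> norm z' \<le> B \<longrightarrow> norm (h (fst z) (snd z) - h (fst z') (snd z')) \<le> K * norm (z - z')" for B
    using K(1) by (intro exI[of _ "2 * \<bar>B\<bar> * K"]) auto
  from ubl_compose[OF ubl_Pair[OF assms(2,3)] UNIV_I this] show ?thesis by simp
qed

lemma ubl_minus: "ubl A I f \<Longrightarrow> ubl A I (\<lambda>v t. - f v t)"
  using ubl_bounded_linear[OF bounded_linear_minus[OF bounded_linear_ident]] .

lemma ubl_diff: "ubl A I f \<Longrightarrow> ubl A I g \<Longrightarrow> ubl A I (\<lambda>v t. f v t - g v t)"
  using ubl_add[OF _ ubl_minus, of A I f g] by simp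

lemma ubl_mult: "ubl A I f \<Longrightarrow> ubl A I g \<Longrightarrow> ubl A I (\<lambda>v t. f v t * (g v t :: real))"
  by (rule ubl_bilinear[OF bounded_bilinear_mult])

lemma ubl_scaleR: "ubl A I f \<Longrightarrow> ubl A I g \<Longrightarrow> ubl A I (\<lambda>v t. f v t *\<^sub>R g v t)"
  by (rule ubl_bilinear[OF bounded_bilinear_scaleR])

lemma ubl_power2: "ubl A I f \<Longrightarrow> ubl A I (\<lambda>v t. (f v t :: real)\<^sup>2)"
  unfolding power2_eq_square by (rule ubl_mult)

lemma ubl_norm:
  assumes "ubl A I f" shows "ubl A I (\<lambda>v t. norm (f v t))"
  by (rule ubl_compose[OF assms UNIV_I]) (auto intro!: exI[of _ 1] norm_triangle_ineq3)

lemma ubl_inverse: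
  fixes f :: "'i \<Rightarrow> real \<Rightarrow> real"
  assumes "ubl A I f" and e: "e > 0" "\<And>v t. v \<in> A \<Longrightarrow> t \<in> I \<Longrightarrow> f v t \<ge> e"
  shows "ubl A I (\<lambda>v t. 1 / f v t)"
proof (rule ubl_compose[OF assms(1), where D="{e..}"])
  have "norm (1 / x - 1 / y) \<le> 1 / (e * e) * norm (x - y)" if "x \<ge> e" "y \<ge> e" for x y
  proof -
    have "1 / x - 1 / y = (y - x) / (x * y)" using that e(1) by (simp add: field_simps)
    then have "norm (1 / x - 1 / y) = norm (x - y) / (x * y)" using that e(1) by (simp add: abs_mult abs_minus_commute)
    also have "\<dots> \<le> norm (x - y) / (e * e)" using that e(1) by (intro frac_le mult_mono) auto
    finally show ?thesis by simp
  qed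
  then show "\<exists>K\<ge>0. \<forall>x\<in>{e..}. \<forall>y\<in>{e..}. norm x \<le> B \<longrightarrow> norm y \<le> B \<longrightarrow> norm (1 / x - 1 / y) \<le> K * norm (x - y)" for B
    using e(1) by (intro exI[of _ "1 / (e * e)"]) auto
qed (use e in auto)

lemma ubl_vec_nth: "ubl A I f \<Longrightarrow> ubl A I (\<lambda>v t. f v t $ i)"
  by (rule ubl_bounded_linear[OF bounded_linear_vec_nth])

lemma ubl_sum: "finite K \<Longrightarrow> (\<And>k. k \<in> K \<Longrightarrow> ubl A I (f k)) \<Longrightarrow> ubl A I (\<lambda>v t. \<Sum>k\<in>K. f k v t)"
proof (induction K rule: finite_induct)
  case empty then show ?case using ubl_const[of A "\<lambda>_. 0" 0] by simp
qed (auto intro!: ubl_add)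

lemma ubl_vec_lambda:
  assumes "\<And>i. ubl A I (\<lambda>v t. f v t i)" shows "ubl A I (\<lambda>v t. (\<chi> i. f v t i) :: real ^ 'n)"
proof -
  have "ubl A I (\<lambda>v t. \<Sum>i\<in>UNIV. f v t i *\<^sub>R axis i (1::real))"
  proof (intro ubl_sum ubl_scaleR assms)
    fix i :: 'n show "ubl A I (\<lambda>v t. axis i (1::real))" by (rule ubl_const[where B=1]) simp
  qed simp
  then show ?thesis
  proof (rule ubl_cong)
    fix v t show "(\<Sum>i\<in>UNIV. f v t i *\<^sub>R axis i (1::real)) = (\<chi> i. f v t i)"
      using basis_expansion[of "\<chi> i. f v t i"] by (simp add: scalar_mult_eq_scaleR)
  qed
qed

lemma C1_lipschitz:
  fixes f :: "'a::euclidean_space \<Rightarrow> 'b::euclidean_space"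
  assumes "C1 f"
  obtains L where "L \<ge> 0" "\<And>x y. norm x \<le> B \<Longrightarrow> norm y \<le> B \<Longrightarrow> norm (f x - f y) \<le> L * norm (x - y)"
proof -
  obtain f' :: "'a \<Rightarrow> 'a \<Rightarrow>\<^sub>L 'b" where f': "\<And>x. (f has_derivative blinfun_apply (f' x)) (at x)" "continuous_on UNIV f'"
    using assms by (auto simp: C1_def)
  have "compact (f' ` cball 0 B)" using f'(2) by (intro compact_continuous_image) (auto intro: continuous_on_subset)
  then have "bounded (f' ` cball 0 B)" by (rule compact_imp_bounded)
  then obtain L where L: "\<And>x. x \<in> cball 0 B \<Longrightarrow> norm (f' x) \<le> L" unfolding bounded_iff by blast
  have "norm (f x - f y) \<le> \<bar>L\<bar> * norm (x - y)" if "norm x \<le> B" "norm y \<le> B" for x y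
  proof (rule differentiable_bound[of "cball 0 B" f "\<lambda>x. blinfun_apply (f' x)"])
    show "onorm (blinfun_apply (f' x)) \<le> \<bar>L\<bar>" if "x \<in> cball 0 B" for x
      using L[OF that] by (simp flip: norm_blinfun.rep_eq)
    show "(f has_derivative blinfun_apply (f' x)) (at x within cball 0 B)" for x
      using f'(1) by (rule has_derivative_at_withinI)
  qed (use that in auto)
  then show ?thesis using that[of "\<bar>L\<bar>"] by auto
qed

lemma C1_continuous:
  assumes "C1 f" shows "continuous_on S f"
proof -
  obtain f' :: "'a \<Rightarrow> 'a \<Rightarrow>\<^sub>L 'b" where "\<And>x. (f has_derivative blinfun_apply (f' x)) (at x)"
    using assms by (auto simp: C1_def)
  then show ?thesis by (intro continuous_at_imp_continuous_on) (blast intro: has_derivative_continuous)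
qed

lemma ubl_C1:
  fixes g :: "'a::euclidean_space \<Rightarrow> 'b::euclidean_space"
  assumes "C1 g" "ubl A I f" shows "ubl A I (\<lambda>v t. g (f v t))"
proof (rule ubl_compose[OF assms(2) UNIV_I])
  fix B
  obtain K where "K \<ge> 0" "\<And>x y. norm x \<le> B \<Longrightarrow> norm y \<le> B \<Longrightarrow> norm (g x - g y) \<le> K * norm (x - y)"
    using C1_lipschitz[OF assms(1), of B] by metis
  then show "\<exists>K\<ge>0. \<forall>x\<in>UNIV. \<forall>y\<in>UNIV. norm x \<le> B \<longrightarrow> norm y \<le> B \<longrightarrow> norm (g x - g y) \<le> K * norm (x - y)" by blast
qed

lemma ubl_mat_vec:
  fixes M :: "'i \<Rightarrow> real \<Rightarrow> real ^ 'n ^ 'm"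
  assumes "ubl A I M" "ubl A I x" shows "ubl A I (\<lambda>v t. M v t *v x v t)"
  unfolding matrix_vector_mult_def
  by (intro ubl_vec_lambda ubl_sum ubl_mult ubl_vec_nth[of A I x] assms
      ubl_vec_nth[of A I "\<lambda>v t. M v t $ _"] ubl_bounded_linear[OF bounded_linear_vec_nth assms(1)]) auto

lemma ubl_Pm:
  fixes V :: "'i \<Rightarrow> real \<Rightarrow> 'a::real_inner"
  assumes "ubl A I \<phi>" "ubl A I a" "ubl A I V" and e: "e > 0" "\<And>v t. v \<in> A \<Longrightarrow> t \<in> I \<Longrightarrow> a v t \<ge> e"
  shows "ubl A I (\<lambda>v t. Pm (\<phi> v t) (a v t) (V v t))"
proof -
  \<comment> \<open>Writing the root as a norm avoids the square root function, which is not
    Lipschitz at 0.\<close>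
  have sq: "sqrt (x\<^sup>2 + 4 * p\<^sup>2 * (norm W)\<^sup>2) = norm (x, (2 * p) *\<^sub>R W)" for x p :: real and W :: 'a
    by (simp add: norm_Pair power_mult_distrib)
  have two: "ubl A I (\<lambda>v t. 2::real)" by (rule ubl_const[where B=2]) simp
  have "ubl A I (\<lambda>v t. a v t + norm (a v t, (2 * \<phi> v t) *\<^sub>R V v t))"
    by (intro ubl_add ubl_norm ubl_Pair ubl_scaleR ubl_mult assms two)
  moreover have "a v t + norm (a v t, (2 * \<phi> v t) *\<^sub>R V v t) \<ge> e" if "v \<in> A" "t \<in> I" for v t
    using e(2)[OF that] by (simp add: add_increasing2)
  ultimately have "ubl A I (\<lambda>v t. 1 / (a v t + norm (a v t, (2 * \<phi> v t) *\<^sub>R V v t)))"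
    using e(1) by (intro ubl_inverse[where e=e]) auto
  then have "ubl A I (\<lambda>v t. (2 * (1 / (a v t + norm (a v t, (2 * \<phi> v t) *\<^sub>R V v t)))) *\<^sub>R V v t)"
    by (intro ubl_scaleR ubl_mult two assms)
  then show ?thesis unfolding Pm_def sq by simp
qed

section \<open>Boundedness of funnel gains\<close>

lemma Phi_props:
  assumes "\<phi> \<in> Phi n" "n \<ge> 1"
  shows "\<And>l t. l < n \<Longrightarrow> t \<ge> 0 \<Longrightarrow> (nderiv 0 l \<phi> has_real_derivative nderiv 0 (Suc l) \<phi> t) (at t within {0..})"
    and "\<And>l. l \<le> n \<Longrightarrow> continuous_on {0..} (nderiv 0 l \<phi>)"
    and "\<And>l. l \<le> n \<Longrightarrow> \<exists>B\<ge>0. \<forall>t\<ge>0. \<bar>nderiv 0 l \<phi> t\<bar> \<le> B"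
    and "\<And>t. t > 0 \<Longrightarrow> \<phi> t > 0" and "\<phi> 0 \<ge> 0"
    and "\<And>\<delta>. \<delta> > 0 \<Longrightarrow> \<exists>m>0. \<forall>t\<ge>\<delta>. \<phi> t \<ge> m"
proof -
  have Ck: "Ck_on n 0 \<infinity> \<phi>" and bd: "\<And>j. j \<le> n \<Longrightarrow> bounded (nderiv 0 j \<phi> ` {0..})"
    and pos: "\<And>t. t > 0 \<Longrightarrow> \<phi> t > 0" and lim: "Liminf at_top (\<lambda>\<tau>. ereal (\<phi> \<tau>)) > 0"
    using assms(1) by (auto simp: Phi_def)
  show d: "(nderiv 0 l \<phi> has_real_derivative nderiv 0 (Suc l) \<phi> t) (at t within {0..})" if "l < n" "t \<ge> 0" for l t
    using Ck that unfolding Ck_on_def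
    by (auto simp: vector_derivative_works has_real_derivative_iff_has_vector_derivative)
  show c: "continuous_on {0..} (nderiv 0 l \<phi>)" if "l \<le> n" for l
  proof (cases "l = n")
    case True then show ?thesis using Ck by (simp add: Ck_on_def)
  next
    case False
    then have "l < n" using that by simp
    then show ?thesis using d[OF \<open>l < n\<close>] by (auto intro!: DERIV_continuous_on)
  qed
  show "\<exists>B\<ge>0. \<forall>t\<ge>0. \<bar>nderiv 0 l \<phi> t\<bar> \<le> B" if "l \<le> n" for l
  proof -
    obtain B where B: "\<forall>x\<in>nderiv 0 l \<phi> ` {0..}. norm x \<le> B" using bd[OF \<open>l \<le> n\<close>] by (auto simp: bounded_iff)
    show ?thesis by (rule exI[of _ "\<bar>B\<bar>"]) (use B in force)
  qed
  show "\<And>t. t > 0 \<Longrightarrow> \<phi> t > 0" by (rule pos)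
  have c0: "continuous_on {0..} \<phi>" using c[of 0] by simp
  have "closure {0<..} = {0::real..}" by simp
  then show "\<phi> 0 \<ge> 0"
    using continuous_ge_on_closure[of "{0<..}" \<phi> 0 0] c0 pos by (auto simp: less_imp_le)
  \<comment> \<open>Far out the positive limit inferior gives the bound, on the remaining compact
    interval positivity does. The interval has to start after 0, where \<open>\<phi>\<close> may
    vanish.\<close>
  show "\<exists>m>0. \<forall>t\<ge>\<delta>. \<phi> t \<ge> m" if \<delta>: "\<delta> > 0" for \<delta>
  proof -
    obtain y where y: "0 < y" "y < Liminf at_top (\<lambda>\<tau>. ereal (\<phi> \<tau>))" using dense[OF lim] by blast
    then have "eventually (\<lambda>\<tau>. y < ereal (\<phi> \<tau>)) at_top"
      using le_Liminf_iff[of "Liminf at_top (\<lambda>\<tau>. ereal (\<phi> \<tau>))" at_top "\<lambda>\<tau>. ereal (\<phi> \<tau>)"] by blast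
    then obtain T where T: "\<And>t. t \<ge> T \<Longrightarrow> y < ereal (\<phi> t)" by (auto simp: eventually_at_top_linorder)
    define r where "r = real_of_ereal y"
    have "y \<noteq> \<infinity>" using T[of T] by auto
    then have yr: "y = ereal r" "r > 0" using y(1) by (cases y; auto simp: r_def)+
    obtain x where x: "x \<in> {\<delta>..max \<delta> T}" "\<And>t. t \<in> {\<delta>..max \<delta> T} \<Longrightarrow> \<phi> x \<le> \<phi> t"
      using continuous_attains_inf[of "{\<delta>..max \<delta> T}" \<phi>] continuous_on_subset[OF c0, of "{\<delta>..max \<delta> T}"] \<delta> by force
    have "min r (\<phi> x) \<le> \<phi> t" if "t \<ge> \<delta>" for t
      using T[of t] x(2)[of t] that yr by (cases "t \<le> max \<delta> T") (auto simp: min_le_iff_disj max_def split: if_splits)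
    moreover have "min r (\<phi> x) > 0" using yr pos[of x] x(1) \<delta> by auto
    ultimately show ?thesis by blast
  qed
qed

text \<open>Whenever the gain is large, \<open>\<phi>\<^sup>2 |e|\<^sup>2\<close> decreases along solutions.\<close>

lemma funnel_gain_bounded:
  fixes e :: "real \<Rightarrow> 'a::euclidean_space" and \<phi> :: "real \<Rightarrow> real"
  assumes w: "0 < w" and Phi: "\<phi> \<in> Phi n" "n \<ge> 1"
    and ce: "continuous_on (tdom 0 w) e"
    and inF: "\<And>t. t \<in> tdom 0 w \<Longrightarrow> (\<phi> t)\<^sup>2 * (norm (e t))\<^sup>2 < 1"
    and M: "M \<ge> 0" and \<gamma>: "\<gamma> > 0"
    and dyn: "\<And>b. b \<in> tdom 0 w \<Longrightarrow> \<exists>g. acb 0 b e g \<and>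
        (AE s in lebesgue_on {0..b}. e s \<bullet> g s \<le> M * norm (e s) - \<gamma> * (norm (e s))\<^sup>2 / (1 - (\<phi> s)\<^sup>2 * (norm (e s))\<^sup>2))"
  shows "\<exists>\<epsilon>>0. \<forall>t\<in>tdom 0 w. (\<phi> t)\<^sup>2 * (norm (e t))\<^sup>2 \<le> 1 - \<epsilon>"
proof -
  define \<phi>' where "\<phi>' = nderiv 0 1 \<phi>"
  have d\<phi>: "(\<phi> has_vector_derivative \<phi>' t) (at t within {0..})" if "t \<ge> 0" for t
    using Phi_props(1)[OF Phi, of 0 t] that Phi(2)
    by (simp add: has_real_derivative_iff_has_vector_derivative \<phi>'_def)
  have c\<phi>': "continuous_on {0..} \<phi>'" using Phi_props(2)[OF Phi, of 1] Phi(2) by (simp add: \<phi>'_def)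
  have c\<phi>: "continuous_on {0..} \<phi>" using Phi_props(2)[OF Phi, of 0] by simp
  obtain B where B: "B \<ge> 0" "\<And>t. t \<ge> 0 \<Longrightarrow> \<bar>\<phi> t\<bar> \<le> B" using Phi_props(3)[OF Phi, of 0] by auto
  obtain \<Lambda> where \<Lambda>: "\<Lambda> \<ge> 0" "\<And>t. t \<ge> 0 \<Longrightarrow> \<bar>\<phi>' t\<bar> \<le> \<Lambda>" using Phi_props(3)[OF Phi, of 1] Phi(2) by (auto simp: \<phi>'_def)
  define W where "W t = (\<phi> t)\<^sup>2 * (norm (e t))\<^sup>2" for t
  have W1: "W t < 1" if "t \<in> tdom 0 w" for t using inF[OF that] by (simp add: W_def)
  have "tdom 0 w \<subseteq> {0..}" by (auto simp: tdom_def)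
  then have cW: "continuous_on (tdom 0 w) W"
    unfolding W_def by (intro continuous_intros ce continuous_on_subset[OF c\<phi>])
  have sub: "{a..b} \<subseteq> tdom 0 w" if "0 \<le> a" "b \<in> tdom 0 w" for a b
    using that tdom_Icc_subset[of b 0 w] by auto
  \<comment> \<open>\<open>\<phi>\<close> may vanish at 0. Up to \<open>\<delta>\<close> the
    quantity \<open>W\<close> is bounded by its maximum; the decay argument is applied later, where
    \<open>\<phi> \<ge> m\<close>.\<close>
  obtain \<delta> where \<delta>: "0 < \<delta>" "ereal \<delta> < w" using ereal_less_obtain[of 0 w] w by (auto simp: zero_ereal_def)
  then have \<delta>J: "\<delta> \<in> tdom 0 w" by (simp add: tdom_def)
  obtain m where m: "m > 0" "\<And>t. t \<ge> \<delta> \<Longrightarrow> \<phi> t \<ge> m" using Phi_props(6)[OF Phi \<delta>(1)] by auto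
  obtain x where x: "x \<in> {0..\<delta>}" "\<And>t. t \<in> {0..\<delta>} \<Longrightarrow> W t \<le> W x"
    using continuous_attains_sup[of "{0..\<delta>}" W] continuous_on_subset[OF cW sub[of 0 \<delta>]] \<delta> \<delta>J by force
  have Wx: "W x < 1" using W1 sub[of 0 \<delta>] x(1) \<delta>J by auto
  \<comment> \<open>Threshold beyond which the damping \<open>\<gamma> * k\<close> outweighs the
    growth rate \<open>\<Lambda> / m\<close> caused by \<open>\<phi>'\<close> and the rate
    \<open>2 * B * M\<close> caused by the perturbation. The summand 1 keeps the threshold at least
    1.\<close>
  define ks where "ks = (\<Lambda> / m + 2 * B * M) / \<gamma> + 1"
  have ks: "ks \<ge> 1" using \<Lambda> m B M \<gamma> by (simp add: ks_def)
  \<comment> \<open>Above the level 1/2 the error is bounded away from 0, so that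
    \<open>M * norm (e s)\<close> is dominated by a quadratic term; above the level
    \<open>1 - 1 / ks\<close> the gain exceeds \<open>ks\<close>.\<close>
  define Ws where "Ws = max (W x) (max (1/2) (1 - 1 / ks))"
  have Ws: "Ws < 1" "W x \<le> Ws" "1/2 \<le> Ws" "1 - 1 / ks \<le> Ws"
    using Wx ks by (auto simp: Ws_def le_max_iff_disj)
  have main: "W t \<le> Ws" if t: "t \<in> tdom 0 w" "t \<ge> \<delta>" for t
  proof (rule ccontr)
    assume n: "\<not> W t \<le> Ws"
    have st: "{\<delta>..t} \<subseteq> tdom 0 w" using sub[of \<delta> t] t \<delta> by auto
    define Z where "Z = {s\<in>{\<delta>..t}. W s \<le> Ws}"
    have "closed Z"
      using continuous_closed_preimage[OF continuous_on_subset[OF cW st], of "{..Ws}"]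
      by (simp add: Z_def vimage_def Int_def)
    have "\<delta> \<in> Z" using x(2)[of \<delta>] Ws \<delta> t by (auto simp: Z_def)
    have "compact Z" using \<open>closed Z\<close> by (auto simp: compact_eq_bounded_closed Z_def intro: bounded_subset[of "{\<delta>..t}"])
    \<comment> \<open>The last time up to \<open>t\<close> at which the level is not exceeded; the
      estimates for large gain hold from then on.\<close>
    then obtain t0 where t0: "t0 \<in> Z" "\<And>s. s \<in> Z \<Longrightarrow> s \<le> t0"
      using compact_attains_sup[of Z] \<open>\<delta> \<in> Z\<close> by auto
    have t0': "\<delta> \<le> t0" "t0 \<le> t" "W t0 \<le> Ws" using t0(1) by (auto simp: Z_def)
    have big: "W s > Ws" if "t0 < s" "s \<le> t" for s
      using t0(2)[of s] that t0' by (force simp: Z_def)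
    obtain g where g: "acb 0 t e g"
      "AE s in lebesgue_on {0..t}. e s \<bullet> g s \<le> M * norm (e s) - \<gamma> * (norm (e s))\<^sup>2 / (1 - (\<phi> s)\<^sup>2 * (norm (e s))\<^sup>2)"
      using dyn[OF t(1)] by blast
    have a1: "acb t0 t e g" using acb_subset[OF g(1)] t0' \<delta> by auto
    have a2: "acb t0 t \<phi> \<phi>'"
      using t0' \<delta> by (intro has_vector_derivative_imp_acb has_vector_derivative_within_subset[OF d\<phi>]
        continuous_on_subset[OF c\<phi>']) auto
    \<comment> \<open>\<open>W\<close> is the squared norm of \<open>p\<close>, so the sign of
      \<open>p \<bullet> p'\<close> decides its monotonicity.\<close>
    define p where "p s = \<phi> s *\<^sub>R e s" for s
    define p' where "p' s = \<phi>' s *\<^sub>R e s + \<phi> s *\<^sub>R g s" for s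
    have a3: "acb t0 t p p'" unfolding p_def p'_def by (rule acb_bilinear[OF bounded_bilinear_scaleR a2 a1])
    have "acb t0 t (\<lambda>s. p s \<bullet> p s) (\<lambda>s. p' s \<bullet> p s + p s \<bullet> p' s)"
      by (rule acb_bilinear[OF bounded_bilinear_inner a3 a3])
    moreover have "AE s in lebesgue_on {t0..t}. p' s \<bullet> p s + p s \<bullet> p' s \<le> 0"
    proof -
      \<comment> \<open>At \<open>t0\<close> itself the level is not exceeded, so this point is left
        out.\<close>
      have A1: "AE s in lebesgue_on {t0..t}. s \<noteq> t0"
        by (subst AE_lebesgue_on_iff_negligible) (auto intro: negligible_subset[of "{t0}"])
      have A2: "AE s in lebesgue_on {t0..t}. e s \<bullet> g s \<le> M * norm (e s) - \<gamma> * (norm (e s))\<^sup>2 / (1 - (\<phi> s)\<^sup>2 * (norm (e s))\<^sup>2)"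
        using g(2) by (rule AE_lebesgue_on_subset) (use t0' \<delta> in auto)
      show ?thesis using A1 A2 AE_space
      proof eventually_elim
        case (elim s)
        then have s: "t0 < s" "s \<le> t" by (auto simp: space_restrict_space)
        define \<rho> where "\<rho> = norm (e s)"
        define k where "k = 1 / (1 - W s)"
        have sJ: "s \<in> tdom 0 w" using st s t0' by auto
        have s0: "s \<ge> \<delta>" "s \<ge> 0" using s t0' \<delta> by auto
        have \<phi>m: "\<phi> s \<ge> m" "\<phi> s > 0" using m(2)[OF s0(1)] m(1) by auto
        have \<phi>B: "\<phi> s \<le> B" using B(2)[OF s0(2)] by auto
        have "B > 0" using \<phi>B \<phi>m by linarith
        have Wb: "W s > 1/2" "W s > 1 - 1/ks" "W s < 1" using big[OF s] Ws W1[OF sJ] by auto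
        have "1 / ks > 1 - W s" using Wb by simp
        then have kk: "k \<ge> ks" using Wb ks unfolding k_def by (simp add: field_simps)
        have W\<rho>: "W s = (\<phi> s * \<rho>)\<^sup>2" by (simp add: W_def \<rho>_def power_mult_distrib)
        have "\<rho> \<noteq> 0" using Wb(1) W\<rho> by auto
        then have \<rho>0: "\<rho> > 0" by (simp add: \<rho>_def)
        have "(1/2)\<^sup>2 \<le> (\<phi> s * \<rho>)\<^sup>2" using Wb(1) W\<rho> by (simp add: power2_eq_square)
        then have "1/2 \<le> \<phi> s * \<rho>" using \<phi>m \<rho>0 by (intro power2_le_imp_le[of "1/2"]) auto
        also have "\<dots> \<le> B * \<rho>" using \<phi>B \<rho>0 by (intro mult_right_mono) auto
        finally have \<rho>B: "1 \<le> 2 * B * \<rho>" by simp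
        have i1: "\<phi>' s \<le> (\<Lambda> / m) * \<phi> s"
        proof -
          have "\<phi>' s \<le> \<Lambda>" using \<Lambda>(2)[OF s0(2)] by auto
          also have "\<Lambda> = (\<Lambda> / m) * m" using m by simp
          also have "\<dots> \<le> (\<Lambda> / m) * \<phi> s" using \<phi>m \<Lambda> m by (intro mult_left_mono) auto
          finally show ?thesis .
        qed
        have i2: "M * \<rho> \<le> 2 * B * M * \<rho>\<^sup>2"
          using mult_left_mono[OF \<rho>B, of "M * \<rho>"] M \<rho>0 by (simp add: power2_eq_square algebra_simps)
        have i3: "\<gamma> * k \<ge> \<Lambda> / m + 2 * B * M"
        proof -
          have "\<gamma> * ks = \<gamma> * ((\<Lambda> / m + 2 * B * M) / \<gamma>) + \<gamma>" by (simp only: ks_def distrib_left mult_1_right)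
          moreover have "\<gamma> * ((\<Lambda> / m + 2 * B * M) / \<gamma>) = \<Lambda> / m + 2 * B * M" using \<gamma> by simp
          ultimately have "\<gamma> * ks = \<Lambda> / m + 2 * B * M + \<gamma>" by metis
          then show ?thesis using mult_left_mono[OF kk, of \<gamma>] \<gamma> by linarith
        qed
        have eg: "e s \<bullet> g s \<le> M * \<rho> - \<gamma> * k * \<rho>\<^sup>2"
        proof -
          have "\<gamma> * k * \<rho>\<^sup>2 = \<gamma> * \<rho>\<^sup>2 / (1 - (\<phi> s)\<^sup>2 * \<rho>\<^sup>2)" by (simp add: k_def W\<rho> power_mult_distrib)
          then show ?thesis using elim(2) unfolding \<rho>_def by simp
        qed
        have "p s \<bullet> p' s = \<phi> s * (\<phi>' s * \<rho>\<^sup>2 + \<phi> s * (e s \<bullet> g s))"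
          by (simp add: p_def p'_def inner_add_right dot_square_norm \<rho>_def algebra_simps)
        also have "\<dots> \<le> \<phi> s * (((\<Lambda> / m) * \<phi> s) * \<rho>\<^sup>2 + \<phi> s * (2 * B * M * \<rho>\<^sup>2 - \<gamma> * k * \<rho>\<^sup>2))"
          using \<phi>m i1 i2 eg by (intro mult_left_mono add_mono mult_right_mono) auto
        also have "\<dots> = (\<phi> s)\<^sup>2 * \<rho>\<^sup>2 * (\<Lambda> / m + 2 * B * M - \<gamma> * k)" by (simp add: power2_eq_square algebra_simps)
        also have "\<dots> \<le> 0" using i3 by (intro mult_nonneg_nonpos) auto
        finally show ?case by (simp add: inner_commute)
      qed
    qed
    ultimately have "p t \<bullet> p t \<le> p t0 \<bullet> p t0"
      by (rule acb_nonincreasing[where f="\<lambda>s. p s \<bullet> p s", OF _ t0'(2)])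
    then have "W t \<le> W t0" by (simp add: p_def W_def dot_square_norm power_mult_distrib)
    then show False using n t0' by simp
  qed
  show ?thesis
  proof (intro exI[of _ "1 - Ws"] conjI ballI)
    fix t assume t: "t \<in> tdom 0 w"
    have "W t \<le> Ws"
    proof (cases "t \<le> \<delta>")
      case True
      then have "W t \<le> W x" using x(2)[of t] t by (auto simp: tdom_def)
      then show ?thesis using Ws by simp
    qed (use main[OF t] in auto)
    then show "(\<phi> t)\<^sup>2 * (norm (e t))\<^sup>2 \<le> 1 - (1 - Ws)" by (simp add: W_def)
  qed (use Ws in auto)
qed

section \<open>Formal derivatives of error expressions\<close>

text \<open>Polynomials in the errors \<open>e\<^sub>j\<close> (\<open>EE j\<close>), the gains \<open>k\<^sub>j\<close> (\<open>KK j\<close>) and the derivatives of the funnel functions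
  (\<open>PP j l\<close>), with the formal time derivative \<open>dex\<close> along \<open>e\<^sub>j' = e\<^sub>j\<^sub>+\<^sub>1 - k\<^sub>j e\<^sub>j\<close>.\<close>

datatype ex = EE nat | KK nat | PP nat nat | Num real | Add ex ex | Mul ex ex

primrec ev :: "(nat \<Rightarrow> nat \<Rightarrow> real) \<Rightarrow> (nat \<Rightarrow> real) \<Rightarrow> ex \<Rightarrow> real" where
  "ev p e (EE j) = e j"
| "ev p e (KK j) = 1 / (1 - (p j 0)\<^sup>2 * (e j)\<^sup>2)"
| "ev p e (PP j l) = p j l"
| "ev p e (Num c) = c"
| "ev p e (Add x y) = ev p e x + ev p e y"
| "ev p e (Mul x y) = ev p e x * ev p e y"

definition dEE :: "nat \<Rightarrow> ex" where
  "dEE j = Add (EE (Suc j)) (Mul (Num (- 1)) (Mul (KK j) (EE j)))"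

primrec dex :: "ex \<Rightarrow> ex" where
  "dex (EE j) = dEE j"
| "dex (KK j) = Mul (Mul (KK j) (KK j)) (Mul (Num 2)
     (Add (Mul (Mul (PP j 0) (PP j 1)) (Mul (EE j) (EE j))) (Mul (Mul (PP j 0) (PP j 0)) (Mul (EE j) (dEE j)))))"
| "dex (PP j l) = PP j (Suc l)"
| "dex (Num c) = Num 0"
| "dex (Add x y) = Add (dex x) (dex y)"
| "dex (Mul x y) = Add (Mul (dex x) y) (Mul x (dex y))"

text \<open>The restriction \<open>j + l < n\<close> reflects that
  \<open>\<phi>\<^sub>i\<^sub>j\<close> has only \<open>r\<^sub>i - j\<close> derivatives. The bound
  \<open>m\<close> is separate from \<open>n\<close> because the last error of a chain has neither a
  gain \<open>k\<^sub>i\<^sub>j\<close> nor a funnel function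
  \<open>\<phi>\<^sub>i\<^sub>j\<close>.\<close>

primrec wfx :: "nat \<Rightarrow> nat \<Rightarrow> ex \<Rightarrow> bool" where
  "wfx n m (EE j) \<longleftrightarrow> j < n"
| "wfx n m (KK j) \<longleftrightarrow> j < n \<and> j < m"
| "wfx n m (PP j l) \<longleftrightarrow> j + l < n \<and> j < m"
| "wfx n m (Num c) \<longleftrightarrow> True"
| "wfx n m (Add x y) \<longleftrightarrow> wfx n m x \<and> wfx n m y"
| "wfx n m (Mul x y) \<longleftrightarrow> wfx n m x \<and> wfx n m y"

lemma wfx_mono: "wfx n m x \<Longrightarrow> n \<le> n' \<Longrightarrow> m \<le> m' \<Longrightarrow> wfx n' m' x"
  by (induction x) auto

text \<open>A derivative brings in the next error and one more derivative of the funnel functions,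
  but no further gain; hence only the first bound grows.\<close>

lemma wfx_dex: "wfx n m x \<Longrightarrow> n \<le> m \<Longrightarrow> wfx (Suc n) m (dex x)"
  by (induction x) (auto simp: dEE_def intro: wfx_mono)

text \<open>\<open>e\<^sub>j - (e\<^sub>0)\<^sup>(\<^sup>j\<^sup>)\<close> as an expression in \<open>e\<^sub>0, \<dots>, e\<^sub>j\<^sub>-\<^sub>1\<close>.\<close>

primrec Rx :: "nat \<Rightarrow> ex" where
  "Rx 0 = Num 0"
| "Rx (Suc j) = Add (dex (Rx j)) (Mul (KK j) (EE j))"

lemma wfx_Rx: "wfx j j (Rx j)"
  by (induction j) (auto intro: wfx_mono[OF wfx_dex])

lemma ev_deriv:
  assumes "wfx n n x"
    and e: "\<And>j. j < n \<Longrightarrow> ((\<lambda>t. e t j) has_real_derivative ev (p t) (e t) (dEE j)) (at t within A)"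
    and p: "\<And>j l. j + l < n \<Longrightarrow> ((\<lambda>t. p t j l) has_real_derivative p t j (Suc l)) (at t within A)"
    and ne: "\<And>j. j < n \<Longrightarrow> 1 - (p t j 0)\<^sup>2 * (e t j)\<^sup>2 \<noteq> 0"
  shows "((\<lambda>t. ev (p t) (e t) x) has_real_derivative ev (p t) (e t) (dex x)) (at t within A)"
  using assms(1)
proof (induction x)
  case (KK j)
  then have j: "j < n" by simp
  have "((\<lambda>t. 1 / (1 - (p t j 0)\<^sup>2 * (e t j)\<^sup>2)) has_real_derivative ev (p t) (e t) (dex (KK j))) (at t within A)"
    using ne[OF j] p[of j 0] j
    by (auto intro!: derivative_eq_intros e[OF j] p simp: power2_eq_square divide_simps)
  then show ?case by simp
next
  case (Mul x y)
  then show ?case by (auto intro!: derivative_eq_intros)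
qed (use e p in \<open>auto intro!: derivative_intros simp: dEE_def\<close>)

lemma ev_continuous:
  assumes "wfx n m x"
    and e: "\<And>j. j < n \<Longrightarrow> continuous_on S (\<lambda>z. e z j)"
    and p: "\<And>j l. j + l < n \<Longrightarrow> j < m \<Longrightarrow> continuous_on S (\<lambda>z. p z j l)"
    and ne: "\<And>j z. j < n \<Longrightarrow> j < m \<Longrightarrow> z \<in> S \<Longrightarrow> 1 - (p z j 0)\<^sup>2 * (e z j)\<^sup>2 \<noteq> 0"
  shows "continuous_on S (\<lambda>z. ev (p z) (e z) x)"
  using assms(1)
proof (induction x)
  case (KK j)
  then have "j < n" "j < m" by auto
  then show ?case using ne p[of j 0] by (auto intro!: continuous_intros e)
qed (auto intro!: continuous_intros e p)

lemma ev_bounded: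
  assumes "wfx n m x"
    and e: "\<And>j. j < n \<Longrightarrow> \<exists>B. \<forall>z\<in>S. \<bar>e z j\<bar> \<le> B"
    and p: "\<And>j l. j + l < n \<Longrightarrow> j < m \<Longrightarrow> \<exists>B. \<forall>z\<in>S. \<bar>p z j l\<bar> \<le> B"
    and ne: "\<And>j. j < n \<Longrightarrow> j < m \<Longrightarrow> \<exists>\<epsilon>>0. \<forall>z\<in>S. (p z j 0)\<^sup>2 * (e z j)\<^sup>2 \<le> 1 - \<epsilon>"
  shows "\<exists>B. \<forall>z\<in>S. \<bar>ev (p z) (e z) x\<bar> \<le> B"
  using assms(1)
proof (induction x)
  case (KK j)
  then obtain \<epsilon> where \<epsilon>: "\<epsilon> > 0" "\<forall>z\<in>S. (p z j 0)\<^sup>2 * (e z j)\<^sup>2 \<le> 1 - \<epsilon>" using ne[of j] by auto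
  have "\<bar>ev (p z) (e z) (KK j)\<bar> \<le> 1 / \<epsilon>" if "z \<in> S" for z
  proof -
    have "\<epsilon> \<le> 1 - (p z j 0)\<^sup>2 * (e z j)\<^sup>2" using \<epsilon>(2) that by force
    then show ?thesis using \<epsilon>(1) by (simp add: frac_le)
  qed
  then show ?case by blast
next
  case (Add x y)
  then obtain B C where "\<forall>z\<in>S. \<bar>ev (p z) (e z) x\<bar> \<le> B" "\<forall>z\<in>S. \<bar>ev (p z) (e z) y\<bar> \<le> C" by auto
  then have "\<forall>z\<in>S. \<bar>ev (p z) (e z) (Add x y)\<bar> \<le> B + C" by force
  then show ?case by blast
next
  case (Mul x y)
  then obtain B C where BC: "\<forall>z\<in>S. \<bar>ev (p z) (e z) x\<bar> \<le> B" "\<forall>z\<in>S. \<bar>ev (p z) (e z) y\<bar> \<le> C" by auto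
  have "\<bar>ev (p z) (e z) (Mul x y)\<bar> \<le> B * C" if "z \<in> S" for z
    using mult_mono[of "\<bar>ev (p z) (e z) x\<bar>" B "\<bar>ev (p z) (e z) y\<bar>" C] BC that by (force simp: abs_mult)
  then show ?case by blast
qed (use e p in auto)

lemma ev_ubl:
  assumes "wfx n m x"
    and e: "\<And>j. j < n \<Longrightarrow> ubl A I (\<lambda>v t. e v t j)"
    and p: "\<And>j l. j + l < n \<Longrightarrow> j < m \<Longrightarrow> ubl A I (\<lambda>v t. p v t j l)"
    and ne: "\<And>j. j < n \<Longrightarrow> j < m \<Longrightarrow> \<exists>\<epsilon>>0. \<forall>v\<in>A. \<forall>t\<in>I. (p v t j 0)\<^sup>2 * (e v t j)\<^sup>2 \<le> 1 - \<epsilon>"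
  shows "ubl A I (\<lambda>v t. ev (p v t) (e v t) x)"
  using assms(1)
proof (induction x)
  case (KK j)
  then obtain \<epsilon> where \<epsilon>: "\<epsilon> > 0" "\<forall>v\<in>A. \<forall>t\<in>I. (p v t j 0)\<^sup>2 * (e v t j)\<^sup>2 \<le> 1 - \<epsilon>" using ne[of j] by auto
  have one: "ubl A I (\<lambda>v t. 1::real)" by (rule ubl_const[where B=1]) simp
  have "ubl A I (\<lambda>v t. 1 / (1 - (p v t j 0)\<^sup>2 * (e v t j)\<^sup>2))"
    using KK \<epsilon> by (intro ubl_inverse[where e=\<epsilon>] ubl_diff one ubl_mult ubl_power2 e p) force+
  then show ?case by simp
next
  case (Num c)
  show ?case using ubl_const[of A "\<lambda>_. c" "\<bar>c\<bar>"] by simp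
qed (auto intro!: ubl_add ubl_mult e p)

section \<open>Causal operators\<close>

lemma op_class_bibo:
  fixes T :: "(real \<Rightarrow> 'a::euclidean_space) \<Rightarrow> real \<Rightarrow> 'b::euclidean_space"
  assumes "op_class h T"
  shows "\<exists>c>0. \<forall>\<zeta> b. continuous_on {-h..} \<zeta> \<longrightarrow> (\<forall>t\<ge>-h. norm (\<zeta> t) \<le> B) \<longrightarrow>
    (AE t in lebesgue_on {0..b}. norm (T \<zeta> t) \<le> c)"
proof -
  have "bibo h T" using assms by (simp add: op_class_def)
  \<comment> \<open>The input bound in \<open>bibo\<close> has to be positive, while
    \<open>B\<close> is arbitrary.\<close>
  moreover have "\<bar>B\<bar> + 1 > 0" by simp
  ultimately have "\<exists>c2>0. \<forall>\<zeta>. continuous_on {-h..} \<zeta> \<and> (\<forall>t\<ge>-h. norm (\<zeta> t) \<le> \<bar>B\<bar> + 1) \<longrightarrow>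
        (AE t in lebesgue_on {0..}. norm (T \<zeta> t) \<le> c2)"
    unfolding bibo_def by (elim allE impE)
  then obtain c where c: "c > 0" and c2: "\<forall>\<zeta>. continuous_on {-h..} \<zeta> \<and> (\<forall>t\<ge>-h. norm (\<zeta> t) \<le> \<bar>B\<bar> + 1) \<longrightarrow>
        (AE t in lebesgue_on {0..}. norm (T \<zeta> t) \<le> c)"
    by blast
  show ?thesis
  proof (intro exI[of _ c] conjI allI impI c)
    fix \<zeta> :: "real \<Rightarrow> 'a" and b :: real assume \<zeta>: "continuous_on {-h..} \<zeta>" "\<forall>t\<ge>-h. norm (\<zeta> t) \<le> B"
    have "\<forall>t\<ge>-h. norm (\<zeta> t) \<le> \<bar>B\<bar> + 1" using \<zeta>(2) by force
    then have "AE t in lebesgue_on {0..}. norm (T \<zeta> t) \<le> c" using \<zeta>(1) c2 by simp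
    then show "AE t in lebesgue_on {0..b}. norm (T \<zeta> t) \<le> c" by (rule AE_lebesgue_on_subset) auto
  qed
qed

lemma op_class_causal:
  assumes "op_class h T" "b \<ge> 0" "continuous_on {-h..} \<zeta>" "continuous_on {-h..} \<xi>"
    "\<And>\<sigma>. -h \<le> \<sigma> \<Longrightarrow> \<sigma> < b \<Longrightarrow> \<zeta> \<sigma> = \<xi> \<sigma>"
  shows "AE \<sigma> in lebesgue_on {0..b}. T \<zeta> \<sigma> = T \<xi> \<sigma>"
proof -
  have "causal h T" using assms(1) by (simp add: op_class_def)
  then have "AE \<sigma> in lebesgue_on {0..<b}. T \<zeta> \<sigma> = T \<xi> \<sigma>"
    unfolding causal_def using assms(2-5) by (metis atLeastLessThan_iff)
  then show ?thesis by (simp add: AE_lebesgue_on_atLeastLessThan)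
qed

lemma op_class_measurable:
  assumes "op_class h T" "continuous_on {-h..} \<zeta>"
  shows "T \<zeta> \<in> borel_measurable (lebesgue_on {0..b})"
proof -
  have "T \<zeta> \<in> borel_measurable (lebesgue_on {0..})" using assms by (auto simp: op_class_def Linf_loc_def)
  then show ?thesis by (rule borel_measurable_lebesgue_on_subset) auto
qed

text \<open>Any upper bound \<open>M\<close> takes the place of the supremum in
  \<open>loc_lipschitz\<close>, which then never has to be evaluated.\<close>

definition lip_near :: "real \<Rightarrow> ((real \<Rightarrow> 'a::euclidean_space) \<Rightarrow> real \<Rightarrow> 'b::euclidean_space) \<Rightarrow> (real \<Rightarrow> 'a) \<Rightarrow>
    real \<Rightarrow> real \<Rightarrow> real \<Rightarrow> real \<Rightarrow> bool" where
  "lip_near h T \<xi> t \<tau> \<delta> c \<longleftrightarrow> (\<forall>\<zeta>1 \<zeta>2 M. continuous_on {-h..} \<zeta>1 \<longrightarrow> continuous_on {-h..} \<zeta>2 \<longrightarrow>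
    (\<forall>\<sigma>\<in>{-h..t}. \<zeta>1 \<sigma> = \<xi> \<sigma> \<and> \<zeta>2 \<sigma> = \<xi> \<sigma>) \<longrightarrow>
    (\<forall>\<sigma>\<in>{t..t+\<tau>}. norm (\<zeta>1 \<sigma> - \<xi> t) < \<delta> \<and> norm (\<zeta>2 \<sigma> - \<xi> t) < \<delta> \<and> norm (\<zeta>1 \<sigma> - \<zeta>2 \<sigma>) \<le> M) \<longrightarrow>
    (AE \<sigma> in lebesgue_on {t..t+\<tau>}. norm (T \<zeta>1 \<sigma> - T \<zeta>2 \<sigma>) \<le> c * M))"

lemma op_class_local_lipschitz:
  fixes T :: "(real \<Rightarrow> 'a::euclidean_space) \<Rightarrow> real \<Rightarrow> 'b::euclidean_space"
  assumes "op_class h T" "t \<ge> 0" "continuous_on {-h..t} \<xi>"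
  shows "\<exists>\<tau>>0. \<exists>\<delta>>0. \<exists>c>0. lip_near h T \<xi> t \<tau> \<delta> c"
proof -
  have "loc_lipschitz h T" using assms(1) by (simp add: op_class_def)
  from this[unfolded loc_lipschitz_def, rule_format, OF assms(2,3)]
  obtain \<tau> \<delta> c where L: "\<tau> > 0" "\<delta> > 0" "c > 0" and L4: "\<forall>\<zeta>1 \<zeta>2.
           continuous_on {-h..} \<zeta>1 \<and> continuous_on {-h..} \<zeta>2 \<and>
           (\<forall>\<sigma>\<in>{-h..t}. \<zeta>1 \<sigma> = \<xi> \<sigma> \<and> \<zeta>2 \<sigma> = \<xi> \<sigma>) \<and>
           (\<forall>\<sigma>\<in>{t..t+\<tau>}. norm (\<zeta>1 \<sigma> - \<xi> t) < \<delta> \<and> norm (\<zeta>2 \<sigma> - \<xi> t) < \<delta>) \<longrightarrow>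
           (AE \<sigma> in lebesgue_on {t..t+\<tau>}.
              norm (T \<zeta>1 \<sigma> - T \<zeta>2 \<sigma>) \<le> c * (SUP s\<in>{t..t+\<tau>}. norm (\<zeta>1 s - \<zeta>2 s)))"
    by blast
  show ?thesis
    unfolding lip_near_def
  proof (rule exI[of _ \<tau>], rule conjI[OF L(1)], rule exI[of _ \<delta>], rule conjI[OF L(2)], rule exI[of _ c],
      rule conjI[OF L(3)], intro allI impI)
    fix \<zeta>1 \<zeta>2 :: "real \<Rightarrow> 'a" and M :: real
    assume a: "continuous_on {-h..} \<zeta>1" "continuous_on {-h..} \<zeta>2"
      "\<forall>\<sigma>\<in>{-h..t}. \<zeta>1 \<sigma> = \<xi> \<sigma> \<and> \<zeta>2 \<sigma> = \<xi> \<sigma>"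
      "\<forall>\<sigma>\<in>{t..t+\<tau>}. norm (\<zeta>1 \<sigma> - \<xi> t) < \<delta> \<and> norm (\<zeta>2 \<sigma> - \<xi> t) < \<delta> \<and> norm (\<zeta>1 \<sigma> - \<zeta>2 \<sigma>) \<le> M"
    have "AE \<sigma> in lebesgue_on {t..t+\<tau>}. norm (T \<zeta>1 \<sigma> - T \<zeta>2 \<sigma>) \<le> c * (SUP s\<in>{t..t+\<tau>}. norm (\<zeta>1 s - \<zeta>2 s))"
      using L4 a by simp
    moreover have "(SUP s\<in>{t..t+\<tau>}. norm (\<zeta>1 s - \<zeta>2 s)) \<le> M"
      by (rule cSUP_least) (use a L(1) in auto)
    then have "c * (SUP s\<in>{t..t+\<tau>}. norm (\<zeta>1 s - \<zeta>2 s)) \<le> c * M" using L(3) by (intro mult_left_mono) auto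
    ultimately show "AE \<sigma> in lebesgue_on {t..t+\<tau>}. norm (T \<zeta>1 \<sigma> - T \<zeta>2 \<sigma>) \<le> c * M"
      by (auto elim!: eventually_mono)
  qed
qed

lemma DAE_op_class: "op_class_DAE h T \<Longrightarrow> op_class h T"
  by (simp add: op_class_DAE_def)

lemma DAE_continuous:
  assumes "op_class_DAE h T" "continuous_on {-h..} \<zeta>"
  shows "continuous_on {0..} (T \<zeta>)"
proof -
  obtain D where "\<forall>t\<ge>0. (T \<zeta> has_vector_derivative D t) (at t within {0..})"
    using assms unfolding op_class_DAE_def by blast
  then show ?thesis
    unfolding continuous_on_eq_continuous_within by (blast intro: has_vector_derivative_continuous)
qed

lemma AE_zero_continuous:
  fixes f :: "real \<Rightarrow> 'a::real_normed_vector"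
  assumes "AE \<sigma> in lebesgue_on {a..b}. f \<sigma> = g \<sigma>" "continuous_on {a..b} f" "continuous_on {a..b} g" "a < b" "t \<in> {a..b}"
  shows "f t = g t"
proof -
  have "norm (f t - g t) \<le> 0"
  proof (rule AE_lebesgue_on_continuous_le[where a=a and b=b and f="\<lambda>t. norm (f t - g t)"])
    show "AE x in lebesgue_on {a..b}. norm (f x - g x) \<le> 0" using assms(1) by (auto elim!: eventually_mono)
    show "continuous_on {a..b} (\<lambda>t. norm (f t - g t))" by (intro continuous_intros assms)
  qed (use assms in auto)
  then show ?thesis by simp
qed

lemma DAE_causal_pos:
  assumes T: "op_class_DAE h T" and b: "b > 0" and c: "continuous_on {-h..} \<zeta>" "continuous_on {-h..} \<xi>"
    and eq: "\<And>\<sigma>. -h \<le> \<sigma> \<Longrightarrow> \<sigma> < b \<Longrightarrow> \<zeta> \<sigma> = \<xi> \<sigma>" and t: "0 \<le> t" "t \<le> b"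
  shows "T \<zeta> t = T \<xi> t"
proof (rule AE_zero_continuous)
  show "AE \<sigma> in lebesgue_on {0..b}. T \<zeta> \<sigma> = T \<xi> \<sigma>"
    using op_class_causal[OF DAE_op_class[OF T] _ c eq] b by simp
  show "continuous_on {0..b} (T \<zeta>)" "continuous_on {0..b} (T \<xi>)"
    by (rule continuous_on_subset[OF DAE_continuous[OF T c(1)]] continuous_on_subset[OF DAE_continuous[OF T c(2)]]; force)+
qed (use b t in auto)

text \<open>At time 0 causality gives no information, as it compares images up to null sets. The
  local Lipschitz condition helps: two inputs with the same history, frozen shortly after 0, stay as
  close to each other as desired, and so do their images.\<close>

lemma DAE_causal:
  assumes T: "op_class_DAE h T" and h: "h \<ge> 0" and c: "continuous_on {-h..} \<zeta>" "continuous_on {-h..} \<xi>"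
    and eq: "\<And>\<sigma>. -h \<le> \<sigma> \<Longrightarrow> \<sigma> \<le> t \<Longrightarrow> \<zeta> \<sigma> = \<xi> \<sigma>" and t: "0 \<le> t"
  shows "T \<zeta> t = T \<xi> t"
proof (cases "t = 0")
  case False
  then show ?thesis using DAE_causal_pos[OF T _ c, of t t] eq t by simp
next
  case True
  have eq0: "\<zeta> 0 = \<xi> 0" using eq True h by simp
  have "continuous_on {-h..0} \<zeta>" by (rule continuous_on_subset[OF c(1)]) auto
  from op_class_local_lipschitz[OF DAE_op_class[OF T] order_refl this]
  obtain \<tau> \<delta> k where L: "\<tau> > 0" "\<delta> > 0" "k > 0" and L4: "lip_near h T \<zeta> 0 \<tau> \<delta> k"
    by blast
  have "norm (T \<zeta> 0 - T \<xi> 0) \<le> 0 + e" if e: "e > 0" for e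
  proof -
    define M where "M = e / k"
    have M: "M > 0" using e L by (simp add: M_def)
    define d where "d = min \<delta> (M / 2)"
    have d: "d > 0" using M L by (simp add: d_def)
    obtain s1 where s1: "s1 > 0" "\<And>x. x \<in> {-h..} \<Longrightarrow> dist x 0 < s1 \<Longrightarrow> dist (\<zeta> x) (\<zeta> 0) < d"
      using c(1)[unfolded continuous_on_iff, THEN bspec[of _ _ 0], rule_format, OF _ d] h by auto
    obtain s2 where s2: "s2 > 0" "\<And>x. x \<in> {-h..} \<Longrightarrow> dist x 0 < s2 \<Longrightarrow> dist (\<xi> x) (\<xi> 0) < d"
      using c(2)[unfolded continuous_on_iff, THEN bspec[of _ _ 0], rule_format, OF _ d] h by auto
    define s where "s = min s1 s2 / 2"
    have s: "s > 0" "s < s1" "s < s2" using s1 s2 by (auto simp: s_def)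
    \<comment> \<open>Freezing after \<open>s > 0\<close> keeps the input close to its value at 0
      for all later times and, by \<open>DAE_causal_pos\<close>, does not change the image at
      0.\<close>
    define \<zeta>' where "\<zeta>' x = \<zeta> (min x s)" for x
    define \<xi>' where "\<xi>' x = \<xi> (min x s)" for x
    have c': "continuous_on {-h..} \<zeta>'" "continuous_on {-h..} \<xi>'"
      unfolding \<zeta>'_def \<xi>'_def using s h
      by (auto intro!: continuous_on_compose2[OF c(1)] continuous_on_compose2[OF c(2)] continuous_intros)
    have e1: "T \<zeta>' 0 = T \<zeta> 0" using s by (intro DAE_causal_pos[OF T s(1) c'(1) c(1)]) (auto simp: \<zeta>'_def)
    have e2: "T \<xi>' 0 = T \<xi> 0" using s by (intro DAE_causal_pos[OF T s(1) c'(2) c(2)]) (auto simp: \<xi>'_def)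
    have near: "norm (\<zeta>' x - \<zeta> 0) < d" "norm (\<xi>' x - \<zeta> 0) < d" if "x \<ge> 0" for x
    proof -
      have "min x s \<in> {-h..}" "dist (min x s) 0 < s1" "dist (min x s) 0 < s2" using that s h by (auto simp: dist_real_def)
      then show "norm (\<zeta>' x - \<zeta> 0) < d" "norm (\<xi>' x - \<zeta> 0) < d"
        using s1(2) s2(2) eq0 by (auto simp: \<zeta>'_def \<xi>'_def dist_norm)
    qed
    have "AE \<sigma> in lebesgue_on {0..0+\<tau>}. norm (T \<zeta>' \<sigma> - T \<xi>' \<sigma>) \<le> k * M"
    proof (rule L4[unfolded lip_near_def, THEN spec, THEN spec, THEN spec, THEN mp, THEN mp, THEN mp, THEN mp, OF c'])
      show "\<forall>\<sigma>\<in>{- h..0}. \<zeta>' \<sigma> = \<zeta> \<sigma> \<and> \<xi>' \<sigma> = \<zeta> \<sigma>" using eq True s by (auto simp: \<zeta>'_def \<xi>'_def min_def)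
      show "\<forall>\<sigma>\<in>{0..0 + \<tau>}. norm (\<zeta>' \<sigma> - \<zeta> 0) < \<delta> \<and> norm (\<xi>' \<sigma> - \<zeta> 0) < \<delta> \<and> norm (\<zeta>' \<sigma> - \<xi>' \<sigma>) \<le> M"
      proof
        fix x assume "x \<in> {0..0+\<tau>}"
        then have n: "norm (\<zeta>' x - \<zeta> 0) < d" "norm (\<xi>' x - \<zeta> 0) < d" using near by auto
        have "norm (\<zeta>' x - \<xi>' x) \<le> norm (\<zeta>' x - \<zeta> 0) + norm (\<xi>' x - \<zeta> 0)"
          using norm_triangle_ineq4[of "\<zeta>' x - \<zeta> 0" "\<xi>' x - \<zeta> 0"] by simp
        then show "norm (\<zeta>' x - \<zeta> 0) < \<delta> \<and> norm (\<xi>' x - \<zeta> 0) < \<delta> \<and> norm (\<zeta>' x - \<xi>' x) \<le> M"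
          using n by (auto simp: d_def)
      qed
    qed
    then have "norm (T \<zeta>' 0 - T \<xi>' 0) \<le> k * M"
      using L(1) DAE_continuous[OF T c'(1)] DAE_continuous[OF T c'(2)]
      by (intro AE_lebesgue_on_continuous_le[where a=0 and b="0+\<tau>" and f="\<lambda>t. norm (T \<zeta>' t - T \<xi>' t)"])
        (auto intro!: continuous_intros intro: continuous_on_subset)
    then show ?thesis using e1 e2 L(3) by (simp add: M_def)
  qed
  then have "norm (T \<zeta> 0 - T \<xi> 0) \<le> 0" by (rule field_le_epsilon)
  then show ?thesis using True by simp
qed

text \<open>Clause (iv) of the operator class enters here: the derivative is a continuous function
  of the input and of its image under \<open>T'\<close>, and both are bounded. The constants depend
  on the input only through \<open>B\<close>.\<close>

lemma DAE_bounded_lipschitz: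
  fixes T :: "(real \<Rightarrow> 'a::euclidean_space) \<Rightarrow> real \<Rightarrow> 'b::euclidean_space"
  assumes T: "op_class_DAE h T" and h: "h \<ge> 0"
  shows "\<exists>c\<ge>0. \<exists>L\<ge>0. \<forall>\<zeta>. continuous_on {-h..} \<zeta> \<longrightarrow> (\<forall>t\<ge>-h. norm (\<zeta> t) \<le> B) \<longrightarrow>
    (\<forall>t\<ge>0. norm (T \<zeta> t) \<le> c) \<and> (\<forall>s\<ge>0. \<forall>t\<ge>0. norm (T \<zeta> t - T \<zeta> s) \<le> L * \<bar>t - s\<bar>)"
proof -
  have "\<exists>(z :: 'a \<times> 'b \<Rightarrow> 'b) T'. continuous_on UNIV z \<and> op_class h T' \<and> (\<forall>\<zeta>. continuous_on {-h..} \<zeta> \<longrightarrow>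
           (\<forall>t\<ge>0. (T \<zeta> has_vector_derivative z (\<zeta> t, T' \<zeta> t)) (at t within {0..})))"
    using T by (simp add: op_class_DAE_def)
  then obtain z :: "'a \<times> 'b \<Rightarrow> 'b" and T' where z: "continuous_on UNIV z" "op_class h T'" and
    dT: "\<forall>\<zeta>. continuous_on {-h..} \<zeta> \<longrightarrow> (\<forall>t\<ge>0. (T \<zeta> has_vector_derivative z (\<zeta> t, T' \<zeta> t)) (at t within {0..}))"
    by (elim exE conjE)
  obtain c where c: "c > 0" and c2: "\<forall>\<zeta> b. continuous_on {-h..} \<zeta> \<longrightarrow> (\<forall>t\<ge>-h. norm (\<zeta> t) \<le> B) \<longrightarrow>
      (AE t in lebesgue_on {0..b}. norm (T \<zeta> t) \<le> c)"
    using op_class_bibo[OF DAE_op_class[OF T], of B] by blast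
  obtain c' where c': "c' > 0" and c'2: "\<forall>\<zeta> b. continuous_on {-h..} \<zeta> \<longrightarrow> (\<forall>t\<ge>-h. norm (\<zeta> t) \<le> B) \<longrightarrow>
      (AE t in lebesgue_on {0..b}. norm (T' \<zeta> t) \<le> c')"
    using op_class_bibo[OF z(2), of B] by blast
  have "compact (z ` (cball 0 B \<times> cball 0 c'))"
    using z(1) by (intro compact_continuous_image compact_Times) (auto intro: continuous_on_subset)
  then have "bounded (z ` (cball 0 B \<times> cball 0 c'))" by (rule compact_imp_bounded)
  then obtain L where "\<forall>w \<in> z ` (cball 0 B \<times> cball 0 c'). norm w \<le> L"
    unfolding bounded_iff by blast
  then have L: "norm (z (x, y)) \<le> L" if "norm x \<le> B" "norm y \<le> c'" for x y
    using that by auto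
  have main: "(\<forall>t\<ge>0. norm (T \<zeta> t) \<le> c) \<and> (\<forall>s\<ge>0. \<forall>t\<ge>0. norm (T \<zeta> t - T \<zeta> s) \<le> \<bar>L\<bar> * \<bar>t - s\<bar>)"
    if \<zeta>: "continuous_on {-h..} \<zeta>" "\<forall>t\<ge>-h. norm (\<zeta> t) \<le> B" for \<zeta>
  proof -
    have bd: "norm (T \<zeta> t) \<le> c" if "t \<ge> 0" for t
    proof (rule AE_lebesgue_on_continuous_le[where a=0 and b="t+1" and f="\<lambda>t. norm (T \<zeta> t)"])
      show "AE x in lebesgue_on {0..t + 1}. norm (T \<zeta> x) \<le> c" using c2 \<zeta> by simp
      show "continuous_on {0..t+1} (\<lambda>t. norm (T \<zeta> t))"
        by (intro continuous_intros continuous_on_subset[OF DAE_continuous[OF T \<zeta>(1)]]) auto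
    qed (use that in auto)
    have "\<exists>D. continuous_on {0..} D \<and> (\<forall>t\<ge>0. (T \<zeta> has_vector_derivative D t) (at t within {0..}))"
      using T \<zeta>(1) by (simp add: op_class_DAE_def)
    then obtain D where D: "continuous_on {0..} D" and D2: "\<forall>t\<ge>0. (T \<zeta> has_vector_derivative D t) (at t within {0..})"
      by (elim exE conjE)
    have Dz: "D t = z (\<zeta> t, T' \<zeta> t)" if "t \<ge> 0" for t
    proof -
      have "(T \<zeta> has_vector_derivative D t) (at t within {t..t+1})" "(T \<zeta> has_vector_derivative z (\<zeta> t, T' \<zeta> t)) (at t within {t..t+1})"
        using D2[rule_format, OF that] dT[rule_format, OF \<zeta>(1) that] that
        by (auto intro: has_vector_derivative_within_subset)
      then show ?thesis by (intro vector_derivative_unique_within_closed_interval[of t "t+1" t "T \<zeta>"]) auto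
    qed
    \<comment> \<open>The image under \<open>T'\<close> is bounded only almost everywhere;
      continuity of \<open>D\<close> makes the bound on the derivative pointwise.\<close>
    have Db: "norm (D t) \<le> L" if "t \<ge> 0" for t
    proof (rule AE_lebesgue_on_continuous_le[where a=0 and b="t+1" and f="\<lambda>t. norm (D t)"])
      show "AE x in lebesgue_on {0..t + 1}. norm (D x) \<le> L"
        using c'2[THEN spec, THEN spec, THEN mp, THEN mp, OF \<zeta>, of "t+1"] AE_space
      proof eventually_elim
        case (elim x)
        then have x: "x \<ge> 0" by (simp add: space_restrict_space)
        have "norm (\<zeta> x) \<le> B" using \<zeta>(2) x h by auto
        then show ?case using L[of "\<zeta> x" "T' \<zeta> x"] elim(1) by (simp add: Dz[OF x])
      qed
      show "continuous_on {0..t+1} (\<lambda>t. norm (D t))"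
        by (intro continuous_intros continuous_on_subset[OF D]) auto
    qed (use that in auto)
    have "norm (T \<zeta> t - T \<zeta> s) \<le> \<bar>L\<bar> * \<bar>t - s\<bar>" if "s \<ge> 0" "t \<ge> 0" for s t
    proof -
      have "norm (T \<zeta> t - T \<zeta> s) \<le> \<bar>L\<bar> * norm (t - s)"
      proof (rule differentiable_bound[of "{0..}" "T \<zeta>" "\<lambda>x h. h *\<^sub>R D x"])
        show "(T \<zeta> has_derivative (\<lambda>h. h *\<^sub>R D x)) (at x within {0..})" if "x \<in> {0..}" for x
          using D2 that by (simp add: has_vector_derivative_def)
        show "onorm (\<lambda>h. h *\<^sub>R D x) \<le> \<bar>L\<bar>" if "x \<in> {0..}" for x
          using order_trans[OF Db[of x] abs_ge_self] that by (intro onorm_bound) (auto simp: mult.commute intro!: mult_left_mono)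
      qed (use that in auto)
      then show ?thesis by simp
    qed
    then show ?thesis using bd by blast
  qed
  show ?thesis
  proof (rule exI[of _ c], rule conjI, use c in simp, rule exI[of _ "\<bar>L\<bar>"], rule conjI, simp, intro conjI allI impI)
    fix \<zeta> :: "real \<Rightarrow> 'a" assume \<zeta>: "continuous_on {-h..} \<zeta>" "\<forall>t\<ge>-h. norm (\<zeta> t) \<le> B"
    show "norm (T \<zeta> t) \<le> c" if "0 \<le> t" for t using main[OF \<zeta>] that by simp
    show "norm (T \<zeta> t - T \<zeta> s) \<le> \<bar>L\<bar> * \<bar>t - s\<bar>" if "0 \<le> s" "0 \<le> t" for s t using main[OF \<zeta>] that by simp
  qed
qed

section \<open>Bounds for signals in the funnel\<close>

lemma finite_min_eps:
  fixes Q :: "'k \<Rightarrow> real \<Rightarrow> bool"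
  assumes "finite F" "\<And>k. k \<in> F \<Longrightarrow> \<exists>\<epsilon>>0. Q k \<epsilon>" "\<And>k \<epsilon> \<epsilon>'. Q k \<epsilon> \<Longrightarrow> 0 < \<epsilon>' \<Longrightarrow> \<epsilon>' \<le> \<epsilon> \<Longrightarrow> Q k \<epsilon>'"
  shows "\<exists>\<epsilon>>0. \<forall>k\<in>F. Q k \<epsilon>"
proof -
  have "\<forall>k\<in>F. \<exists>\<epsilon>. \<epsilon> > 0 \<and> Q k \<epsilon>" using assms(2) by blast
  then obtain f where f: "\<forall>k\<in>F. f k > 0 \<and> Q k (f k)" by (rule bchoice[THEN exE])
  define m where "m = Min (insert 1 (f ` F))"
  have fin: "finite (insert 1 (f ` F))" using assms(1) by simp
  have m: "m > 0" unfolding m_def using f fin by (subst Min_gr_iff) auto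
  have "Q k m" if "k \<in> F" for k
  proof (rule assms(3)[OF _ m])
    show "Q k (f k)" using f that by simp
    show "m \<le> f k" unfolding m_def using fin that by (intro Min_le) auto
  qed
  then show ?thesis using m by (intro exI[of _ m]) simp
qed

text \<open>Where \<open>\<phi>\<close> is bounded below, the funnel bounds the error; near 0, where
  the funnel may be infinitely wide, continuity does.\<close>

lemma funnel_error_bounded:
  fixes e :: "real \<Rightarrow> 'a::real_normed_vector"
  assumes w: "0 < w" and Phi: "\<phi> \<in> Phi n" "n \<ge> 1" and ce: "continuous_on (tdom 0 w) e"
    and lt: "\<And>t. t \<in> tdom 0 w \<Longrightarrow> (\<phi> t)\<^sup>2 * (norm (e t))\<^sup>2 < 1"
  shows "\<exists>B\<ge>0. \<forall>t\<in>tdom 0 w. norm (e t) \<le> B"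
proof -
  obtain \<delta> where \<delta>: "0 < \<delta>" "ereal \<delta> < w" using ereal_less_obtain[of 0 w] w by (auto simp: zero_ereal_def)
  obtain m where m: "m > 0" "\<And>t. t \<ge> \<delta> \<Longrightarrow> \<phi> t \<ge> m" using Phi_props(6)[OF Phi \<delta>(1)] by auto
  have "{0..\<delta>} \<subseteq> tdom 0 w" by (rule tdom_Icc[OF \<delta>(2)])
  then have "compact (e ` {0..\<delta>})" using ce by (intro compact_continuous_image) (auto intro: continuous_on_subset)
  then have "bounded (e ` {0..\<delta>})" by (rule compact_imp_bounded)
  then obtain B where B: "\<forall>x\<in>e ` {0..\<delta>}. norm x \<le> B" unfolding bounded_iff by blast
  have "norm (e t) \<le> max B (1 / m)" if t: "t \<in> tdom 0 w" for t
  proof (cases "t \<le> \<delta>")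
    case True
    then show ?thesis using B t by (auto simp: tdom_def le_max_iff_disj)
  next
    case False
    then have p: "\<phi> t \<ge> m" using m by simp
    have "(\<phi> t * norm (e t))\<^sup>2 < 1\<^sup>2" using lt[OF t] by (simp add: power_mult_distrib)
    then have "\<phi> t * norm (e t) < 1" by (rule power2_less_imp_less) simp
    then have "m * norm (e t) < 1" using mult_right_mono[OF p norm_ge_zero, of "e t"] by linarith
    then have "norm (e t) \<le> 1 / m" using m(1) by (simp add: field_simps)
    then show ?thesis by simp
  qed
  then show ?thesis by (intro exI[of _ "max (max B (1 / m)) 0"]) (auto simp: le_max_iff_disj)
qed

lemma Winf_ubl:
  assumes "Winf 1 f" shows "ubl A {0..} (\<lambda>v. f)" "continuous_on {0..} f"
proof -
  have "(1::nat) \<ge> 1" by simp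
  from Winf_rep[OF assms this] obtain G where G': "G 0 = f \<and> (\<forall>j<1. \<forall>b\<ge>0. acb 0 b (G j) (G (Suc j))) \<and>
    (\<forall>j<1. continuous_on {0..} (G j) \<and> bounded (G j ` {0..})) \<and> (\<exists>M\<ge>0. \<forall>b. ebd M 0 b (G 1))"
    by (elim exE)
  then have G: "G 0 = f" "\<And>b. b \<ge> 0 \<Longrightarrow> acb 0 b (G 0) (G 1)" "continuous_on {0..} (G 0)" "bounded (G 0 ` {0..})"
    by auto
  obtain M where M: "\<And>b. ebd M 0 b (G 1)" using G' by auto
  show "continuous_on {0..} f" using G by simp
  obtain B where B: "\<forall>x\<in>f ` {0..}. norm x \<le> B" using G(1,4) by (auto simp: bounded_iff)
  show "ubl A {0..} (\<lambda>v. f)"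
  proof (rule ublI)
    show "norm (f t) \<le> B" if "t \<in> {0..}" for t using B that by auto
    show "norm (f t - f s) \<le> M * \<bar>t - s\<bar>" if "s \<in> {0..}" "t \<in> {0..}" for s t
      using acb_lip_ebd[OF G(2) M, of "max s t" s t] that G(1) by auto
  qed
qed

lemma Phi_ubl:
  assumes "\<phi> \<in> Phi n" "l < n" shows "ubl A {0..} (\<lambda>v. nderiv 0 l \<phi>)"
proof -
  have n: "n \<ge> 1" using assms(2) by simp
  obtain B where B: "\<And>t. t \<ge> 0 \<Longrightarrow> \<bar>nderiv 0 l \<phi> t\<bar> \<le> B" using Phi_props(3)[OF assms(1) n, of l] assms(2) by auto
  obtain L where L: "\<And>t. t \<ge> 0 \<Longrightarrow> \<bar>nderiv 0 (Suc l) \<phi> t\<bar> \<le> L" using Phi_props(3)[OF assms(1) n, of "Suc l"] assms(2) by auto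
  show ?thesis
  proof (rule ublI)
    show "norm (nderiv 0 l \<phi> t) \<le> B" if "t \<in> {0..}" for t using B that by auto
    show "norm (nderiv 0 l \<phi> t - nderiv 0 l \<phi> s) \<le> L * \<bar>t - s\<bar>" if "s \<in> {0..}" "t \<in> {0..}" for s t
    proof -
      have "norm (nderiv 0 l \<phi> t - nderiv 0 l \<phi> s) \<le> L * norm (t - s)"
      proof (rule field_differentiable_bound[of "{0..}" "nderiv 0 l \<phi>" "nderiv 0 (Suc l) \<phi>"])
        show "(nderiv 0 l \<phi> has_field_derivative nderiv 0 (Suc l) \<phi> z) (at z within {0..})" if "z \<in> {0..}" for z
          using Phi_props(1)[OF assms(1) n assms(2), of z] that by simp
        show "norm (nderiv 0 (Suc l) \<phi> z) \<le> L" if "z \<in> {0..}" for z using L[of z] that by simp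
      qed (use that in auto)
      then show ?thesis by simp
    qed
  qed
qed

lemma dominated_convergence_AE:
  fixes f :: "nat \<Rightarrow> real \<Rightarrow> 'b::euclidean_space"
  assumes "\<And>n. f n integrable_on {a..b}" "\<And>n. AE t in lebesgue_on {a..b}. norm (f n t) \<le> M"
    and "AE t in lebesgue_on {a..b}. (\<lambda>n. f n t) \<longlonglongrightarrow> g t"
  shows "(\<lambda>n. integral {a..b} (f n)) \<longlonglongrightarrow> integral {a..b} g"
proof -
  define N where "N = {t\<in>{a..b}. \<not> ((\<forall>n. norm (f n t) \<le> M) \<and> (\<lambda>n. f n t) \<longlonglongrightarrow> g t)}"
  have "AE t in lebesgue_on {a..b}. (\<forall>n. norm (f n t) \<le> M) \<and> (\<lambda>n. f n t) \<longlonglongrightarrow> g t"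
    using assms(2,3) by (auto simp: AE_all_countable)
  then have N: "negligible N" unfolding N_def by (subst (asm) AE_lebesgue_on_iff_negligible) auto
  define f' where "f' n t = (if t \<in> N then 0 else f n t)" for n t
  define g' where "g' t = (if t \<in> N then 0 else g t)" for t
  have "(\<lambda>n. integral {a..b} (f' n)) \<longlonglongrightarrow> integral {a..b} g'"
  proof (rule dominated_convergence(2)[where h="\<lambda>_. \<bar>M\<bar>"])
    show "f' n integrable_on {a..b}" for n
      by (rule integrable_spike[OF assms(1)[of n] N]) (auto simp: f'_def)
    show "norm (f' n x) \<le> \<bar>M\<bar>" if "x \<in> {a..b}" for n x
    proof (cases "x \<in> N")
      case False
      then have "norm (f n x) \<le> M" using that by (auto simp: N_def)
      then show ?thesis using False by (simp add: f'_def)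
    qed (simp add: f'_def)
    show "(\<lambda>n. f' n x) \<longlonglongrightarrow> g' x" if "x \<in> {a..b}" for x
      using that by (cases "x \<in> N") (auto simp: f'_def g'_def N_def)
  qed (rule integrable_const_ivl)
  moreover have "integral {a..b} (f' n) = integral {a..b} (f n)" for n
    by (rule integral_spike[OF N]) (auto simp: f'_def)
  moreover have "integral {a..b} g' = integral {a..b} g"
    by (rule integral_spike[OF N]) (auto simp: g'_def)
  ultimately show ?thesis by simp
qed

text \<open>Let \<open>w = \<phi>\<^sup>2 * (norm e)\<^sup>2\<close>. The feedback equation gives
  \<open>a * norm e = norm V * (1 - w)\<close>. If \<open>w\<close> exceeds 1/2, then
  \<open>norm e\<close> is at least \<open>1 / (2 * F)\<close>, which bounds \<open>1 - w\<close>
  from below.\<close>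

lemma Pm_gain_bounded:
  assumes "e = Pm \<phi> a V" "0 < a0" "a0 \<le> a" "norm V \<le> B" "\<bar>\<phi>\<bar> \<le> F" "B > 0" "F > 0"
  shows "\<phi>\<^sup>2 * (norm e)\<^sup>2 \<le> 1 - min (1/2) (a0 / (2 * F * B))"
proof -
  define w where "w = \<phi>\<^sup>2 * (norm e)\<^sup>2"
  have e: "w < 1" "(a / (1 - w)) *\<^sub>R e = V" using iffD1[OF Pm_iff assms(1)] assms(2,3) by (auto simp: w_def)
  show ?thesis
  proof (cases "w \<le> 1/2")
    case True then show ?thesis by (simp add: w_def[symmetric] min_def)
  next
    case False
    have wf: "w = (\<bar>\<phi>\<bar> * norm e)\<^sup>2" by (simp add: w_def power_mult_distrib)
    have "(1/2)\<^sup>2 \<le> (\<bar>\<phi>\<bar> * norm e)\<^sup>2" using False wf by (simp add: power2_eq_square)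
    then have "1/2 \<le> \<bar>\<phi>\<bar> * norm e" by (rule power2_le_imp_le) simp
    also have "\<dots> \<le> F * norm e" using assms(5) by (intro mult_right_mono) auto
    finally have ne: "1 / (2 * F) \<le> norm e" using assms(7) by (simp add: field_simps)
    have "a * norm e / (1 - w) = norm V" using e assms(2,3) by auto
    then have "a * norm e = norm V * (1 - w)" using e(1) by (simp add: field_simps)
    also have "\<dots> \<le> B * (1 - w)" using assms(4) e(1) by (intro mult_right_mono) auto
    finally have "a * norm e \<le> B * (1 - w)" .
    moreover have "a0 * (1 / (2 * F)) \<le> a * norm e" using ne assms(2,3,7) by (intro mult_mono) auto
    ultimately have "a0 * (1 / (2 * F)) \<le> B * (1 - w)" by linarith
    then have "a0 / (2 * F * B) \<le> 1 - w" using assms(6,7) by (simp add: field_simps)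
    then show ?thesis by (simp add: w_def[symmetric] min_le_iff_disj)
  qed
qed

lemma ubl_boundD: "ubl A I f \<Longrightarrow> \<exists>B\<ge>0. \<forall>v\<in>A. \<forall>t\<in>I. norm (f v t) \<le> B"
  and ubl_lipD: "ubl A I f \<Longrightarrow> \<exists>L\<ge>0. \<forall>v\<in>A. \<forall>s\<in>I. \<forall>t\<in>I. norm (f v t - f v s) \<le> L * \<bar>t - s\<bar>"
  by (simp_all add: ubl_def)

section \<open>The closed loop in error coordinates\<close>

text \<open>\<open>yr i j\<close> represents the \<open>j\<close>-th derivative of the
  \<open>i\<close>-th reference component: continuous for \<open>j < ord S i\<close>, essentially
  bounded for \<open>j = ord S i\<close>. It is a parameter because \<open>Winf\<close> only asserts
  the existence of such a chain.\<close>

locale fdae_loop =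
  fixes S :: "('m::finite, 's::finite, 'k::finite, 'n::finite) fdae"
    and C :: "'m funnel_controller" and \<alpha> :: real
    and y0 :: "'m \<Rightarrow> nat \<Rightarrow> real \<Rightarrow> real"
    and yr :: "'m \<Rightarrow> nat \<Rightarrow> real \<Rightarrow> real"
  assumes fmt: "fdae_format S"
    and A1: "assmA1 S" and A2: "assmA2 S" and A3: "assmA3 S" and A4: "assmA4 S \<alpha>" and A5: "assmA5 S"
    and phiI: "phiI C \<in> Phi 1" and phiII: "phiII C \<in> Phi 1"
    and phi: "\<And>i j. i \<in> idxI S \<Longrightarrow> j + 2 \<le> rdeg S i \<Longrightarrow> phi C i j \<in> Phi (rdeg S i - j)"
    and khat_pos: "khat C > 0"
    and khat: "khat C > inverse \<alpha> * (SUP Z. jac2_norm S Z)"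
    and init: "initial_data S y0" and consis: "consistent S C y0"
    and inI: "phiI C 0 * norm (errI S C (init_poly S y0) 0) < 1"
    and inII: "phiII C 0 * norm (errII S C (init_poly S y0) 0) < 1"
    and inj: "\<And>i j. i \<in> idxI S \<Longrightarrow> j + 2 \<le> rdeg S i \<Longrightarrow> phi C i j 0 * \<bar>err C (init_poly S y0) i j 0\<bar> < 1"
    and yr_0: "\<And>i t. yr i 0 t = yref C t $ i"
    and yr_acb: "\<And>i j b. j < ord S i \<Longrightarrow> b \<ge> 0 \<Longrightarrow> acb 0 b (yr i j) (yr i (Suc j))"
    and yr_cont: "\<And>i j. j < ord S i \<Longrightarrow> continuous_on {0..} (yr i j)"
    and yr_bdd: "\<And>i j. j < ord S i \<Longrightarrow> bounded (yr i j ` {0..})"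
    and yr_top: "\<And>i. \<exists>M\<ge>0. \<forall>b. ebd M 0 b (yr i (ord S i))"
begin

abbreviation "h \<equiv> delay S"
abbreviation "II \<equiv> idxI S"
abbreviation "r \<equiv> rdeg S"

lemma h_nonneg: "h \<ge> 0" and r_pos: "i \<in> II \<Longrightarrow> r i \<ge> 1" and pos_bij: "bij_betw (pos S) (Yidx S) UNIV"
  using fmt by (auto simp: fdae_format_def)

lemma ord_I [simp]: "i \<in> II \<Longrightarrow> ord S i = r i" and ord_II [simp]: "i \<notin> II \<Longrightarrow> ord S i = 1"
  by (auto simp: ord_def)

lemma ord_pos: "ord S i \<ge> 1"
  using r_pos by (cases "i \<in> II") auto

definition st :: "real ^ 'n \<Rightarrow> 'm \<Rightarrow> nat \<Rightarrow> real" where "st x i j = x $ pos S (i, j)"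

definition ci :: "'n \<Rightarrow> 'm" where "ci n = fst (inv_into (Yidx S) (pos S) n)"
definition cj :: "'n \<Rightarrow> nat" where "cj n = snd (inv_into (Yidx S) (pos S) n)"

lemma cj_less: "cj n < ord S (ci n)"
proof -
  have "inv_into (Yidx S) (pos S) n \<in> Yidx S"
    using pos_bij by (intro inv_into_into) (auto simp: bij_betw_def)
  then show ?thesis by (auto simp: Yidx_def ci_def cj_def)
qed

lemma pos_cij: "pos S (ci n, cj n) = n"
  using f_inv_into_f[of n "pos S" "Yidx S"] pos_bij by (auto simp: bij_betw_def ci_def cj_def)

lemma cij_pos: "j < ord S i \<Longrightarrow> ci (pos S (i, j)) = i \<and> cj (pos S (i, j)) = j"
  using pos_bij by (auto simp: bij_betw_def ci_def cj_def Yidx_def inv_into_f_f)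

lemma Yvec_nth: "Yvec S v $ n = v (ci n) (cj n)"
  by (simp add: Yvec_def ci_def cj_def case_prod_beta)

lemma st_Yvec [simp]: "j < ord S i \<Longrightarrow> st (Yvec S v) i j = v i j"
  by (simp add: st_def Yvec_nth cij_pos)

lemma nth_st: "x $ n = st x (ci n) (cj n)"
  by (simp add: st_def pos_cij)

lemma st_eqI: "(\<And>i j. j < ord S i \<Longrightarrow> st x i j = st y i j) \<Longrightarrow> x = y"
  by (simp add: vec_eq_iff nth_st cj_less)

lemma st_linear: "bounded_linear (\<lambda>x. st x i j)"
  unfolding st_def by (rule bounded_linear_vec_nth)

lemma st_add [simp]: "st (x + y) i j = st x i j + st y i j"
  and st_diff [simp]: "st (x - y) i j = st x i j - st y i j"
  and st_zero [simp]: "st 0 i j = 0"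
  by (simp_all add: st_def)

lemma st_le_norm: "\<bar>st x i j\<bar> \<le> norm x"
  unfolding st_def using component_le_norm_cart[of x] by simp

lemma Yvec_cong: "(\<And>i j. j < ord S i \<Longrightarrow> v i j = w i j) \<Longrightarrow> Yvec S v = Yvec S w"
  by (intro st_eqI) simp

lemma continuous_on_Yvec:
  assumes "\<And>i j. j < ord S i \<Longrightarrow> continuous_on A (\<lambda>z. v z i j)"
  shows "continuous_on A (\<lambda>z. Yvec S (v z))"
proof -
  have "continuous_on A (\<lambda>z. \<chi> n. v z (ci n) (cj n))" by (intro continuous_on_vec_lambda assms cj_less)
  moreover have "(\<chi> n. v z (ci n) (cj n)) = Yvec S (v z)" for z by (simp add: vec_eq_iff Yvec_nth)
  ultimately show ?thesis by simp
qed

lemma ubl_Yvec: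
  assumes "\<And>i j. j < ord S i \<Longrightarrow> ubl A I (\<lambda>v t. f v t i j)"
  shows "ubl A I (\<lambda>v t. Yvec S (f v t))"
proof -
  have "ubl A I (\<lambda>v t. \<chi> n. f v t (ci n) (cj n))" by (intro ubl_vec_lambda assms cj_less)
  moreover have "(\<chi> n. f v t (ci n) (cj n)) = Yvec S (f v t)" for v t by (simp add: vec_eq_iff Yvec_nth)
  ultimately show ?thesis by simp
qed

text \<open>The argument order makes \<open>ph i t\<close> an environment for \<open>ev\<close>,
  with the errors supplied by \<open>st x i\<close>.\<close>

definition ph :: "'m \<Rightarrow> real \<Rightarrow> nat \<Rightarrow> nat \<Rightarrow> real" where "ph i t j l = nderiv 0 l (phi C i j) t"

definition EIx :: "real ^ 'n \<Rightarrow> real ^ 'm" where "EIx x = (\<chi> i. if i \<in> II then st x i (r i - 1) else 0)"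
definition EIIx :: "real ^ 'n \<Rightarrow> real ^ 'm" where "EIIx x = (\<chi> i. if i \<in> II then 0 else st x i 0)"
definition PI :: "real ^ 'n \<Rightarrow> real ^ 'n" where "PI x = Yvec S (\<lambda>i j. if i \<in> II then st x i j else 0)"
definition emb :: "real ^ 'm \<Rightarrow> real ^ 'n" where "emb e = Yvec S (\<lambda>i j. if i \<in> II then 0 else e $ i)"
definition out :: "real ^ 'n \<Rightarrow> real ^ 'm" where "out Z = (\<chi> i. st Z i 0)"

lemma linear_maps: "bounded_linear EIx" "bounded_linear EIIx" "bounded_linear PI" "bounded_linear emb" "bounded_linear out"
  unfolding linear_conv_bounded_linear[symmetric]
  by (auto intro!: linearI simp: EIx_def EIIx_def PI_def emb_def out_def vec_eq_iff Yvec_nth st_def)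

text \<open>This splits the state into the part governed by the differential equation and the part
  determined by the algebraic one.\<close>

lemma PI_plus_emb: "PI x + emb (EIIx x) = x"
proof (rule st_eqI)
  fix i j assume j: "j < ord S i"
  then show "st (PI x + emb (EIIx x)) i j = st x i j"
    by (cases "i \<in> II") (auto simp: PI_def emb_def EIIx_def)
qed

lemma EII_emb: "e \<in> coords (- II) \<Longrightarrow> EIIx (emb e) = e"
  by (auto simp: vec_eq_iff EIIx_def emb_def coords_def ord_pos[unfolded Suc_le_eq One_nat_def])

lemma EI_coords: "EIx x \<in> coords II"
  by (auto simp: EIx_def coords_def)

lemma EI_PI: "EIx (PI x) = EIx x"
proof -
  have "st (PI x) i (r i - 1) = st x i (r i - 1)" if "i \<in> II" for i
    using r_pos[OF that] that unfolding PI_def by (subst st_Yvec) auto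
  then show ?thesis by (simp add: vec_eq_iff EIx_def)
qed

lemma PI_PI [simp]: "PI (PI x) = PI x"
  by (rule st_eqI) (auto simp: PI_def)

lemma PI_emb [simp]: "PI (emb e) = 0"
  by (rule st_eqI) (auto simp: PI_def emb_def)

lemma EII_PI [simp]: "EIIx (PI x) = 0"
  by (auto simp: vec_eq_iff EIIx_def PI_def ord_pos[unfolded Suc_le_eq One_nat_def])

lemma st_PI: "i \<in> II \<Longrightarrow> j < r i \<Longrightarrow> st (PI x) i j = st x i j"
  by (simp add: PI_def)

lemma norm_emb_le: "norm (emb e) \<le> norm e"
proof -
  have "(norm (emb e))\<^sup>2 = (\<Sum>n\<in>UNIV. (emb e $ n)\<^sup>2)"
    by (simp add: norm_vec_def L2_set_def sum_nonneg)
  also have "\<dots> = (\<Sum>n\<in>(\<lambda>i. pos S (i, 0)) ` (- II). (emb e $ n)\<^sup>2)"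
  proof (rule sum.mono_neutral_right)
    show "\<forall>n\<in>UNIV - (\<lambda>i. pos S (i, 0)) ` (- II). (emb e $ n)\<^sup>2 = 0"
    proof
      fix n assume n: "n \<in> UNIV - (\<lambda>i. pos S (i, 0)) ` (- II)"
      have "ci n \<in> II"
      proof (rule ccontr)
        assume "ci n \<notin> II"
        then have "cj n = 0" using cj_less[of n] by simp
        then have "n = pos S (ci n, 0)" using pos_cij[of n] by simp
        then show False using n \<open>ci n \<notin> II\<close> by blast
      qed
      then show "(emb e $ n)\<^sup>2 = 0" by (simp add: emb_def Yvec_nth)
    qed
  qed auto
  also have "\<dots> = (\<Sum>i\<in>-II. (e $ i)\<^sup>2)"
  proof (subst sum.reindex)
    show "inj_on (\<lambda>i. pos S (i, 0)) (- II)"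
      by (rule inj_onI) (metis Compl_iff cij_pos less_one ord_II)
    show "sum ((\<lambda>n. (emb e $ n)\<^sup>2) \<circ> (\<lambda>i. pos S (i, 0))) (- II) = (\<Sum>i\<in>-II. (e $ i)\<^sup>2)"
      by (rule sum.cong) (auto simp: emb_def Yvec_nth cij_pos)
  qed
  also have "\<dots> \<le> (\<Sum>i\<in>UNIV. (e $ i)\<^sup>2)" by (rule sum_mono2) auto
  also have "\<dots> = (norm e)\<^sup>2" by (simp add: norm_vec_def L2_set_def sum_nonneg)
  finally show ?thesis by (rule power2_le_imp_le) simp
qed

lemma norm_split: "norm x \<le> norm (PI x) + norm (EIIx x)"
proof -
  have "norm x \<le> norm (PI x) + norm (emb (EIIx x))" using norm_triangle_ineq[of "PI x" "emb (EIIx x)"] PI_plus_emb by simp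
  then show ?thesis using norm_emb_le[of "EIIx x"] by linarith
qed

text \<open>Identifies the matrix in the condition on the gain with the embedding of the second
  block, so that \<open>jac2_norm\<close> becomes the operator norm of the derivative of
  \<open>f2\<close> along \<open>emb\<close>.\<close>

lemma emb_lastcols: "emb e = lastcols S *v e"
proof (rule st_eqI)
  fix i j assume j: "j < ord S i"
  have comp: "st (lastcols S *v e) i j = (\<Sum>k\<in>UNIV. (if k \<notin> II \<and> pos S (i, j) = pos S (k, 0) then 1 else 0) * e $ k)"
    unfolding st_def matrix_vector_mult_def lastcols_def by simp
  have eq: "pos S (i, j) = pos S (k, 0) \<longleftrightarrow> k = i \<and> j = 0" if "k \<notin> II" for k
  proof
    assume "pos S (i, j) = pos S (k, 0)"
    moreover have "ci (pos S (k, 0)) = k \<and> cj (pos S (k, 0)) = 0" using that by (intro cij_pos) simp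
    ultimately show "k = i \<and> j = 0" using cij_pos[OF j] by metis
  qed auto
  have "(if k \<notin> II \<and> pos S (i, j) = pos S (k, 0) then 1 else 0) * e $ k = (if k = i then (if i \<in> II then 0 else e $ i) else 0)" for k
    using eq[of k] j by (cases "k \<in> II") auto
  then have "st (lastcols S *v e) i j = (if i \<in> II then 0 else e $ i)" unfolding comp by simp
  then show "st (emb e) i j = st (lastcols S *v e) i j" using j by (simp add: emb_def)
qed

text \<open>The state \<open>x\<close> consists of the errors \<open>e\<^sub>i\<^sub>j\<close>; \<open>Yf t x\<close> is the corresponding vector \<open>Y(t)\<close>.\<close>

definition Yf :: "real \<Rightarrow> real ^ 'n \<Rightarrow> real ^ 'n" where
  "Yf t x = Yvec S (\<lambda>i j. yr i j t + st x i j - ev (ph i t) (st x i) (Rx j))"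

definition UI :: "real \<Rightarrow> real ^ 'n \<Rightarrow> real ^ 'm" where
  "UI t x = - ((1 / (1 - (phiI C t)\<^sup>2 * (norm (EIx x))\<^sup>2)) *\<^sub>R EIx x)"

definition good :: "real \<Rightarrow> real ^ 'n \<Rightarrow> bool" where
  "good t x \<longleftrightarrow> (\<forall>i\<in>II. \<forall>j. j + 2 \<le> r i \<longrightarrow> (phi C i j t)\<^sup>2 * (st x i j)\<^sup>2 < 1) \<and> (phiI C t)\<^sup>2 * (norm (EIx x))\<^sup>2 < 1"

text \<open>Concerns the gains \<open>k\<^sub>i\<^sub>j\<close> alone: in the a priori estimates
  they are bounded first, and with them already \<open>Y\<close>.\<close>

definition goodR :: "real \<Rightarrow> real \<Rightarrow> real ^ 'n \<Rightarrow> bool" where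
  "goodR \<epsilon> t x \<longleftrightarrow> (\<forall>i\<in>II. \<forall>j. j + 2 \<le> r i \<longrightarrow> (phi C i j t)\<^sup>2 * (st x i j)\<^sup>2 \<le> 1 - \<epsilon>)"

definition goodeps :: "real \<Rightarrow> real \<Rightarrow> real ^ 'n \<Rightarrow> bool" where
  "goodeps \<epsilon> t x \<longleftrightarrow> goodR \<epsilon> t x \<and> (phiI C t)\<^sup>2 * (norm (EIx x))\<^sup>2 \<le> 1 - \<epsilon>"

lemma goodeps_good: "\<epsilon> > 0 \<Longrightarrow> goodeps \<epsilon> t x \<Longrightarrow> good t x"
  by (force simp: goodeps_def goodR_def good_def)

text \<open>Right-hand side for the first block: the chain relation for all errors but the last, and
  for the last one the system equation minus the top derivative of the reference plus the derivative
  of \<open>Rx\<close>. The zero entries for the second block make it invariant under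
  \<open>PI\<close>.\<close>

definition gf :: "real \<Rightarrow> real ^ 'n \<Rightarrow> real ^ 'k \<Rightarrow> real ^ 'n" where
  "gf t x \<eta> = Yvec S (\<lambda>i j. if i \<in> II then
     (if Suc j < r i then ev (ph i t) (st x i) (dEE j)
      else (f1 S (d1 S t, \<eta>) + GammaI S (d2 S t, \<eta>) *v UI t x) $ i - yr i (r i) t + ev (ph i t) (st x i) (dex (Rx j)))
     else 0)"

text \<open>The algebraic equation solved for the error in the feedback term, with effective gain
  constant \<open>khat C * f4\<close>. It remains implicit: \<open>Yf t x\<close> still contains the
  second block of \<open>x\<close>.\<close>

definition eIIf :: "real \<Rightarrow> real ^ 'n \<Rightarrow> real ^ 'k \<Rightarrow> real ^ 'm" where
  "eIIf t x \<eta> = Pm (phiII C t) (khat C * f4 S (d5 S t, \<eta>))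
     (f2 S (Yf t x) + f3 S (d3 S t, \<eta>) + GammaII S (d4 S t, \<eta>) *v UI t x)"

lemma \<alpha>_pos: "\<alpha> > 0" and f4_ge: "f4 S p \<ge> \<alpha>" and f4_C1: "C1 (f4 S)"
  using A4 unfolding assmA4_def by blast+

lemma C1s: "C1 (f2 S)" "C1 (f3 S)" "C1 (GammaII S)" and f1_cont: "continuous_on UNIV (f1 S)"
  and GI_cont: "continuous_on UNIV (GammaI S)"
  using A1 A3 by (auto simp: assmA1_def assmA3_def)

lemma kf4_pos: "khat C * f4 S p > 0" and kf4_ge: "khat C * f4 S p \<ge> khat C * \<alpha>" and k\<alpha>: "khat C * \<alpha> > 0"
  using khat_pos \<alpha>_pos f4_ge[of p] by (auto intro: mult_left_mono mult_pos_pos less_le_trans)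

lemma d_Winf: "Winf 1 (d3 S)" "Winf 1 (d4 S)" "Winf 1 (d5 S)"
  using A2 by (auto simp: assmA2_def)

lemma d_Linf: "Linf (d1 S)" "Linf (d2 S)"
  using A2 by (auto simp: assmA2_def)

lemma phi_cont:
  assumes "i \<in> II" "j + 2 \<le> r i" "j + l \<le> r i"
  shows "continuous_on {0..} (\<lambda>t. ph i t j l)"
  unfolding ph_def using assms by (intro Phi_props(2)[OF phi[OF assms(1,2)]]) auto

lemma phi_deriv:
  assumes "i \<in> II" "j + 2 \<le> r i" "j + l < r i" "t \<ge> 0"
  shows "((\<lambda>t. ph i t j l) has_real_derivative ph i t j (Suc l)) (at t within {0..})"
  unfolding ph_def using assms Phi_props(1)[OF phi[OF assms(1,2)], of l t] by auto

lemma phi_ubl: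
  assumes "i \<in> II" "j + 2 \<le> r i" "j + l < r i" "J \<subseteq> {0..}"
  shows "ubl A J (\<lambda>v t. ph i t j l)"
proof -
  have "ubl A {0..} (\<lambda>v t. ph i t j l)"
    unfolding ph_def using assms by (intro Phi_ubl[OF phi[OF assms(1,2)], unfolded eta_contract_eq]) auto
  then show ?thesis using ubl_reindex[of A "{0..}" "\<lambda>v t. ph i t j l" A "\<lambda>x. x" J] assms(4) by simp
qed

lemma phi_bdd:
  assumes "i \<in> II" "j + 2 \<le> r i" "j + l \<le> r i"
  shows "\<exists>B. \<forall>t\<ge>0. \<bar>ph i t j l\<bar> \<le> B"
proof -
  have "r i - j \<ge> 1" "l \<le> r i - j" using assms by auto
  from Phi_props(3)[OF phi[OF assms(1,2)] this] show ?thesis unfolding ph_def by blast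
qed

lemma phiI_cont: "continuous_on {0..} (phiI C)" "continuous_on {0..} (phiII C)"
  using Phi_props(2)[OF phiI, of 0] Phi_props(2)[OF phiII, of 0] by simp_all

lemma phiI_ubl: "ubl A {0..} (\<lambda>v. phiI C)" "ubl A {0..} (\<lambda>v. phiII C)"
  using Phi_ubl[OF phiI, of 0] Phi_ubl[OF phiII, of 0] by simp_all

lemma yr_ubl:
  assumes "j < ord S i" shows "ubl A {0..} (\<lambda>v t. yr i j t)"
proof -
  obtain B where B: "\<forall>x\<in>yr i j ` {0..}. norm x \<le> B" using yr_bdd[OF assms] unfolding bounded_iff by blast
  obtain M where M: "\<And>b. ebd M 0 b (yr i (Suc j))"
  proof (cases "Suc j < ord S i")
    case True
    obtain B' where B': "\<forall>x\<in>yr i (Suc j) ` {0..}. norm x \<le> B'" using yr_bdd[OF True] unfolding bounded_iff by blast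
    have "ebd B' 0 b (yr i (Suc j))" for b
      unfolding ebd_def
    proof
      show "yr i (Suc j) \<in> borel_measurable (lebesgue_on {0..b})"
        using yr_cont[OF True] by (intro continuous_imp_measurable_on_sets_lebesgue) (auto intro: continuous_on_subset)
      show "AE t in lebesgue_on {0..b}. norm (yr i (Suc j) t) \<le> B'"
        using B' by (intro AE_I2) (auto simp: space_restrict_space)
    qed
    then show ?thesis using that by blast
  next
    case False
    then have "Suc j = ord S i" using assms by simp
    then show ?thesis using yr_top[of i] that by auto
  qed
  show ?thesis
  proof (rule ublI)
    show "norm (yr i j t) \<le> B" if "t \<in> {0..}" for t using B that by auto
    show "norm (yr i j t - yr i j s) \<le> M * \<bar>t - s\<bar>" if "s \<in> {0..}" "t \<in> {0..}" for s t
      using acb_lip_ebd[OF yr_acb[OF assms] M, of "max s t" s t] that by auto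
  qed
qed

text \<open>The arbitrary parameter space covers continuity in the state (\<open>a\<close>
  constant), along a path (\<open>b\<close> a function of time) and in both variables.\<close>

lemma ev_good_continuous:
  fixes a :: "'z::topological_space \<Rightarrow> real"
  assumes i: "i \<in> II" and wf: "wfx n m x" "n \<le> r i" "m \<le> r i - 1"
    and a: "continuous_on D a" "continuous_on D b" "\<And>z. z \<in> D \<Longrightarrow> 0 \<le> a z \<and> good (a z) (b z)"
  shows "continuous_on D (\<lambda>z. ev (ph i (a z)) (st (b z) i) x)"
proof (rule ev_continuous[OF wf(1)])
  show "continuous_on D (\<lambda>z. st (b z) i j)" for j
    by (rule bounded_linear.continuous_on[OF st_linear a(2)])
  show "continuous_on D (\<lambda>z. ph i (a z) j l)" if "j + l < n" "j < m" for j l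
    by (rule continuous_on_compose2[OF phi_cont[OF i, of j l] a(1)]) (use that wf a(3) in auto)
  show "1 - (ph i (a z) j 0)\<^sup>2 * (st (b z) i j)\<^sup>2 \<noteq> 0" if "j < n" "j < m" "z \<in> D" for j z
  proof -
    have "good (a z) (b z)" "j + 2 \<le> r i" using a(3)[OF that(3)] that wf by auto
    then have "(phi C i j (a z))\<^sup>2 * (st (b z) i j)\<^sup>2 < 1" using i unfolding good_def by blast
    then show ?thesis by (simp add: ph_def)
  qed
qed

lemma Yf_continuous:
  fixes a :: "'z::topological_space \<Rightarrow> real"
  assumes a: "continuous_on D a" "continuous_on D b" "\<And>z. z \<in> D \<Longrightarrow> 0 \<le> a z \<and> good (a z) (b z)"
  shows "continuous_on D (\<lambda>z. Yf (a z) (b z))"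
  unfolding Yf_def
proof (rule continuous_on_Yvec)
  fix i j assume j: "j < ord S i"
  have y: "continuous_on D (\<lambda>z. yr i j (a z))"
    by (rule continuous_on_compose2[OF yr_cont[OF j] a(1)]) (use a(3) in auto)
  have s: "continuous_on D (\<lambda>z. st (b z) i j)"
    by (rule bounded_linear.continuous_on[OF st_linear a(2)])
  have "continuous_on D (\<lambda>z. ev (ph i (a z)) (st (b z) i) (Rx j))"
  proof (cases "i \<in> II")
    case True
    then show ?thesis using j by (intro ev_good_continuous[OF True wfx_Rx _ _ a]) auto
  next
    case False
    then have "j = 0" using j by simp
    then show ?thesis by simp
  qed
  then show "continuous_on D (\<lambda>z. yr i j (a z) + st (b z) i j - ev (ph i (a z)) (st (b z) i) (Rx j))"
    by (intro continuous_intros y s)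
qed

lemma UI_continuous:
  fixes a :: "'z::topological_space \<Rightarrow> real"
  assumes a: "continuous_on D a" "continuous_on D b" "\<And>z. z \<in> D \<Longrightarrow> 0 \<le> a z \<and> good (a z) (b z)"
  shows "continuous_on D (\<lambda>z. UI (a z) (b z))"
proof -
  have p: "continuous_on D (\<lambda>z. phiI C (a z))"
    by (rule continuous_on_compose2[OF phiI_cont(1) a(1)]) (use a(3) in auto)
  have e: "continuous_on D (\<lambda>z. EIx (b z))"
    by (rule bounded_linear.continuous_on[OF linear_maps(1) a(2)])
  have "1 - (phiI C (a z))\<^sup>2 * (norm (EIx (b z)))\<^sup>2 \<noteq> 0" if "z \<in> D" for z
    using a(3)[OF that] by (auto simp: good_def)
  then show ?thesis unfolding UI_def by (intro continuous_intros p e) auto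
qed

lemma continuous_on_mat_vec:
  fixes M :: "'z::topological_space \<Rightarrow> real ^ 'a ^ 'b"
  assumes "continuous_on D M" "continuous_on D x"
  shows "continuous_on D (\<lambda>z. M z *v x z)"
  unfolding matrix_vector_mult_def by (intro continuous_intros assms)

lemma Pm_continuous:
  assumes "continuous_on D p" "continuous_on D a" "continuous_on D V" "\<And>z. z \<in> D \<Longrightarrow> a z > 0"
  shows "continuous_on D (\<lambda>z. Pm (p z) (a z) (V z))"
proof -
  have "a z + sqrt ((a z)\<^sup>2 + 4 * (p z)\<^sup>2 * (norm (V z))\<^sup>2) \<noteq> 0" if "z \<in> D" for z
  proof -
    have "a z > 0" using assms(4)[OF that] .
    moreover have "sqrt ((a z)\<^sup>2 + 4 * (p z)\<^sup>2 * (norm (V z))\<^sup>2) \<ge> 0" by simp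
    ultimately show ?thesis by linarith
  qed
  then show ?thesis unfolding Pm_def by (intro continuous_intros assms) auto
qed

lemma eIIf_continuous:
  fixes a :: "'z::topological_space \<Rightarrow> real"
  assumes a: "continuous_on D a" "continuous_on D b" "\<And>z. z \<in> D \<Longrightarrow> 0 \<le> a z \<and> good (a z) (b z)"
    and c: "continuous_on D c"
  shows "continuous_on D (\<lambda>z. eIIf (a z) (b z) (c z))"
  unfolding eIIf_def
proof (rule Pm_continuous)
  have d: "continuous_on D (\<lambda>z. d3 S (a z))" "continuous_on D (\<lambda>z. d4 S (a z))" "continuous_on D (\<lambda>z. d5 S (a z))"
    using a(3) by (auto intro!: continuous_on_compose2[OF Winf_ubl(2)[OF d_Winf(1)] a(1)]
      continuous_on_compose2[OF Winf_ubl(2)[OF d_Winf(2)] a(1)] continuous_on_compose2[OF Winf_ubl(2)[OF d_Winf(3)] a(1)])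
  show "continuous_on D (\<lambda>z. phiII C (a z))"
    by (rule continuous_on_compose2[OF phiI_cont(2) a(1)]) (use a(3) in auto)
  show "continuous_on D (\<lambda>z. khat C * f4 S (d5 S (a z), c z))"
    by (intro continuous_intros continuous_on_compose2[OF C1_continuous[OF f4_C1, of UNIV]] d c) auto
  show "continuous_on D (\<lambda>z. f2 S (Yf (a z) (b z)) + f3 S (d3 S (a z), c z) + GammaII S (d4 S (a z), c z) *v UI (a z) (b z))"
    by (intro continuous_intros continuous_on_mat_vec continuous_on_compose2[OF C1_continuous[OF C1s(1), of UNIV]]
      continuous_on_compose2[OF C1_continuous[OF C1s(2), of UNIV]] continuous_on_compose2[OF C1_continuous[OF C1s(3), of UNIV]]
      d c Yf_continuous[OF a] UI_continuous[OF a]) auto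
qed (rule kf4_pos)

definition "JJ = (SUP Z. jac2_norm S Z)"
definition "rho = JJ / (khat C * \<alpha>)"

lemma jac2_le: "jac2_norm S Z \<le> JJ" and JJ_nonneg: "JJ \<ge> 0"
proof -
  have "bdd_above (range (jac2_norm S))" using A3 by (simp add: assmA3_def)
  then show le: "jac2_norm S Z \<le> JJ" for Z unfolding JJ_def by (intro cSUP_upper) auto
  have "0 \<le> jac2_norm S 0" unfolding jac2_norm_def by (intro onorm_pos_le matrix_vector_mul_bounded_linear)
  then show "JJ \<ge> 0" using le[of 0] by linarith
qed

lemma rho: "0 \<le> rho" "rho < 1"
proof -
  show "0 \<le> rho" using JJ_nonneg k\<alpha> by (simp add: rho_def)
  have "JJ / \<alpha> < khat C" using khat by (simp add: JJ_def divide_inverse mult.commute)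
  then have "JJ < khat C * \<alpha>" using \<alpha>_pos by (simp add: pos_divide_less_eq)
  then show "rho < 1" using k\<alpha> by (simp add: rho_def)
qed

text \<open>Mean value inequality along \<open>emb\<close>: by \<open>emb_lastcols\<close> the
  derivative in these directions is bounded by \<open>JJ\<close>.\<close>

lemma f2_lipschitz_II: "norm (f2 S (Z + emb e) - f2 S (Z + emb e')) \<le> JJ * norm (e - e')"
proof -
  obtain f' :: "real ^ 'n \<Rightarrow> (real ^ 'n) \<Rightarrow>\<^sub>L (real ^ 'm)" where f': "\<And>x. (f2 S has_derivative blinfun_apply (f' x)) (at x)"
    using C1s(1) by (auto simp: C1_def)
  interpret emb: bounded_linear emb by (rule linear_maps(4))
  have "norm ((\<lambda>e. f2 S (Z + emb e)) e - (\<lambda>e. f2 S (Z + emb e)) e') \<le> JJ * norm (e - e')"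
  proof (rule differentiable_bound[of UNIV _ "\<lambda>x v. f' (Z + emb x) (emb v)"])
    show "((\<lambda>e. f2 S (Z + emb e)) has_derivative (\<lambda>v. f' (Z + emb x) (emb v))) (at x within UNIV)" for x
    proof -
      have "((\<lambda>e. Z + emb e) has_derivative emb) (at x)"
        by (auto intro!: derivative_eq_intros emb.has_derivative)
      from has_derivative_compose[OF this f'] show ?thesis by simp
    qed
    show "onorm (\<lambda>v. f' (Z + emb x) (emb v)) \<le> JJ" for x
    proof -
      have "frechet_derivative (f2 S) (at (Z + emb x)) = blinfun_apply (f' (Z + emb x))"
        using frechet_derivative_at[OF f'] by simp
      moreover have "(matrix (blinfun_apply (f' (Z + emb x))) ** lastcols S) *v v = f' (Z + emb x) (emb v)" for v
        by (simp add: matrix_vector_mul_assoc[symmetric] emb_lastcols matrix_works blinfun.bounded_linear_right bounded_linear.linear)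
      ultimately have "jac2_norm S (Z + emb x) = onorm (\<lambda>v. f' (Z + emb x) (emb v))"
        by (simp add: jac2_norm_def)
      then show ?thesis using jac2_le by metis
    qed
  qed auto
  then show ?thesis by simp
qed

text \<open>In the second block an output is reference plus error, so these errors enter
  \<open>Y\<close> additively; all nonlinear corrections come from the first block.\<close>

lemma Yf_emb: "Yf t x = Yf t (PI x) + emb (EIIx x)"
proof (rule st_eqI)
  fix i j assume j: "j < ord S i"
  show "st (Yf t x) i j = st (Yf t (PI x) + emb (EIIx x)) i j"
  proof (cases "i \<in> II")
    case True
    have "ev (ph i t) (st (PI x) i) (Rx j) = ev (ph i t) (st x i) (Rx j)"
    proof -
      have "wfx n m y \<Longrightarrow> n \<le> r i \<Longrightarrow> ev (ph i t) (st (PI x) i) y = ev (ph i t) (st x i) y" for y n m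
        using True by (induction y) (auto simp: st_PI)
      then show ?thesis using wfx_Rx[of j] j True by auto
    qed
    then show ?thesis using True j by (simp add: Yf_def st_PI) (simp add: emb_def)
  next
    case False
    then have "j = 0" using j by simp
    then show ?thesis using False by (simp add: Yf_def) (simp add: PI_def emb_def EIIx_def)
  qed
qed

lemma ubl_restrict: "ubl A {0..} f \<Longrightarrow> J \<subseteq> {0..} \<Longrightarrow> ubl A J f"
  using ubl_reindex[of A "{0..}" f A "\<lambda>x. x" J] by simp

lemma UI_ubl:
  assumes J: "J \<subseteq> {0..}" and P: "ubl A J (\<lambda>v t. PI (u v t))" and \<epsilon>: "\<epsilon> > 0"
    and g: "\<And>v t. v \<in> A \<Longrightarrow> t \<in> J \<Longrightarrow> goodeps \<epsilon> t (u v t)"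
  shows "ubl A J (\<lambda>v t. UI t (u v t))"
proof -
  have e: "ubl A J (\<lambda>v t. EIx (u v t))" using ubl_bounded_linear[OF linear_maps(1) P] by (simp add: EI_PI)
  have one: "ubl A J (\<lambda>v t. 1::real)" by (rule ubl_const[where B=1]) simp
  have p: "ubl A J (\<lambda>v t. phiI C t)" by (rule ubl_restrict[OF phiI_ubl(1) J])
  have "ubl A J (\<lambda>v t. 1 / (1 - (phiI C t)\<^sup>2 * (norm (EIx (u v t)))\<^sup>2))"
  proof (rule ubl_inverse[OF _ \<epsilon>])
    show "ubl A J (\<lambda>v t. 1 - (phiI C t)\<^sup>2 * (norm (EIx (u v t)))\<^sup>2)"
      by (intro ubl_diff one ubl_mult ubl_power2 p ubl_norm e)
    show "\<epsilon> \<le> 1 - (phiI C t)\<^sup>2 * (norm (EIx (u v t)))\<^sup>2" if "v \<in> A" "t \<in> J" for v t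
      using g[OF that] by (simp add: goodeps_def)
  qed
  then show ?thesis unfolding UI_def by (intro ubl_minus ubl_scaleR e)
qed

text \<open>Only the first block is assumed Lipschitz in time; for the second block this is the
  goal.\<close>

lemma Yf_PI_ubl:
  assumes J: "J \<subseteq> {0..}" and P: "ubl A J (\<lambda>v t. PI (u v t))" and \<epsilon>: "\<epsilon> > 0"
    and g: "\<And>v t. v \<in> A \<Longrightarrow> t \<in> J \<Longrightarrow> goodeps \<epsilon> t (u v t)"
  shows "ubl A J (\<lambda>v t. Yf t (PI (u v t)))"
  unfolding Yf_def
proof (rule ubl_Yvec)
  fix i j assume j: "j < ord S i"
  have s: "ubl A J (\<lambda>v t. st (PI (u v t)) i j)" for i j by (rule ubl_bounded_linear[OF st_linear P])
  have y: "ubl A J (\<lambda>v t. yr i j t)" by (rule ubl_restrict[OF yr_ubl[OF j] J])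
  have "ubl A J (\<lambda>v t. ev (ph i t) (st (PI (u v t)) i) (Rx j))"
  proof (cases "i \<in> II")
    case True
    show ?thesis
    proof (rule ev_ubl[OF wfx_Rx])
      show "ubl A J (\<lambda>v t. ph i t k l)" if "k + l < j" for k l
        using that j True by (intro phi_ubl[OF True _ _ J]) auto
      show "\<exists>\<epsilon>>0. \<forall>v\<in>A. \<forall>t\<in>J. (ph i t k 0)\<^sup>2 * (st (PI (u v t)) i k)\<^sup>2 \<le> 1 - \<epsilon>" if "k < j" for k
      proof (intro exI[of _ \<epsilon>] conjI ballI \<epsilon>)
        fix v t assume "v \<in> A" "t \<in> J"
        then have "goodeps \<epsilon> t (u v t)" by (rule g)
        then show "(ph i t k 0)\<^sup>2 * (st (PI (u v t)) i k)\<^sup>2 \<le> 1 - \<epsilon>"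
          using that j True by (auto simp: goodeps_def goodR_def ph_def st_PI)
      qed
    qed (rule s)
  next
    case False
    then have "j = 0" using j by simp
    then show ?thesis using ubl_const[of A "\<lambda>_. 0::real" 0 J] by simp
  qed
  then show "ubl A J (\<lambda>v t. yr i j t + st (PI (u v t)) i j - ev (ph i t) (st (PI (u v t)) i) (Rx j))"
    by (intro ubl_add ubl_diff y s)
qed

text \<open>The second block of errors contracts with factor \<open>rho < 1\<close>; everything else is Lipschitz in time.\<close>

lemma eIIf_contraction:
  assumes J: "J \<subseteq> {0..}" and P: "ubl A J (\<lambda>v t. PI (u v t))" and \<epsilon>: "\<epsilon> > 0"
    and g: "\<And>v t. v \<in> A \<Longrightarrow> t \<in> J \<Longrightarrow> goodeps \<epsilon> t (u v t)"
    and eb: "\<And>v t. v \<in> A \<Longrightarrow> t \<in> J \<Longrightarrow> norm (EIIx (u v t)) \<le> B" and w: "ubl A J w"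
  shows "\<exists>M\<ge>0. \<forall>v\<in>A. \<forall>s\<in>J. \<forall>t\<in>J. norm (eIIf t (u v t) (w v t) - eIIf s (u v s) (w v s)) \<le>
    M * \<bar>t - s\<bar> + rho * norm (EIIx (u v t) - EIIx (u v s))"
proof -
  define q where "q v t = Yf t (PI (u v t))" for v t
  define e where "e v t = EIIx (u v t)" for v t
  define c where "c v t = f3 S (d3 S t, w v t) + GammaII S (d4 S t, w v t) *v UI t (u v t)" for v t
  define a where "a v t = khat C * f4 S (d5 S t, w v t)" for v t
  define V where "V v t = f2 S (q v t + emb (e v t)) + c v t" for v t
  have eII: "eIIf t (u v t) (w v t) = Pm (phiII C t) (a v t) (V v t)" for v t
    unfolding eIIf_def a_def V_def c_def q_def e_def Yf_emb[of t "u v t"] by (simp add: add.assoc)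
  have qu: "ubl A J q" unfolding q_def by (rule Yf_PI_ubl[OF J P \<epsilon> g])
  have du: "ubl A J (\<lambda>v t. (d3 S t, w v t))" "ubl A J (\<lambda>v t. (d4 S t, w v t))" "ubl A J (\<lambda>v t. (d5 S t, w v t))"
    using ubl_restrict[OF Winf_ubl(1)[OF d_Winf(1)] J] ubl_restrict[OF Winf_ubl(1)[OF d_Winf(2)] J] ubl_restrict[OF Winf_ubl(1)[OF d_Winf(3)] J]
    by (auto intro!: ubl_Pair w)
  have cu: "ubl A J c" unfolding c_def
    by (intro ubl_add ubl_mat_vec ubl_C1[OF C1s(2) du(1)] ubl_C1[OF C1s(3) du(2)] UI_ubl[OF J P \<epsilon> g])
  have kc: "ubl A J (\<lambda>v t. khat C)" using khat_pos by (intro ubl_const[where B="khat C"]) auto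
  have au: "ubl A J a" unfolding a_def by (intro ubl_mult kc ubl_C1[OF f4_C1 du(3)])
  have age: "a v t \<ge> khat C * \<alpha>" for v t unfolding a_def by (rule kf4_ge)
  have eBb: "norm (emb (e v t)) \<le> B" if "v \<in> A" "t \<in> J" for v t
    using norm_emb_le[of "e v t"] eb[OF that] by (simp add: e_def)
  \<comment> \<open>Pairs of a member and a time \<open>s\<close>. The second block, and later
    \<open>V\<close>, is frozen at \<open>s\<close> while the other arguments move; indexing by
    pairs makes the constants uniform in \<open>s\<close> too.\<close>
  define A2 where "A2 = {(v, s). v \<in> A \<and> s \<in> J}"
  have fstA: "fst x \<in> A" "snd x \<in> J" if "x \<in> A2" for x using that by (auto simp: A2_def)
  have q2: "ubl A2 J (\<lambda>x. q (fst x))" by (rule ubl_reindex[OF qu fstA(1) order_refl])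
  have a2: "ubl A2 J (\<lambda>x. a (fst x))" by (rule ubl_reindex[OF au fstA(1) order_refl])
  have e2: "ubl A2 J (\<lambda>x t. emb (e (fst x) (snd x)))"
    by (rule ubl_const[where B=B]) (rule eBb[OF fstA])
  have f2u: "ubl A2 J (\<lambda>x t. f2 S (q (fst x) t + emb (e (fst x) (snd x))))"
    by (rule ubl_C1[OF C1s(1) ubl_add[OF q2 e2]])
  obtain B2 where B2: "\<forall>x\<in>A2. \<forall>t\<in>J. norm (f2 S (q (fst x) t + emb (e (fst x) (snd x)))) \<le> B2"
    using ubl_boundD[OF f2u] by (elim exE conjE)
  obtain L2 where L2: "L2 \<ge> 0" and L2': "\<forall>x\<in>A2. \<forall>s\<in>J. \<forall>t\<in>J. norm (f2 S (q (fst x) t + emb (e (fst x) (snd x))) - f2 S (q (fst x) s + emb (e (fst x) (snd x)))) \<le> L2 * \<bar>t - s\<bar>"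
    using ubl_lipD[OF f2u] by (elim exE conjE)
  obtain Bc where Bc: "\<forall>v\<in>A. \<forall>t\<in>J. norm (c v t) \<le> Bc" using ubl_boundD[OF cu] by (elim exE conjE)
  obtain Lc where Lc: "Lc \<ge> 0" and Lc': "\<forall>v\<in>A. \<forall>s\<in>J. \<forall>t\<in>J. norm (c v t - c v s) \<le> Lc * \<bar>t - s\<bar>"
    using ubl_lipD[OF cu] by (elim exE conjE)
  have Vb: "norm (V v t) \<le> B2 + Bc" if "v \<in> A" "t \<in> J" for v t
  proof -
    have "(v, t) \<in> A2" using that by (simp add: A2_def)
    from bspec[OF bspec[OF B2 this] that(2)] have "norm (f2 S (q v t + emb (e v t))) \<le> B2" by simp
    then show ?thesis unfolding V_def using bspec[OF bspec[OF Bc that(1)] that(2)] by (rule norm_triangle_mono)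
  qed
  have pu: "ubl A2 J (\<lambda>x t. Pm (phiII C t) (a (fst x) t) (V (fst x) (snd x)))"
  proof (rule ubl_Pm[OF _ a2 _ k\<alpha>])
    show "ubl A2 J (\<lambda>v t. phiII C t)" by (rule ubl_restrict[OF phiI_ubl(2) J])
    show "ubl A2 J (\<lambda>x t. V (fst x) (snd x))"
      by (rule ubl_const[where B="B2 + Bc"]) (rule Vb[OF fstA])
  qed (rule age)
  obtain Lp where Lp: "Lp \<ge> 0" and Lp': "\<forall>x\<in>A2. \<forall>s\<in>J. \<forall>t\<in>J.
    norm (Pm (phiII C t) (a (fst x) t) (V (fst x) (snd x)) - Pm (phiII C s) (a (fst x) s) (V (fst x) (snd x))) \<le> Lp * \<bar>t - s\<bar>"
    using ubl_lipD[OF pu] by (elim exE conjE)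
  show ?thesis
  proof (rule exI[of _ "(L2 + Lc) / (khat C * \<alpha>) + Lp"], rule conjI, use L2 Lc Lp k\<alpha> in simp, intro ballI)
    fix v s t assume v: "v \<in> A" "s \<in> J" "t \<in> J"
    have x: "(v, s) \<in> A2" using v by (simp add: A2_def)
    \<comment> \<open>Telescoping: the change of the second block costs \<open>JJ\<close>, which has
      to stay sharp to give \<open>rho\<close>; the two other differences are Lipschitz in
      time.\<close>
    have "norm (V v t - V v s) \<le> norm (f2 S (q v t + emb (e v t)) - f2 S (q v t + emb (e v s)))
      + norm (f2 S (q v t + emb (e v s)) - f2 S (q v s + emb (e v s))) + norm (c v t - c v s)"
    proof -
      have d: "V v t - V v s = (f2 S (q v t + emb (e v t)) - f2 S (q v t + emb (e v s)))
       + (f2 S (q v t + emb (e v s)) - f2 S (q v s + emb (e v s))) + (c v t - c v s)" by (simp add: V_def)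
      show ?thesis unfolding d
        using norm_triangle_ineq[of "(f2 S (q v t + emb (e v t)) - f2 S (q v t + emb (e v s))) + (f2 S (q v t + emb (e v s)) - f2 S (q v s + emb (e v s)))" "c v t - c v s"]
          norm_triangle_ineq[of "f2 S (q v t + emb (e v t)) - f2 S (q v t + emb (e v s))" "f2 S (q v t + emb (e v s)) - f2 S (q v s + emb (e v s))"]
        by linarith
    qed
    also have "\<dots> \<le> JJ * norm (e v t - e v s) + L2 * \<bar>t - s\<bar> + Lc * \<bar>t - s\<bar>"
      using L2'[THEN bspec, OF x, THEN bspec, OF v(2), THEN bspec, OF v(3)]
        Lc'[THEN bspec, OF v(1), THEN bspec, OF v(2), THEN bspec, OF v(3)] by (intro add_mono f2_lipschitz_II) simp_all
    finally have Vd: "norm (V v t - V v s) \<le> JJ * norm (e v t - e v s) + (L2 + Lc) * \<bar>t - s\<bar>" by (simp add: algebra_simps)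
    have ap: "a v t > 0" using age[of v t] k\<alpha> by linarith
    have "norm (Pm (phiII C t) (a v t) (V v t) - Pm (phiII C t) (a v t) (V v s)) \<le> norm (V v t - V v s) / a v t"
      by (rule Pm_lipschitz[OF ap])
    also have "\<dots> \<le> norm (V v t - V v s) / (khat C * \<alpha>)"
      using age[of v t] k\<alpha> by (intro divide_left_mono mult_pos_pos ap khat_pos \<alpha>_pos) auto
    also have "\<dots> \<le> (JJ * norm (e v t - e v s) + (L2 + Lc) * \<bar>t - s\<bar>) / (khat C * \<alpha>)"
      using Vd k\<alpha> by (intro divide_right_mono) auto
    also have "\<dots> = rho * norm (e v t - e v s) + (L2 + Lc) / (khat C * \<alpha>) * \<bar>t - s\<bar>"
      by (simp add: rho_def add_divide_distrib distrib_right)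
    finally have 1: "norm (Pm (phiII C t) (a v t) (V v t) - Pm (phiII C t) (a v t) (V v s)) \<le>
      rho * norm (e v t - e v s) + (L2 + Lc) / (khat C * \<alpha>) * \<bar>t - s\<bar>" .
    have 2: "norm (Pm (phiII C t) (a v t) (V v s) - Pm (phiII C s) (a v s) (V v s)) \<le> Lp * \<bar>t - s\<bar>"
      using Lp'[THEN bspec, OF x, THEN bspec, OF v(2), THEN bspec, OF v(3)] by simp
    have "norm (Pm (phiII C t) (a v t) (V v t) - Pm (phiII C s) (a v s) (V v s)) \<le>
      norm (Pm (phiII C t) (a v t) (V v t) - Pm (phiII C t) (a v t) (V v s)) + norm (Pm (phiII C t) (a v t) (V v s) - Pm (phiII C s) (a v s) (V v s))"
      using norm_triangle_ineq[of "Pm (phiII C t) (a v t) (V v t) - Pm (phiII C t) (a v t) (V v s)" "Pm (phiII C t) (a v t) (V v s) - Pm (phiII C s) (a v s) (V v s)"]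
      by simp
    then show "norm (eIIf t (u v t) (w v t) - eIIf s (u v s) (w v s)) \<le>
       ((L2 + Lc) / (khat C * \<alpha>) + Lp) * \<bar>t - s\<bar> + rho * norm (EIIx (u v t) - EIIx (u v s))"
      using 1 2 unfolding eII e_def by (simp add: distrib_right)
  qed
qed

end

lemma borel_measurable_vec_nth:
  fixes f :: "'z \<Rightarrow> real ^ 'n"
  assumes "\<And>i. (\<lambda>x. f x $ i) \<in> borel_measurable M"
  shows "f \<in> borel_measurable M"
proof -
  have "(\<lambda>x. \<Sum>i\<in>UNIV. f x $ i *\<^sub>R axis i (1::real)) \<in> borel_measurable M"
    using assms by (intro borel_measurable_sum borel_measurable_scaleR) auto
  moreover have "(\<Sum>i\<in>UNIV. f x $ i *\<^sub>R axis i (1::real)) = f x" for x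
    using basis_expansion[of "f x"] by (simp add: scalar_mult_eq_scaleR)
  ultimately show ?thesis by simp
qed

lemma borel_measurable_compose_continuous:
  fixes F :: "'a::second_countable_topology \<times> 'b::second_countable_topology \<Rightarrow> 'c::topological_space"
  assumes "continuous_on UNIV F" "f \<in> borel_measurable M" "g \<in> borel_measurable M"
  shows "(\<lambda>x. F (f x, g x)) \<in> borel_measurable M"
  using borel_measurable_continuous_on[OF assms(1) borel_measurable_Pair[OF assms(2,3)]] .

lemma borel_measurable_mat_vec:
  fixes A :: "'z \<Rightarrow> real ^ 'n ^ 'm"
  assumes "A \<in> borel_measurable M" "x \<in> borel_measurable M"
  shows "(\<lambda>z. A z *v x z) \<in> borel_measurable M"
proof -
  have "continuous_on UNIV (\<lambda>p :: (real ^ 'n ^ 'm) \<times> (real ^ 'n). fst p *v snd p)"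
    unfolding matrix_vector_mult_def by (intro continuous_intros)
  from borel_measurable_compose_continuous[OF this assms] show ?thesis by simp
qed

context fdae_loop
begin

section \<open>Bounds for the right-hand sides\<close>

text \<open>\<open>None\<close> stands for the gain \<open>k\<^sub>I\<close> and
  \<open>Some (i, j)\<close> for \<open>k\<^sub>i\<^sub>j\<close>; thus finitely many scalar
  conditions of the same form describe \<open>good\<close> and \<open>goodeps\<close>.\<close>

definition gix :: "('m \<times> nat) option set" where
  "gix = insert None (Some ` {(i, j). i \<in> II \<and> j + 2 \<le> r i})"

definition gq :: "('m \<times> nat) option \<Rightarrow> real \<Rightarrow> real ^ 'n \<Rightarrow> real" where
  "gq k t x = (case k of None \<Rightarrow> (phiI C t)\<^sup>2 * (norm (EIx x))\<^sup>2 | Some (i, j) \<Rightarrow> (phi C i j t)\<^sup>2 * (st x i j)\<^sup>2)"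

lemma finite_chain_ix: "finite {(i, j). i \<in> II \<and> j + 2 \<le> r i}"
  by (rule finite_subset[of _ "SIGMA i:II. {..r i}"]) auto

lemma finite_gix: "finite gix"
  using finite_chain_ix by (simp add: gix_def)

lemma good_gq: "good t x \<longleftrightarrow> (\<forall>k\<in>gix. gq k t x < 1)"
  and goodeps_gq: "goodeps \<epsilon> t x \<longleftrightarrow> (\<forall>k\<in>gix. gq k t x \<le> 1 - \<epsilon>)"
  by (auto simp: good_def goodeps_def goodR_def gix_def gq_def)

lemma gq_continuous:
  fixes a :: "'z::topological_space \<Rightarrow> real"
  assumes k: "k \<in> gix" and a: "continuous_on D a" "continuous_on D b" "\<And>z. z \<in> D \<Longrightarrow> 0 \<le> a z"
  shows "continuous_on D (\<lambda>z. gq k (a z) (b z))"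
proof (cases k)
  case None
  have "continuous_on D (\<lambda>z. phiI C (a z))" by (rule continuous_on_compose2[OF phiI_cont(1) a(1)]) (use a(3) in auto)
  then show ?thesis
    by (simp add: None gq_def) (intro continuous_intros bounded_linear.continuous_on[OF linear_maps(1) a(2)])
next
  case (Some ij)
  then obtain i j where ij: "ij = (i, j)" "i \<in> II" "j + 2 \<le> r i" using k by (auto simp: gix_def)
  have "continuous_on {0..} (phi C i j)" using phi_cont[OF ij(2,3), of 0] ij(3) by (simp add: ph_def)
  then have "continuous_on D (\<lambda>z. phi C i j (a z))" by (rule continuous_on_compose2[OF _ a(1)]) (use a(3) in auto)
  then show ?thesis
    by (simp add: Some ij(1) gq_def) (intro continuous_intros bounded_linear.continuous_on[OF st_linear a(2)])
qed

text \<open>On a compact set each of the finitely many continuous functions \<open>gq k\<close>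
  attains its maximum, which is less than 1.\<close>

lemma goodeps_compact:
  fixes K :: "(real \<times> (real ^ 'n)) set"
  assumes "compact K" "\<And>t x. (t, x) \<in> K \<Longrightarrow> 0 \<le> t \<and> good t x"
  shows "\<exists>\<epsilon>>0. \<forall>(t, x)\<in>K. goodeps \<epsilon> t x"
proof (cases "K = {}")
  case True then show ?thesis by (intro exI[of _ 1]) auto
next
  case False
  have K: "0 \<le> fst z \<and> good (fst z) (snd z)" if "z \<in> K" for z using assms(2)[of "fst z" "snd z"] that by simp
  have "\<exists>\<epsilon>>0. \<forall>z\<in>K. gq k (fst z) (snd z) \<le> 1 - \<epsilon>" if k: "k \<in> gix" for k
  proof -
    have "continuous_on K (\<lambda>z. gq k (fst z) (snd z))" by (rule gq_continuous[OF k]) (use K in \<open>auto intro!: continuous_intros\<close>)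
    then obtain z where z: "z \<in> K" "\<forall>y\<in>K. gq k (fst y) (snd y) \<le> gq k (fst z) (snd z)"
      using continuous_attains_sup[OF assms(1) False] by blast
    then have "gq k (fst z) (snd z) < 1" using K k by (auto simp: good_gq)
    then show ?thesis using z(2) by (intro exI[of _ "1 - gq k (fst z) (snd z)"]) auto
  qed
  then have "\<exists>\<epsilon>>0. \<forall>k\<in>gix. \<forall>z\<in>K. gq k (fst z) (snd z) \<le> 1 - \<epsilon>"
    by (rule finite_min_eps[where Q="\<lambda>k \<epsilon>. \<forall>z\<in>K. gq k (fst z) (snd z) \<le> 1 - \<epsilon>", OF finite_gix]) force+
  then obtain \<epsilon> where "\<epsilon> > 0" "\<forall>k\<in>gix. \<forall>z\<in>K. gq k (fst z) (snd z) \<le> 1 - \<epsilon>" by blast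
  then show ?thesis by (intro exI[of _ \<epsilon>]) (fastforce simp: goodeps_gq)
qed

lemma goodeps_path:
  assumes "0 \<le> c" "continuous_on {c..d} u" "\<And>t. t \<in> {c..d} \<Longrightarrow> good t (u t)"
  shows "\<exists>\<epsilon>>0. \<forall>t\<in>{c..d}. goodeps \<epsilon> t (u t)"
proof -
  have "compact ((\<lambda>t. (t, u t)) ` {c..d})"
    by (intro compact_continuous_image continuous_intros assms(2)) auto
  then have "\<exists>\<epsilon>>0. \<forall>(t, x)\<in>(\<lambda>t. (t, u t)) ` {c..d}. goodeps \<epsilon> t x"
    by (rule goodeps_compact) (use assms(1,3) in auto)
  then show ?thesis by auto
qed

lemma ev_goodR_bounded:
  assumes i: "i \<in> II" and wf: "wfx n m x" "n \<le> r i" "m \<le> r i - 1" and \<epsilon>: "\<epsilon> > 0"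
  shows "\<exists>M. \<forall>t\<ge>0. \<forall>y. goodR \<epsilon> t y \<longrightarrow> norm y \<le> B \<longrightarrow> \<bar>ev (ph i t) (st y i) x\<bar> \<le> M"
proof -
  define Z where "Z = {z :: real \<times> (real ^ 'n). fst z \<ge> 0 \<and> goodR \<epsilon> (fst z) (snd z) \<and> norm (snd z) \<le> B}"
  have "\<exists>M. \<forall>z\<in>Z. \<bar>ev (ph i (fst z)) (st (snd z) i) x\<bar> \<le> M"
  proof (rule ev_bounded[OF wf(1)])
    show "\<exists>M. \<forall>z\<in>Z. \<bar>st (snd z) i j\<bar> \<le> M" for j
      by (rule exI[of _ B]) (auto simp: Z_def intro: order_trans[OF st_le_norm])
    show "\<exists>M. \<forall>z\<in>Z. \<bar>ph i (fst z) j l\<bar> \<le> M" if "j + l < n" "j < m" for j l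
    proof -
      have "\<exists>M. \<forall>t\<ge>0. \<bar>ph i t j l\<bar> \<le> M" using that wf by (intro phi_bdd[OF i]) auto
      then show ?thesis by (auto simp: Z_def)
    qed
    show "\<exists>\<epsilon>>0. \<forall>z\<in>Z. (ph i (fst z) j 0)\<^sup>2 * (st (snd z) i j)\<^sup>2 \<le> 1 - \<epsilon>" if "j < n" "j < m" for j
      by (rule exI[of _ \<epsilon>]) (use that wf \<epsilon> i in \<open>auto simp: Z_def goodR_def ph_def\<close>)
  qed
  then show ?thesis by (auto simp: Z_def)
qed

lemma UI_bounded:
  assumes "\<epsilon> > 0" shows "\<exists>M\<ge>0. \<forall>t y. goodeps \<epsilon> t y \<longrightarrow> norm y \<le> B \<longrightarrow> norm (UI t y) \<le> M"
proof -
  obtain K where K: "K \<ge> 0" "\<And>y. norm (EIx y) \<le> norm y * K" using bounded_linear.nonneg_bounded[OF linear_maps(1)] by blast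
  have "norm (UI t y) \<le> (1 / \<epsilon>) * (\<bar>B\<bar> * K)" if "goodeps \<epsilon> t y" "norm y \<le> B" for t y
  proof -
    have "\<epsilon> \<le> 1 - (phiI C t)\<^sup>2 * (norm (EIx y))\<^sup>2" using that by (simp add: goodeps_def)
    then have 1: "\<bar>1 / (1 - (phiI C t)\<^sup>2 * (norm (EIx y))\<^sup>2)\<bar> \<le> 1 / \<epsilon>" using assms by (simp add: frac_le)
    have "norm (EIx y) \<le> \<bar>B\<bar> * K" using K(2)[of y] mult_right_mono[OF _ K(1), of "norm y" "\<bar>B\<bar>"] that by linarith
    then show ?thesis unfolding UI_def norm_minus_cancel norm_scaleR using 1 assms K(1) by (intro mult_mono) auto
  qed
  then show ?thesis using assms K(1) by (intro exI[of _ "(1 / \<epsilon>) * (\<bar>B\<bar> * K)"]) auto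
qed

lemma Linf_bd:
  assumes "Linf d" shows "\<exists>D. \<forall>b. AE t in lebesgue_on {0..b}. norm (d t) \<le> D"
  using Linf_ebd[OF assms] by (auto simp: ebd_def)

lemma continuous_bounded_cball:
  fixes F :: "'a::euclidean_space \<times> 'b::euclidean_space \<Rightarrow> 'c::real_normed_vector"
  assumes "continuous_on UNIV F" shows "\<exists>M\<ge>0. \<forall>x y. norm x \<le> D \<longrightarrow> norm y \<le> c \<longrightarrow> norm (F (x, y)) \<le> M"
proof -
  have "compact (F ` (cball 0 D \<times> cball 0 c))"
    using assms by (intro compact_continuous_image compact_Times) (auto intro: continuous_on_subset)
  then have "bounded (F ` (cball 0 D \<times> cball 0 c))" by (rule compact_imp_bounded)
  then obtain M where M: "\<forall>w\<in>F ` (cball 0 D \<times> cball 0 c). norm w \<le> M" unfolding bounded_iff by blast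
  show ?thesis
  proof (intro exI[of _ "\<bar>M\<bar>"] conjI allI impI)
    fix x :: 'a and y :: 'b assume "norm x \<le> D" "norm y \<le> c"
    then have "norm (F (x, y)) \<le> M" using M by auto
    then show "norm (F (x, y)) \<le> \<bar>M\<bar>" by simp
  qed simp
qed

text \<open>The derivative of the last error of the \<open>i\<close>-th chain, without the contribution of the input.\<close>

definition drift :: "'m \<Rightarrow> real \<Rightarrow> real ^ 'n \<Rightarrow> real ^ 'k \<Rightarrow> real" where
  "drift i t x \<eta> = f1 S (d1 S t, \<eta>) $ i - yr i (r i) t + ev (ph i t) (st x i) (dex (Rx (r i - 1)))"

text \<open>The quantifiers over \<open>x\<close> and \<open>\<eta>\<close> stand inside
  \<open>AE\<close>: the exceptional set comes only from \<open>d1\<close> and the top derivative of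
  the reference. Hence the bound can be applied along arbitrary functions.\<close>

lemma drift_bounded:
  assumes i: "i \<in> II" and \<epsilon>: "\<epsilon> > 0"
  shows "\<exists>M. \<forall>b. AE t in lebesgue_on {0..b}. \<forall>x \<eta>. goodR \<epsilon> t x \<longrightarrow> norm x \<le> B \<longrightarrow> norm \<eta> \<le> c \<longrightarrow> \<bar>drift i t x \<eta>\<bar> \<le> M"
proof -
  obtain D where D: "\<forall>b. AE t in lebesgue_on {0..b}. norm (d1 S t) \<le> D" using Linf_bd[OF d_Linf(1)] by blast
  obtain F where F: "\<forall>x y. norm x \<le> D \<longrightarrow> norm y \<le> c \<longrightarrow> norm (f1 S (x, y)) \<le> F"
    using continuous_bounded_cball[OF f1_cont, of D c] by blast
  obtain Y where Y: "\<forall>b. AE t in lebesgue_on {0..b}. norm (yr i (r i) t) \<le> Y" using yr_top[of i] i by (auto simp: ebd_def)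
  have wf: "wfx (Suc (r i - 1)) (r i - 1) (dex (Rx (r i - 1)))" by (intro wfx_dex wfx_Rx) simp
  obtain E where E: "\<forall>t\<ge>0. \<forall>y. goodR \<epsilon> t y \<longrightarrow> norm y \<le> B \<longrightarrow> \<bar>ev (ph i t) (st y i) (dex (Rx (r i - 1)))\<bar> \<le> E"
    using ev_goodR_bounded[OF i wf _ order_refl \<epsilon>, of B] r_pos[OF i] by auto
  have "AE t in lebesgue_on {0..b}. \<forall>x \<eta>. goodR \<epsilon> t x \<longrightarrow> norm x \<le> B \<longrightarrow> norm \<eta> \<le> c \<longrightarrow> \<bar>drift i t x \<eta>\<bar> \<le> F + Y + E" for b
    using D[THEN spec, of b] Y[THEN spec, of b] AE_space
  proof eventually_elim
    case (elim t)
    then have t: "t \<ge> 0" by (simp add: space_restrict_space)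
    show ?case
    proof (intro allI impI)
      fix x \<eta> assume a: "goodR \<epsilon> t x" "norm x \<le> B" "norm (\<eta> :: real ^ 'k) \<le> c"
      have "norm (f1 S (d1 S t, \<eta>)) \<le> F" using F elim(1) a(3) by blast
      then have 1: "\<bar>f1 S (d1 S t, \<eta>) $ i\<bar> \<le> F" using component_le_norm_cart order_trans by blast
      have 2: "\<bar>yr i (r i) t\<bar> \<le> Y" using elim(2) by simp
      have 3: "\<bar>ev (ph i t) (st x i) (dex (Rx (r i - 1)))\<bar> \<le> E" using E t a by blast
      show "\<bar>drift i t x \<eta>\<bar> \<le> F + Y + E" using 1 2 3 unfolding drift_def by linarith
    qed
  qed
  then show ?thesis by blast
qed

lemma gf_nth:
  "st (gf t x \<eta>) i j = (if i \<in> II then (if Suc j < r i then ev (ph i t) (st x i) (dEE j)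
     else drift i t x \<eta> + (GammaI S (d2 S t, \<eta>) *v UI t x) $ i) else 0)" if "j < ord S i"
proof (cases "i \<in> II \<and> \<not> Suc j < r i")
  case True
  then have "j = r i - 1" using that by auto
  then show ?thesis using True that unfolding gf_def by (simp add: drift_def)
next
  case False then show ?thesis using that unfolding gf_def by auto
qed

lemma wfx_dEE: "wfx (Suc (Suc j)) (Suc j) (dEE j)"
  by (simp add: dEE_def)

lemma gf_bounded:
  assumes \<epsilon>: "\<epsilon> > 0"
  shows "\<exists>M\<ge>0. \<forall>b. AE t in lebesgue_on {0..b}. \<forall>x \<eta>. goodeps \<epsilon> t x \<longrightarrow> norm x \<le> B \<longrightarrow> norm \<eta> \<le> c \<longrightarrow> norm (gf t x \<eta>) \<le> M"
proof -
  obtain D where D: "\<forall>b. AE t in lebesgue_on {0..b}. norm (d2 S t) \<le> D" using Linf_bd[OF d_Linf(2)] by blast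
  obtain U where U: "\<forall>t y. goodeps \<epsilon> t y \<longrightarrow> norm y \<le> B \<longrightarrow> norm (UI t y) \<le> U" using UI_bounded[OF \<epsilon>, of B] by blast
  obtain G where G: "\<forall>x y. norm x \<le> D \<longrightarrow> norm y \<le> c \<longrightarrow> norm (GammaI S (x, y)) \<le> G"
    using continuous_bounded_cball[OF GI_cont, of D c] by blast
  have "continuous_on UNIV (\<lambda>p :: (real ^ 'm ^ 'm) \<times> (real ^ 'm). fst p *v snd p)"
    unfolding matrix_vector_mult_def by (intro continuous_intros)
  then obtain P where P: "\<forall>(A :: real ^ 'm ^ 'm) (y :: real ^ 'm). norm A \<le> G \<longrightarrow> norm y \<le> U \<longrightarrow> norm (A *v y :: real ^ 'm) \<le> P"
    using continuous_bounded_cball[of "\<lambda>p :: (real ^ 'm ^ 'm) \<times> (real ^ 'm). fst p *v snd p" G U] by auto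
  have comp: "\<exists>M. \<forall>b. AE t in lebesgue_on {0..b}. \<forall>x \<eta>. goodeps \<epsilon> t x \<longrightarrow> norm x \<le> B \<longrightarrow> norm \<eta> \<le> c \<longrightarrow> \<bar>gf t x \<eta> $ n\<bar> \<le> M" for n
  proof -
    define i where "i = ci n"
    define j where "j = cj n"
    have j: "j < ord S i" using cj_less[of n] by (simp add: i_def j_def)
    have gn: "gf t x \<eta> $ n = st (gf t x \<eta>) i j" for t x \<eta> by (simp add: nth_st i_def j_def)
    consider "i \<notin> II" | "i \<in> II" "Suc j < r i" | "i \<in> II" "\<not> Suc j < r i" by blast
    then show ?thesis
    proof cases
      case 1
      show ?thesis by (rule exI[of _ 0]) (simp add: gn gf_nth[OF j] 1)
    next
      case 2
      obtain E where E: "\<forall>t\<ge>0. \<forall>y. goodR \<epsilon> t y \<longrightarrow> norm y \<le> B \<longrightarrow> \<bar>ev (ph i t) (st y i) (dEE j)\<bar> \<le> E"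
      proof -
        have le: "Suc (Suc j) \<le> r i" "Suc j \<le> r i - 1" using 2 by auto
        show ?thesis using that ev_goodR_bounded[OF 2(1) wfx_dEE le \<epsilon>, of B] by blast
      qed
      show ?thesis
        by (intro exI[of _ E] allI AE_I2) (use E in \<open>auto simp: gn gf_nth[OF j] 2 space_restrict_space goodeps_def\<close>)
    next
      case 3
      obtain M where M: "\<forall>b. AE t in lebesgue_on {0..b}. \<forall>x \<eta>. goodR \<epsilon> t x \<longrightarrow> norm x \<le> B \<longrightarrow> norm \<eta> \<le> c \<longrightarrow> \<bar>drift i t x \<eta>\<bar> \<le> M"
        using drift_bounded[OF 3(1) \<epsilon>, of B c] by blast
      have "AE t in lebesgue_on {0..b}. \<forall>x \<eta>. goodeps \<epsilon> t x \<longrightarrow> norm x \<le> B \<longrightarrow> norm \<eta> \<le> c \<longrightarrow> \<bar>gf t x \<eta> $ n\<bar> \<le> M + P" for b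
        using M[THEN spec, of b] D[THEN spec, of b]
      proof eventually_elim
        case (elim t)
        show ?case
        proof (intro allI impI)
          fix x \<eta> assume a: "goodeps \<epsilon> t x" "norm x \<le> B" "norm (\<eta> :: real ^ 'k) \<le> c"
          have "norm (GammaI S (d2 S t, \<eta>)) \<le> G" using G elim(2) a(3) by blast
          moreover have "norm (UI t x) \<le> U" using U a by blast
          ultimately have "norm (GammaI S (d2 S t, \<eta>) *v UI t x) \<le> P" using P by blast
          then have "\<bar>(GammaI S (d2 S t, \<eta>) *v UI t x) $ i\<bar> \<le> P" using component_le_norm_cart order_trans by blast
          moreover have "\<bar>drift i t x \<eta>\<bar> \<le> M" using elim(1) a by (simp add: goodeps_def)
          ultimately show "\<bar>gf t x \<eta> $ n\<bar> \<le> M + P" using 3 by (simp add: gn gf_nth[OF j])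
        qed
      qed
      then show ?thesis by blast
    qed
  qed
  have "\<forall>n. \<exists>M. \<forall>b. AE t in lebesgue_on {0..b}. \<forall>x \<eta>. goodeps \<epsilon> t x \<longrightarrow> norm x \<le> B \<longrightarrow> norm \<eta> \<le> c \<longrightarrow> \<bar>gf t x \<eta> $ n\<bar> \<le> M"
    by (rule allI) (rule comp)
  from choice[OF this] obtain Mn where
    Mn: "\<forall>n b. AE t in lebesgue_on {0..b}. \<forall>x \<eta>. goodeps \<epsilon> t x \<longrightarrow> norm x \<le> B \<longrightarrow> norm \<eta> \<le> c \<longrightarrow> \<bar>gf t x \<eta> $ n\<bar> \<le> Mn n"
    by (elim exE)
  have "AE t in lebesgue_on {0..b}. \<forall>x \<eta>. goodeps \<epsilon> t x \<longrightarrow> norm x \<le> B \<longrightarrow> norm \<eta> \<le> c \<longrightarrow> norm (gf t x \<eta>) \<le> \<bar>\<Sum>n\<in>UNIV. Mn n\<bar>" for b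
  proof -
    have "AE t in lebesgue_on {0..b}. \<forall>n. \<forall>x \<eta>. goodeps \<epsilon> t x \<longrightarrow> norm x \<le> B \<longrightarrow> norm \<eta> \<le> c \<longrightarrow> \<bar>gf t x \<eta> $ n\<bar> \<le> Mn n"
      using Mn by (intro eventually_all_finite) blast
    then show ?thesis
    proof eventually_elim
      case (elim t)
      show ?case
      proof (intro allI impI)
        fix x \<eta> assume a: "goodeps \<epsilon> t x" "norm x \<le> B" "norm (\<eta> :: real ^ 'k) \<le> c"
        have "norm (gf t x \<eta>) \<le> (\<Sum>n\<in>UNIV. \<bar>gf t x \<eta> $ n\<bar>)" by (rule norm_le_l1_cart)
        also have "\<dots> \<le> (\<Sum>n\<in>UNIV. Mn n)" using elim a by (intro sum_mono) blast
        finally show "norm (gf t x \<eta>) \<le> \<bar>\<Sum>n\<in>UNIV. Mn n\<bar>" by linarith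
      qed
    qed
  qed
  then show ?thesis by (intro exI[of _ "\<bar>\<Sum>n\<in>UNIV. Mn n\<bar>"]) auto
qed

lemma gf_measurable:
  assumes c: "0 \<le> c" "continuous_on {c..d} u" "\<And>t. t \<in> {c..d} \<Longrightarrow> good t (u t)"
    and \<eta>: "\<eta> \<in> borel_measurable (lebesgue_on {c..d})"
  shows "(\<lambda>t. gf t (u t) (\<eta> t)) \<in> borel_measurable (lebesgue_on {c..d})"
proof (rule borel_measurable_vec_nth)
  fix n
  let ?M = "lebesgue_on {c..d}"
  have sub: "f \<in> borel_measurable ?M" if "continuous_on {c..d} f" for f :: "real \<Rightarrow> 'z::euclidean_space"
    using that by (intro continuous_imp_measurable_on_sets_lebesgue) auto
  have sub0: "f \<in> borel_measurable ?M" if "f \<in> borel_measurable (lebesgue_on {0..d})" for f :: "real \<Rightarrow> 'z::euclidean_space"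
    using that by (rule borel_measurable_lebesgue_on_subset) (use c in auto)
  have D: "d1 S \<in> borel_measurable ?M" "d2 S \<in> borel_measurable ?M"
    using Linf_ebd[OF d_Linf(1)] Linf_ebd[OF d_Linf(2)] by (auto simp: ebd_def intro!: sub0)
  have g': "0 \<le> t \<and> good t (u t)" if "t \<in> {c..d}" for t using c that by auto
  have U: "(\<lambda>t. UI t (u t)) \<in> borel_measurable ?M"
    by (rule sub, rule UI_continuous) (use c(2) g' in auto)
  have V: "(\<lambda>t. (GammaI S (d2 S t, \<eta> t) *v UI t (u t)) $ i) \<in> borel_measurable ?M" for i
    using borel_measurable_continuous_on[OF bounded_linear.continuous_on[OF bounded_linear_vec_nth continuous_on_id]
      borel_measurable_mat_vec[OF borel_measurable_compose_continuous[OF GI_cont D(2) \<eta>] U], of i] by simp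
  have W: "(\<lambda>t. f1 S (d1 S t, \<eta> t) $ i) \<in> borel_measurable ?M" for i
    using borel_measurable_continuous_on[OF bounded_linear.continuous_on[OF bounded_linear_vec_nth continuous_on_id]
      borel_measurable_compose_continuous[OF f1_cont D(1) \<eta>], of i] by simp
  define i where "i = ci n"
  define j where "j = cj n"
  have j: "j < ord S i" using cj_less[of n] by (simp add: i_def j_def)
  have gn: "gf t x \<eta> $ n = st (gf t x \<eta>) i j" for t x \<eta> by (simp add: nth_st i_def j_def)
  consider "i \<notin> II" | "i \<in> II" "Suc j < r i" | "i \<in> II" "\<not> Suc j < r i" by blast
  then show "(\<lambda>t. gf t (u t) (\<eta> t) $ n) \<in> borel_measurable ?M"
  proof cases
    case 1 then show ?thesis by (simp add: gn gf_nth[OF j])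
  next
    case 2
    have "continuous_on {c..d} (\<lambda>t. ev (ph i t) (st (u t) i) (dEE j))"
      by (rule ev_good_continuous[OF 2(1) wfx_dEE]) (use 2 c(2) g' in auto)
    then show ?thesis using 2 by (simp add: gn gf_nth[OF j] sub)
  next
    case 3
    have "wfx (Suc (r i - 1)) (r i - 1) (dex (Rx (r i - 1)))" by (intro wfx_dex wfx_Rx) simp
    then have "continuous_on {c..d} (\<lambda>t. ev (ph i t) (st (u t) i) (dex (Rx (r i - 1))))"
      by (rule ev_good_continuous[OF 3(1)]) (use r_pos[OF 3(1)] c(2) g' in auto)
    then have "(\<lambda>t. ev (ph i t) (st (u t) i) (dex (Rx (r i - 1)))) \<in> borel_measurable ?M" by (rule sub)
    moreover have "yr i (r i) \<in> borel_measurable ?M" using yr_top[of i] 3 by (auto simp: ebd_def intro!: sub0)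
    ultimately have "(\<lambda>t. drift i t (u t) (\<eta> t) + (GammaI S (d2 S t, \<eta> t) *v UI t (u t)) $ i) \<in> borel_measurable ?M"
      unfolding drift_def by (intro borel_measurable_add borel_measurable_diff V W)
    then show ?thesis using 3 by (simp add: gn gf_nth[OF j])
  qed
qed

text \<open>\<open>M\<close> depends on \<open>\<epsilon>\<close>, \<open>B\<close> and
  \<open>c\<close> alone, so it serves all approximants and solutions on all intervals.\<close>

lemma gf_path_ebd:
  assumes \<epsilon>: "\<epsilon> > 0"
  shows "\<exists>M\<ge>0. \<forall>a b u \<eta>. 0 \<le> a \<longrightarrow> continuous_on {a..b} u \<longrightarrow> (\<forall>t\<in>{a..b}. goodeps \<epsilon> t (u t) \<and> norm (u t) \<le> B) \<longrightarrow>
    \<eta> \<in> borel_measurable (lebesgue_on {a..b}) \<longrightarrow> (AE t in lebesgue_on {a..b}. norm (\<eta> t) \<le> c) \<longrightarrow> ebd M a b (\<lambda>t. gf t (u t) (\<eta> t))"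
proof -
  obtain M where M: "M \<ge> 0" "\<forall>b. AE t in lebesgue_on {0..b}. \<forall>x \<eta>. goodeps \<epsilon> t x \<longrightarrow> norm x \<le> B \<longrightarrow> norm \<eta> \<le> c \<longrightarrow> norm (gf t x \<eta>) \<le> M"
    using gf_bounded[OF \<epsilon>, of B c] by blast
  show ?thesis
    unfolding ebd_def
  proof (rule exI[of _ M], intro conjI allI impI M(1))
    fix a b :: real and u and \<eta> :: "real \<Rightarrow> real ^ 'k"
    assume a: "0 \<le> a" and u: "continuous_on {a..b} u" "\<forall>t\<in>{a..b}. goodeps \<epsilon> t (u t) \<and> norm (u t) \<le> B"
      and m: "\<eta> \<in> borel_measurable (lebesgue_on {a..b})" and bd: "AE t in lebesgue_on {a..b}. norm (\<eta> t) \<le> c"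
    show "(\<lambda>t. gf t (u t) (\<eta> t)) \<in> borel_measurable (lebesgue_on {a..b})"
      using u goodeps_good[OF \<epsilon>] by (intro gf_measurable a m) auto
    have "AE t in lebesgue_on {a..b}. \<forall>x \<eta>. goodeps \<epsilon> t x \<longrightarrow> norm x \<le> B \<longrightarrow> norm \<eta> \<le> c \<longrightarrow> norm (gf t x \<eta>) \<le> M"
      by (rule AE_lebesgue_on_subset[OF M(2)[THEN spec, of b]]) (use a in auto)
    then show "AE t in lebesgue_on {a..b}. norm (gf t (u t) (\<eta> t)) \<le> M"
      using bd AE_space
    proof eventually_elim
      case (elim t)
      then have "t \<in> {a..b}" by (simp add: space_restrict_space)
      then show ?case using elim(1,2) u(2) by blast
    qed
  qed
qed

text \<open>At a fixed time the right-hand side is continuous in the state and the operator value.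
  In time it is only measurable, so limits under the integral are taken pointwise by this
  rule.\<close>

lemma gf_tendsto:
  assumes t: "t \<ge> 0" and g: "good t x" "\<And>n. good t (X n)" and X: "X \<longlonglongrightarrow> x" and H: "H \<longlonglongrightarrow> \<eta>"
  shows "(\<lambda>n. gf t (X n) (H n)) \<longlonglongrightarrow> gf t x \<eta>"
proof (rule vec_tendstoI)
  fix k
  define i where "i = ci k"
  define j where "j = cj k"
  have j: "j < ord S i" using cj_less[of k] by (simp add: i_def j_def)
  have gn: "gf t x \<eta> $ k = st (gf t x \<eta>) i j" for t x \<eta> by (simp add: nth_st i_def j_def)
  have comp: "(\<lambda>n. F (X n)) \<longlonglongrightarrow> F x" if "continuous_on {x. good t x} F" for F :: "real ^ 'n \<Rightarrow> 'z::topological_space"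
    using continuous_on_tendsto_compose[OF that X] g by simp
  have e: "(\<lambda>n. ev (ph i t) (st (X n) i) y) \<longlonglongrightarrow> ev (ph i t) (st x i) y"
    if "i \<in> II" "wfx n m y" "n \<le> r i" "m \<le> r i - 1" for y n m
    by (rule comp, rule ev_good_continuous[OF that]) (use t in auto)
  have U: "(\<lambda>n. UI t (X n)) \<longlonglongrightarrow> UI t x" by (rule comp, rule UI_continuous) (use t in auto)
  have GI: "(\<lambda>n. GammaI S (d2 S t, H n)) \<longlonglongrightarrow> GammaI S (d2 S t, \<eta>)"
    by (rule continuous_on_tendsto_compose[OF GI_cont tendsto_Pair[OF tendsto_const H]]) auto
  have F1: "(\<lambda>n. f1 S (d1 S t, H n)) \<longlonglongrightarrow> f1 S (d1 S t, \<eta>)"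
    by (rule continuous_on_tendsto_compose[OF f1_cont tendsto_Pair[OF tendsto_const H]]) auto
  have V: "(\<lambda>n. (GammaI S (d2 S t, H n) *v UI t (X n)) $ i) \<longlonglongrightarrow> (GammaI S (d2 S t, \<eta>) *v UI t x) $ i"
    unfolding matrix_vector_mult_def by (auto intro!: tendsto_intros GI U)
  consider "i \<notin> II" | "i \<in> II" "Suc j < r i" | "i \<in> II" "\<not> Suc j < r i" by blast
  then show "(\<lambda>n. gf t (X n) (H n) $ k) \<longlonglongrightarrow> gf t x \<eta> $ k"
  proof cases
    case 1 then show ?thesis by (simp add: gn gf_nth[OF j])
  next
    case 2 then show ?thesis using e[OF 2(1) wfx_dEE] by (simp add: gn gf_nth[OF j])
  next
    case 3
    have "wfx (Suc (r i - 1)) (r i - 1) (dex (Rx (r i - 1)))" by (intro wfx_dex wfx_Rx) simp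
    from e[OF 3(1) this] have "(\<lambda>n. ev (ph i t) (st (X n) i) (dex (Rx (r i - 1)))) \<longlonglongrightarrow> ev (ph i t) (st x i) (dex (Rx (r i - 1)))"
      using r_pos[OF 3(1)] by simp
    then have "(\<lambda>n. drift i t (X n) (H n) + (GammaI S (d2 S t, H n) *v UI t (X n)) $ i) \<longlonglongrightarrow> drift i t x \<eta> + (GammaI S (d2 S t, \<eta>) *v UI t x) $ i"
      unfolding drift_def by (intro tendsto_intros V F1)
    then show ?thesis using 3 by (simp add: gn gf_nth[OF j])
  qed
qed

lemma Yf_bounded:
  assumes \<epsilon>: "\<epsilon> > 0"
  shows "\<exists>M. \<forall>t\<ge>0. \<forall>x. goodR \<epsilon> t x \<longrightarrow> norm x \<le> B \<longrightarrow> norm (Yf t x) \<le> M"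
proof -
  have "\<exists>M. \<forall>t\<ge>0. \<forall>x. goodR \<epsilon> t x \<longrightarrow> norm x \<le> B \<longrightarrow> \<bar>Yf t x $ n\<bar> \<le> M" for n
  proof -
    define i where "i = ci n"
    define j where "j = cj n"
    have j: "j < ord S i" using cj_less[of n] by (simp add: i_def j_def)
    have Yn: "Yf t x $ n = yr i j t + st x i j - ev (ph i t) (st x i) (Rx j)" for t x
      by (simp add: Yf_def Yvec_nth i_def j_def)
    obtain D where D: "\<forall>x\<in>yr i j ` {0..}. norm x \<le> D" using yr_bdd[OF j] unfolding bounded_iff by blast
    have "\<exists>E. \<forall>t\<ge>0. \<forall>y. goodR \<epsilon> t y \<longrightarrow> norm y \<le> B \<longrightarrow> \<bar>ev (ph i t) (st y i) (Rx j)\<bar> \<le> E"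
    proof (cases "i \<in> II")
      case True
      have "j \<le> r i" "j \<le> r i - 1" using j True by auto
      then show ?thesis by (rule ev_goodR_bounded[OF True wfx_Rx _ _ \<epsilon>])
    next
      case False
      then have "j = 0" using j by simp
      then show ?thesis by (intro exI[of _ 0]) simp
    qed
    then obtain E where E: "\<forall>t\<ge>0. \<forall>y. goodR \<epsilon> t y \<longrightarrow> norm y \<le> B \<longrightarrow> \<bar>ev (ph i t) (st y i) (Rx j)\<bar> \<le> E" by blast
    have "\<bar>Yf t x $ n\<bar> \<le> D + B + E" if "t \<ge> 0" "goodR \<epsilon> t x" "norm x \<le> B" for t x
    proof -
      have "\<bar>yr i j t\<bar> \<le> D" using D that(1) by auto
      moreover have "\<bar>st x i j\<bar> \<le> B" using st_le_norm[of x i j] that(3) by linarith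
      moreover have "\<bar>ev (ph i t) (st x i) (Rx j)\<bar> \<le> E" using E that by blast
      ultimately show ?thesis unfolding Yn by linarith
    qed
    then show ?thesis by blast
  qed
  then have "\<forall>n. \<exists>M. \<forall>t\<ge>0. \<forall>x. goodR \<epsilon> t x \<longrightarrow> norm x \<le> B \<longrightarrow> \<bar>Yf t x $ n\<bar> \<le> M" by (rule allI)
  from choice[OF this] obtain M where M: "\<forall>n. \<forall>t\<ge>0. \<forall>x. goodR \<epsilon> t x \<longrightarrow> norm x \<le> B \<longrightarrow> \<bar>Yf t x $ n\<bar> \<le> M n" by (elim exE)
  have "norm (Yf t x) \<le> (\<Sum>n\<in>UNIV. M n)" if "t \<ge> 0" "goodR \<epsilon> t x" "norm x \<le> B" for t x
  proof -
    have "norm (Yf t x) \<le> (\<Sum>n\<in>UNIV. \<bar>Yf t x $ n\<bar>)" by (rule norm_le_l1_cart)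
    also have "\<dots> \<le> (\<Sum>n\<in>UNIV. M n)" using M that by (intro sum_mono) blast
    finally show ?thesis .
  qed
  then show ?thesis by blast
qed

lemma VII_bounded:
  assumes \<epsilon>: "\<epsilon> > 0"
  shows "\<exists>M. \<forall>t\<ge>0. \<forall>x \<eta>. goodeps \<epsilon> t x \<longrightarrow> norm x \<le> B \<longrightarrow> norm \<eta> \<le> c \<longrightarrow>
    norm (f2 S (Yf t x) + f3 S (d3 S t, \<eta>) + GammaII S (d4 S t, \<eta>) *v UI t x) \<le> M"
proof -
  obtain Y where Y: "\<forall>t\<ge>0. \<forall>x. goodR \<epsilon> t x \<longrightarrow> norm x \<le> B \<longrightarrow> norm (Yf t x) \<le> Y" using Yf_bounded[OF \<epsilon>, of B] by blast
  obtain U where U: "\<forall>t y. goodeps \<epsilon> t y \<longrightarrow> norm y \<le> B \<longrightarrow> norm (UI t y) \<le> U" using UI_bounded[OF \<epsilon>, of B] by blast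
  obtain D3 where D3: "\<forall>v\<in>{()}. \<forall>t\<in>{0..}. norm (d3 S t) \<le> D3" using ubl_boundD[OF Winf_ubl(1)[OF d_Winf(1), of "{()}"]] by blast
  obtain D4 where D4: "\<forall>v\<in>{()}. \<forall>t\<in>{0..}. norm (d4 S t) \<le> D4" using ubl_boundD[OF Winf_ubl(1)[OF d_Winf(2), of "{()}"]] by blast
  have "bounded (f2 S ` cball 0 Y)"
    by (intro compact_imp_bounded compact_continuous_image C1_continuous[OF C1s(1)]) simp
  then obtain F2 where F2: "\<forall>w\<in>f2 S ` cball 0 Y. norm w \<le> F2" unfolding bounded_iff by blast
  obtain F3 where F3: "\<forall>x y. norm x \<le> D3 \<longrightarrow> norm y \<le> c \<longrightarrow> norm (f3 S (x, y)) \<le> F3"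
    using continuous_bounded_cball[OF C1_continuous[OF C1s(2)], of D3 c] by blast
  obtain G where G: "\<forall>x y. norm x \<le> D4 \<longrightarrow> norm y \<le> c \<longrightarrow> norm (GammaII S (x, y)) \<le> G"
    using continuous_bounded_cball[OF C1_continuous[OF C1s(3)], of D4 c] by blast
  have "continuous_on UNIV (\<lambda>p :: (real ^ 'm ^ 'm) \<times> (real ^ 'm). fst p *v snd p)"
    unfolding matrix_vector_mult_def by (intro continuous_intros)
  then obtain P where P: "\<forall>(A :: real ^ 'm ^ 'm) (y :: real ^ 'm). norm A \<le> G \<longrightarrow> norm y \<le> U \<longrightarrow> norm (A *v y :: real ^ 'm) \<le> P"
    using continuous_bounded_cball[of "\<lambda>p :: (real ^ 'm ^ 'm) \<times> (real ^ 'm). fst p *v snd p" G U] by auto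
  have "norm (f2 S (Yf t x) + f3 S (d3 S t, \<eta>) + GammaII S (d4 S t, \<eta>) *v UI t x) \<le> F2 + F3 + P"
    if a: "t \<ge> 0" "goodeps \<epsilon> t x" "norm x \<le> B" "norm \<eta> \<le> c" for t x \<eta>
  proof -
    have "norm (Yf t x) \<le> Y" using Y a by (simp add: goodeps_def)
    then have 1: "norm (f2 S (Yf t x)) \<le> F2" using F2 by auto
    have 2: "norm (f3 S (d3 S t, \<eta>)) \<le> F3" using F3 D3 a by simp
    have "norm (GammaII S (d4 S t, \<eta>)) \<le> G" using G D4 a by simp
    then have 3: "norm (GammaII S (d4 S t, \<eta>) *v UI t x) \<le> P" using P U a by simp
    show ?thesis by (intro norm_triangle_mono 1 2 3)
  qed
  then show ?thesis by blast
qed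

text \<open>Homogeneity reduces the claim to unit vectors of \<open>coords II\<close>; there the
  form is positive and attains its minimum on a compact set. This constant is the damping of the
  first block by its input.\<close>

lemma GammaI_coercive:
  "\<exists>\<gamma>>0. \<forall>d \<eta> x. norm d \<le> D \<longrightarrow> norm \<eta> \<le> c \<longrightarrow> x \<in> coords II \<longrightarrow> \<gamma> * (norm x)\<^sup>2 \<le> x \<bullet> (GammaI S (d, \<eta>) *v x)"
proof -
  define q where "q z = snd z \<bullet> (GammaI S (fst z) *v snd z)" for z
  define K where "K = ((cball 0 D :: (real ^ 's) set) \<times> (cball 0 c :: (real ^ 'k) set)) \<times> (coords II \<inter> sphere 0 1 :: (real ^ 'm) set)"
  have "closed (coords II :: (real ^ 'm) set)"
  proof -
    have "coords II = (\<Inter>i\<in>-II. {x :: real ^ 'm. x $ i = 0})" by (auto simp: coords_def)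
    moreover have "closed {x :: real ^ 'm. x $ i = 0}" for i
      by (rule closed_Collect_eq) (intro continuous_intros)+
    ultimately show ?thesis by (simp add: closed_INT)
  qed
  then have K: "compact K" unfolding K_def by (intro compact_Times closed_Int_compact compact_cball compact_sphere)
  have cq: "continuous_on K q"
    unfolding q_def by (intro continuous_intros continuous_on_mat_vec continuous_on_compose2[OF GI_cont]) auto
  have pos: "q z > 0" if "z \<in> K" for z
  proof -
    obtain p x where z: "z = (p, x)" by (cases z)
    have x: "x \<in> coords II" "x \<noteq> 0" using that by (auto simp: K_def z)
    have "x \<bullet> ((GammaI S p + transpose (GammaI S p)) *v x) > 0" using A1 x unfolding assmA1_def by blast
    moreover have "x \<bullet> ((GammaI S p + transpose (GammaI S p)) *v x) = 2 * (x \<bullet> (GammaI S p *v x))"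
      by (simp add: matrix_vector_mult_add_rdistrib inner_add_right dot_lmul_matrix[symmetric] transpose_matrix_vector inner_commute)
    ultimately show ?thesis by (simp add: q_def z)
  qed
  have "\<exists>\<gamma>>0. \<forall>z\<in>K. \<gamma> \<le> q z"
  proof (cases "K = {}")
    \<comment> \<open>This occurs, for instance, if the first block is empty and there is no unit
      vector.\<close>
    case True then show ?thesis by (intro exI[of _ 1]) auto
  next
    case False
    then obtain z where "z \<in> K" "\<forall>y\<in>K. q z \<le> q y" using continuous_attains_inf[OF K False cq] by blast
    then show ?thesis using pos by (intro exI[of _ "q z"]) auto
  qed
  then obtain \<gamma> where \<gamma>: "\<gamma> > 0" "\<forall>z\<in>K. \<gamma> \<le> q z" by blast
  have "\<gamma> * (norm x)\<^sup>2 \<le> x \<bullet> (GammaI S (d, \<eta>) *v x)" if a: "norm d \<le> D" "norm \<eta> \<le> c" "x \<in> coords II" for d \<eta> x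
  proof (cases "x = 0")
    case False
    define y where "y = (1 / norm x) *\<^sub>R x"
    have "((d, \<eta>), y) \<in> K" using a False by (auto simp: K_def y_def coords_def)
    then have "\<gamma> \<le> y \<bullet> (GammaI S (d, \<eta>) *v y)" using \<gamma>(2) by (auto simp: q_def)
    also have "\<dots> = (x \<bullet> (GammaI S (d, \<eta>) *v x)) / (norm x)\<^sup>2"
      unfolding y_def matrix_vector_mult_scaleR inner_scaleR_left inner_scaleR_right by (simp add: power2_eq_square)
    finally show ?thesis using False by (simp add: field_simps)
  qed simp
  then show ?thesis using \<gamma>(1) by blast
qed

end

section \<open>Initial errors\<close>

lemma ev_cong: "wfx n m x \<Longrightarrow> (\<And>j. j < n \<Longrightarrow> e j = e' j) \<Longrightarrow> ev p e x = ev p e' x"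
  by (induction x) auto

text \<open>As \<open>\<omega>\<close> is excluded, a right neighbourhood of every \<open>t\<close>
  in the domain stays inside it; values beyond \<open>\<omega>\<close> do not influence
  derivatives.\<close>

lemma tdom_nhd:
  assumes "t \<in> tdom a \<omega>" "\<And>s. s \<in> tdom a \<omega> \<Longrightarrow> f s = g s"
  shows "\<forall>\<^sub>F s in at t within {a..}. f s = g s"
proof -
  obtain d where d: "t < d" "ereal d < \<omega>" using assms(1) ereal_less_obtain by (auto simp: tdom_def)
  have "\<forall>\<^sub>F s in at t within {a..}. s < d" using d(1) by (rule order_tendstoD(2)[OF tendsto_ident_at])
  moreover have "\<forall>\<^sub>F s in at t within {a..}. s \<in> {a..}" by (auto simp: eventually_at_filter)
  ultimately show ?thesis
  proof eventually_elim
    case (elim s)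
    then have "s \<in> tdom a \<omega>" using less_trans[of "ereal s" "ereal d" \<omega>] d(2) by (simp add: tdom_def)
    then show ?case by (rule assms(2))
  qed
qed

lemma has_real_derivative_tdom_cong:
  assumes "(f has_real_derivative D) (at t within {a..})" "t \<in> tdom a \<omega>" "\<And>s. s \<in> tdom a \<omega> \<Longrightarrow> f s = g s"
  shows "(g has_real_derivative D) (at t within {a..})"
  using has_field_derivative_cong_eventually[OF tdom_nhd[OF assms(2,3)]] assms by auto

text \<open>Derivatives within the half-line are unique because each of its points is a limit point.
  Applied to \<open>nderiv a j f\<close>, the rule also computes the derivative of order
  \<open>Suc j\<close>.\<close>

lemma nderiv_1_eq:
  assumes "(f has_real_derivative D) (at t within {a..})" "a \<le> t"
  shows "nderiv a (Suc 0) f t = D"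
proof -
  have "at t within {a..} \<noteq> bot"
  proof -
    have "t islimpt {a..t + 1}" by (rule connected_imp_perfect) (use assms(2) in auto)
    then have "t islimpt {a..}" by (rule islimpt_subset) auto
    then show ?thesis by (simp add: trivial_limit_within)
  qed
  then show ?thesis
    using assms(1) vector_derivative_within[of t "{a..}" f D] by (simp add: has_real_derivative_iff_has_vector_derivative)
qed

context fdae_loop
begin

lemma yr_deriv:
  assumes "Suc j < ord S i" "t \<ge> 0"
  shows "(yr i j has_real_derivative yr i (Suc j) t) (at t within {0..})"
proof -
  have "(yr i j has_vector_derivative yr i (Suc j) t) (at t within {0..t + 1})" "t < t + 1"
    using assms continuous_on_subset[OF yr_cont[OF assms(1)], of "{0..t+1}"]
    by (auto intro!: acb_has_vector_derivative[OF yr_acb])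
  from has_vector_derivative_within_Ici[OF this] show ?thesis
    by (simp add: has_real_derivative_iff_has_vector_derivative)
qed

text \<open>\<open>Rx j\<close> expresses \<open>e\<^sub>i\<^sub>j\<close> through \<open>e\<^sub>i\<^sup>(\<^sup>j\<^sup>)\<close> and the previous errors; the derivatives of the errors
  are again expressions in the errors.\<close>

lemma err_formula:
  assumes i: "i \<in> II"
    and Y0: "\<And>t. t \<in> tdom 0 \<omega> \<Longrightarrow> Y 0 t = y t $ i"
    and Yd: "\<And>j t. Suc j < r i \<Longrightarrow> t \<in> tdom 0 \<omega> \<Longrightarrow> (Y j has_real_derivative Y (Suc j) t) (at t within {0..})"
  shows "n < r i \<Longrightarrow> (\<And>j t. j < n \<Longrightarrow> t \<in> tdom 0 \<omega> \<Longrightarrow> gain_denom (phi C i j) (err C y i j) t \<noteq> 0) \<Longrightarrow>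
    \<forall>j\<le>n. \<forall>t\<in>tdom 0 \<omega>. err C y i j t = Y j t - yr i j t + ev (ph i t) (\<lambda>k. err C y i k t) (Rx j) \<and>
      (Suc j < r i \<longrightarrow> (err C y i j has_real_derivative ev (ph i t) (\<lambda>k. err C y i k t) (dEE j)) (at t within {0..}))"
proof (induction n)
  have t0: "t \<ge> 0" if "t \<in> tdom 0 \<omega>" for t using that by (simp add: tdom_def)
  \<comment> \<open>The formula for \<open>e\<^sub>n\<close> is differentiated with
    \<open>ev_deriv\<close>. Inserted into the recursive definition, the result gives both the chain
    equation and the formula for the next error.\<close>
  have step: "(err C y i n has_real_derivative ev (ph i t) (\<lambda>k. err C y i k t) (dEE n)) (at t within {0..}) \<and>
      err C y i (Suc n) t = Y (Suc n) t - yr i (Suc n) t + ev (ph i t) (\<lambda>k. err C y i k t) (Rx (Suc n))"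
    if n: "Suc n < r i" and F: "\<And>t. t \<in> tdom 0 \<omega> \<Longrightarrow> err C y i n t = Y n t - yr i n t + ev (ph i t) (\<lambda>k. err C y i k t) (Rx n)"
      and D: "\<And>j t. j < n \<Longrightarrow> t \<in> tdom 0 \<omega> \<Longrightarrow> (err C y i j has_real_derivative ev (ph i t) (\<lambda>k. err C y i k t) (dEE j)) (at t within {0..})"
      and ne: "\<And>j t. j < n \<Longrightarrow> t \<in> tdom 0 \<omega> \<Longrightarrow> gain_denom (phi C i j) (err C y i j) t \<noteq> 0"
      and t: "t \<in> tdom 0 \<omega>" for n t
  proof -
    have dx: "((\<lambda>t. ev (ph i t) (\<lambda>k. err C y i k t) (Rx n)) has_real_derivative ev (ph i t) (\<lambda>k. err C y i k t) (dex (Rx n))) (at t within {0..})"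
    proof (rule ev_deriv[OF wfx_Rx])
      show "((\<lambda>t. ph i t j l) has_real_derivative ph i t j (Suc l)) (at t within {0..})" if "j + l < n" for j l
        using phi_deriv[OF i, of j l t] that n t0[OF t] by simp
      show "1 - (ph i t j 0)\<^sup>2 * (err C y i j t)\<^sup>2 \<noteq> 0" if "j < n" for j
        using ne[OF that t] by (simp add: gain_denom_def ph_def)
    qed (use D[OF _ t] in simp)
    define V where "V = Y (Suc n) t - yr i (Suc n) t + ev (ph i t) (\<lambda>k. err C y i k t) (dex (Rx n))"
    have "((\<lambda>t. Y n t - yr i n t + ev (ph i t) (\<lambda>k. err C y i k t) (Rx n)) has_real_derivative V) (at t within {0..})"
      unfolding V_def by (intro DERIV_add DERIV_diff Yd n t dx yr_deriv t0[OF t]) (use i n in simp)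
    then have d: "(err C y i n has_real_derivative V) (at t within {0..})"
      by (rule has_real_derivative_tdom_cong[OF _ t]) (simp add: F)
    have nd: "nderiv 0 (Suc 0) (err C y i n) t = V" by (rule nderiv_1_eq[OF d t0[OF t]])
    have S: "err C y i (Suc n) t = V + 1 / (1 - (ph i t n 0)\<^sup>2 * (err C y i n t)\<^sup>2) * err C y i n t"
      using nd unfolding err_def by (simp add: gain_denom_def ph_def)
    have "V = ev (ph i t) (\<lambda>k. err C y i k t) (dEE n)" using S by (simp add: dEE_def)
    then show ?thesis using d S by (simp add: V_def)
  qed
  {
    case 0
    have F: "err C y i 0 t = Y 0 t - yr i 0 t + ev (ph i t) (\<lambda>k. err C y i k t) (Rx 0)" if "t \<in> tdom 0 \<omega>" for t
      using Y0[OF that] by (simp add: err_def yr_0)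
    then show ?case using step[OF _ F] by auto
  next
    case (Suc n)
    have IH: "\<And>j t. j \<le> n \<Longrightarrow> t \<in> tdom 0 \<omega> \<Longrightarrow> err C y i j t = Y j t - yr i j t + ev (ph i t) (\<lambda>k. err C y i k t) (Rx j)"
      "\<And>j t. j \<le> n \<Longrightarrow> t \<in> tdom 0 \<omega> \<Longrightarrow> (err C y i j has_real_derivative ev (ph i t) (\<lambda>k. err C y i k t) (dEE j)) (at t within {0..})"
      using Suc by auto
    have F: "err C y i (Suc n) t = Y (Suc n) t - yr i (Suc n) t + ev (ph i t) (\<lambda>k. err C y i k t) (Rx (Suc n))" if "t \<in> tdom 0 \<omega>" for t
      using step[OF Suc.prems(1) IH(1) IH(2) Suc.prems(2) that] by simp
    have "(err C y i (Suc n) has_real_derivative ev (ph i t) (\<lambda>k. err C y i k t) (dEE (Suc n))) (at t within {0..})"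
      if "Suc (Suc n) < r i" "t \<in> tdom 0 \<omega>" for t
      using step[OF that(1) F IH(2) Suc.prems(2) that(2)] by simp
    then show ?case using IH F by (auto simp: le_Suc_eq)
  }
qed

text \<open>The \<open>j\<close>-th derivative of the \<open>i\<close>-th component of
  \<open>init_poly\<close>.\<close>

definition pol :: "'m \<Rightarrow> nat \<Rightarrow> real \<Rightarrow> real" where
  "pol i j t = (\<Sum>l<ord S i - j. y0 i (l + j) 0 / fact l * t ^ l)"

lemma pol_0: "init_poly S y0 t $ i = pol i 0 t"
  by (simp add: pol_def init_poly_def)

lemma pol_at_0: "j < ord S i \<Longrightarrow> pol i j 0 = y0 i j 0"
  unfolding pol_def by (cases "ord S i - j") (auto simp: sum.lessThan_Suc_shift)

lemma pol_deriv:
  assumes "j < ord S i" shows "(pol i j has_real_derivative pol i (Suc j) t) (at t within A)"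
proof -
  obtain n where n: "ord S i - j = Suc n" "ord S i - Suc j = n" using assms by (metis Suc_diff_Suc)
  have eq: "pol i j = (\<lambda>t. y0 i j 0 + (\<Sum>l<n. y0 i (l + Suc j) 0 / fact (Suc l) * t ^ Suc l))"
    unfolding pol_def n sum.lessThan_Suc_shift by (rule ext) (simp del: fact_Suc power_Suc)
  have "((\<lambda>t. y0 i j 0 + (\<Sum>l<n. y0 i (l + Suc j) 0 / fact (Suc l) * t ^ Suc l)) has_real_derivative
      0 + (\<Sum>l<n. y0 i (l + Suc j) 0 / fact (Suc l) * (real (Suc l) * t ^ l))) (at t within A)"
    by (intro DERIV_add DERIV_const DERIV_sum DERIV_cmult) (use DERIV_pow[of "Suc _" t A] in simp)
  moreover have "0 + (\<Sum>l<n. y0 i (l + Suc j) 0 / fact (Suc l) * (real (Suc l) * t ^ l)) = pol i (Suc j) t"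
    unfolding pol_def n by simp
  ultimately show ?thesis using eq by simp
qed

text \<open>The errors of \<open>init_poly\<close> at 0 contain derivatives at 0 and hence involve
  the gains on a right neighbourhood of 0. There the denominators stay positive by continuity, one
  index after the other.\<close>

lemma init_poly_denom:
  assumes i: "i \<in> II"
  shows "n < r i \<Longrightarrow> \<exists>\<omega>>0. \<forall>j<n. \<forall>t\<in>tdom 0 (ereal \<omega>). gain_denom (phi C i j) (err C (init_poly S y0) i j) t \<noteq> 0"
proof (induction n)
  case 0
  show ?case by (intro exI[of _ 1]) simp
next
  case (Suc n)
  then obtain \<omega> where \<omega>: "\<omega> > 0" and ne: "\<And>j t. j < n \<Longrightarrow> t \<in> tdom 0 (ereal \<omega>) \<Longrightarrow> gain_denom (phi C i j) (err C (init_poly S y0) i j) t \<noteq> 0"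
    by auto
  let ?E = "err C (init_poly S y0) i n"
  have n: "n < r i" and n2: "n + 2 \<le> r i" using Suc.prems by auto
  have 0: "0 \<in> tdom 0 (ereal \<omega>)" using \<omega> by (simp add: tdom_def)
  have "(?E has_real_derivative ev (ph i 0) (\<lambda>k. err C (init_poly S y0) i k 0) (dEE n)) (at 0 within {0..})"
    using err_formula[OF i _ _ n ne, of \<omega> "pol i"] pol_0 pol_deriv[of _ i] i Suc.prems 0 by auto
  then have "continuous (at 0 within {0..}) ?E" by (rule DERIV_continuous)
  moreover have "continuous (at 0 within {0..}) (phi C i n)"
    using phi_cont[OF i n2, of 0] n2 by (simp add: ph_def continuous_on_eq_continuous_within)
  ultimately have "continuous (at 0 within {0..}) (gain_denom (phi C i n) ?E)"
    unfolding gain_denom_def by (intro continuous_intros)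
  then have "(gain_denom (phi C i n) ?E \<longlongrightarrow> gain_denom (phi C i n) ?E 0) (at 0 within {0..})"
    by (simp add: continuous_within)
  moreover have "gain_denom (phi C i n) ?E 0 > 0"
  proof -
    have "phi C i n 0 \<ge> 0" using Phi_props(5)[OF phi[OF i n2]] n2 by simp
    then have "(phi C i n 0 * \<bar>?E 0\<bar>)\<^sup>2 < 1" using inj[OF i n2] by (simp add: abs_square_less_1)
    then show ?thesis by (simp add: gain_denom_def power_mult_distrib)
  qed
  ultimately have "\<forall>\<^sub>F t in at 0 within {0..}. gain_denom (phi C i n) ?E t > 0" by (rule order_tendstoD(1))
  then obtain d where d: "d > 0" "\<forall>t\<in>{0..}. t \<noteq> 0 \<and> dist t 0 < d \<longrightarrow> gain_denom (phi C i n) ?E t > 0"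
    unfolding eventually_at by blast
  show ?case
  proof (intro exI[of _ "min \<omega> d"] conjI allI impI ballI)
    fix j t assume j: "j < Suc n" and t: "t \<in> tdom 0 (ereal (min \<omega> d))"
    show "gain_denom (phi C i j) (err C (init_poly S y0) i j) t \<noteq> 0"
    proof (cases "j = n")
      case True
      then show ?thesis using d t \<open>gain_denom (phi C i n) ?E 0 > 0\<close> by (cases "t = 0") (auto simp: tdom_def)
    next
      case False
      then show ?thesis using ne[of j t] j t by (auto simp: tdom_def)
    qed
  qed (use \<omega> d in auto)
qed

lemma err_init:
  assumes i: "i \<in> II" and j: "j < r i"
  shows "err C (init_poly S y0) i j 0 = y0 i j 0 - yr i j 0 + ev (ph i 0) (\<lambda>k. err C (init_poly S y0) i k 0) (Rx j)"
proof -
  have n: "r i - 1 < r i" using r_pos[OF i] by simp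
  obtain \<omega> where \<omega>: "\<omega> > 0" and ne: "\<And>j t. j < r i - 1 \<Longrightarrow> t \<in> tdom 0 (ereal \<omega>) \<Longrightarrow> gain_denom (phi C i j) (err C (init_poly S y0) i j) t \<noteq> 0"
    using init_poly_denom[OF i n] by auto
  have 0: "0 \<in> tdom 0 (ereal \<omega>)" using \<omega> by (simp add: tdom_def)
  have "err C (init_poly S y0) i j 0 = pol i j 0 - yr i j 0 + ev (ph i 0) (\<lambda>k. err C (init_poly S y0) i k 0) (Rx j)"
    using err_formula[OF i _ _ n ne, of \<omega> "pol i"] pol_0 pol_deriv[of _ i] i j 0 by auto
  then show ?thesis using pol_at_0[of j i] i j by simp
qed

definition Y0 :: "real \<Rightarrow> real ^ 'n" where "Y0 t = Yvec S (\<lambda>i j. y0 i j t)"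

definition x0 :: "real ^ 'n" where "x0 = Yvec S (\<lambda>i j. err C (init_poly S y0) i j 0)"

lemma Y0_continuous: "continuous_on {-h..0} Y0"
  unfolding Y0_def using init by (intro continuous_on_Yvec) (auto simp: initial_data_def)

lemma EIx_Yvec: "EIx (Yvec S (\<lambda>i j. err C y i j t)) = errI S C y t"
proof -
  have "r i - 1 < ord S i" if "i \<in> II" for i using r_pos[OF that] that by simp
  then show ?thesis by (simp add: EIx_def errI_def vec_eq_iff)
qed

lemma EIIx_Yvec: "EIIx (Yvec S (\<lambda>i j. err C y i j t)) = errII S C y t"
  by (simp add: EIIx_def errII_def vec_eq_iff err_def)

lemma UI_eq: "EIx x = errI S C y t \<Longrightarrow> UI t x = inputI S C y t"
  by (simp add: UI_def inputI_def gainI_def gain_denom_def)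

lemma square_less_1: "0 \<le> p \<Longrightarrow> 0 \<le> e \<Longrightarrow> p * e < 1 \<Longrightarrow> p\<^sup>2 * e\<^sup>2 < (1::real)"
  using abs_square_less_1[of "p * e"] by (simp add: power_mult_distrib)

lemma x0_good: "good 0 x0"
  unfolding good_def
proof (intro conjI ballI allI impI)
  fix i j assume ij: "i \<in> II" "j + 2 \<le> r i"
  have "phi C i j 0 \<ge> 0" using Phi_props(5)[OF phi[OF ij]] ij by simp
  then have "(phi C i j 0)\<^sup>2 * \<bar>err C (init_poly S y0) i j 0\<bar>\<^sup>2 < 1" by (intro square_less_1 inj[OF ij]) auto
  then show "(phi C i j 0)\<^sup>2 * (st x0 i j)\<^sup>2 < 1" using ij by (simp add: x0_def)
next
  show "(phiI C 0)\<^sup>2 * (norm (EIx x0))\<^sup>2 < 1"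
    unfolding x0_def EIx_Yvec using Phi_props(5)[OF phiI] inI by (intro square_less_1) auto
qed

lemma x0_Yf: "Yf 0 x0 = Y0 0"
proof (rule st_eqI)
  fix i j assume j: "j < ord S i"
  show "st (Yf 0 x0) i j = st (Y0 0) i j"
  proof (cases "i \<in> II")
    case True
    have "ev (ph i 0) (st x0 i) (Rx j) = ev (ph i 0) (\<lambda>k. err C (init_poly S y0) i k 0) (Rx j)"
      by (rule ev_cong[OF wfx_Rx]) (use j True in \<open>auto simp: x0_def\<close>)
    then show ?thesis using err_init[OF True, of j] j True by (simp add: Yf_def Y0_def) (simp add: x0_def)
  next
    case False
    then have "j = 0" using j by simp
    then show ?thesis using False by (simp add: Yf_def Y0_def) (simp add: x0_def err_def yr_0 init_poly_def)
  qed
qed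

end

section \<open>Solutions in error coordinates\<close>

context fdae_loop
begin

text \<open>The signal \<open>Y\<close> on \<open>[-h, a]\<close>, continued by a constant.\<close>

definition path :: "real \<Rightarrow> (real \<Rightarrow> real ^ 'n) \<Rightarrow> real \<Rightarrow> real ^ 'n" where
  "path a u t = (if t \<le> 0 then Y0 t else Yf (min t a) (u (min t a)))"

definition adm :: "real \<Rightarrow> (real \<Rightarrow> real ^ 'n) \<Rightarrow> bool" where
  "adm a u \<longleftrightarrow> 0 \<le> a \<and> continuous_on {0..a} u \<and> u 0 = x0 \<and> (\<forall>t\<in>{0..a}. good t (u t))"

definition W1 :: "real \<Rightarrow> (real \<Rightarrow> real ^ 'n) \<Rightarrow> real \<Rightarrow> real ^ 'k" where "W1 a u = T1 S (path a u)"
definition W2 :: "real \<Rightarrow> (real \<Rightarrow> real ^ 'n) \<Rightarrow> real \<Rightarrow> real ^ 'k" where "W2 a u = T2 S (\<lambda>t. out (path a u t))"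

text \<open>Consistency of the initial value is the algebraic equation at time 0, with the operator
  evaluated on the constant continuation of the history.\<close>

lemma x0_II: "EIIx x0 = eIIf 0 x0 (W2 0 (\<lambda>_. x0) 0)"
proof -
  have "out (path 0 (\<lambda>_. x0) t) = (\<chi> i. y0 i 0 (min t 0))" for t
    using ord_pos by (auto simp: path_def out_def Y0_def x0_Yf vec_eq_iff min_def Suc_le_eq)
  then have w: "W2 0 (\<lambda>_. x0) 0 = localize0 (T2 S) (\<lambda>t. \<chi> i. y0 i 0 t)"
    by (simp add: W2_def localize0_def)
  define w where "w = localize0 (T2 S) (\<lambda>t. \<chi> i. y0 i 0 t)"
  let ?y = "init_poly S y0"
  have e: "EIIx x0 = errII S C ?y 0" and U: "UI 0 x0 = inputI S C ?y 0"
    using UI_eq[of x0 ?y 0] by (simp_all add: x0_def EIIx_Yvec EIx_Yvec)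
  define V where "V = f2 S (Yf 0 x0) + f3 S (d3 S 0, w) + GammaII S (d4 S 0, w) *v UI 0 x0"
  have "V + f4 S (d5 S 0, w) *\<^sub>R inputII S C ?y 0 = 0"
    using consis unfolding consistent_def Let_def V_def w_def U x0_Yf by (simp add: Y0_def)
  then have "(khat C * f4 S (d5 S 0, w) / (1 - (phiII C 0)\<^sup>2 * (norm (EIIx x0))\<^sup>2)) *\<^sub>R EIIx x0 = V"
    by (simp add: inputII_def gainII_def gain_denom_def e algebra_simps)
  moreover have "(phiII C 0)\<^sup>2 * (norm (EIIx x0))\<^sup>2 < 1"
    unfolding e using Phi_props(5)[OF phiII] inII by (intro square_less_1) auto
  ultimately show ?thesis unfolding eIIf_def w w_def[symmetric] V_def[symmetric] Pm_iff[OF kf4_pos] by blast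
qed

text \<open>The closed loop on a compact interval, in integrated form for the first block and
  pointwise for the second. The operators act on the constant continuation of the signal, as they
  require arguments on \<open>[-h, \<infinity>)\<close>.\<close>

definition csol :: "real \<Rightarrow> (real \<Rightarrow> real ^ 'n) \<Rightarrow> bool" where
  "csol a u \<longleftrightarrow> adm a u \<and>
     (\<forall>t\<in>{0..a}. PI (u t) = PI x0 + integral {0..t} (\<lambda>s. gf s (u s) (W1 a u s))) \<and>
     (\<forall>t\<in>{0..a}. EIIx (u t) = eIIf t (u t) (W2 a u t))"

lemma T1: "op_class h (T1 S)" and T2: "op_class_DAE h (T2 S)"
  using A5 by (auto simp: assmA5_def)

lemma path_continuous:
  assumes "adm a u" shows "continuous_on {-h..} (path a u)"
proof -
  have a: "0 \<le> a" "continuous_on {0..a} u" "u 0 = x0" "\<And>t. t \<in> {0..a} \<Longrightarrow> good t (u t)" using assms by (auto simp: adm_def)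
  have m: "continuous_on {0..} (\<lambda>t. min t a)" by (intro continuous_intros)
  have um: "continuous_on {0..} (\<lambda>t. u (min t a))"
    by (rule continuous_on_compose2[OF a(2) m]) (use a in auto)
  have 2: "continuous_on {0..} (\<lambda>t. Yf (min t a) (u (min t a)))"
    by (rule Yf_continuous[OF m um]) (use a in auto)
  have "continuous_on ({-h..0} \<union> {0..}) (path a u)"
    unfolding path_def
  proof (rule continuous_on_cases)
    show "\<forall>t. t \<in> {-h..0} \<and> \<not> t \<le> 0 \<or> t \<in> {0..} \<and> t \<le> 0 \<longrightarrow> Y0 t = Yf (min t a) (u (min t a))"
      using a x0_Yf by auto
  qed (use Y0_continuous 2 in auto)
  moreover have "{-h..0} \<union> {0..} = {-h..}" using h_nonneg by auto
  ultimately show ?thesis by simp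
qed

lemma out_continuous: "continuous_on A f \<Longrightarrow> continuous_on A (\<lambda>t. out (f t))"
  by (rule bounded_linear.continuous_on[OF linear_maps(5)])

lemma path_cong:
  assumes "\<And>s. s \<in> {0..t} \<Longrightarrow> u s = v s" "t \<le> a" "t \<le> b" "s \<le> t"
  shows "path a u s = path b v s"
  using assms by (auto simp: path_def min_def)

text \<open>By causality the operator values up to \<open>t\<close> depend neither on the later
  course of the state nor on where the constant continuation starts.\<close>

lemma W1_cong:
  assumes "adm a u" "adm b v" "\<And>s. s \<in> {0..t} \<Longrightarrow> u s = v s" "0 \<le> t" "t \<le> a" "t \<le> b"
  shows "AE s in lebesgue_on {0..t}. W1 a u s = W1 b v s"
  unfolding W1_def using path_cong[OF assms(3,5,6)] assms(4)
  by (intro op_class_causal[OF T1] path_continuous assms(1,2)) auto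

lemma W2_cong:
  assumes "adm a u" "adm b v" "\<And>s. s \<in> {0..t} \<Longrightarrow> u s = v s" "0 \<le> t" "t \<le> a" "t \<le> b"
  shows "W2 a u t = W2 b v t"
  unfolding W2_def using path_cong[OF assms(3,5,6)] assms(4)
  by (intro DAE_causal[OF T2 h_nonneg] out_continuous path_continuous assms(1,2)) auto

lemma adm_subset: "adm a u \<Longrightarrow> 0 \<le> b \<Longrightarrow> b \<le> a \<Longrightarrow> adm b u"
  unfolding adm_def by (auto intro: continuous_on_subset)

lemma adm_cong:
  assumes "adm a u" "\<And>t. t \<in> {0..a} \<Longrightarrow> v t = u t" shows "adm a v"
proof -
  have "continuous_on {0..a} v" using continuous_on_cong[of "{0..a}" "{0..a}" v u] assms by (auto simp: adm_def)
  then show ?thesis using assms by (auto simp: adm_def)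
qed

lemma W1_measurable: "adm a u \<Longrightarrow> W1 a u \<in> borel_measurable (lebesgue_on {0..b})"
  unfolding W1_def by (intro op_class_measurable[OF T1] path_continuous)

lemma W2_continuous: "adm a u \<Longrightarrow> continuous_on {0..} (W2 a u)"
  unfolding W2_def by (intro DAE_continuous[OF T2] out_continuous path_continuous)

definition Wbd :: "real \<Rightarrow> real \<Rightarrow> real \<Rightarrow> real \<Rightarrow> bool" where
  "Wbd B c1 c2 L \<longleftrightarrow> (\<forall>a u. adm a u \<longrightarrow> (\<forall>t\<ge>-h. norm (path a u t) \<le> B) \<longrightarrow>
     (\<forall>b. AE t in lebesgue_on {0..b}. norm (W1 a u t) \<le> c1) \<and> (\<forall>t\<ge>0. norm (W2 a u t) \<le> c2) \<and>
     (\<forall>s\<ge>0. \<forall>t\<ge>0. norm (W2 a u t - W2 a u s) \<le> L * \<bar>t - s\<bar>))"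

lemma WbdD:
  assumes "Wbd B c1 c2 L" "adm a u" "\<forall>t\<ge>-h. norm (path a u t) \<le> B"
  shows "AE t in lebesgue_on {0..b}. norm (W1 a u t) \<le> c1" "0 \<le> t \<Longrightarrow> norm (W2 a u t) \<le> c2"
    "0 \<le> s \<Longrightarrow> 0 \<le> t \<Longrightarrow> norm (W2 a u t - W2 a u s) \<le> L * \<bar>t - s\<bar>"
  using assms unfolding Wbd_def by simp_all

lemma path_bounded_W: "\<exists>c1 c2 L. 0 \<le> c1 \<and> 0 \<le> c2 \<and> 0 \<le> L \<and> Wbd B c1 c2 L"
proof -
  obtain K where K: "K \<ge> 0" "\<And>y. norm (out y) \<le> norm y * K" using bounded_linear.nonneg_bounded[OF linear_maps(5)] by blast
  obtain c1 where c1: "c1 > 0" "\<forall>\<zeta> b. continuous_on {-h..} \<zeta> \<longrightarrow> (\<forall>t\<ge>-h. norm (\<zeta> t) \<le> B) \<longrightarrow>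
    (AE t in lebesgue_on {0..b}. norm (T1 S \<zeta> t) \<le> c1)" using op_class_bibo[OF T1, of B] by blast
  obtain c2 L where c2: "c2 \<ge> 0" "L \<ge> 0" "\<forall>\<zeta>. continuous_on {-h..} \<zeta> \<longrightarrow> (\<forall>t\<ge>-h. norm (\<zeta> t) \<le> B * K) \<longrightarrow>
    (\<forall>t\<ge>0. norm (T2 S \<zeta> t) \<le> c2) \<and> (\<forall>s\<ge>0. \<forall>t\<ge>0. norm (T2 S \<zeta> t - T2 S \<zeta> s) \<le> L * \<bar>t - s\<bar>)"
    using DAE_bounded_lipschitz[OF T2 h_nonneg, of "B * K"] by blast
  show ?thesis
    unfolding Wbd_def
  proof (rule exI[of _ c1], rule exI[of _ c2], rule exI[of _ L], intro conjI allI impI)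
    fix a u assume u: "adm a u" "\<forall>t\<ge>-h. norm (path a u t) \<le> B"
    have o: "\<forall>t\<ge>-h. norm (out (path a u t)) \<le> B * K"
    proof (intro allI impI)
      fix t assume "t \<ge> -h"
      then have "norm (path a u t) * K \<le> B * K" using u(2) K(1) by (intro mult_right_mono) auto
      then show "norm (out (path a u t)) \<le> B * K" using K(2)[of "path a u t"] by linarith
    qed
    show "AE t in lebesgue_on {0..b}. norm (W1 a u t) \<le> c1" for b
      using c1(2) path_continuous[OF u(1)] u(2) unfolding W1_def by simp
    show "norm (W2 a u t) \<le> c2" if "0 \<le> t" for t
      using c2(3) out_continuous[OF path_continuous[OF u(1)]] o that unfolding W2_def by simp
    show "norm (W2 a u t - W2 a u s) \<le> L * \<bar>t - s\<bar>" if "0 \<le> s" "0 \<le> t" for s t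
      using c2(3) out_continuous[OF path_continuous[OF u(1)]] o that unfolding W2_def by simp
  qed (use c1 c2 in auto)
qed

lemma adm_bounds:
  assumes "adm a u"
  shows "\<exists>B. \<forall>t\<ge>-h. norm (path a u t) \<le> B" "\<exists>B. \<forall>t\<in>{0..a}. norm (u t) \<le> B" "\<exists>\<epsilon>>0. \<forall>t\<in>{0..a}. goodeps \<epsilon> t (u t)"
proof -
  have a: "0 \<le> a" "continuous_on {0..a} u" "\<And>t. t \<in> {0..a} \<Longrightarrow> good t (u t)" using assms by (auto simp: adm_def)
  have cb: "\<exists>B. \<forall>t\<in>{c..d}. norm (f t) \<le> B" if "continuous_on {c..d} f" for c d :: real and f :: "real \<Rightarrow> real ^ 'n"
  proof -
    have "bounded (f ` {c..d})" using that by (intro compact_imp_bounded compact_continuous_image) auto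
    then show ?thesis unfolding bounded_iff by blast
  qed
  show "\<exists>B. \<forall>t\<in>{0..a}. norm (u t) \<le> B" using cb[OF a(2)] .
  show "\<exists>\<epsilon>>0. \<forall>t\<in>{0..a}. goodeps \<epsilon> t (u t)" using goodeps_path[OF _ a(2)] a(3) by simp
  have "continuous_on {-h..a} (path a u)" by (rule continuous_on_subset[OF path_continuous[OF assms]]) auto
  then obtain B where B: "\<forall>t\<in>{-h..a}. norm (path a u t) \<le> B" using cb by blast
  have "norm (path a u t) \<le> B" if "t \<ge> -h" for t
  proof (cases "t \<le> a")
    case False
    then have "path a u t = path a u a" using a(1) x0_Yf assms by (auto simp: path_def adm_def)
    then show ?thesis using B a(1) h_nonneg by auto
  qed (use B that in auto)
  then show "\<exists>B. \<forall>t\<ge>-h. norm (path a u t) \<le> B" by blast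
qed

lemma gf_ebd:
  assumes "adm a u" shows "\<exists>M\<ge>0. ebd M 0 a (\<lambda>s. gf s (u s) (W1 a u s))"
proof -
  obtain B where B: "\<forall>t\<ge>-h. norm (path a u t) \<le> B" using adm_bounds(1)[OF assms] by blast
  obtain Bu where Bu: "\<forall>t\<in>{0..a}. norm (u t) \<le> Bu" using adm_bounds(2)[OF assms] by blast
  obtain \<epsilon> where \<epsilon>: "\<epsilon> > 0" "\<forall>t\<in>{0..a}. goodeps \<epsilon> t (u t)" using adm_bounds(3)[OF assms] by blast
  obtain c1 c2 L where "Wbd B c1 c2 L" using path_bounded_W[of B] by blast
  note c1 = WbdD(1)[OF this assms B]
  have au: "continuous_on {0..a} u" using assms by (simp add: adm_def)
  show ?thesis
    using gf_path_ebd[OF \<epsilon>(1), of Bu c1] au \<epsilon>(2) Bu W1_measurable[OF assms, of a] c1[of a] by (elim exE conjE) (intro exI, blast)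
qed

lemma gf_W1_cong:
  assumes "adm a u" "adm b v" "\<And>s. s \<in> {0..t} \<Longrightarrow> u s = v s" "0 \<le> t" "t \<le> a" "t \<le> b"
  shows "integral {0..t} (\<lambda>s. gf s (u s) (W1 a u s)) = integral {0..t} (\<lambda>s. gf s (v s) (W1 b v s))"
proof -
  have "negligible {s\<in>{0..t}. \<not> (W1 a u s = W1 b v s)}"
    using W1_cong[OF assms] by (simp add: AE_lebesgue_on_iff_negligible)
  then show ?thesis by (rule integral_spike) (use assms(3) in auto)
qed

lemma csol_subset:
  assumes "csol a u" "0 \<le> b" "b \<le> a" shows "csol b u"
proof -
  have a: "adm a u" and b: "adm b u" using assms adm_subset by (auto simp: csol_def)
  have "PI (u t) = PI x0 + integral {0..t} (\<lambda>s. gf s (u s) (W1 b u s))" if "t \<in> {0..b}" for t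
    using assms gf_W1_cong[OF a b, of t] that by (auto simp: csol_def)
  moreover have "EIIx (u t) = eIIf t (u t) (W2 b u t)" if "t \<in> {0..b}" for t
    using assms W2_cong[OF a b, of t] that by (auto simp: csol_def)
  ultimately show ?thesis using b by (auto simp: csol_def)
qed

lemma csol_cong:
  assumes "csol a u" "\<And>t. t \<in> {0..a} \<Longrightarrow> v t = u t" shows "csol a v"
proof -
  have a: "adm a u" and b: "adm a v" using assms adm_cong by (auto simp: csol_def)
  have eq: "u s = v s" if "s \<in> {0..t}" "t \<le> a" for s t using assms(2)[of s] that by auto
  have "PI (v t) = PI x0 + integral {0..t} (\<lambda>s. gf s (v s) (W1 a v s))" if "t \<in> {0..a}" for t
    using assms gf_W1_cong[OF a b, of t] eq that by (auto simp: csol_def)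
  moreover have "EIIx (v t) = eIIf t (v t) (W2 a v t)" if "t \<in> {0..a}" for t
    using assms W2_cong[OF a b, of t] eq that by (auto simp: csol_def)
  ultimately show ?thesis using b by (auto simp: csol_def)
qed

lemma csol_acb:
  assumes "csol a u" shows "acb 0 a (\<lambda>t. PI (u t)) (\<lambda>s. gf s (u s) (W1 a u s))"
proof -
  have u: "adm a u" "u 0 = x0" "\<And>t. t \<in> {0..a} \<Longrightarrow> PI (u t) = PI x0 + integral {0..t} (\<lambda>s. gf s (u s) (W1 a u s))"
    using assms by (auto simp: csol_def adm_def)
  obtain M where "ebd M 0 a (\<lambda>s. gf s (u s) (W1 a u s))" using gf_ebd[OF u(1)] by blast
  then show ?thesis by (rule acbI) (use u in auto)
qed

lemma acb_bounded_linear: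
  fixes f :: "real \<Rightarrow> 'a::euclidean_space" and l :: "'a \<Rightarrow> 'b::euclidean_space"
  assumes l: "bounded_linear l" and f: "acb a b f f'"
  shows "acb a b (\<lambda>t. l (f t)) (\<lambda>t. l (f' t))"
proof -
  obtain M where M: "ebd M a b f'" using acbD(1)[OF f] by blast
  obtain K where K: "K \<ge> 0" "\<And>y. norm (l y) \<le> norm y * K" using bounded_linear.nonneg_bounded[OF l] by blast
  have "ebd (M * K) a b (\<lambda>t. l (f' t))"
    unfolding ebd_def
  proof
    have "f' \<in> borel_measurable (lebesgue_on {a..b})" "AE t in lebesgue_on {a..b}. norm (f' t) \<le> M" using M by (auto simp: ebd_def)
    then show "(\<lambda>t. l (f' t)) \<in> borel_measurable (lebesgue_on {a..b})"
      using borel_measurable_continuous_on[OF bounded_linear.continuous_on[OF l continuous_on_id], of f' "lebesgue_on {a..b}"] by blast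
    show "AE t in lebesgue_on {a..b}. norm (l (f' t)) \<le> M * K"
      using \<open>AE t in lebesgue_on {a..b}. norm (f' t) \<le> M\<close>
    proof eventually_elim
      case (elim t)
      show ?case using K(2)[of "f' t"] mult_right_mono[OF elim K(1)] by linarith
    qed
  qed
  then show ?thesis
  proof (rule acbI)
    fix t assume t: "t \<in> {a..b}"
    have i: "f' integrable_on {a..t}" using ebd_integrable[OF ebd_subset[OF M, of a t]] t by simp
    have "l (integral {a..t} f') = integral {a..t} (\<lambda>s. l (f' s))"
      using integral_linear[OF i l] by (simp add: o_def)
    moreover have "l (f t) = l (f a + integral {a..t} f')" using acbD(2)[OF f t] by simp
    ultimately show "l (f t) = l (f a) + integral {a..t} (\<lambda>s. l (f' s))"
      by (simp add: linear_add[OF bounded_linear.linear[OF l]])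
  qed
qed

lemma csol_st_acb:
  assumes "csol a u" "i \<in> II" "j < r i"
  shows "acb 0 a (\<lambda>t. st (u t) i j) (\<lambda>s. st (gf s (u s) (W1 a u s)) i j)"
  using acb_bounded_linear[OF st_linear csol_acb[OF assms(1)], of i j] assms(2,3) by (simp add: st_PI)

lemma csol_EI_acb:
  assumes "csol a u"
  shows "acb 0 a (\<lambda>t. EIx (u t)) (\<lambda>s. EIx (gf s (u s) (W1 a u s)))"
  using acb_bounded_linear[OF linear_maps(1) csol_acb[OF assms]] by (simp add: EI_PI)

end

section \<open>A priori bounds\<close>

lemma continuous_on_tdom:
  assumes "\<And>b. b \<in> tdom a \<omega> \<Longrightarrow> continuous_on {a..b} f"
  shows "continuous_on (tdom a \<omega>) f"
  unfolding continuous_on_eq_continuous_within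
proof
  fix t assume t: "t \<in> tdom a \<omega>"
  then obtain d where d: "t < d" "ereal d < \<omega>" using ereal_less_obtain by (auto simp: tdom_def)
  then have dJ: "d \<in> tdom a \<omega>" using t by (auto simp: tdom_def)
  then have "continuous (at t within {a..d}) f" using assms t d by (auto simp: continuous_on_eq_continuous_within tdom_def)
  moreover have "at t within {a..d} = at t within tdom a \<omega>"
    using tdom_Icc_subset[OF dJ] d by (intro at_within_nhd[of t "{..<d}"]) (auto simp: tdom_def)
  ultimately show "continuous (at t within tdom a \<omega>) f" by simp
qed

context fdae_loop
begin

lemma goodR_mono: "goodR \<epsilon> t x \<Longrightarrow> \<epsilon>' \<le> \<epsilon> \<Longrightarrow> goodR \<epsilon>' t x"
  unfolding goodR_def by fastforce

lemma goodeps_mono: "goodeps \<epsilon> t x \<Longrightarrow> \<epsilon>' \<le> \<epsilon> \<Longrightarrow> goodeps \<epsilon>' t x"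
  unfolding goodeps_def using goodR_mono by fastforce

text \<open>A priori bounds on a half-open interval, obtained step by step: the errors are bounded by the funnels, then the
  gains \<open>k\<^sub>i\<^sub>j\<close>, hence \<open>Y\<close> and the operator values, then \<open>k\<^sub>I\<close>, the derivatives, and finally \<open>k\<^sub>I\<^sub>I\<close>.\<close>

lemma osol_bounds:
  assumes w: "0 < w" and sol: "\<And>b. b \<in> tdom 0 w \<Longrightarrow> csol b u"
  shows "\<exists>\<epsilon>>0. \<forall>t\<in>tdom 0 w. goodeps \<epsilon> t (u t) \<and> (phiII C t)\<^sup>2 * (norm (EIIx (u t)))\<^sup>2 \<le> 1 - \<epsilon>" (is ?G)
    and "\<exists>L. \<forall>s\<in>tdom 0 w. \<forall>t\<in>tdom 0 w. norm (u t - u s) \<le> L * \<bar>t - s\<bar>" (is ?L)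
    and "\<exists>B. \<forall>t\<in>tdom 0 w. norm (u t) \<le> B" (is ?B)
proof -
  define J where "J = tdom 0 w"
  have J0: "t \<ge> 0" if "t \<in> J" for t using that by (simp add: J_def tdom_def)
  have Jsub: "{0..b} \<subseteq> J" if "b \<in> J" for b using tdom_Icc_subset that unfolding J_def by blast
  have ad: "adm b u" if "b \<in> J" for b using sol[of b] that by (simp add: csol_def J_def)
  have good: "good t (u t)" if "t \<in> J" for t using ad[OF that] J0[OF that] by (simp add: adm_def)
  have cu: "continuous_on J u"
    unfolding J_def by (rule continuous_on_tdom) (use ad in \<open>auto simp: adm_def J_def\<close>)
  have cst: "continuous_on J (\<lambda>t. st (u t) i j)" for i j
    by (rule bounded_linear.continuous_on[OF st_linear cu])
  have cEI: "continuous_on J (\<lambda>t. EIx (u t))" and cEII: "continuous_on J (\<lambda>t. EIIx (u t))"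
    by (rule bounded_linear.continuous_on[OF linear_maps(1) cu], rule bounded_linear.continuous_on[OF linear_maps(2) cu])
  have EIIeq: "EIIx (u t) = eIIf t (u t) (W2 t u t)" if "t \<in> J" for t
    using sol[of t] that J0[OF that] by (auto simp: csol_def J_def)
  have EIb: "\<exists>B\<ge>0. \<forall>t\<in>J. norm (EIx (u t)) \<le> B"
    unfolding J_def
    by (rule funnel_error_bounded[OF w phiI]) (use cEI good in \<open>auto simp: good_def J_def\<close>)
  have EIIlt: "(phiII C t)\<^sup>2 * (norm (EIIx (u t)))\<^sup>2 < 1" if "t \<in> J" for t
    using EIIeq[OF that] Pm_iff[OF kf4_pos, of "EIIx (u t)" "phiII C t"] unfolding eIIf_def by blast
  have EIIb: "\<exists>B\<ge>0. \<forall>t\<in>J. norm (EIIx (u t)) \<le> B"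
    unfolding J_def
    by (rule funnel_error_bounded[OF w phiII]) (use cEII EIIlt in \<open>auto simp: J_def\<close>)
  have stb: "\<exists>B\<ge>0. \<forall>t\<in>J. \<bar>st (u t) i j\<bar> \<le> B" if j: "j < ord S i" for i j
  proof (cases "i \<in> II")
    case True
    show ?thesis
    proof (cases "j + 2 \<le> r i")
      case 2: True
      have "r i - j \<ge> 1" using 2 by simp
      from funnel_error_bounded[OF w phi[OF True 2] this, of "\<lambda>t. st (u t) i j"] cst[of i j] good True 2
      show ?thesis by (auto simp: J_def good_def)
    next
      case False
      \<comment> \<open>The last error of a chain has no scalar funnel of its own; it is a component
        of \<open>e\<^sub>I\<close>.\<close>
      then have jr: "j = r i - 1" using j True by simp
      have "\<bar>st (u t) i j\<bar> \<le> norm (EIx (u t))" for t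
        using component_le_norm_cart[of "EIx (u t)" i] True jr by (simp add: EIx_def)
      then show ?thesis using EIb order_trans by blast
    qed
  next
    case False
    then have jr: "j = 0" using j by simp
    have "\<bar>st (u t) i j\<bar> \<le> norm (EIIx (u t))" for t
      using component_le_norm_cart[of "EIIx (u t)" i] False jr by (simp add: EIIx_def)
    then show ?thesis using EIIb order_trans by blast
  qed
  have ub: "\<exists>B\<ge>0. \<forall>t\<in>J. norm (u t) \<le> B"
  proof -
    have "\<forall>n. \<exists>B. \<forall>t\<in>J. \<bar>u t $ n\<bar> \<le> B" using stb[OF cj_less] by (auto simp: nth_st)
    from choice[OF this] obtain M where M: "\<forall>n. \<forall>t\<in>J. \<bar>u t $ n\<bar> \<le> M n" by (elim exE)
    have "norm (u t) \<le> \<bar>\<Sum>n\<in>UNIV. M n\<bar>" if "t \<in> J" for t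
    proof -
      have "norm (u t) \<le> (\<Sum>n\<in>UNIV. \<bar>u t $ n\<bar>)" by (rule norm_le_l1_cart)
      also have "\<dots> \<le> (\<Sum>n\<in>UNIV. M n)" using M that by (intro sum_mono) blast
      finally show ?thesis by linarith
    qed
    then show ?thesis by (intro exI[of _ "\<bar>\<Sum>n\<in>UNIV. M n\<bar>"]) auto
  qed
  then obtain Bu where Bu: "Bu \<ge> 0" "\<forall>t\<in>J. norm (u t) \<le> Bu" by blast
  show ?B using Bu(2) unfolding J_def by blast
  define F where "F = {(i, j). i \<in> II \<and> j + 2 \<le> r i}"
  have fin: "finite F" unfolding F_def by (rule finite_chain_ix)
  have gain: "\<exists>\<epsilon>>0. \<forall>t\<in>J. (phi C (fst k) (snd k) t)\<^sup>2 * (st (u t) (fst k) (snd k))\<^sup>2 \<le> 1 - \<epsilon>" if k: "k \<in> F" for k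
  proof -
    define i where "i = fst k"
    define j where "j = snd k"
    have ij: "i \<in> II" "j + 2 \<le> r i" using k by (auto simp: F_def i_def j_def)
    have ij': "Suc j < ord S i" "r i - j \<ge> 1" using ij by auto
    \<comment> \<open>In the chain equation the error is driven by the next one, already bounded by
      \<open>M\<close>, and damped by \<open>k\<^sub>i\<^sub>j\<close> with coefficient 1.\<close>
    obtain M where M: "M \<ge> 0" "\<forall>t\<in>J. \<bar>st (u t) i (Suc j)\<bar> \<le> M" using stb[OF ij'(1)] by blast
    have "\<exists>\<epsilon>>0. \<forall>t\<in>tdom 0 w. (phi C i j t)\<^sup>2 * (norm (st (u t) i j))\<^sup>2 \<le> 1 - \<epsilon>"
    proof (rule funnel_gain_bounded[OF w phi[OF ij] ij'(2)])
      show "continuous_on (tdom 0 w) (\<lambda>t. st (u t) i j)" using cst by (simp add: J_def)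
      show "(phi C i j t)\<^sup>2 * (norm (st (u t) i j))\<^sup>2 < 1" if "t \<in> tdom 0 w" for t
        using good[of t] that ij by (simp add: good_def J_def)
      show "0 \<le> M" "0 < (1::real)" using M by auto
      fix b assume b: "b \<in> tdom 0 w"
      show "\<exists>g. acb 0 b (\<lambda>t. st (u t) i j) g \<and> (AE s in lebesgue_on {0..b}. st (u s) i j \<bullet> g s \<le>
          M * norm (st (u s) i j) - 1 * (norm (st (u s) i j))\<^sup>2 / (1 - (phi C i j s)\<^sup>2 * (norm (st (u s) i j))\<^sup>2))"
      proof (intro exI[of _ "\<lambda>s. st (gf s (u s) (W1 b u s)) i j"] conjI AE_I2)
        show "acb 0 b (\<lambda>t. st (u t) i j) (\<lambda>s. st (gf s (u s) (W1 b u s)) i j)"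
          using ij by (intro csol_st_acb sol b) auto
        fix s assume "s \<in> space (lebesgue_on {0..b})"
        then have s: "s \<in> J" using b Jsub[of b] by (auto simp: space_restrict_space J_def)
        have "st (gf s (u s) (W1 b u s)) i j = st (u s) i (Suc j) - st (u s) i j / (1 - (phi C i j s)\<^sup>2 * (st (u s) i j)\<^sup>2)"
          using ij gf_nth[of j i] by (simp add: dEE_def ph_def)
        then have "st (u s) i j \<bullet> st (gf s (u s) (W1 b u s)) i j =
          st (u s) i j * st (u s) i (Suc j) - (st (u s) i j)\<^sup>2 / (1 - (phi C i j s)\<^sup>2 * (st (u s) i j)\<^sup>2)"
          by (simp add: right_diff_distrib power2_eq_square)
        moreover have "st (u s) i j * st (u s) i (Suc j) \<le> M * \<bar>st (u s) i j\<bar>"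
        proof -
          have "st (u s) i j * st (u s) i (Suc j) \<le> \<bar>st (u s) i j\<bar> * \<bar>st (u s) i (Suc j)\<bar>"
            by (metis abs_ge_self abs_mult)
          also have "\<dots> \<le> \<bar>st (u s) i j\<bar> * M" using M s by (intro mult_left_mono) auto
          finally show ?thesis by (simp add: mult.commute)
        qed
        ultimately show "st (u s) i j \<bullet> st (gf s (u s) (W1 b u s)) i j \<le>
          M * norm (st (u s) i j) - 1 * (norm (st (u s) i j))\<^sup>2 / (1 - (phi C i j s)\<^sup>2 * (norm (st (u s) i j))\<^sup>2)"
          by simp
      qed
    qed
    then show ?thesis by (simp add: i_def j_def J_def)
  qed
  have "\<exists>\<epsilon>>0. \<forall>k\<in>F. \<forall>t\<in>J. (phi C (fst k) (snd k) t)\<^sup>2 * (st (u t) (fst k) (snd k))\<^sup>2 \<le> 1 - \<epsilon>"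
    by (rule finite_min_eps[where Q="\<lambda>k \<epsilon>. \<forall>t\<in>J. (phi C (fst k) (snd k) t)\<^sup>2 * (st (u t) (fst k) (snd k))\<^sup>2 \<le> 1 - \<epsilon>", OF fin gain])
      fastforce+
  then obtain \<epsilon>1 where e1: "\<epsilon>1 > 0" "\<forall>k\<in>F. \<forall>t\<in>J. (phi C (fst k) (snd k) t)\<^sup>2 * (st (u t) (fst k) (snd k))\<^sup>2 \<le> 1 - \<epsilon>1" by blast
  have gR: "goodR \<epsilon>1 t (u t)" if "t \<in> J" for t
    unfolding goodR_def
  proof (intro ballI allI impI)
    fix i j assume "i \<in> II" "j + 2 \<le> r i"
    then have "(i, j) \<in> F" by (simp add: F_def)
    then show "(phi C i j t)\<^sup>2 * (st (u t) i j)\<^sup>2 \<le> 1 - \<epsilon>1" using e1(2) that by fastforce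
  qed
  obtain BY where BY: "\<forall>t\<ge>0. \<forall>x. goodR \<epsilon>1 t x \<longrightarrow> norm x \<le> Bu \<longrightarrow> norm (Yf t x) \<le> BY" using Yf_bounded[OF e1(1), of Bu] by blast
  have "bounded (Y0 ` {-h..0})" using Y0_continuous by (intro compact_imp_bounded compact_continuous_image) auto
  then obtain B0 where B0: "\<forall>y\<in>Y0 ` {-h..0}. norm y \<le> B0" unfolding bounded_iff by blast
  define BP where "BP = max B0 BY"
  have pb: "\<forall>t\<ge>-h. norm (path b u t) \<le> BP" if b: "b \<in> J" for b
  proof (intro allI impI)
    fix t assume t: "t \<ge> -h"
    show "norm (path b u t) \<le> BP"
    proof (cases "t \<le> 0")
      case True
      then have "norm (Y0 t) \<le> B0" using B0 t by auto
      then show ?thesis using True by (simp add: path_def BP_def)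
    next
      case False
      then have "min t b \<in> J" using Jsub[OF b] J0[OF b] by auto
      then have "norm (Yf (min t b) (u (min t b))) \<le> BY" using BY gR Bu(2) J0 by blast
      then show ?thesis using False by (simp add: path_def BP_def)
    qed
  qed
  obtain c1 c2 L2 where c: "0 \<le> c1" "0 \<le> c2" "0 \<le> L2" and W: "Wbd BP c1 c2 L2" using path_bounded_W[of BP] by blast
  have "\<exists>\<epsilon>>0. \<forall>t\<in>tdom 0 w. (phiI C t)\<^sup>2 * (norm (EIx (u t)))\<^sup>2 \<le> 1 - \<epsilon>"
  proof -
    obtain D2 where D2: "\<forall>b. AE t in lebesgue_on {0..b}. norm (d2 S t) \<le> D2" using Linf_bd[OF d_Linf(2)] by blast
    obtain \<gamma> where \<gamma>: "\<gamma> > 0" "\<forall>d \<eta> x. norm d \<le> D2 \<longrightarrow> norm \<eta> \<le> c1 \<longrightarrow> x \<in> coords II \<longrightarrow> \<gamma> * (norm x)\<^sup>2 \<le> x \<bullet> (GammaI S (d, \<eta>) *v x)"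
      using GammaI_coercive[of D2 c1] by blast
    have "\<forall>i. \<exists>M. i \<in> II \<longrightarrow> (\<forall>b. AE t in lebesgue_on {0..b}. \<forall>x \<eta>. goodR \<epsilon>1 t x \<longrightarrow> norm x \<le> Bu \<longrightarrow> norm \<eta> \<le> c1 \<longrightarrow> \<bar>drift i t x \<eta>\<bar> \<le> M)"
      using drift_bounded[OF _ e1(1), of _ Bu c1] by blast
    from choice[OF this] obtain Md where Md: "\<forall>i. i \<in> II \<longrightarrow> (\<forall>b. AE t in lebesgue_on {0..b}. \<forall>x \<eta>. goodR \<epsilon>1 t x \<longrightarrow> norm x \<le> Bu \<longrightarrow> norm \<eta> \<le> c1 \<longrightarrow> \<bar>drift i t x \<eta>\<bar> \<le> Md i)"
      by (elim exE)
    \<comment> \<open>Bounds everything but the input term in the derivative of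
      \<open>e\<^sub>I\<close>. The input term provides the damping, with the coercivity constant
      \<open>\<gamma>\<close> for operator values bounded by \<open>c1\<close>.\<close>
    define M where "M = (\<Sum>i\<in>UNIV. \<bar>Md i\<bar>)"
    show ?thesis
    proof (rule funnel_gain_bounded[OF w phiI order_refl])
      show "continuous_on (tdom 0 w) (\<lambda>t. EIx (u t))" using cEI by (simp add: J_def)
      show "(phiI C t)\<^sup>2 * (norm (EIx (u t)))\<^sup>2 < 1" if "t \<in> tdom 0 w" for t
        using good[of t] that by (simp add: good_def J_def)
      show "0 \<le> M" by (simp add: M_def sum_nonneg)
      show "0 < \<gamma>" by (rule \<gamma>(1))
      fix b assume b: "b \<in> tdom 0 w"
      then have bJ: "b \<in> J" by (simp add: J_def)
      show "\<exists>g. acb 0 b (\<lambda>t. EIx (u t)) g \<and> (AE s in lebesgue_on {0..b}. EIx (u s) \<bullet> g s \<le>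
          M * norm (EIx (u s)) - \<gamma> * (norm (EIx (u s)))\<^sup>2 / (1 - (phiI C s)\<^sup>2 * (norm (EIx (u s)))\<^sup>2))"
      proof (intro exI[of _ "\<lambda>s. EIx (gf s (u s) (W1 b u s))"] conjI csol_EI_acb sol b)
        have A3: "AE s in lebesgue_on {0..b}. \<forall>i. i \<in> II \<longrightarrow> (\<forall>x \<eta>. goodR \<epsilon>1 s x \<longrightarrow> norm x \<le> Bu \<longrightarrow> norm \<eta> \<le> c1 \<longrightarrow> \<bar>drift i s x \<eta>\<bar> \<le> Md i)"
        proof (rule eventually_all_finite)
          fix i
          show "AE s in lebesgue_on {0..b}. i \<in> II \<longrightarrow> (\<forall>x \<eta>. goodR \<epsilon>1 s x \<longrightarrow> norm x \<le> Bu \<longrightarrow> norm \<eta> \<le> c1 \<longrightarrow> \<bar>drift i s x \<eta>\<bar> \<le> Md i)"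
            using Md by (cases "i \<in> II") auto
        qed
        show "AE s in lebesgue_on {0..b}. EIx (u s) \<bullet> EIx (gf s (u s) (W1 b u s)) \<le>
          M * norm (EIx (u s)) - \<gamma> * (norm (EIx (u s)))\<^sup>2 / (1 - (phiI C s)\<^sup>2 * (norm (EIx (u s)))\<^sup>2)"
          using WbdD(1)[OF W ad[OF bJ] pb[OF bJ], of b] D2[THEN spec, of b] A3 AE_space
        proof eventually_elim
          case (elim s)
          then have s: "s \<in> J" using Jsub[OF bJ] by (auto simp: space_restrict_space)
          define e where "e = EIx (u s)"
          define \<eta> where "\<eta> = W1 b u s"
          define k where "k = 1 / (1 - (phiI C s)\<^sup>2 * (norm e)\<^sup>2)"
          define dv where "dv = (\<chi> i. if i \<in> II then drift i s (u s) \<eta> else 0)"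
          have k: "k \<ge> 0" using good[OF s] by (simp add: k_def e_def good_def)
          have UIe: "UI s (u s) = - (k *\<^sub>R e)" by (simp add: UI_def k_def e_def)
          have e0: "e $ i = 0" if "i \<notin> II" for i using that by (simp add: e_def EIx_def)
          have g: "EIx (gf s (u s) \<eta>) $ i = (if i \<in> II then drift i s (u s) \<eta> + (GammaI S (d2 S s, \<eta>) *v UI s (u s)) $ i else 0)" for i
            using gf_nth[of "r i - 1" i] r_pos[of i] by (auto simp: EIx_def)
          have "e \<bullet> EIx (gf s (u s) \<eta>) = e \<bullet> (dv + GammaI S (d2 S s, \<eta>) *v UI s (u s))"
            unfolding inner_vec_def by (rule sum.cong) (auto simp: g dv_def e0)
          also have "\<dots> = e \<bullet> dv - k * (e \<bullet> (GammaI S (d2 S s, \<eta>) *v e))"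
            by (simp add: inner_add_right UIe scaleR_minus_left[symmetric] matrix_vector_mult_scaleR del: scaleR_minus_left)
          also have "\<dots> \<le> M * norm e - k * (\<gamma> * (norm e)\<^sup>2)"
          proof -
            have "\<bar>dv $ i\<bar> \<le> \<bar>Md i\<bar>" for i
            proof (cases "i \<in> II")
              case True
              have "norm (u s) \<le> Bu" using Bu(2) s by blast
              then have "\<bar>drift i s (u s) \<eta>\<bar> \<le> Md i" using elim(3) True gR[OF s] elim(1) unfolding \<eta>_def by blast
              then show ?thesis using True by (simp add: dv_def)
            qed (simp add: dv_def)
            then have "norm dv \<le> M" unfolding M_def using norm_le_l1_cart[of dv] sum_mono[of UNIV "\<lambda>i. \<bar>dv $ i\<bar>" "\<lambda>i. \<bar>Md i\<bar>"] by auto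
            then have "norm e * norm dv \<le> norm e * M" by (intro mult_left_mono) auto
            then have 1: "e \<bullet> dv \<le> M * norm e" using norm_cauchy_schwarz[of e dv] by (simp add: mult.commute)
            have "\<gamma> * (norm e)\<^sup>2 \<le> e \<bullet> (GammaI S (d2 S s, \<eta>) *v e)"
              using \<gamma>(2) elim(1,2) EI_coords[of "u s"] by (simp add: e_def \<eta>_def)
            then have "k * (\<gamma> * (norm e)\<^sup>2) \<le> k * (e \<bullet> (GammaI S (d2 S s, \<eta>) *v e))" using k by (rule mult_left_mono)
            then show ?thesis using 1 by linarith
          qed
          finally show ?case by (simp add: e_def \<eta>_def k_def)
        qed
      qed
    qed
  qed
  then obtain \<epsilon>2 where e2: "\<epsilon>2 > 0" "\<forall>t\<in>J. (phiI C t)\<^sup>2 * (norm (EIx (u t)))\<^sup>2 \<le> 1 - \<epsilon>2" unfolding J_def by blast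
  define \<epsilon> where "\<epsilon> = min \<epsilon>1 \<epsilon>2"
  have eps: "\<epsilon> > 0" using e1 e2 by (simp add: \<epsilon>_def)
  have ge: "goodeps \<epsilon> t (u t)" if "t \<in> J" for t
  proof -
    have "(phiI C t)\<^sup>2 * (norm (EIx (u t)))\<^sup>2 \<le> 1 - \<epsilon>2" using e2(2) that by blast
    moreover have "goodR \<epsilon> t (u t)" using goodR_mono[OF gR[OF that]] by (simp add: \<epsilon>_def)
    ultimately show ?thesis by (auto simp: goodeps_def \<epsilon>_def)
  qed
  obtain M where M: "M \<ge> 0" and Me: "\<forall>a b u \<eta>. 0 \<le> a \<longrightarrow> continuous_on {a..b} u \<longrightarrow> (\<forall>t\<in>{a..b}. goodeps \<epsilon> t (u t) \<and> norm (u t) \<le> Bu) \<longrightarrow>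
    \<eta> \<in> borel_measurable (lebesgue_on {a..b}) \<longrightarrow> (AE t in lebesgue_on {a..b}. norm (\<eta> t) \<le> c1) \<longrightarrow> ebd M a b (\<lambda>t. gf t (u t) (\<eta> t))"
    using gf_path_ebd[OF eps, of Bu c1] by (elim exE conjE)
  have ge_ebd: "ebd M 0 b (\<lambda>s. gf s (u s) (W1 b u s))" if b: "b \<in> J" for b
    by (rule Me[rule_format]) (use ad[OF b] W1_measurable WbdD(1)[OF W ad[OF b] pb[OF b]] ge Bu(2) Jsub[OF b] in \<open>auto simp: adm_def\<close>)
  have PIlip: "norm (PI (u t) - PI (u s)) \<le> M * \<bar>t - s\<bar>" if "s \<in> J" "t \<in> J" for s t
  proof -
    have m: "max s t \<in> J" using that by (simp add: max_def)
    show ?thesis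
      using acb_lip_ebd[OF csol_acb[OF sol] ge_ebd[OF m], of s t] m that J0 by (auto simp: J_def)
  qed
  obtain KP where KP: "\<forall>y. norm (PI y) \<le> norm y * KP" "KP \<ge> 0"
    using bounded_linear.nonneg_bounded[OF linear_maps(3)] by blast
  have Pu: "ubl {()} J (\<lambda>v t. PI (u t))"
  proof (rule ublI)
    show "norm (PI (u t)) \<le> Bu * KP" if "t \<in> J" for t
      using KP(1)[THEN spec, of "u t"] mult_right_mono[OF _ KP(2), of "norm (u t)" Bu] Bu(2) that by auto
    show "norm (PI (u t) - PI (u s)) \<le> M * \<bar>t - s\<bar>" if "s \<in> J" "t \<in> J" for s t using PIlip that .
  qed
  \<comment> \<open>The operator is evaluated on continuations of varying length; by causality the
    longer of two continuations serves both times.\<close>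
  have Wu: "ubl {()} J (\<lambda>v t. W2 t u t)"
  proof (rule ublI)
    show "norm (W2 t u t) \<le> c2" if "t \<in> J" for t using WbdD(2)[OF W ad[OF that] pb[OF that]] J0[OF that] .
    have le: "norm (W2 t u t - W2 s u s) \<le> L2 * \<bar>t - s\<bar>" if "s \<in> J" "t \<in> J" "s \<le> t" for s t
    proof -
      have "W2 s u s = W2 t u s" using W2_cong[OF ad[OF that(1)] ad[OF that(2)], of s] J0 that by auto
      then show ?thesis using WbdD(3)[OF W ad[OF that(2)] pb[OF that(2)], of s t] J0 that by auto
    qed
    show "norm (W2 t u t - W2 s u s) \<le> L2 * \<bar>t - s\<bar>" if "s \<in> J" "t \<in> J" for s t
      using le[of s t] le[of t s] that by (cases "s \<le> t") (auto simp: norm_minus_commute abs_minus_commute)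
  qed
  obtain BII where BII: "\<forall>t\<in>J. norm (EIIx (u t)) \<le> BII" using EIIb by blast
  have Jp: "J \<subseteq> {0..}" using J0 by auto
  have "\<exists>M\<ge>0. \<forall>v\<in>{()}. \<forall>s\<in>J. \<forall>t\<in>J. norm (eIIf t (u t) (W2 t u t) - eIIf s (u s) (W2 s u s)) \<le>
    M * \<bar>t - s\<bar> + rho * norm (EIIx (u t) - EIIx (u s))"
    by (rule eIIf_contraction[OF Jp Pu eps _ _ Wu]) (use ge BII in auto)
  then obtain ME where ME: "ME \<ge> 0" "\<forall>s\<in>J. \<forall>t\<in>J. norm (eIIf t (u t) (W2 t u t) - eIIf s (u s) (W2 s u s)) \<le>
    ME * \<bar>t - s\<bar> + rho * norm (EIIx (u t) - EIIx (u s))" by blast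
  \<comment> \<open>The fixed point equation bounds the increment by \<open>rho\<close> times itself
    plus a Lipschitz term in time, so it can be absorbed.\<close>
  have EIIlip: "norm (EIIx (u t) - EIIx (u s)) \<le> (ME / (1 - rho)) * \<bar>t - s\<bar>" if "s \<in> J" "t \<in> J" for s t
  proof -
    have "norm (EIIx (u t) - EIIx (u s)) \<le> ME * \<bar>t - s\<bar> + rho * norm (EIIx (u t) - EIIx (u s))"
      using ME(2) that EIIeq by simp
    then have "(1 - rho) * norm (EIIx (u t) - EIIx (u s)) \<le> ME * \<bar>t - s\<bar>" by (simp add: algebra_simps)
    then show ?thesis using rho(2) by (simp add: field_simps)
  qed
  have "norm (u t - u s) \<le> (M + ME / (1 - rho)) * \<bar>t - s\<bar>" if "s \<in> J" "t \<in> J" for s t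
  proof -
    have "norm (u t - u s) \<le> norm (PI (u t - u s)) + norm (EIIx (u t - u s))" by (rule norm_split)
    also have "\<dots> = norm (PI (u t) - PI (u s)) + norm (EIIx (u t) - EIIx (u s))"
      by (simp add: linear_diff[OF bounded_linear.linear[OF linear_maps(3)]] linear_diff[OF bounded_linear.linear[OF linear_maps(2)]])
    also have "\<dots> \<le> M * \<bar>t - s\<bar> + (ME / (1 - rho)) * \<bar>t - s\<bar>" by (intro add_mono PIlip EIIlip that)
    finally show ?thesis by (simp add: distrib_right)
  qed
  then show ?L unfolding J_def by blast
  obtain MV where MV: "\<forall>t\<ge>0. \<forall>x \<eta>. goodeps \<epsilon> t x \<longrightarrow> norm x \<le> Bu \<longrightarrow> norm \<eta> \<le> c2 \<longrightarrow>
    norm (f2 S (Yf t x) + f3 S (d3 S t, \<eta>) + GammaII S (d4 S t, \<eta>) *v UI t x) \<le> MV" using VII_bounded[OF eps, of Bu c2] by blast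
  obtain FII where FII: "\<forall>t\<ge>0. \<bar>phiII C t\<bar> \<le> FII" using Phi_props(3)[OF phiII order_refl, of 0] by auto
  \<comment> \<open>The value delivered by \<open>Pm_gain_bounded\<close>; the added ones make its
    bounds positive.\<close>
  define \<epsilon>3 where "\<epsilon>3 = min (1/2) (khat C * \<alpha> / (2 * (\<bar>FII\<bar> + 1) * (\<bar>MV\<bar> + 1)))"
  have e3: "\<epsilon>3 > 0" using k\<alpha> by (simp add: \<epsilon>3_def)
  have gII: "(phiII C t)\<^sup>2 * (norm (EIIx (u t)))\<^sup>2 \<le> 1 - \<epsilon>3" if t: "t \<in> J" for t
    unfolding \<epsilon>3_def
  proof (rule Pm_gain_bounded)
    show "EIIx (u t) = Pm (phiII C t) (khat C * f4 S (d5 S t, W2 t u t))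
      (f2 S (Yf t (u t)) + f3 S (d3 S t, W2 t u t) + GammaII S (d4 S t, W2 t u t) *v UI t (u t))"
      using EIIeq[OF t] by (simp add: eIIf_def)
    have "norm (W2 t u t) \<le> c2" using WbdD(2)[OF W ad[OF t] pb[OF t]] J0[OF t] .
    then have "norm (f2 S (Yf t (u t)) + f3 S (d3 S t, W2 t u t) + GammaII S (d4 S t, W2 t u t) *v UI t (u t)) \<le> MV"
      using MV J0[OF t] ge[OF t] Bu(2) t by blast
    then show "norm (f2 S (Yf t (u t)) + f3 S (d3 S t, W2 t u t) + GammaII S (d4 S t, W2 t u t) *v UI t (u t)) \<le> \<bar>MV\<bar> + 1" by linarith
    have "\<bar>phiII C t\<bar> \<le> FII" using FII J0[OF t] by blast
    then show "\<bar>phiII C t\<bar> \<le> \<bar>FII\<bar> + 1" by linarith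
  qed (use k\<alpha> kf4_ge in auto)
  show ?G
  proof (intro exI[of _ "min \<epsilon> \<epsilon>3"] conjI ballI)
    fix t assume "t \<in> tdom 0 w"
    then have t: "t \<in> J" by (simp add: J_def)
    show "goodeps (min \<epsilon> \<epsilon>3) t (u t)" by (rule goodeps_mono[OF ge[OF t]]) simp
    show "(phiII C t)\<^sup>2 * (norm (EIIx (u t)))\<^sup>2 \<le> 1 - min \<epsilon> \<epsilon>3" using gII[OF t] by linarith
  qed (use eps e3 in simp)
qed

end

section \<open>Local existence\<close>

lemma zero_on_closure:
  fixes f :: "real \<Rightarrow> 'a::real_normed_vector"
  assumes "a < b" "continuous_on {a..b} f" "\<And>t. t \<in> {a..<b} \<Longrightarrow> f t = 0" "t \<in> {a..b}"
  shows "f t = 0"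
  using continuous_constant_on_closure[of "{a..<b}" f 0 t] assms by simp

context fdae_loop
begin

text \<open>The a priori Lipschitz bound provides a limit at \<open>a\<close>, the uniform distance
  \<open>\<epsilon>\<close> keeps this limit inside the funnels, and both equations persist by
  continuity.\<close>

lemma csol_closing:
  assumes a: "0 < a" and sol: "\<And>b. 0 \<le> b \<Longrightarrow> b < a \<Longrightarrow> csol b u"
  shows "\<exists>v. csol a v \<and> (\<forall>t\<in>{0..<a}. v t = u t)"
proof -
  have J: "tdom 0 (ereal a) = {0..<a}" by (auto simp: tdom_def)
  have w: "0 < ereal a" using a by simp
  have sol': "csol b u" if "b \<in> tdom 0 (ereal a)" for b using sol[of b] that by (auto simp: tdom_def)
  obtain \<epsilon> where \<epsilon>: "\<epsilon> > 0" "\<forall>t\<in>{0..<a}. goodeps \<epsilon> t (u t)" using osol_bounds(1)[OF w sol'] unfolding J by blast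
  obtain L where L: "\<forall>s\<in>{0..<a}. \<forall>t\<in>{0..<a}. norm (u t - u s) \<le> L * \<bar>t - s\<bar>" using osol_bounds(2)[OF w sol'] unfolding J by blast
  have "uniformly_continuous_on {0..<a} u"
    unfolding uniformly_continuous_on_def
  proof (intro allI impI)
    fix e :: real assume e: "e > 0"
    show "\<exists>d>0. \<forall>x\<in>{0..<a}. \<forall>x'\<in>{0..<a}. dist x' x < d \<longrightarrow> dist (u x') (u x) < e"
    proof (intro exI[of _ "e / (\<bar>L\<bar> + 1)"] conjI ballI impI)
      show "0 < e / (\<bar>L\<bar> + 1)" using e by simp
      fix s t assume st: "s \<in> {0..<a}" "t \<in> {0..<a}" "dist t s < e / (\<bar>L\<bar> + 1)"
      have "dist (u t) (u s) \<le> L * \<bar>t - s\<bar>" using L st by (simp add: dist_norm)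
      also have "\<dots> \<le> (\<bar>L\<bar> + 1) * \<bar>t - s\<bar>" by (intro mult_right_mono) auto
      also have "\<dots> < e" using st(3) by (simp add: dist_real_def field_simps)
      finally show "dist (u t) (u s) < e" .
    qed
  qed
  from uniformly_continuous_on_extension_on_closure[OF this] obtain v where
    v: "uniformly_continuous_on (closure {0..<a}) v" "\<And>x. x \<in> {0..<a} \<Longrightarrow> u x = v x" by metis
  have cl: "closure {0..<a} = {0..a}" using a by simp
  have cv: "continuous_on {0..a} v" using uniformly_continuous_imp_continuous[OF v(1)] cl by simp
  \<comment> \<open>Non-strict bounds pass to the limit, whereas the strict ones of
    \<open>good\<close> might be lost.\<close>
  have le: "f t \<le> 1 - \<epsilon>" if "continuous_on {0..a} f" "\<And>t. t \<in> {0..<a} \<Longrightarrow> f t \<le> 1 - \<epsilon>" "t \<in> {0..a}" for f t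
    using continuous_le_on_closure[of "{0..<a}" f t "1 - \<epsilon>"] that cl by simp
  have sub: "{0..a} \<subseteq> {0..}" by auto
  have ge: "goodeps \<epsilon> t (v t)" if t: "t \<in> {0..a}" for t
    unfolding goodeps_gq
  proof
    fix k assume k: "k \<in> gix"
    show "gq k t (v t) \<le> 1 - \<epsilon>"
    proof (rule le[where f="\<lambda>t. gq k t (v t)", OF _ _ t])
      show "continuous_on {0..a} (\<lambda>t. gq k t (v t))" by (rule gq_continuous[OF k continuous_on_id cv]) simp
      show "gq k t (v t) \<le> 1 - \<epsilon>" if "t \<in> {0..<a}" for t
        using \<epsilon>(2) v(2)[OF that, symmetric] that k by (simp add: goodeps_gq)
    qed
  qed
  have good: "good t (v t)" if "t \<in> {0..a}" for t using goodeps_good[OF \<epsilon>(1) ge[OF that]] .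
  have adu: "adm t u" if "t \<in> {0..<a}" for t using sol[of t] that by (simp add: csol_def)
  have "u 0 = x0" using adu[of 0] a by (simp add: adm_def)
  then have adv: "adm a v" using cv good a v(2)[of 0] by (simp add: adm_def)
  have uv: "u s = v s" if "s \<in> {0..t}" "t < a" for s t using v(2)[of s] that by simp
  obtain M where M: "ebd M 0 a (\<lambda>s. gf s (v s) (W1 a v s))" using gf_ebd[OF adv] by blast
  have 1: "PI (v t) = PI x0 + integral {0..t} (\<lambda>s. gf s (v s) (W1 a v s))" if t: "t \<in> {0..a}" for t
  proof -
    have "PI (v t) - (PI x0 + integral {0..t} (\<lambda>s. gf s (v s) (W1 a v s))) = 0"
    proof (rule zero_on_closure[OF a, where f="\<lambda>t. PI (v t) - (PI x0 + integral {0..t} (\<lambda>s. gf s (v s) (W1 a v s)))", OF _ _ t])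
      show "continuous_on {0..a} (\<lambda>t. PI (v t) - (PI x0 + integral {0..t} (\<lambda>s. gf s (v s) (W1 a v s))))"
        by (intro continuous_intros bounded_linear.continuous_on[OF linear_maps(3) cv] indefinite_integral_continuous_1 ebd_integrable[OF M])
      fix t assume t: "t \<in> {0..<a}"
      have "PI (u t) = PI x0 + integral {0..t} (\<lambda>s. gf s (u s) (W1 t u s))" using sol[of t] t by (simp add: csol_def)
      moreover have "integral {0..t} (\<lambda>s. gf s (u s) (W1 t u s)) = integral {0..t} (\<lambda>s. gf s (v s) (W1 a v s))"
        using uv t by (intro gf_W1_cong[OF adu adv]) auto
      ultimately show "PI (v t) - (PI x0 + integral {0..t} (\<lambda>s. gf s (v s) (W1 a v s))) = 0" using v(2)[OF t] by simp
    qed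
    then show ?thesis by simp
  qed
  have 2: "EIIx (v t) = eIIf t (v t) (W2 a v t)" if t: "t \<in> {0..a}" for t
  proof -
    have "EIIx (v t) - eIIf t (v t) (W2 a v t) = 0"
    proof (rule zero_on_closure[OF a, where f="\<lambda>t. EIIx (v t) - eIIf t (v t) (W2 a v t)", OF _ _ t])
      have "continuous_on {0..a} (\<lambda>t. eIIf t (v t) (W2 a v t))"
        by (rule eIIf_continuous[OF continuous_on_id cv _ continuous_on_subset[OF W2_continuous[OF adv] sub]]) (use good in auto)
      then show "continuous_on {0..a} (\<lambda>t. EIIx (v t) - eIIf t (v t) (W2 a v t))"
        by (intro continuous_intros bounded_linear.continuous_on[OF linear_maps(2) cv])
      fix t assume t: "t \<in> {0..<a}"
      have "EIIx (u t) = eIIf t (u t) (W2 t u t)" using sol[of t] t by (simp add: csol_def)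
      moreover have "W2 t u t = W2 a v t" using uv t by (intro W2_cong[OF adu adv]) auto
      ultimately show "EIIx (v t) - eIIf t (v t) (W2 a v t) = 0" using v(2)[OF t] by simp
    qed
    then show ?thesis by simp
  qed
  have "csol a v" using adv 1 2 by (simp add: csol_def)
  then show ?thesis using v(2) by (intro exI[of _ v]) auto
qed

lemma good_open:
  assumes "good a x" "a \<ge> 0"
  shows "\<exists>d>0. \<forall>t\<ge>0. \<forall>y. dist (t, y) (a, x) < d \<longrightarrow> good t y"
proof -
  define D where "D = {z :: real \<times> (real ^ 'n). fst z \<ge> 0}"
  have "\<forall>\<^sub>F z in at (a, x) within D. \<forall>k\<in>gix. gq k (fst z) (snd z) < 1"
  proof (rule eventually_ball_finite[OF finite_gix], rule ballI)
    fix k assume k: "k \<in> gix"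
    have "continuous_on D (\<lambda>z. gq k (fst z) (snd z))" by (rule gq_continuous[OF k]) (auto simp: D_def intro!: continuous_intros)
    then have "((\<lambda>z. gq k (fst z) (snd z)) \<longlongrightarrow> gq k a x) (at (a, x) within D)"
      using assms(2) by (force simp: continuous_on_def D_def)
    moreover have "gq k a x < 1" using assms(1) k by (simp add: good_gq)
    ultimately show "\<forall>\<^sub>F z in at (a, x) within D. gq k (fst z) (snd z) < 1" by (rule order_tendstoD(2))
  qed
  then obtain d where d: "d > 0" "\<forall>z\<in>D. z \<noteq> (a, x) \<and> dist z (a, x) < d \<longrightarrow> good (fst z) (snd z)"
    unfolding eventually_at good_gq by blast
  have "good t y" if "t \<ge> 0" "dist (t, y) (a, x) < d" for t y
    using d(2) that assms(1) by (cases "(t, y) = (a, x)") (auto simp: D_def)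
  then show ?thesis using d(1) by blast
qed

text \<open>Provides a neighbourhood in which both \<open>Y\<close> and the output remain in the
  range of validity of the local Lipschitz conditions of the operators.\<close>

lemma Yf_near:
  assumes "good a x" "a \<ge> 0" "e > 0"
  shows "\<exists>d>0. \<forall>t\<in>{a..a+d}. \<forall>y\<in>cball x d. good t y \<and> norm (Yf t y - Yf a x) < e \<and> norm (out (Yf t y) - out (Yf a x)) < e"
proof -
  obtain d1 where d1: "d1 > 0" "\<forall>t\<ge>0. \<forall>y. dist (t, y) (a, x) < d1 \<longrightarrow> good t y" using good_open[OF assms(1,2)] by blast
  define D where "D = {z :: real \<times> (real ^ 'n). fst z \<ge> 0 \<and> good (fst z) (snd z)}"
  have z0: "(a, x) \<in> D" using assms by (simp add: D_def)
  have cY: "continuous_on D (\<lambda>z. Yf (fst z) (snd z))"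
    by (rule Yf_continuous) (auto simp: D_def intro!: continuous_intros)
  obtain d2 where d2: "d2 > 0" "\<forall>z\<in>D. dist z (a, x) < d2 \<longrightarrow> dist (Yf (fst z) (snd z)) (Yf a x) < e"
    using cY[unfolded continuous_on_iff, THEN bspec, OF z0, THEN spec, of e] assms(3) by auto
  obtain d3 where d3: "d3 > 0" "\<forall>z\<in>D. dist z (a, x) < d3 \<longrightarrow> dist (out (Yf (fst z) (snd z))) (out (Yf a x)) < e"
    using out_continuous[OF cY, unfolded continuous_on_iff, THEN bspec, OF z0, THEN spec, of e] assms(3) by auto
  define d where "d = min d1 (min d2 d3) / 3"
  have d: "d > 0" "2 * d < d1" "2 * d < d2" "2 * d < d3" using d1 d2 d3 by (auto simp: d_def)
  have "good t y \<and> norm (Yf t y - Yf a x) < e \<and> norm (out (Yf t y) - out (Yf a x)) < e" if "t \<in> {a..a+d}" "y \<in> cball x d" for t y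
  proof -
    have "dist (t, y) (a, x) \<le> dist t a + dist y x"
      unfolding dist_norm using norm_Pair_le[of "t - a" "y - x"] by simp
    also have "\<dots> \<le> 2 * d" using that by (auto simp: dist_real_def dist_commute)
    finally have n: "dist (t, y) (a, x) < d1" "dist (t, y) (a, x) < d2" "dist (t, y) (a, x) < d3" using d by linarith+
    have t0: "t \<ge> 0" using that assms by simp
    then have g: "good t y" using d1(2) n by blast
    then have "(t, y) \<in> D" using t0 by (simp add: D_def)
    then show ?thesis using g d2(2) d3(2) n by (fastforce simp: dist_norm)
  qed
  then show ?thesis using d(1) by blast
qed

lemma PI_gf: "PI (gf t x \<eta>) = gf t x \<eta>" and EII_gf: "EIIx (gf t x \<eta>) = 0"
proof -
  show "PI (gf t x \<eta>) = gf t x \<eta>"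
  proof (rule st_eqI)
    fix i j assume j: "j < ord S i"
    show "st (PI (gf t x \<eta>)) i j = st (gf t x \<eta>) i j" using gf_nth[OF j] j by (simp add: PI_def)
  qed
  then show "EIIx (gf t x \<eta>) = 0" using EII_PI by metis
qed

lemma eIIf_coords: "eIIf t x \<eta> \<in> coords (- II)"
proof -
  have "f2 S Z \<in> coords (- II)" "f3 S p \<in> coords (- II)" for Z p using A3 by (auto simp: assmA3_def)
  moreover have "GammaII S p *v y \<in> coords (- II)" for p y
  proof -
    have "GammaII S p \<in> block_mats (- II) II" using A1 unfolding assmA1_def by blast
    then show ?thesis by (auto simp: coords_def block_mats_def matrix_vector_mult_def)
  qed
  ultimately show ?thesis unfolding eIIf_def Pm_def by (simp add: coords_def)
qed

lemma integral_PI_gf: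
  assumes "(\<lambda>s. gf s (p s) (q s)) integrable_on A"
  shows "PI (integral A (\<lambda>s. gf s (p s) (q s))) = integral A (\<lambda>s. gf s (p s) (q s))"
    "EIIx (integral A (\<lambda>s. gf s (p s) (q s))) = 0"
  using integral_linear[OF assms linear_maps(3)] integral_linear[OF assms linear_maps(2)] by (simp_all add: o_def PI_gf EII_gf)

text \<open>Tonelli's method, started at time \<open>a\<close>. The map \<open>G\<close> integrates
  the first block and re-solves the algebraic equation for the second; its domain is described by
  two Lipschitz constants, one for each block.\<close>

lemma csol_extend:
  assumes sol: "csol a u"
  shows "\<exists>b>a. \<exists>v. csol b v \<and> (\<forall>t\<in>{0..a}. v t = u t)"
proof -
  have ad: "adm a u" and solP: "\<And>t. t \<in> {0..a} \<Longrightarrow> PI (u t) = PI x0 + integral {0..t} (\<lambda>s. gf s (u s) (W1 a u s))"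
    and solE: "\<And>t. t \<in> {0..a} \<Longrightarrow> EIIx (u t) = eIIf t (u t) (W2 a u t)" using sol by (auto simp: csol_def)
  have a: "0 \<le> a" "continuous_on {0..a} u" "u 0 = x0" "\<And>t. t \<in> {0..a} \<Longrightarrow> good t (u t)" using ad by (auto simp: adm_def)
  define xa where "xa = u a"
  have pa: "path a u a = Yf a xa" using a x0_Yf by (auto simp: path_def xa_def)
  have cp: "continuous_on {-h..a} (path a u)" by (rule continuous_on_subset[OF path_continuous[OF ad]]) auto
  obtain \<tau>1 \<delta>1 k1 where T1l: "\<tau>1 > 0" "\<delta>1 > 0" "k1 > 0" and T1L: "lip_near h (T1 S) (path a u) a \<tau>1 \<delta>1 k1"
    using op_class_local_lipschitz[OF T1 a(1) cp] by (elim exE conjE)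
  obtain \<tau>2 \<delta>2 k2 where T2l: "\<tau>2 > 0" "\<delta>2 > 0" "k2 > 0" and T2L: "lip_near h (T2 S) (\<lambda>t. out (path a u t)) a \<tau>2 \<delta>2 k2"
    using op_class_local_lipschitz[OF DAE_op_class[OF T2] a(1) out_continuous[OF cp]] by (elim exE conjE)
  define e where "e = min \<delta>1 \<delta>2"
  have e: "e > 0" "e \<le> \<delta>1" "e \<le> \<delta>2" using T1l T2l by (auto simp: e_def)
  have gxa: "good a xa" using a by (simp add: xa_def)
  obtain d0 where d0: "d0 > 0" and near: "\<forall>t\<in>{a..a+d0}. \<forall>y\<in>cball xa d0. good t y \<and> norm (Yf t y - Yf a xa) < e \<and> norm (out (Yf t y) - out (Yf a xa)) < e"
    using Yf_near[OF gxa a(1) e(1)] by (elim exE conjE)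
  \<comment> \<open>The uniform constants are obtained on \<open>[a, c]\<close> first, because the
    length of the actual step \<open>[a, b]\<close> depends on them.\<close>
  define c where "c = a + d0"
  have ac: "a < c" using d0 by (simp add: c_def)
  define K0 where "K0 = {a..c} \<times> cball xa d0"
  have K0: "compact K0" unfolding K0_def by (intro compact_Times compact_cball) auto
  have K0g: "0 \<le> t \<and> good t y" if "(t, y) \<in> K0" for t y using that near a(1) by (auto simp: K0_def c_def)
  obtain \<epsilon> where \<epsilon>: "\<epsilon> > 0" "\<forall>(t, y)\<in>K0. goodeps \<epsilon> t y" using goodeps_compact[OF K0 K0g] by blast
  define j where "j v t = (if t \<le> a then u t else v t)" for v :: "real \<Rightarrow> real ^ 'n" and t
  define V where "V = {v :: real \<Rightarrow> real ^ 'n. v a = xa \<and> continuous_on {a..c} v \<and> (\<forall>t\<in>{a..c}. v t \<in> cball xa d0)}"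
  have jV: "j v t = v t" if "v \<in> V" "a \<le> t" for v t using that by (auto simp: j_def V_def xa_def)
  have ju: "j v t = u t" if "t \<le> a" for v t using that by (simp add: j_def)
  have adj: "adm c (j v)" if v: "v \<in> V" for v
  proof -
    have "continuous_on ({0..a} \<union> {a..c}) (j v)"
      unfolding j_def
      by (rule continuous_on_cases) (use v a(2) in \<open>auto simp: V_def xa_def\<close>)
    moreover have "{0..a} \<union> {a..c} = {0..c}" using a(1) ac by auto
    moreover have "good t (j v t)" if t: "t \<in> {0..c}" for t
    proof (cases "t \<le> a")
      case False
      then have "(t, v t) \<in> K0" using v t by (auto simp: V_def K0_def)
      then show ?thesis using K0g False by (simp add: j_def)
    qed (use a(4) t in \<open>simp add: j_def\<close>)
    ultimately show ?thesis using a ac by (simp add: adm_def j_def)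
  qed
  have path_le: "path c (j v) \<sigma> = path a u \<sigma>" if "\<sigma> \<le> a" for v \<sigma>
    using path_cong[of a "j v" u c a \<sigma>] that ac ju by auto
  have path_gt: "path c (j v) \<sigma> = Yf (min \<sigma> c) (v (min \<sigma> c))" if "v \<in> V" "a \<le> \<sigma>" for v \<sigma>
  proof (cases "\<sigma> \<le> 0")
    case True
    then have "\<sigma> = a" "a = 0" using that a(1) by auto
    then show ?thesis using x0_Yf that ac a(3) by (simp add: path_def V_def xa_def)
  next
    case False
    then show ?thesis using jV[OF that(1), of "min \<sigma> c"] that ac by (simp add: path_def)
  qed
  have mK0: "(min \<sigma> c, v (min \<sigma> c)) \<in> K0" if "v \<in> V" "a \<le> \<sigma>" for v \<sigma>
    using that ac by (auto simp: V_def K0_def)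
  have path_near: "norm (path c (j v) \<sigma> - path a u a) < e \<and> norm (out (path c (j v) \<sigma>) - out (path a u a)) < e" if "v \<in> V" "a \<le> \<sigma>" for v \<sigma>
    using near mK0[OF that] unfolding path_gt[OF that] pa by (auto simp: K0_def c_def)
  obtain B1 where B1: "\<forall>t\<ge>-h. norm (path a u t) \<le> B1" using adm_bounds(1)[OF ad] by blast
  define BP where "BP = B1 + e"
  have pB: "\<forall>t\<ge>-h. norm (path c (j v) t) \<le> BP" if v: "v \<in> V" for v
  proof (intro allI impI)
    fix t assume t: "t \<ge> -h"
    show "norm (path c (j v) t) \<le> BP"
    proof (cases "t \<le> a")
      case True
      have "norm (path a u t) \<le> B1" using B1 t by blast
      then show ?thesis using e(1) path_le[OF True, of v] by (simp add: BP_def)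
    next
      case False
      then have "norm (path c (j v) t - path a u a) < e" using path_near[OF v] by simp
      moreover have "norm (path a u a) \<le> B1" using B1 a(1) h_nonneg by auto
      ultimately show ?thesis using norm_triangle_sub[of "path c (j v) t" "path a u a"] by (simp add: BP_def)
    qed
  qed
  obtain c1 c2 L where W: "0 \<le> c1" "0 \<le> c2" "0 \<le> L" "Wbd BP c1 c2 L" using path_bounded_W[of BP] by blast
  note Wb = WbdD[OF W(4) adj pB]
  obtain M where M: "M \<ge> 0" and Mb: "\<forall>a b u \<eta>. 0 \<le> a \<longrightarrow> continuous_on {a..b} u \<longrightarrow> (\<forall>t\<in>{a..b}. goodeps \<epsilon> t (u t) \<and> norm (u t) \<le> norm xa + d0) \<longrightarrow>
    \<eta> \<in> borel_measurable (lebesgue_on {a..b}) \<longrightarrow> (AE t in lebesgue_on {a..b}. norm (\<eta> t) \<le> c1) \<longrightarrow> ebd M a b (\<lambda>t. gf t (u t) (\<eta> t))"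
    using gf_path_ebd[OF \<epsilon>(1), of "norm xa + d0" c1] by (elim exE conjE)
  have sb: "norm x \<le> norm xa + d0" if "x \<in> cball xa d0" for x
    using that norm_triangle_sub[of x xa] by (simp add: dist_norm norm_minus_commute)
  define g where "g v s = gf s (v s) (W1 c (j v) s)" for v s
  have gebd: "ebd M a c (g v)" if v: "v \<in> V" for v
    unfolding g_def
  proof (rule Mb[rule_format, OF a(1)])
    show "continuous_on {a..c} v" using v by (simp add: V_def)
    show "goodeps \<epsilon> t (v t) \<and> norm (v t) \<le> norm xa + d0" if "t \<in> {a..c}" for t
      using v that \<epsilon>(2) sb by (auto simp: V_def K0_def)
    show "W1 c (j v) \<in> borel_measurable (lebesgue_on {a..c})"
      using W1_measurable[OF adj[OF v], of c] by (rule borel_measurable_lebesgue_on_subset) (use a in auto)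
    show "AE t in lebesgue_on {a..c}. norm (W1 c (j v) t) \<le> c1"
      by (rule AE_lebesgue_on_subset[OF Wb(1)[OF v v, of c]]) (use a in auto)
  qed
  \<comment> \<open>\<open>M\<close> may be 0, but the gauge \<open>R\<close> divides by this
    constant.\<close>
  define MP where "MP = M + 1"
  \<comment> \<open>No Lipschitz condition is imposed on the second block. The constant
    \<open>M'\<close> found on this class can therefore be used, without circularity, to choose the
    Lipschitz constant of that block.\<close>
  define A where "A = {v\<in>V. \<forall>s\<in>{a..c}. \<forall>t\<in>{a..c}. norm (PI (v t) - PI (v s)) \<le> MP * \<bar>t - s\<bar>}"
  have AV: "A \<subseteq> V" by (auto simp: A_def)
  define w where "w v t = W2 c (j v) t" for v t
  define Jc where "Jc = {a..c}"
  have Jc: "Jc \<subseteq> {0..}" "\<And>t. t \<in> Jc \<Longrightarrow> 0 \<le> t" using a(1) by (auto simp: Jc_def)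
  obtain KP where KP: "KP \<ge> 0" "\<And>y. norm (PI y) \<le> norm y * KP" using bounded_linear.nonneg_bounded[OF linear_maps(3)] by blast
  obtain KE where KE: "KE \<ge> 0" "\<And>y. norm (EIIx y) \<le> norm y * KE" using bounded_linear.nonneg_bounded[OF linear_maps(2)] by blast
  have vb: "norm (v t) \<le> norm xa + d0" if "v \<in> A" "t \<in> Jc" for v t using that AV by (intro sb) (auto simp: V_def Jc_def)
  have Pu: "ubl A Jc (\<lambda>v t. PI (v t))"
  proof (rule ublI)
    show "norm (PI (v t)) \<le> (norm xa + d0) * KP" if "v \<in> A" "t \<in> Jc" for v t
      using KP(2)[of "v t"] mult_right_mono[OF vb[OF that] KP(1)] by linarith
    show "norm (PI (v t) - PI (v s)) \<le> MP * \<bar>t - s\<bar>" if "v \<in> A" "s \<in> Jc" "t \<in> Jc" for v s t using that by (auto simp: A_def Jc_def)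
  qed
  have wu: "ubl A Jc w"
  proof (rule ublI)
    show "norm (w v t) \<le> c2" if "v \<in> A" "t \<in> Jc" for v t using Wb(2)[of v t] that AV Jc(2) by (auto simp: w_def)
    show "norm (w v t - w v s) \<le> L * \<bar>t - s\<bar>" if "v \<in> A" "s \<in> Jc" "t \<in> Jc" for v s t
      using Wb(3)[of v s t] that AV Jc(2) by (auto simp: w_def)
  qed
  have ge: "goodeps \<epsilon> t (v t)" if "v \<in> A" "t \<in> Jc" for v t
    using that AV \<epsilon>(2) by (force simp: V_def Jc_def K0_def)
  have EB: "norm (EIIx (v t)) \<le> (norm xa + d0) * KE" if "v \<in> A" "t \<in> Jc" for v t
    using KE(2)[of "v t"] mult_right_mono[OF vb[OF that] KE(1)] by linarith
  have "\<exists>M\<ge>0. \<forall>v\<in>A. \<forall>s\<in>Jc. \<forall>t\<in>Jc. norm (eIIf t (v t) (w v t) - eIIf s (v s) (w v s)) \<le>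
    M * \<bar>t - s\<bar> + rho * norm (EIIx (v t) - EIIx (v s))"
    by (rule eIIf_contraction[where u="\<lambda>v. v" and B="(norm xa + d0) * KE", OF Jc(1) Pu \<epsilon>(1) _ _ wu]) (fact ge EB)+
  then obtain M' where M': "M' \<ge> 0" and contr: "\<forall>v\<in>A. \<forall>s\<in>Jc. \<forall>t\<in>Jc. norm (eIIf t (v t) (w v t) - eIIf s (v s) (w v s)) \<le>
    M' * \<bar>t - s\<bar> + rho * norm (EIIx (v t) - EIIx (v s))" by (elim exE conjE)
  \<comment> \<open>Chosen such that \<open>M' + rho * LI \<le> LI\<close>: the second block stays
    \<open>LI\<close>-Lipschitz under \<open>G\<close>.\<close>
  define LI where "LI = (M' + 1) / (1 - rho)"
  have "(1 - rho) * LI = M' + 1" using rho by (simp add: LI_def)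
  then have "LI - rho * LI = M' + 1" by (simp add: left_diff_distrib)
  moreover have "LI > 0" using M' rho by (simp add: LI_def)
  ultimately have LI: "LI > 0" "M' + rho * LI \<le> LI" by linarith+
  have MP: "MP > 0" "M \<le> MP" using M by (auto simp: MP_def)
  \<comment> \<open>Measures both blocks at once but keeps their Lipschitz constants apart, since
    \<open>M'\<close> depends on that of the first block.\<close>
  define R where "R x = max (norm (PI x) / MP) (norm (EIIx x) / LI)" for x
  have R_iff: "R x \<le> s \<longleftrightarrow> norm (PI x) \<le> MP * s \<and> norm (EIIx x) \<le> LI * s" for x s
    using MP(1) LI(1) by (simp add: R_def divide_le_eq mult.commute)
  define cc where "cc = MP + LI"
  have cc: "cc > 0" using MP LI by (simp add: cc_def)
  have Rn: "norm x \<le> cc * R x" for x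
  proof -
    have "norm (PI x) \<le> MP * R x \<and> norm (EIIx x) \<le> LI * R x" using R_iff[of x "R x"] by simp
    then show ?thesis using norm_split[of x] by (simp add: cc_def distrib_right)
  qed
  \<comment> \<open>The step is short enough for \<open>cc\<close>-Lipschitz functions to stay in
    the ball of radius \<open>d0\<close> and for the local Lipschitz conditions of both
    operators.\<close>
  define b where "b = a + min (min d0 (d0 / cc)) (min \<tau>1 \<tau>2)"
  have b: "a < b" "b \<le> c" "cc * (b - a) \<le> d0" "b \<le> a + \<tau>1" "b \<le> a + \<tau>2"
  proof -
    show "a < b" using d0 cc T1l T2l by (simp add: b_def)
    have "b - a \<le> d0 / cc" by (simp add: b_def)
    then show "cc * (b - a) \<le> d0" using cc by (simp add: pos_le_divide_eq mult.commute)
  qed (auto simp: b_def c_def)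
  have lP: "linear PI" and lE: "linear EIIx" using linear_maps by (auto intro: bounded_linear.linear)
  define K where "K = {v :: real \<Rightarrow> real ^ 'n. v a = xa \<and> (\<forall>s t. a \<le> s \<longrightarrow> s \<le> t \<longrightarrow> t \<le> b \<longrightarrow> R (v t - v s) \<le> t - s)}"
  \<comment> \<open>Constant continuation from \<open>b\<close> up to \<open>c\<close>, so that the
    estimates for the class \<open>A\<close> apply.\<close>
  define ex where "ex v t = v (min t b)" for v :: "real \<Rightarrow> real ^ 'n" and t
  have KL: "norm (PI (v t) - PI (v s)) \<le> MP * \<bar>t - s\<bar> \<and> norm (EIIx (v t) - EIIx (v s)) \<le> LI * \<bar>t - s\<bar> \<and> norm (v t - v s) \<le> cc * \<bar>t - s\<bar>"
    if v: "v \<in> K" "s \<in> {a..b}" "t \<in> {a..b}" for v s t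
  proof -
    have le: "norm (PI (v t) - PI (v s)) \<le> MP * \<bar>t - s\<bar> \<and> norm (EIIx (v t) - EIIx (v s)) \<le> LI * \<bar>t - s\<bar> \<and> norm (v t - v s) \<le> cc * \<bar>t - s\<bar>"
      if "s \<in> {a..b}" "t \<in> {a..b}" "s \<le> t" for s t
    proof -
      have "R (v t - v s) \<le> t - s" using v(1) that by (auto simp: K_def)
      then have "norm (PI (v t - v s)) \<le> MP * (t - s) \<and> norm (EIIx (v t - v s)) \<le> LI * (t - s)" "cc * R (v t - v s) \<le> cc * (t - s)"
        using R_iff cc by auto
      then show ?thesis using Rn[of "v t - v s"] that by (simp add: linear_diff[OF lP] linear_diff[OF lE])
    qed
    show ?thesis using le[OF v(2,3)] le[OF v(3,2)] by (cases "s \<le> t") (auto simp: norm_minus_commute abs_minus_commute)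
  qed
  have exA: "ex v \<in> A" if v: "v \<in> K" for v
  proof -
    have m: "min t b \<in> {a..b}" if "t \<in> {a..c}" for t using that b by auto
    have mm: "\<bar>min t b - min s b\<bar> \<le> \<bar>t - s\<bar>" for s t by linarith
    have a0: "ex v a = xa" using v b by (simp add: ex_def K_def)
    have lip: "norm (ex v t - ex v s) \<le> cc * \<bar>t - s\<bar>" if "s \<in> {a..c}" "t \<in> {a..c}" for s t
      unfolding ex_def by (rule order_trans[OF _ mult_left_mono[OF mm[of t s]]]) (use KL[OF v m[OF that(1)] m[OF that(2)]] cc in auto)
    have "continuous_on {a..c} (ex v)" by (rule lipschitz_imp_continuous_on) (rule lip)
    moreover have "ex v t \<in> cball xa d0" if t: "t \<in> {a..c}" for t
    proof -
      have "norm (v (min t b) - v a) \<le> cc * \<bar>min t b - a\<bar>" using KL[OF v _ m[OF t], of a] b by auto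
      also have "\<dots> \<le> cc * (b - a)" using cc t b by (intro mult_left_mono) auto
      finally show ?thesis using b(3) v by (simp add: ex_def K_def dist_norm norm_minus_commute)
    qed
    moreover have "norm (PI (ex v t) - PI (ex v s)) \<le> MP * \<bar>t - s\<bar>" if "s \<in> {a..c}" "t \<in> {a..c}" for s t
      unfolding ex_def by (rule order_trans[OF _ mult_left_mono[OF mm[of t s]]]) (use KL[OF v m[OF that(1)] m[OF that(2)]] MP in auto)
    ultimately show ?thesis using a0 by (simp add: A_def V_def)
  qed
  have exV: "ex v \<in> V" if "v \<in> K" for v using exA[OF that] AV by blast
  have ext: "ex v t = v t" if "t \<le> b" for v t using that by (simp add: ex_def min_def)
  define G where "G v t = PI xa + integral {a..t} (g (ex v)) + emb (eIIf t (v t) (w (ex v) t))" for v t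
  have gint: "g (ex v) integrable_on {a..t}" if "v \<in> K" "t \<le> b" for v t
    using ebd_integrable[OF ebd_subset[OF gebd[OF exV[OF that(1)]], of a t]] that b by auto
  have PG: "PI (G v t) = PI xa + integral {a..t} (g (ex v))" if "v \<in> K" "t \<le> b" for v t
    using integral_PI_gf(1)[OF gint[OF that, unfolded g_def]] unfolding G_def g_def by (simp add: linear_add[OF lP])
  have EG: "EIIx (G v t) = eIIf t (v t) (w (ex v) t)" if "v \<in> K" "t \<le> b" for v t
    using integral_PI_gf(2)[OF gint[OF that, unfolded g_def]] unfolding G_def g_def
    by (simp add: linear_add[OF lE] EII_emb[OF eIIf_coords])
  have bJ: "t \<in> Jc" if "t \<in> {a..b}" for t using that b by (auto simp: Jc_def)
  have w_a: "w v a = W2 a u a" if "v \<in> V" for v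
    unfolding w_def by (rule W2_cong[OF adj[OF that] ad]) (use a ac ju in auto)
  have "\<exists>v\<in>K. \<forall>t\<in>{a..b}. G v t = v t"
  proof (rule tonelli_fixed_point[OF b(1) _ _ Rn less_imp_le[OF cc] K_def])
    show "continuous_on UNIV R"
      unfolding R_def
      by (intro continuous_intros bounded_linear.continuous_on[OF linear_maps(3)] bounded_linear.continuous_on[OF linear_maps(2)]) (use MP LI in auto)
    show "R 0 = 0" using linear_0[OF lP] linear_0[OF lE] by (simp add: R_def)
    fix v assume v: "v \<in> K"
    have va: "v a = xa" using v by (simp add: K_def)
    \<comment> \<open>The initial value is reproduced because \<open>u\<close> satisfies the
      algebraic equation at \<open>a\<close>.\<close>
    have "G v a = PI xa + emb (eIIf a xa (W2 a u a))" using w_a[OF exV[OF v]] va by (simp add: G_def)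
    also have "eIIf a xa (W2 a u a) = EIIx xa" using solE[of a] a(1) by (simp add: xa_def)
    finally have Ga: "G v a = xa" by (simp add: PI_plus_emb)
    show "G v \<in> K"
      unfolding K_def
    proof (intro CollectI conjI allI impI Ga)
      fix s t assume st: "a \<le> s" "s \<le> t" "t \<le> b"
      have "PI (G v t) - PI (G v s) = integral {s..t} (g (ex v))"
        using PG[OF v, of s] PG[OF v, of t] Henstock_Kurzweil_Integration.integral_combine[of a s t "g (ex v)"] gint[OF v, of t] st by (simp add: algebra_simps)
      moreover have "norm (integral {s..t} (g (ex v))) \<le> M * (t - s)"
        using ebd_integral_bound[OF gebd[OF exV[OF v]], of s t] st b by simp
      moreover have "M * (t - s) \<le> MP * (t - s)" using MP st by (intro mult_right_mono) auto
      ultimately have 1: "norm (PI (G v t) - PI (G v s)) \<le> MP * (t - s)" by simp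
      have I: "s \<in> {a..b}" "t \<in> {a..b}" using st by auto
      have "norm (EIIx (G v t) - EIIx (G v s)) \<le> M' * \<bar>t - s\<bar> + rho * norm (EIIx (v t) - EIIx (v s))"
        using contr[THEN bspec, OF exA[OF v], THEN bspec, OF bJ[OF I(1)], THEN bspec, OF bJ[OF I(2)]] EG[OF v, of s] EG[OF v, of t] st
          ext[of s v] ext[of t v] by simp
      also have "\<dots> \<le> M' * (t - s) + rho * (LI * (t - s))"
        using KL[OF v I] st rho(1) M' by (intro add_mono mult_left_mono) auto
      also have "\<dots> = (M' + rho * LI) * (t - s)" by (simp add: algebra_simps)
      also have "\<dots> \<le> LI * (t - s)" using LI(2) st by (intro mult_right_mono) auto
      finally show "R (G v t - G v s) \<le> t - s" using 1 unfolding R_iff by (simp add: linear_diff[OF lP] linear_diff[OF lE])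
    qed
  next
    fix v z t assume vz: "v \<in> K" "z \<in> K" "t \<in> {a..b}" "\<And>s. s \<in> {a..t} \<Longrightarrow> v s = z s"
    have eqj: "j (ex v) s = j (ex z) s" if "s \<in> {0..t}" for s
      using vz(3) vz(4)[of s] that by (auto simp: j_def ext)
    have t0: "0 \<le> t" "t \<le> c" using vz(3) a b by auto
    have "AE s in lebesgue_on {0..t}. W1 c (j (ex v)) s = W1 c (j (ex z)) s"
      by (rule W1_cong[OF adj[OF exV[OF vz(1)]] adj[OF exV[OF vz(2)]]]) (use eqj t0 in auto)
    then have "AE s in lebesgue_on {a..t}. W1 c (j (ex v)) s = W1 c (j (ex z)) s"
      by (rule AE_lebesgue_on_subset) (use a in auto)
    then have "negligible {s\<in>{a..t}. \<not> (W1 c (j (ex v)) s = W1 c (j (ex z)) s)}" by (simp add: AE_lebesgue_on_iff_negligible)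
    then have "integral {a..t} (g (ex v)) = integral {a..t} (g (ex z))"
      by (rule integral_spike) (use vz ext in \<open>auto simp: g_def\<close>)
    moreover have "w (ex v) t = w (ex z) t" unfolding w_def
      by (rule W2_cong[OF adj[OF exV[OF vz(1)]] adj[OF exV[OF vz(2)]]]) (use eqj t0 in auto)
    moreover have "v t = z t" using vz by auto
    ultimately show "G v t = G z t" by (simp add: G_def)
  next
    fix U z t assume U: "\<And>n. U n \<in> K" and z: "z \<in> K" and lim: "uniform_limit {a..b} U z sequentially" and t: "t \<in> {a..b}"
    have cY: "continuous_on K0 (\<lambda>p. Yf (fst p) (snd p))"
      by (rule Yf_continuous) (auto intro!: continuous_intros simp: K0g)
    have uc: "uniformly_continuous_on K0 (\<lambda>p. Yf (fst p) (snd p))" by (rule compact_uniformly_continuous[OF cY K0])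
    \<comment> \<open>Uniform convergence carries over to the signals \<open>Y\<close> by uniform
      continuity of \<open>Yf\<close> on the compact set \<open>K0\<close>.\<close>
    have near_n: "\<exists>N. \<forall>n\<ge>N. \<forall>\<sigma>\<ge>a. norm (path c (j (ex (U n))) \<sigma> - path c (j (ex z)) \<sigma>) \<le> d" if d: "d > 0" for d
    proof -
      obtain \<eta> where \<eta>: "\<eta> > 0" and uc': "\<forall>p\<in>K0. \<forall>p'\<in>K0. dist p' p < \<eta> \<longrightarrow> dist (Yf (fst p') (snd p')) (Yf (fst p) (snd p)) < d"
        using uc d unfolding uniformly_continuous_on_def by meson
      obtain N where N: "\<forall>n\<ge>N. \<forall>s\<in>{a..b}. dist (U n s) (z s) < \<eta>"
        using lim \<eta> unfolding uniform_limit_iff eventually_sequentially by meson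
      show ?thesis
      proof (intro exI[of _ N] allI impI)
        fix n \<sigma> assume n: "n \<ge> N" and s: "a \<le> \<sigma>"
        have "min (min \<sigma> c) b \<in> {a..b}" using s ac b by auto
        then have "dist (ex (U n) (min \<sigma> c)) (ex z (min \<sigma> c)) < \<eta>" using N n by (simp add: ex_def)
        then have "dist (min \<sigma> c, ex (U n) (min \<sigma> c)) (min \<sigma> c, ex z (min \<sigma> c)) < \<eta>" by (simp add: dist_Pair_Pair)
        then have "dist (Yf (min \<sigma> c) (ex (U n) (min \<sigma> c))) (Yf (min \<sigma> c) (ex z (min \<sigma> c))) < d"
          using uc' mK0[OF exV[OF U] s] mK0[OF exV[OF z] s] by fastforce
        then show "norm (path c (j (ex (U n))) \<sigma> - path c (j (ex z)) \<sigma>) \<le> d"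
          using path_gt[OF exV[OF U] s] path_gt[OF exV[OF z] s] by (simp add: dist_norm)
      qed
    qed
    \<comment> \<open>Restricting the tolerances to \<open>1 / (m + 1)\<close> leaves countably many
      estimates, whose null sets can be united.\<close>
    have "\<forall>m. \<exists>N. \<forall>n\<ge>N. \<forall>\<sigma>\<ge>a. norm (path c (j (ex (U n))) \<sigma> - path c (j (ex z)) \<sigma>) \<le> inverse (real (Suc m))"
      using near_n by (simp del: of_nat_Suc)
    from choice[OF this] obtain N where N: "\<forall>m. \<forall>n\<ge>N m. \<forall>\<sigma>\<ge>a. norm (path c (j (ex (U n))) \<sigma> - path c (j (ex z)) \<sigma>) \<le> inverse (real (Suc m))"
      by (elim exE)
    have conv: "X \<longlonglongrightarrow> l" if X: "\<forall>m. \<forall>n\<ge>N m. norm (X n - l) \<le> k * inverse (real (Suc m))" and k: "k > 0"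
      for X :: "nat \<Rightarrow> real ^ 'k" and l k
    proof (rule LIMSEQ_I)
      fix q :: real assume "q > 0"
      then obtain m where "inverse (real (Suc m)) < q / k" using reals_Archimedean[of "q / k"] k by auto
      then have "k * inverse (real (Suc m)) < q" using k by (simp add: pos_less_divide_eq mult.commute)
      then show "\<exists>no. \<forall>n\<ge>no. norm (X n - l) < q" using X by (intro exI[of _ "N m"]) (meson le_less_trans)
    qed
    have pc: "continuous_on {-h..} (path c (j (ex v)))" if "v \<in> K" for v using path_continuous[OF adj[OF exV[OF that]]] .
    \<comment> \<open>Both signals share the history \<open>path a u\<close> and stay near its end
      value, so the local Lipschitz condition of \<open>T1\<close> applies.\<close>
    have l1: "AE s in lebesgue_on {a..a+\<tau>1}. norm (W1 c (j (ex (U n))) s - W1 c (j (ex z)) s) \<le> k1 * inverse (real (Suc m))" if n: "n \<ge> N m" for m n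
      unfolding W1_def
    proof (rule T1L[unfolded lip_near_def, rule_format, OF pc[OF U] pc[OF z]])
      fix \<sigma> assume s: "\<sigma> \<in> {a..a+\<tau>1}"
      then show "norm (path c (j (ex (U n))) \<sigma> - path a u a) < \<delta>1 \<and> norm (path c (j (ex z)) \<sigma> - path a u a) < \<delta>1 \<and>
          norm (path c (j (ex (U n))) \<sigma> - path c (j (ex z)) \<sigma>) \<le> inverse (real (Suc m))"
        using path_near[OF exV[OF U], of \<sigma> n] path_near[OF exV[OF z], of \<sigma>] e(2) N n by (auto simp del: of_nat_Suc)
    qed (use path_le in auto)
    have "AE s in lebesgue_on {a..a+\<tau>1}. \<forall>m n. N m \<le> n \<longrightarrow> norm (W1 c (j (ex (U n))) s - W1 c (j (ex z)) s) \<le> k1 * inverse (real (Suc m))"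
      unfolding AE_all_countable
    proof (intro allI)
      show "AE s in lebesgue_on {a..a+\<tau>1}. N m \<le> n \<longrightarrow> norm (W1 c (j (ex (U n))) s - W1 c (j (ex z)) s) \<le> k1 * inverse (real (Suc m))" for m n
        using l1[of m n] by (cases "N m \<le> n") (simp_all del: of_nat_Suc)
    qed
    then have "AE s in lebesgue_on {a..t}. \<forall>m n. N m \<le> n \<longrightarrow> norm (W1 c (j (ex (U n))) s - W1 c (j (ex z)) s) \<le> k1 * inverse (real (Suc m))"
      by (rule AE_lebesgue_on_subset) (use t b in auto)
    then have gl: "AE s in lebesgue_on {a..t}. (\<lambda>n. g (ex (U n)) s) \<longlonglongrightarrow> g (ex z) s"
      using AE_space
    proof eventually_elim
      case (elim s)
      have s: "s \<in> {a..b}" "s \<in> Jc" using elim(2) t b by (auto simp: space_restrict_space Jc_def)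
      have "(\<lambda>n. W1 c (j (ex (U n))) s) \<longlonglongrightarrow> W1 c (j (ex z)) s" by (rule conv[OF _ T1l(3)]) (use elim(1) in blast)
      moreover have "(\<lambda>n. ex (U n) s) \<longlonglongrightarrow> ex z s" using tendsto_uniform_limitI[OF lim s(1)] s(1) by (simp add: ext)
      ultimately show ?case unfolding g_def
        by (intro gf_tendsto) (use s Jc(2) goodeps_good[OF \<epsilon>(1) ge[OF exA[OF U]]] goodeps_good[OF \<epsilon>(1) ge[OF exA[OF z]]] in auto)
    qed
    have "(\<lambda>n. integral {a..t} (g (ex (U n)))) \<longlonglongrightarrow> integral {a..t} (g (ex z))"
    proof (rule dominated_convergence_AE[OF _ _ gl])
      show "g (ex (U n)) integrable_on {a..t}" for n using gint[OF U] t by simp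
      show "AE s in lebesgue_on {a..t}. norm (g (ex (U n)) s) \<le> M" for n
        using ebd_subset[OF gebd[OF exV[OF U]], of a t n] t b by (simp add: ebd_def)
    qed
    moreover have "(\<lambda>n. eIIf t (U n t) (w (ex (U n)) t)) \<longlonglongrightarrow> eIIf t (z t) (w (ex z) t)"
    proof -
      obtain KO where KO: "KO \<ge> 0" "\<And>y. norm (out y) \<le> norm y * KO" using bounded_linear.nonneg_bounded[OF linear_maps(5)] by blast
      have lO: "linear out" using linear_maps by (auto intro: bounded_linear.linear)
      have "norm (w (ex (U n)) t - w (ex z) t) \<le> (k2 * (KO + 1)) * inverse (real (Suc m))" if n: "n \<ge> N m" for m n
      proof -
        \<comment> \<open>The algebraic equation needs the operator value at the single time
          \<open>t\<close>; continuity of the images under \<open>T2\<close> turns this estimate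
          into a pointwise one.\<close>
        have "AE s in lebesgue_on {a..a+\<tau>2}. norm (w (ex (U n)) s - w (ex z) s) \<le> k2 * ((KO + 1) * inverse (real (Suc m)))"
          unfolding W2_def w_def
        proof (rule T2L[unfolded lip_near_def, rule_format, OF out_continuous[OF pc[OF U]] out_continuous[OF pc[OF z]]])
          fix \<sigma> assume s: "\<sigma> \<in> {a..a+\<tau>2}"
          have d: "norm (path c (j (ex (U n))) \<sigma> - path c (j (ex z)) \<sigma>) \<le> inverse (real (Suc m))" using N n s by (auto simp del: of_nat_Suc)
          have "norm (out (path c (j (ex (U n))) \<sigma>) - out (path c (j (ex z)) \<sigma>)) \<le> norm (path c (j (ex (U n))) \<sigma> - path c (j (ex z)) \<sigma>) * KO"
            using KO(2) by (simp add: linear_diff[OF lO, symmetric])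
          also have "\<dots> \<le> inverse (real (Suc m)) * (KO + 1)" using d KO by (intro mult_mono) auto
          finally show "norm (out (path c (j (ex (U n))) \<sigma>) - out (path a u a)) < \<delta>2 \<and> norm (out (path c (j (ex z)) \<sigma>) - out (path a u a)) < \<delta>2 \<and>
              norm (out (path c (j (ex (U n))) \<sigma>) - out (path c (j (ex z)) \<sigma>)) \<le> (KO + 1) * inverse (real (Suc m))"
            using path_near[OF exV[OF U], of \<sigma> n] path_near[OF exV[OF z], of \<sigma>] e(3) s by (simp add: mult.commute)
        qed (use path_le in auto)
        moreover have "continuous_on {a..a+\<tau>2} (\<lambda>s. norm (w (ex (U n)) s - w (ex z) s))"
          unfolding w_def
          by (intro continuous_intros continuous_on_subset[OF W2_continuous[OF adj[OF exV[OF U]]]] continuous_on_subset[OF W2_continuous[OF adj[OF exV[OF z]]]])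
            (use a in auto)
        ultimately have "norm (w (ex (U n)) t - w (ex z) t) \<le> k2 * ((KO + 1) * inverse (real (Suc m)))"
          using t b T2l(1) by (intro AE_lebesgue_on_continuous_le[where a=a and b="a+\<tau>2" and f="\<lambda>s. norm (w (ex (U n)) s - w (ex z) s)"]) auto
        then show ?thesis by (simp only: mult.assoc)
      qed
      then have wl: "(\<lambda>n. w (ex (U n)) t) \<longlonglongrightarrow> w (ex z) t"
        using T2l(3) KO(1) by (intro conv[where k="k2 * (KO + 1)"]) auto
      have tJ: "t \<in> Jc" using bJ[OF t] .
      have gU: "good t (U n t)" for n using goodeps_good[OF \<epsilon>(1) ge[OF exA[OF U] tJ]] t by (simp add: ext)
      have gz: "good t (z t)" using goodeps_good[OF \<epsilon>(1) ge[OF exA[OF z] tJ]] t by (simp add: ext)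
      define D where "D = {p :: (real ^ 'n) \<times> (real ^ 'k). good t (fst p)}"
      have cD: "continuous_on D (\<lambda>p. eIIf t (fst p) (snd p))"
        by (rule eIIf_continuous[where a="\<lambda>_. t"]) (use Jc(2)[OF tJ] in \<open>auto simp: D_def intro!: continuous_intros\<close>)
      have "(\<lambda>n. (U n t, w (ex (U n)) t)) \<longlonglongrightarrow> (z t, w (ex z) t)"
        by (intro tendsto_Pair wl tendsto_uniform_limitI[OF lim t])
      from continuous_on_tendsto_compose[OF cD this] show ?thesis using gU gz by (simp add: D_def)
    qed
    ultimately show "(\<lambda>n. G (U n) t) \<longlonglongrightarrow> G z t"
      unfolding G_def by (intro tendsto_intros bounded_linear.tendsto[OF linear_maps(4)])
  qed
  then obtain z where z: "z \<in> K" "\<And>t. t \<in> {a..b} \<Longrightarrow> G z t = z t" by blast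
  define y where "y = j (ex z)"
  have yz: "y t = z t" if "t \<in> {a..b}" for t using jV[OF exV[OF z(1)], of t] that ext by (simp add: y_def)
  have yu: "y t = u t" if "t \<le> a" for t using ju[OF that] by (simp add: y_def)
  have adc: "adm c y" using adj[OF exV[OF z(1)]] by (simp add: y_def)
  have adb: "adm b y" using adm_subset[OF adc] b a by auto
  have "PI (y t) = PI x0 + integral {0..t} (\<lambda>s. gf s (y s) (W1 b y s))" if t: "t \<in> {0..b}" for t
  proof (cases "t \<le> a")
    case True
    have "integral {0..t} (\<lambda>s. gf s (y s) (W1 b y s)) = integral {0..t} (\<lambda>s. gf s (u s) (W1 a u s))"
      by (rule gf_W1_cong[OF adb ad]) (use yu True t b in auto)
    then show ?thesis using solP[of t] yu[OF True] True t by simp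
  next
    case False
    have t': "t \<in> {a..b}" using False t by simp
    have "PI (y t) = PI xa + integral {a..t} (g (ex z))" using PG[OF z(1), of t] z(2)[OF t'] yz[OF t'] t by simp
    moreover have "integral {a..t} (g (ex z)) = integral {a..t} (\<lambda>s. gf s (y s) (W1 c y s))"
      unfolding g_def by (rule integral_cong) (use t' yz ext in \<open>auto simp: y_def\<close>)
    moreover have "PI xa = PI x0 + integral {0..a} (\<lambda>s. gf s (y s) (W1 c y s))"
    proof -
      have "integral {0..a} (\<lambda>s. gf s (y s) (W1 c y s)) = integral {0..a} (\<lambda>s. gf s (u s) (W1 a u s))"
        by (rule gf_W1_cong[OF adc ad]) (use yu a ac in auto)
      then show ?thesis using solP[of a] a(1) by (simp add: xa_def)
    qed
    moreover have "integral {0..t} (\<lambda>s. gf s (y s) (W1 c y s)) = integral {0..a} (\<lambda>s. gf s (y s) (W1 c y s)) + integral {a..t} (\<lambda>s. gf s (y s) (W1 c y s))"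
    proof -
      obtain M2 where "ebd M2 0 c (\<lambda>s. gf s (y s) (W1 c y s))" using gf_ebd[OF adc] by blast
      from ebd_integrable[OF ebd_subset[OF this, of 0 t]] have "(\<lambda>s. gf s (y s) (W1 c y s)) integrable_on {0..t}" using t b by simp
      then show ?thesis using Henstock_Kurzweil_Integration.integral_combine[of 0 a t "\<lambda>s. gf s (y s) (W1 c y s)"] a t' by simp
    qed
    moreover have "integral {0..t} (\<lambda>s. gf s (y s) (W1 c y s)) = integral {0..t} (\<lambda>s. gf s (y s) (W1 b y s))"
      by (rule gf_W1_cong[OF adc adb]) (use t b in auto)
    ultimately show ?thesis by simp
  qed
  moreover have "EIIx (y t) = eIIf t (y t) (W2 b y t)" if t: "t \<in> {0..b}" for t
  proof (cases "t \<le> a")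
    case True
    have "W2 b y t = W2 a u t" by (rule W2_cong[OF adb ad]) (use yu True t b in auto)
    then show ?thesis using solE[of t] yu[OF True] True t by simp
  next
    case False
    have t': "t \<in> {a..b}" using False t by simp
    have "W2 b y t = W2 c y t" by (rule W2_cong[OF adb adc]) (use t b in auto)
    then show ?thesis using EG[OF z(1), of t] z(2)[OF t'] yz[OF t'] t by (simp add: w_def y_def)
  qed
  ultimately have "csol b y" using adb by (simp add: csol_def)
  then show ?thesis using b(1) yu by (intro exI[of _ b] conjI exI[of _ y]) auto
qed

end

section \<open>From solutions to error coordinates and back\<close>

lemma acb_AE_cong:
  assumes f: "acb a b f f'" and ae: "AE t in lebesgue_on {a..b}. f' t = g' t" and g: "ebd M a b g'"
  shows "acb a b f g'"
  using g
proof (rule acbI)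
  fix t assume t: "t \<in> {a..b}"
  have "negligible {s\<in>{a..b}. f' s \<noteq> g' s}" using ae by (simp add: AE_lebesgue_on_iff_negligible)
  then have "integral {a..t} f' = integral {a..t} g'" by (rule integral_spike) (use t in auto)
  then show "f t = f a + integral {a..t} g'" using acbD(2)[OF f t] by simp
qed

lemma acb_cong:
  assumes f: "acb a b f f'" and eq: "\<And>t. t \<in> {a..b} \<Longrightarrow> g t = f t"
  shows "acb a b g f'"
proof -
  obtain M where "ebd M a b f'" using acbD(1)[OF f] by blast
  then show ?thesis
  proof (rule acbI)
    fix t assume t: "t \<in> {a..b}"
    then show "g t = g a + integral {a..t} f'" using acbD(2)[OF f t] eq[of t] eq[of a] by simp
  qed
qed

text \<open>Solutions are only required to have nonzero gain denominators. Positivity at the start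
  and the intermediate value theorem keep them inside the funnels.\<close>

lemma positive_on_tdom:
  fixes f :: "real \<Rightarrow> real"
  assumes c: "continuous_on (tdom a \<omega>) f" and ne: "\<And>t. t \<in> tdom a \<omega> \<Longrightarrow> f t \<noteq> 0" and a: "f a > 0" and t: "t \<in> tdom a \<omega>"
  shows "f t > 0"
proof (rule ccontr)
  assume "\<not> f t > 0"
  moreover have "a \<le> t" using t by (simp add: tdom_def)
  ultimately obtain s where "a \<le> s" "s \<le> t" "f s = 0"
    using IVT2'[of f t 0 a] a continuous_on_subset[OF c tdom_Icc_subset[OF t]] by auto
  then show False using ne[of s] tdom_Icc_subset[OF t] by auto
qed

context fdae_loop
begin

lemma csol_0: "csol 0 (\<lambda>_. x0)"
  using x0_good x0_II by (simp add: csol_def adm_def)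

lemma csol_global:
  assumes "csol a u0" shows "\<exists>u. (\<forall>b\<ge>0. csol b u) \<and> (\<forall>t\<in>{0..a}. u t = u0 t)"
proof (rule extend_to_all[where P=csol, OF _ _ _ _ _ assms])
  show "0 \<le> a" if "csol a u" for a u using that by (simp add: csol_def adm_def)
  show "csol a v" if "csol a u" "\<And>t. t \<in> {0..a} \<Longrightarrow> v t = u t" for a u v by (rule csol_cong[OF that])
  show "csol b u" if "csol a u" "0 \<le> b" "b \<le> a" for a b u by (rule csol_subset[OF that])
  show "\<exists>v. csol a v \<and> (\<forall>t\<in>{0..<a}. v t = u t)" if "0 < a" "\<And>b. 0 \<le> b \<Longrightarrow> b < a \<Longrightarrow> csol b u" for a u
    by (rule csol_closing[OF that])
  show "\<exists>b>a. \<exists>v. csol b v \<and> (\<forall>t\<in>{0..a}. v t = u t)" if "csol a u" for a u by (rule csol_extend[OF that])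
qed

text \<open>For finite \<open>\<omega>\<close> the solution is first closed at
  \<open>\<omega>\<close> and then continued; for infinite \<open>\<omega>\<close> it is global
  already.\<close>

lemma csol_global_open:
  assumes w: "0 < \<omega>" and sol: "\<And>b. b \<in> tdom 0 \<omega> \<Longrightarrow> csol b u"
  shows "\<exists>v. (\<forall>b\<ge>0. csol b v) \<and> (\<forall>t\<in>tdom 0 \<omega>. v t = u t)"
proof (cases \<omega>)
  case (real a)
  then have "a > 0" "tdom 0 \<omega> = {0..<a}" using w by (auto simp: tdom_def)
  then obtain v where v: "csol a v" "\<forall>t\<in>{0..<a}. v t = u t" using csol_closing[of a u] sol by auto
  obtain z where z: "\<forall>b\<ge>0. csol b z" "\<forall>t\<in>{0..a}. z t = v t" using csol_global[OF v(1)] by blast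
  show ?thesis using z v \<open>tdom 0 \<omega> = {0..<a}\<close> by (intro exI[of _ z]) auto
next
  case PInf
  then show ?thesis using sol by (intro exI[of _ u]) auto
qed (use w in auto)

lemma Yf_ev_cong: "j < ord S i \<Longrightarrow> i \<in> II \<Longrightarrow> (\<And>k. k < j \<Longrightarrow> st x i k = e k) \<Longrightarrow>
  st (Yf t x) i j = yr i j t + st x i j - ev (ph i t) e (Rx j)"
  using ev_cong[OF wfx_Rx, of j "st x i" e "ph i t"] by (simp add: Yf_def)

lemma csol_acbI:
  assumes ad: "adm b u"
    and st: "\<And>i j. i \<in> II \<Longrightarrow> j < r i \<Longrightarrow> acb 0 b (\<lambda>t. st (u t) i j) (\<lambda>s. st (gf s (u s) (W1 b u s)) i j)"
    and E: "\<And>t. t \<in> {0..b} \<Longrightarrow> EIIx (u t) = eIIf t (u t) (W2 b u t)"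
  shows "csol b u"
proof -
  obtain M where M: "ebd M 0 b (\<lambda>s. gf s (u s) (W1 b u s))" using gf_ebd[OF ad] by blast
  have "PI (u t) = PI x0 + integral {0..t} (\<lambda>s. gf s (u s) (W1 b u s))" if t: "t \<in> {0..b}" for t
  proof (rule st_eqI)
    fix i j assume j: "j < ord S i"
    have int: "(\<lambda>s. gf s (u s) (W1 b u s)) integrable_on {0..t}" using ebd_integrable[OF ebd_subset[OF M, of 0 t]] t by simp
    have I: "st (integral {0..t} (\<lambda>s. gf s (u s) (W1 b u s))) i j = integral {0..t} (\<lambda>s. st (gf s (u s) (W1 b u s)) i j)"
      using integral_linear[OF int st_linear, of i j] by (simp add: o_def)
    show "st (PI (u t)) i j = st (PI x0 + integral {0..t} (\<lambda>s. gf s (u s) (W1 b u s))) i j"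
    proof (cases "i \<in> II")
      case True
      then show ?thesis using acbD(2)[OF st[OF True] t] j ad I by (simp add: st_PI adm_def)
    next
      case False
      then show ?thesis using j I by (simp add: PI_def gf_nth)
    qed
  qed
  then show ?thesis using ad E by (simp add: csol_def)
qed

lemma ev_acb:
  assumes i: "i \<in> II" and wf: "wfx n n x" "Suc n \<le> r i"
    and e: "\<And>j t. j < n \<Longrightarrow> t \<in> {0..b} \<Longrightarrow> ((\<lambda>t. st (u t) i j) has_real_derivative ev (ph i t) (st (u t) i) (dEE j)) (at t within {0..})"
    and c: "continuous_on {0..b} u" and g: "\<And>t. t \<in> {0..b} \<Longrightarrow> good t (u t)"
  shows "acb 0 b (\<lambda>t. ev (ph i t) (st (u t) i) x) (\<lambda>t. ev (ph i t) (st (u t) i) (dex x))"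
proof (rule has_vector_derivative_imp_acb)
  show "continuous_on {0..b} (\<lambda>t. ev (ph i t) (st (u t) i) (dex x))"
    by (rule ev_good_continuous[OF i wfx_dex[OF wf(1)] _ _ continuous_on_id c]) (use wf(2) g in auto)
  fix t assume t: "t \<in> {0..b}"
  have "((\<lambda>t. ev (ph i t) (st (u t) i) x) has_real_derivative ev (ph i t) (st (u t) i) (dex x)) (at t within {0..})"
  proof (rule ev_deriv[OF wf(1)])
    show "((\<lambda>t. ph i t j l) has_real_derivative ph i t j (Suc l)) (at t within {0..})" if "j + l < n" for j l
      using phi_deriv[OF i, of j l t] that wf(2) t by simp
    show "1 - (ph i t j 0)\<^sup>2 * (st (u t) i j)\<^sup>2 \<noteq> 0" if "j < n" for j
    proof -
      have "j + 2 \<le> r i" using that wf(2) by simp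
      then have "(phi C i j t)\<^sup>2 * (st (u t) i j)\<^sup>2 < 1" using g[OF t] i unfolding good_def by blast
      then show ?thesis by (simp add: ph_def)
    qed
  qed (use e t in simp)
  then show "((\<lambda>t. ev (ph i t) (st (u t) i) x) has_vector_derivative ev (ph i t) (st (u t) i) (dex x)) (at t within {0..b})"
    unfolding has_real_derivative_iff_has_vector_derivative by (rule has_vector_derivative_within_subset) auto
qed

text \<open>The errors of a solution satisfy the chain equations by \<open>err_formula\<close>. The
  weak derivative of the highest output derivative becomes an integral equation, and the algebraic
  equation, given almost everywhere, holds everywhere by continuity.\<close>

lemma solution_csol:
  assumes sol: "solution S C y0 \<omega> y"
  defines "u \<equiv> \<lambda>t. Yvec S (\<lambda>i j. err C y i j t)"
  shows "b \<in> tdom 0 \<omega> \<Longrightarrow> csol b u"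
    and "t \<in> tdom 0 \<omega> \<Longrightarrow> Yf t (u t) = Ysig S y t"
proof -
  have \<omega>: "\<omega> > 0" and Ck: "\<And>i. Ck_on (ord S i - 1) (- h) \<omega> (\<lambda>t. y t $ i)"
    and ini: "\<And>i j t. j < ord S i \<Longrightarrow> t \<in> {-h..0} \<Longrightarrow> nderiv (- h) j (\<lambda>\<sigma>. y \<sigma> $ i) t = y0 i j t"
    and neI: "\<And>t. t \<in> tdom 0 \<omega> \<Longrightarrow> gain_denom (phiI C) (errI S C y) t \<noteq> 0"
    and neII: "\<And>t. t \<in> tdom 0 \<omega> \<Longrightarrow> gain_denom (phiII C) (errII S C y) t \<noteq> 0"
    and nej: "\<And>t i j. t \<in> tdom 0 \<omega> \<Longrightarrow> i \<in> II \<Longrightarrow> j + 2 \<le> r i \<Longrightarrow> gain_denom (phi C i j) (err C y i j) t \<noteq> 0"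
    using sol unfolding solution_def by blast+
  obtain w1 w2 where w1: "localizes h (T1 S) \<omega> (Ysig S y) w1" and w2: "localizes h (T2 S) \<omega> y w2"
    and wd: "\<And>i. i \<in> II \<Longrightarrow> weak_deriv 0 \<omega> (nderiv (- h) (r i - 1) (\<lambda>\<sigma>. y \<sigma> $ i))
           (\<lambda>t. (f1 S (d1 S t, w1 t) + GammaI S (d2 S t, w1 t) *v inputI S C y t) $ i)"
    and alg: "AE t in lebesgue_on (tdom 0 \<omega>). 0 = f2 S (Ysig S y t) + f3 S (d3 S t, w2 t)
             + GammaII S (d4 S t, w2 t) *v inputI S C y t + f4 S (d5 S t, w2 t) *\<^sub>R inputII S C y t"
    using sol unfolding solution_def by blast
  have D0: "t \<ge> 0" if "t \<in> tdom 0 \<omega>" for t using that by (simp add: tdom_def)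
  have Dh: "tdom 0 \<omega> \<subseteq> tdom (-h) \<omega>" using h_nonneg by (auto simp: tdom_def)
  have z: "0 \<in> tdom 0 \<omega>" using \<omega> by (simp add: tdom_def zero_ereal_def)
  define Y where "Y i j = nderiv (-h) j (\<lambda>\<sigma>. y \<sigma> $ i)" for i j
  have Yd': "(Y i j has_real_derivative Y i (Suc j) t) (at t within {-h..})" if "Suc j < ord S i" "t \<in> tdom (-h) \<omega>" for i j t
  proof -
    have "Y i j differentiable (at t within {-h..})" using Ck[of i] that by (simp add: Ck_on_def Y_def)
    then show ?thesis using vector_derivative_works by (auto simp: Y_def has_real_derivative_iff_has_vector_derivative)
  qed
  have Yd: "(Y i j has_real_derivative Y i (Suc j) t) (at t within {0..})" if "Suc j < ord S i" "t \<in> tdom 0 \<omega>" for i j t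
    by (rule DERIV_subset[OF Yd'[OF that(1)]]) (use that Dh h_nonneg in auto)
  have Yc: "continuous_on (tdom 0 \<omega>) (Y i j)" if j: "j < ord S i" for i j
  proof (cases "Suc j < ord S i")
    case True
    show ?thesis unfolding continuous_on_eq_continuous_within
    proof
      fix t assume t: "t \<in> tdom 0 \<omega>"
      show "continuous (at t within tdom 0 \<omega>) (Y i j)"
        by (rule continuous_within_subset[OF DERIV_continuous[OF Yd[OF True t]]]) (auto simp: tdom_def)
    qed
  next
    case False
    then have "j = ord S i - 1" using j by simp
    then show ?thesis using Ck[of i] continuous_on_subset[OF _ Dh] by (auto simp: Ck_on_def Y_def)
  qed
  have Y_0: "Y i 0 t = y t $ i" for i t by (simp add: Y_def)
  have F: "err C y i j t = Y i j t - yr i j t + ev (ph i t) (\<lambda>k. err C y i k t) (Rx j) \<and>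
      (Suc j < r i \<longrightarrow> (err C y i j has_real_derivative ev (ph i t) (\<lambda>k. err C y i k t) (dEE j)) (at t within {0..}))"
    if i: "i \<in> II" and j: "j < r i" and t: "t \<in> tdom 0 \<omega>" for i j t
  proof -
    have n: "r i - 1 < r i" using r_pos[OF i] by simp
    have "\<forall>j\<le>r i - 1. \<forall>t\<in>tdom 0 \<omega>. err C y i j t = Y i j t - yr i j t + ev (ph i t) (\<lambda>k. err C y i k t) (Rx j) \<and>
      (Suc j < r i \<longrightarrow> (err C y i j has_real_derivative ev (ph i t) (\<lambda>k. err C y i k t) (dEE j)) (at t within {0..}))"
      by (rule err_formula[OF i _ _ n]) (use Y_0 Yd i nej in auto)
    then show ?thesis using j t by auto
  qed
  have su: "st (u t) i j = err C y i j t" if "j < ord S i" for t i j using that by (simp add: u_def)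
  have EI: "EIx (u t) = errI S C y t" and EII: "EIIx (u t) = errII S C y t" for t
    by (simp_all add: u_def EIx_Yvec EIIx_Yvec)
  have evu: "ev (ph i t) (\<lambda>k. err C y i k t) x = ev (ph i t) (st (u t) i) x" if "i \<in> II" "wfx n m x" "n \<le> r i" for i t x n m
    by (rule ev_cong[OF that(2)]) (use su that in simp)
  have du: "((\<lambda>t. st (u t) i j) has_real_derivative ev (ph i t) (st (u t) i) (dEE j)) (at t within {0..})"
    if "i \<in> II" "Suc j < r i" "t \<in> tdom 0 \<omega>" for i j t
    using F[of i j t] that evu[OF that(1) wfx_dEE[of j], of t] su[of j i] by simp
  show YfY: "Yf t (u t) = Ysig S y t" if t: "t \<in> tdom 0 \<omega>" for t
  proof (rule st_eqI)
    fix i j assume j: "j < ord S i"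
    show "st (Yf t (u t)) i j = st (Ysig S y t) i j"
    proof (cases "i \<in> II")
      case True
      then show ?thesis using Yf_ev_cong[OF j True, of "u t" "\<lambda>k. err C y i k t" t] su[of _ i t] F[OF True _ t, of j] j
        by (simp add: Ysig_def Y_def)
    next
      case False
      then have "j = 0" using j by simp
      then show ?thesis using False by (simp add: Yf_def Ysig_def u_def err_def yr_0)
    qed
  qed
  have u0: "u 0 = x0"
  proof (rule st_eqI)
    fix i j assume j: "j < ord S i"
    show "st (u 0) i j = st x0 i j"
    proof (cases "i \<in> II")
      case True
      \<comment> \<open>Both sides obey the same formula in terms of the derivatives at 0 and the
        previous errors.\<close>
      have "j < r i \<Longrightarrow> err C y i j 0 = err C (init_poly S y0) i j 0"
      proof (induction j rule: less_induct)
        case (less j)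
        have "ev (ph i 0) (\<lambda>k. err C y i k 0) (Rx j) = ev (ph i 0) (\<lambda>k. err C (init_poly S y0) i k 0) (Rx j)"
          by (rule ev_cong[OF wfx_Rx]) (use less in auto)
        moreover have "Y i j 0 = y0 i j 0" unfolding Y_def by (rule ini) (use less True h_nonneg in auto)
        ultimately show ?case using F[OF True less.prems z] err_init[OF True less.prems] by simp
      qed
      then show ?thesis using j True by (simp add: u_def x0_def)
    next
      case False
      then have "j = 0" using j by simp
      moreover have "y 0 $ i = y0 i 0 0" using ini[of 0 i 0] False h_nonneg by simp
      ultimately show ?thesis using False by (simp add: u_def x0_def err_def init_poly_def)
    qed
  qed
  have yr_c: "continuous_on (tdom 0 \<omega>) (yr i j)" if "j < ord S i" for i j
    by (rule continuous_on_subset[OF yr_cont[OF that]]) (auto simp: tdom_def)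
  have Ec: "continuous_on (tdom 0 \<omega>) (err C y i j)" if j: "j < ord S i" for i j
  proof (cases "i \<in> II")
    case True
    then show ?thesis using j
    proof (induction j rule: less_induct)
      case (less j)
      have "continuous_on (tdom 0 \<omega>) (\<lambda>t. Y i j t - yr i j t + ev (ph i t) (\<lambda>k. err C y i k t) (Rx j))"
      proof (intro continuous_intros Yc yr_c less.prems ev_continuous[OF wfx_Rx])
        show "continuous_on (tdom 0 \<omega>) (err C y i k)" if "k < j" for k using less that by simp
        show "continuous_on (tdom 0 \<omega>) (\<lambda>t. ph i t k l)" if "k + l < j" for k l
          by (rule continuous_on_subset[OF phi_cont[OF True]]) (use that less.prems True in \<open>auto simp: tdom_def\<close>)
        show "1 - (ph i t k 0)\<^sup>2 * (err C y i k t)\<^sup>2 \<noteq> 0" if "k < j" "t \<in> tdom 0 \<omega>" for k t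
          using nej[OF that(2) True, of k] that less.prems True by (simp add: gain_denom_def ph_def)
      qed
      then show ?case by (rule continuous_on_eq) (use F True less.prems in simp)
    qed
  next
    case False
    then have j0: "j = 0" using j by simp
    have "continuous_on (tdom 0 \<omega>) (\<lambda>t. Y i 0 t - yr i 0 t)" using False by (intro continuous_intros Yc yr_c) auto
    then show ?thesis by (simp add: j0 err_def Y_0 yr_0)
  qed
  have uc: "continuous_on (tdom 0 \<omega>) u" unfolding u_def by (rule continuous_on_Yvec) (rule Ec)
  have cEI: "continuous_on (tdom 0 \<omega>) (errI S C y)" "continuous_on (tdom 0 \<omega>) (errII S C y)"
    using bounded_linear.continuous_on[OF linear_maps(1) uc] bounded_linear.continuous_on[OF linear_maps(2) uc] by (simp_all add: EI EII)
  have cph: "continuous_on (tdom 0 \<omega>) (phiI C)" "continuous_on (tdom 0 \<omega>) (phiII C)"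
    by (auto intro!: continuous_on_subset[OF phiI_cont(1)] continuous_on_subset[OF phiI_cont(2)] simp: tdom_def)
  have g0: "good 0 (u 0)" using x0_good u0 by simp
  have good: "good t (u t)" if t: "t \<in> tdom 0 \<omega>" for t
    unfolding good_def
  proof (intro conjI ballI allI impI)
    fix i j assume ij: "i \<in> II" "j + 2 \<le> r i"
    have "gain_denom (phi C i j) (err C y i j) t > 0"
    proof (rule positive_on_tdom[OF _ _ _ t])
      have "continuous_on (tdom 0 \<omega>) (phi C i j)"
        using continuous_on_subset[OF phi_cont[OF ij, of 0], of "tdom 0 \<omega>"] ij by (auto simp: ph_def tdom_def)
      moreover have "continuous_on (tdom 0 \<omega>) (err C y i j)" using Ec ij by simp
      ultimately show "continuous_on (tdom 0 \<omega>) (gain_denom (phi C i j) (err C y i j))"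
        unfolding gain_denom_def by (intro continuous_intros)
      show "0 < gain_denom (phi C i j) (err C y i j) 0" using g0 ij su[of j i 0, symmetric] by (simp add: good_def gain_denom_def)
    qed (use nej ij in auto)
    then show "(phi C i j t)\<^sup>2 * (st (u t) i j)\<^sup>2 < 1" using su[of j i t] ij by (simp add: gain_denom_def)
  next
    have "gain_denom (phiI C) (errI S C y) t > 0"
    proof (rule positive_on_tdom[OF _ _ _ t])
      show "continuous_on (tdom 0 \<omega>) (gain_denom (phiI C) (errI S C y))"
        unfolding gain_denom_def by (intro continuous_intros cEI cph)
      show "0 < gain_denom (phiI C) (errI S C y) 0" using g0 by (simp add: good_def gain_denom_def EI)
    qed (use neI in auto)
    then show "(phiI C t)\<^sup>2 * (norm (EIx (u t)))\<^sup>2 < 1" by (simp add: gain_denom_def EI)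
  qed
  have posII: "gain_denom (phiII C) (errII S C y) t > 0" if t: "t \<in> tdom 0 \<omega>" for t
  proof (rule positive_on_tdom[OF _ _ _ t])
    show "continuous_on (tdom 0 \<omega>) (gain_denom (phiII C) (errII S C y))"
      unfolding gain_denom_def by (intro continuous_intros cEI cph)
    have "EIIx x0 = errII S C y 0" using EII[of 0] u0 by simp
    then show "0 < gain_denom (phiII C) (errII S C y) 0"
      using x0_II Pm_iff[OF kf4_pos, of "EIIx x0" "phiII C 0"] unfolding eIIf_def gain_denom_def by fastforce
  qed (use neII in auto)
  \<comment> \<open>For \<open>b = 0\<close> localization gives no information; that case follows by
    restriction from a longer interval.\<close>
  have pos_case: "csol b u" if b: "b \<in> tdom 0 \<omega>" "b > 0" for b
  proof -
    have sub: "{0..b} \<subseteq> tdom 0 \<omega>" by (rule tdom_Icc_subset[OF b(1)])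
    have bw: "ereal b < \<omega>" using b(1) by (simp add: tdom_def)
    have ad: "adm b u" using b(2) u0 good sub continuous_on_subset[OF uc sub] by (auto simp: adm_def)
    have pY: "path b u t = Ysig S y t" if "t \<in> {-h..b}" for t
    proof (cases "t \<le> 0")
      case True
      then show ?thesis using that ini by (auto simp: path_def Y0_def Ysig_def intro!: Yvec_cong)
    next
      case False
      then have "t \<in> tdom 0 \<omega>" using that sub by auto
      then show ?thesis using False that YfY[of t] by (simp add: path_def min_def)
    qed
    have oY: "out (Ysig S y t) = y t" for t using ord_pos by (simp add: out_def Ysig_def vec_eq_iff Suc_le_eq)
    have e1: "AE t in lebesgue_on {0..b}. W1 b u t = w1 t"
    proof -
      have "\<forall>t\<in>{-h..<b}. path b u t = Ysig S y t" using pY by auto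
      then have "AE t in lebesgue_on {0..<b}. T1 S (path b u) t = w1 t"
        using w1 path_continuous[OF ad] b(2) bw unfolding localizes_def by blast
      then show ?thesis by (simp add: W1_def AE_lebesgue_on_atLeastLessThan)
    qed
    have e2: "AE t in lebesgue_on {0..b}. W2 b u t = w2 t"
    proof -
      have "\<forall>t\<in>{-h..<b}. out (path b u t) = y t" using pY oY by auto
      then have "AE t in lebesgue_on {0..<b}. T2 S (\<lambda>t. out (path b u t)) t = w2 t"
        using w2 out_continuous[OF path_continuous[OF ad]] b(2) bw unfolding localizes_def by blast
      then show ?thesis by (simp add: W2_def AE_lebesgue_on_atLeastLessThan)
    qed
    have UI: "UI t (u t) = inputI S C y t" for t by (rule UI_eq[OF EI])
    have cu: "continuous_on {0..b} u" and gu: "\<And>t. t \<in> {0..b} \<Longrightarrow> good t (u t)" using ad by (auto simp: adm_def)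
    show ?thesis
    proof (rule csol_acbI[OF ad])
      fix i j assume i: "i \<in> II" and j: "j < r i"
      obtain M where M: "ebd M 0 b (\<lambda>s. st (gf s (u s) (W1 b u s)) i j)"
      proof -
        obtain M where "ebd M 0 b (\<lambda>s. gf s (u s) (W1 b u s))" using gf_ebd[OF ad] by blast
        then have "acb 0 b (\<lambda>t. 0 + integral {0..t} (\<lambda>s. gf s (u s) (W1 b u s))) (\<lambda>s. gf s (u s) (W1 b u s))" by (rule acbI) simp
        from acbD(1)[OF acb_bounded_linear[OF st_linear this, of i j]] show ?thesis using that by blast
      qed
      show "acb 0 b (\<lambda>t. st (u t) i j) (\<lambda>s. st (gf s (u s) (W1 b u s)) i j)"
      proof (cases "Suc j < r i")
        case True
        have "acb 0 b (\<lambda>t. st (u t) i j) (\<lambda>s. ev (ph i s) (st (u s) i) (dEE j))"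
        proof (rule has_vector_derivative_imp_acb)
          show "((\<lambda>t. st (u t) i j) has_vector_derivative ev (ph i t) (st (u t) i) (dEE j)) (at t within {0..b})" if "t \<in> {0..b}" for t
          proof -
            have "t \<in> tdom 0 \<omega>" using that sub by blast
            from du[OF i True this] show ?thesis
              unfolding has_real_derivative_iff_has_vector_derivative by (rule has_vector_derivative_within_subset) auto
          qed
          show "continuous_on {0..b} (\<lambda>s. ev (ph i s) (st (u s) i) (dEE j))"
            by (rule ev_good_continuous[OF i wfx_dEE _ _ continuous_on_id cu]) (use True gu in auto)
        qed
        then show ?thesis using True i by (simp add: gf_nth)
      next
        case False
        then have j1: "j = r i - 1" using j by simp
        have rp: "Suc j = r i" using j1 r_pos[OF i] by simp
        \<comment> \<open>\<open>G\<close> is the right-hand side with the representative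
          \<open>w1\<close> supplied by the solution, \<open>H\<close> the one with the canonical
          operator value. They agree almost everywhere, which yields the essential bound on
          \<open>G\<close>.\<close>
        define G where "G s = (f1 S (d1 S s, w1 s) + GammaI S (d2 S s, w1 s) *v inputI S C y s) $ i" for s
        define H where "H s = (f1 S (d1 S s, W1 b u s) + GammaI S (d2 S s, W1 b u s) *v inputI S C y s) $ i" for s
        have stgf: "st (gf s (u s) (W1 b u s)) i j = H s - yr i (r i) s + ev (ph i s) (st (u s) i) (dex (Rx j))" for s
          using i j False by (simp add: gf_nth drift_def H_def UI j1)
        have exc: "continuous_on {0..b} (\<lambda>s. ev (ph i s) (st (u s) i) (dex (Rx j)))"
          by (rule ev_good_continuous[OF i wfx_dex[OF wfx_Rx] _ _ continuous_on_id cu]) (use rp gu in auto)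
        obtain Mx where Mx: "ebd Mx 0 b (\<lambda>s. ev (ph i s) (st (u s) i) (dex (Rx j)))" using continuous_ebd[OF exc] by blast
        obtain My where My: "ebd My 0 b (yr i (r i))" using yr_top[of i] i by auto
        have GH: "AE s in lebesgue_on {0..b}. G s = H s" using e1 by (auto simp: G_def H_def elim: eventually_mono)
        have wi: "weak_deriv 0 \<omega> (Y i j) G" using wd[OF i] unfolding Y_def G_def j1 .
        have Gm: "G \<in> borel_measurable (lebesgue_on {0..b})"
          using wi b bw by (auto simp: weak_deriv_def intro: absolutely_integrable_measurable[THEN iffD1, THEN conjunct1])
        have "AE s in lebesgue_on {0..b}. norm (G s) \<le> M + My + Mx"
          using GH M[unfolded ebd_def, THEN conjunct2] My[unfolded ebd_def, THEN conjunct2] Mx[unfolded ebd_def, THEN conjunct2]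
        proof eventually_elim
          case (elim s) then show ?case using stgf[of s] by auto
        qed
        then have Gb: "ebd (M + My + Mx) 0 b G" using Gm by (simp add: ebd_def)
        have 1: "acb 0 b (Y i j) G" by (rule weak_deriv_imp_acb[OF wi Yc bw Gb]) (use i j in simp)
        have 2: "acb 0 b (yr i j) (yr i (r i))" using yr_acb[of j i b] i j b rp by simp
        have 3: "acb 0 b (\<lambda>t. ev (ph i t) (st (u t) i) (Rx j)) (\<lambda>t. ev (ph i t) (st (u t) i) (dex (Rx j)))"
          by (rule ev_acb[OF i wfx_Rx _ _ cu gu]) (use rp du[OF i] sub in auto)
        have "acb 0 b (\<lambda>t. Y i j t + - yr i j t + ev (ph i t) (st (u t) i) (Rx j)) (\<lambda>t. G t + - yr i (r i) t + ev (ph i t) (st (u t) i) (dex (Rx j)))"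
          by (intro acb_add acb_minus 1 2 3)
        then have "acb 0 b (\<lambda>t. Y i j t + - yr i j t + ev (ph i t) (st (u t) i) (Rx j)) (\<lambda>s. st (gf s (u s) (W1 b u s)) i j)"
          by (rule acb_AE_cong[OF _ _ M]) (use GH in \<open>auto simp: stgf elim: eventually_mono\<close>)
        then show ?thesis
        proof (rule acb_cong)
          fix t assume t: "t \<in> {0..b}"
          then have "t \<in> tdom 0 \<omega>" using sub by blast
          from F[OF i j this] show "st (u t) i j = Y i j t + - yr i j t + ev (ph i t) (st (u t) i) (Rx j)"
            using su[of j i t] i j evu[OF i wfx_Rx[of j], of t] by simp
        qed
      qed
    next
      fix t assume t: "t \<in> {0..b}"
      define A where "A t = f2 S (Yf t (u t)) + f3 S (d3 S t, W2 b u t) + GammaII S (d4 S t, W2 b u t) *v UI t (u t)" for t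
      define K where "K t = khat C * f4 S (d5 S t, W2 b u t) / (1 - (phiII C t)\<^sup>2 * (norm (EIIx (u t)))\<^sup>2)" for t
      have in2: "f4 S (d5 S t, W2 b u t) *\<^sub>R inputII S C y t = - (K t *\<^sub>R EIIx (u t))" for t
        by (simp add: inputII_def gainII_def gain_denom_def K_def EII)
      have "AE t in lebesgue_on {0..b}. 0 = f2 S (Ysig S y t) + f3 S (d3 S t, w2 t)
             + GammaII S (d4 S t, w2 t) *v inputI S C y t + f4 S (d5 S t, w2 t) *\<^sub>R inputII S C y t"
        by (rule AE_lebesgue_on_subset[OF alg sub]) (auto simp: tdom_def)
      then have "AE t in lebesgue_on {0..b}. K t *\<^sub>R EIIx (u t) = A t"
        using e2 AE_space
      proof eventually_elim
        case (elim t)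
        then have "t \<in> tdom 0 \<omega>" using sub by (auto simp: space_restrict_space)
        then show ?case using elim YfY[of t] in2[of t] by (simp add: A_def UI)
      qed
      then have "K t *\<^sub>R EIIx (u t) = A t"
      proof (rule AE_zero_continuous[OF _ _ _ b(2) t])
        have W2c: "continuous_on {0..b} (W2 b u)" using continuous_on_subset[OF W2_continuous[OF ad]] by auto
        have g2: "\<And>t. t \<in> {0..b} \<Longrightarrow> 0 \<le> t \<and> good t (u t)" using gu by auto
        have s0: "{0..b} \<subseteq> {0..}" by auto
        have d: "continuous_on {0..b} (d3 S)" "continuous_on {0..b} (d4 S)" "continuous_on {0..b} (d5 S)"
          using Winf_ubl(2)[OF d_Winf(1)] Winf_ubl(2)[OF d_Winf(2)] Winf_ubl(2)[OF d_Winf(3)] continuous_on_subset[OF _ s0] by auto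
        show "continuous_on {0..b} A" unfolding A_def
          by (intro continuous_intros continuous_on_mat_vec continuous_on_compose2[OF C1_continuous[OF C1s(1), of UNIV]]
            continuous_on_compose2[OF C1_continuous[OF C1s(2), of UNIV]] continuous_on_compose2[OF C1_continuous[OF C1s(3), of UNIV]]
            d W2c Yf_continuous[OF continuous_on_id cu g2] UI_continuous[OF continuous_on_id cu g2]) auto
        have "1 - (phiII C s)\<^sup>2 * (norm (EIIx (u s)))\<^sup>2 \<noteq> 0" if "s \<in> {0..b}" for s
          using posII[of s] that sub by (auto simp: gain_denom_def EII)
        then show "continuous_on {0..b} (\<lambda>t. K t *\<^sub>R EIIx (u t))" unfolding K_def
          by (intro continuous_intros continuous_on_compose2[OF C1_continuous[OF f4_C1, of UNIV]] d W2c
            bounded_linear.continuous_on[OF linear_maps(2) cu] continuous_on_subset[OF phiI_cont(2) s0]) auto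
      qed
      moreover have "(phiII C t)\<^sup>2 * (norm (EIIx (u t)))\<^sup>2 < 1"
        using posII[of t] t sub by (auto simp: gain_denom_def EII)
      ultimately show "EIIx (u t) = eIIf t (u t) (W2 b u t)"
        unfolding eIIf_def Pm_iff[OF kf4_pos] K_def A_def by blast
    qed
  qed
  show "csol b u" if b: "b \<in> tdom 0 \<omega>" for b
  proof -
    obtain b' where b': "b < b'" "ereal b' < \<omega>" using ereal_less_obtain[of b \<omega>] b by (auto simp: tdom_def)
    have "b' \<in> tdom 0 \<omega>" "b' > 0" using b' D0[OF b] by (auto simp: tdom_def)
    then show ?thesis using csol_subset[OF pos_case, of b' b] D0[OF b] b' by simp
  qed
qed

end

section \<open>From error coordinates back to outputs\<close>

lemma has_real_derivative_Un_closed: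
  assumes "closed A" "closed B"
    and A: "t \<in> A \<Longrightarrow> (f has_real_derivative D) (at t within A)"
    and B: "t \<in> B \<Longrightarrow> (f has_real_derivative D) (at t within B)"
  shows "(f has_real_derivative D) (at t within (A \<union> B))"
proof -
  \<comment> \<open>Outside a closed set the filter within that set is trivial, so each side has to
    be checked only where \<open>t\<close> belongs to it.\<close>
  have "(f has_real_derivative D) (at t within X)" if "closed X" "t \<in> X \<Longrightarrow> (f has_real_derivative D) (at t within X)" for X
  proof (cases "t \<in> X")
    case False
    then have "at t within X = bot" using \<open>closed X\<close> by (meson closed_limpt trivial_limit_within)
    then show ?thesis by (simp add: has_field_derivative_iff)
  qed (use that in simp)
  then have "(f has_real_derivative D) (at t within A)" "(f has_real_derivative D) (at t within B)" using assms by blast+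
  then show ?thesis unfolding has_field_derivative_iff unfolding at_within_union by (simp add: filterlim_sup)
qed

context fdae_loop
begin

text \<open>The counterpart of \<open>path\<close> without truncation, for a state given on all of
  \<open>[0, \<infinity>)\<close>.\<close>

definition Yg :: "(real \<Rightarrow> real ^ 'n) \<Rightarrow> real \<Rightarrow> real ^ 'n" where
  "Yg u t = (if t \<le> 0 then Y0 t else Yf t (u t))"

definition yg :: "(real \<Rightarrow> real ^ 'n) \<Rightarrow> real \<Rightarrow> real ^ 'm" where "yg u t = out (Yg u t)"

lemma path_Yg: "t \<le> b \<Longrightarrow> path b u t = Yg u t"
  by (simp add: path_def Yg_def min_def)

context
  fixes u :: "real \<Rightarrow> real ^ 'n"
  assumes sol: "\<And>b. b \<ge> 0 \<Longrightarrow> csol b u"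
begin

lemma glob_adm: "b \<ge> 0 \<Longrightarrow> adm b u"
  using sol by (auto simp: csol_def)

lemma glob_good: "t \<ge> 0 \<Longrightarrow> good t (u t)" and glob_0: "u 0 = x0" and glob_cont: "continuous_on {0..b} u"
proof -
  show "t \<ge> 0 \<Longrightarrow> good t (u t)" and "u 0 = x0" using glob_adm[of t] glob_adm[of 0] by (auto simp: adm_def)
  show "continuous_on {0..b} u" using glob_adm[of b] by (cases "b \<ge> 0") (auto simp: adm_def)
qed

lemma Yg_nonneg: "t \<ge> 0 \<Longrightarrow> Yg u t = Yf t (u t)"
  using x0_Yf glob_0 by (auto simp: Yg_def)

lemma Yg_continuous: "continuous_on {-h..} (Yg u)"
proof (rule continuous_on_Ici(2))
  fix b :: real assume "-h \<le> b"
  have "continuous_on {-h..b} (path (max b 0) u)"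
    by (rule continuous_on_subset[OF path_continuous[OF glob_adm]]) auto
  then show "continuous_on {-h..b} (Yg u)" by (rule continuous_on_eq) (auto intro!: path_Yg)
qed

lemma glob_st_deriv:
  assumes i: "i \<in> II" and j: "Suc j < r i" and t: "t \<ge> 0"
  shows "((\<lambda>t. st (u t) i j) has_real_derivative ev (ph i t) (st (u t) i) (dEE j)) (at t within {0..})"
proof -
  have 1: "acb 0 (t + 1) (\<lambda>t. st (u t) i j) (\<lambda>s. ev (ph i s) (st (u s) i) (dEE j))"
    using csol_st_acb[OF sol i, of "t + 1" j] j t i by (simp add: gf_nth)
  have 2: "continuous_on {0..t + 1} (\<lambda>s. ev (ph i s) (st (u s) i) (dEE j))"
    by (rule ev_good_continuous[OF i wfx_dEE _ _ continuous_on_id glob_cont]) (use j glob_good in auto)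
  from acb_has_vector_derivative[OF 1 2, of t] t
  have "((\<lambda>t. st (u t) i j) has_vector_derivative ev (ph i t) (st (u t) i) (dEE j)) (at t within {0..t + 1})" by simp
  from has_vector_derivative_within_Ici[OF this] show ?thesis by (simp add: has_real_derivative_iff_has_vector_derivative)
qed

lemma Yg_deriv:
  assumes j: "Suc j < ord S i" and t: "t \<ge> -h"
  shows "((\<lambda>t. st (Yg u t) i j) has_real_derivative st (Yg u t) i (Suc j)) (at t within {-h..})"
proof -
  have i: "i \<in> II" using j by (cases "i \<in> II") auto
  have jr: "Suc j < r i" using j i by simp
  have 1: "((\<lambda>t. st (Yg u t) i j) has_real_derivative st (Yg u t) i (Suc j)) (at t within {-h..0})" if t: "t \<in> {-h..0}"
  proof -
    have "(y0 i j has_real_derivative y0 i (Suc j) t) (at t within {-h..0})"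
      using init j t unfolding initial_data_def by blast
    then have "((\<lambda>t. st (Yg u t) i j) has_real_derivative y0 i (Suc j) t) (at t within {-h..0})"
      by (rule has_field_derivative_transform_within[of _ _ _ _ 1]) (use t j in \<open>auto simp: Yg_def Y0_def\<close>)
    then show ?thesis using t j by (simp add: Yg_def Y0_def)
  qed
  have 2: "((\<lambda>t. st (Yg u t) i j) has_real_derivative st (Yg u t) i (Suc j)) (at t within {0..})" if t: "t \<in> {0..}"
  proof -
    have t0: "t \<ge> 0" using t by simp
    have dx: "((\<lambda>t. ev (ph i t) (st (u t) i) (Rx j)) has_real_derivative ev (ph i t) (st (u t) i) (dex (Rx j))) (at t within {0..})"
    proof (rule ev_deriv[OF wfx_Rx])
      show "((\<lambda>t. st (u t) i k) has_real_derivative ev (ph i t) (st (u t) i) (dEE k)) (at t within {0..})" if "k < j" for k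
        by (rule glob_st_deriv[OF i _ t0]) (use that jr in simp)
      show "((\<lambda>t. ph i t k l) has_real_derivative ph i t k (Suc l)) (at t within {0..})" if "k + l < j" for k l
        using phi_deriv[OF i, of k l t] that jr t0 by simp
      show "1 - (ph i t k 0)\<^sup>2 * (st (u t) i k)\<^sup>2 \<noteq> 0" if "k < j" for k
      proof -
        have "k + 2 \<le> r i" using that jr by simp
        then have "(phi C i k t)\<^sup>2 * (st (u t) i k)\<^sup>2 < 1" using glob_good[OF t0] i unfolding good_def by blast
        then show ?thesis by (simp add: ph_def)
      qed
    qed
    have "((\<lambda>t. yr i j t + st (u t) i j - ev (ph i t) (st (u t) i) (Rx j)) has_real_derivative
        yr i (Suc j) t + ev (ph i t) (st (u t) i) (dEE j) - ev (ph i t) (st (u t) i) (dex (Rx j))) (at t within {0..})"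
      by (intro DERIV_add DERIV_diff dx yr_deriv[OF j t0] glob_st_deriv[OF i jr t0])
    moreover have "yr i (Suc j) t + ev (ph i t) (st (u t) i) (dEE j) - ev (ph i t) (st (u t) i) (dex (Rx j)) = st (Yg u t) i (Suc j)"
      using j by (simp add: Yg_nonneg[OF t0] Yf_def dEE_def)
    ultimately have "((\<lambda>t. yr i j t + st (u t) i j - ev (ph i t) (st (u t) i) (Rx j)) has_real_derivative st (Yg u t) i (Suc j)) (at t within {0..})"
      by simp
    then show ?thesis
      by (rule has_field_derivative_transform_within[of _ _ _ _ 1]) (use t j in \<open>auto simp: Yg_nonneg Yf_def\<close>)
  qed
  \<comment> \<open>At 0 both sides have the derivative \<open>y0 i (Suc j) 0\<close>, by
    \<open>x0_Yf\<close>; for \<open>h = 0\<close> the history contributes a trivial filter.\<close>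
  have "((\<lambda>t. st (Yg u t) i j) has_real_derivative st (Yg u t) i (Suc j)) (at t within ({-h..0} \<union> {0..}))"
    by (rule has_real_derivative_Un_closed[OF _ _ 1 2]) auto
  moreover have "{-h..0} \<union> {0..} = {-h..}" using h_nonneg by auto
  ultimately show ?thesis by simp
qed

lemma nderiv_yg: "j < ord S i \<Longrightarrow> t \<ge> -h \<Longrightarrow> nderiv (-h) j (\<lambda>\<sigma>. yg u \<sigma> $ i) t = st (Yg u t) i j"
proof (induction j arbitrary: t)
  case (Suc j)
  have "(nderiv (-h) j (\<lambda>\<sigma>. yg u \<sigma> $ i) has_real_derivative st (Yg u t) i (Suc j)) (at t within {-h..})"
    by (rule has_real_derivative_tdom_cong[OF Yg_deriv[OF Suc.prems], of \<infinity>]) (use Suc in auto)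
  from nderiv_1_eq[OF this Suc.prems(2)] show ?case by simp
qed (simp add: yg_def out_def)

lemma Ysig_yg: "t \<ge> -h \<Longrightarrow> Ysig S (yg u) t = Yg u t"
  by (rule st_eqI) (simp add: Ysig_def nderiv_yg)

text \<open>The chain equations of the state are the recursion that defines the errors, so by
  induction the controller recovers the state from the constructed output.\<close>

lemma err_yg: "j < ord S i \<Longrightarrow> t \<ge> 0 \<Longrightarrow> err C (yg u) i j t = st (u t) i j"
proof (induction j arbitrary: t)
  case 0
  then show ?case by (simp add: err_def yg_def out_def Yg_nonneg Yf_def yr_0)
next
  case (Suc j)
  have i: "i \<in> II" using Suc.prems by (cases "i \<in> II") auto
  have "(err C (yg u) i j has_real_derivative ev (ph i t) (st (u t) i) (dEE j)) (at t within {0..})"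
    by (rule has_real_derivative_tdom_cong[OF glob_st_deriv[OF i], of _ _ \<infinity>]) (use Suc i in auto)
  from nderiv_1_eq[OF this Suc.prems(2)]
  have "err C (yg u) i (Suc j) t = ev (ph i t) (st (u t) i) (dEE j) + 1 / gain_denom (phi C i j) (err C (yg u) i j) t * err C (yg u) i j t"
    by (simp add: err_def)
  then show ?case using Suc by (simp add: dEE_def gain_denom_def ph_def)
qed

lemma u_yg: "t \<ge> 0 \<Longrightarrow> u t = Yvec S (\<lambda>i j. err C (yg u) i j t)"
  by (rule st_eqI) (simp add: err_yg)

lemma errI_yg: "t \<ge> 0 \<Longrightarrow> errI S C (yg u) t = EIx (u t)" and errII_yg: "t \<ge> 0 \<Longrightarrow> errII S C (yg u) t = EIIx (u t)"
  by (simp_all add: u_yg EIx_Yvec EIIx_Yvec)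

lemma glob_EII: "t \<ge> 0 \<Longrightarrow> EIIx (u t) = eIIf t (u t) (T2 S (\<lambda>t. out (Yg u t)) t)"
proof -
  assume t: "t \<ge> 0"
  have "W2 t u t = T2 S (\<lambda>t. out (Yg u t)) t"
    unfolding W2_def
    by (rule DAE_causal[OF T2 h_nonneg out_continuous[OF path_continuous[OF glob_adm[OF t]]] out_continuous[OF Yg_continuous] _ t])
      (simp add: path_Yg)
  then show ?thesis using sol[OF t] t by (simp add: csol_def)
qed

lemma glob_st_acb:
  assumes i: "i \<in> II" and j: "j < r i" and b: "b \<ge> 0"
  shows "acb 0 b (\<lambda>t. st (u t) i j) (\<lambda>s. st (gf s (u s) (T1 S (Yg u) s)) i j)"
proof -
  have A: "acb 0 b (\<lambda>t. PI (u t)) (\<lambda>s. gf s (u s) (W1 b u s))" by (rule csol_acb[OF sol[OF b]])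
  obtain M where M: "ebd M 0 b (\<lambda>s. gf s (u s) (W1 b u s))" using acbD(1)[OF A] by blast
  have ae: "AE s in lebesgue_on {0..b}. gf s (u s) (W1 b u s) = gf s (u s) (T1 S (Yg u) s)"
  proof -
    have "AE s in lebesgue_on {0..b}. T1 S (path b u) s = T1 S (Yg u) s"
      by (rule op_class_causal[OF T1 b path_continuous[OF glob_adm[OF b]] Yg_continuous]) (simp add: path_Yg)
    then show ?thesis by (auto simp: W1_def elim: eventually_mono)
  qed
  have m: "(\<lambda>s. gf s (u s) (T1 S (Yg u) s)) \<in> borel_measurable (lebesgue_on {0..b})"
    by (rule gf_measurable[OF order_refl glob_cont glob_good op_class_measurable[OF T1 Yg_continuous]]) simp
  have "AE s in lebesgue_on {0..b}. norm (gf s (u s) (T1 S (Yg u) s)) \<le> M"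
    using ae M[unfolded ebd_def, THEN conjunct2] by eventually_elim simp
  with m have "ebd M 0 b (\<lambda>s. gf s (u s) (T1 S (Yg u) s))" by (simp add: ebd_def)
  from acb_AE_cong[OF A ae this] have "acb 0 b (\<lambda>t. PI (u t)) (\<lambda>s. gf s (u s) (T1 S (Yg u) s))" .
  from acb_bounded_linear[OF st_linear this, of i j] show ?thesis using i j by (simp add: st_PI)
qed

lemma csol_solution: "solution S C y0 \<infinity> (yg u)"
proof -
  define w1 where "w1 = T1 S (Yg u)"
  define w2 where "w2 = T2 S (\<lambda>t. out (Yg u t))"
  have oc: "continuous_on {-h..} (\<lambda>t. out (Yg u t))" by (rule out_continuous[OF Yg_continuous])
  have UI: "UI t (u t) = inputI S C (yg u) t" if "t \<ge> 0" for t by (rule UI_eq) (simp add: errI_yg that)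
  have EIIlt: "(phiII C t)\<^sup>2 * (norm (EIIx (u t)))\<^sup>2 < 1 \<and>
      (khat C * f4 S (d5 S t, w2 t) / (1 - (phiII C t)\<^sup>2 * (norm (EIIx (u t)))\<^sup>2)) *\<^sub>R EIIx (u t) =
      f2 S (Yf t (u t)) + f3 S (d3 S t, w2 t) + GammaII S (d4 S t, w2 t) *v UI t (u t)" if "t \<ge> 0" for t
    using glob_EII[OF that] unfolding w2_def eIIf_def Pm_iff[OF kf4_pos] .
  have "Ck_on (ord S i - 1) (- h) \<infinity> (\<lambda>t. yg u t $ i)" for i
    unfolding Ck_on_def
  proof (intro conjI allI impI ballI)
    fix j t assume j: "j < ord S i - 1" and t: "t \<in> tdom (-h) \<infinity>"
    have t': "t \<ge> -h" using t by simp
    have "(nderiv (-h) j (\<lambda>\<sigma>. yg u \<sigma> $ i) has_real_derivative st (Yg u t) i (Suc j)) (at t within {-h..})"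
      by (rule has_real_derivative_tdom_cong[OF Yg_deriv[of j i t], of \<infinity>]) (use j t' nderiv_yg in auto)
    then show "nderiv (- h) j (\<lambda>t. yg u t $ i) differentiable at t within {- h..}"
      unfolding has_real_derivative_iff_has_vector_derivative by (rule differentiableI_vector)
  next
    have o: "ord S i - 1 < ord S i" using ord_pos[of i] by simp
    have "continuous_on {-h..} (\<lambda>t. st (Yg u t) i (ord S i - 1))"
      by (rule bounded_linear.continuous_on[OF st_linear Yg_continuous])
    then show "continuous_on (tdom (-h) \<infinity>) (nderiv (- h) (ord S i - 1) (\<lambda>t. yg u t $ i))"
      unfolding tdom_infinity by (rule continuous_on_eq) (use nderiv_yg[OF o] in simp)
  qed
  moreover have "nderiv (- h) j (\<lambda>\<sigma>. yg u \<sigma> $ i) t = y0 i j t" if "j < ord S i" "t \<in> {-h..0}" for i j t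
    using nderiv_yg[of j i t] that by (simp add: Yg_def Y0_def)
  moreover have "gain_denom (phiI C) (errI S C (yg u)) t \<noteq> 0 \<and> gain_denom (phiII C) (errII S C (yg u)) t \<noteq> 0 \<and>
        (\<forall>i\<in>II. \<forall>j. j + 2 \<le> r i \<longrightarrow> gain_denom (phi C i j) (err C (yg u) i j) t \<noteq> 0)" if t: "t \<in> tdom 0 \<infinity>" for t
  proof -
    have t: "t \<ge> 0" using t by simp
    have "(phi C i j t)\<^sup>2 * (st (u t) i j)\<^sup>2 < 1" if "i \<in> II" "j + 2 \<le> r i" for i j
      using glob_good[OF t] that unfolding good_def by blast
    moreover have "(phiI C t)\<^sup>2 * (norm (EIx (u t)))\<^sup>2 < 1" using glob_good[OF t] unfolding good_def by blast
    ultimately show ?thesis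
      using EIIlt[OF t] by (force simp: gain_denom_def errI_yg[OF t] errII_yg[OF t] err_yg t)
  qed
  moreover have "localizes h (T1 S) \<infinity> (Ysig S (yg u)) w1"
    unfolding localizes_def
  proof (intro allI impI)
    fix b :: real and \<zeta> :: "real \<Rightarrow> real ^ 'n"
    assume b: "b > 0" "continuous_on {-h..} \<zeta> \<and> (\<forall>t\<in>{-h..<b}. \<zeta> t = Ysig S (yg u) t)"
    have "AE t in lebesgue_on {0..b}. T1 S \<zeta> t = T1 S (Yg u) t"
      by (rule op_class_causal[OF T1 less_imp_le[OF b(1)] _ Yg_continuous]) (use b Ysig_yg in auto)
    then show "AE t in lebesgue_on {0..<b}. T1 S \<zeta> t = w1 t" by (simp add: w1_def AE_lebesgue_on_atLeastLessThan)
  qed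
  moreover have "localizes h (T2 S) \<infinity> (yg u) w2"
    unfolding localizes_def
  proof (intro allI impI)
    fix b :: real and \<zeta> :: "real \<Rightarrow> real ^ 'm"
    assume b: "b > 0" "continuous_on {-h..} \<zeta> \<and> (\<forall>t\<in>{-h..<b}. \<zeta> t = yg u t)"
    have "AE t in lebesgue_on {0..b}. T2 S \<zeta> t = T2 S (\<lambda>t. out (Yg u t)) t"
      by (rule op_class_causal[OF DAE_op_class[OF T2] less_imp_le[OF b(1)] _ oc]) (use b in \<open>auto simp: yg_def\<close>)
    then show "AE t in lebesgue_on {0..<b}. T2 S \<zeta> t = w2 t" by (simp add: w2_def AE_lebesgue_on_atLeastLessThan)
  qed
  moreover have "weak_deriv 0 \<infinity> (nderiv (- h) (r i - 1) (\<lambda>\<sigma>. yg u \<sigma> $ i))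
     (\<lambda>t. (f1 S (d1 S t, w1 t) + GammaI S (d2 S t, w1 t) *v inputI S C (yg u) t) $ i)" if i: "i \<in> II" for i
  proof (rule acb_imp_weak_deriv)
    fix b :: real assume b: "0 \<le> b"
    define j where "j = r i - 1"
    have j: "Suc j = r i" "j < r i" "j < ord S i" using r_pos[OF i] i by (auto simp: j_def)
    define G where "G t = (f1 S (d1 S t, w1 t) + GammaI S (d2 S t, w1 t) *v inputI S C (yg u) t) $ i" for t
    have 1: "acb 0 b (yr i j) (yr i (r i))" using yr_acb[OF j(3) b] j by simp
    have 2: "acb 0 b (\<lambda>t. st (u t) i j) (\<lambda>s. st (gf s (u s) (w1 s)) i j)" unfolding w1_def by (rule glob_st_acb[OF i j(2) b])
    have 3: "acb 0 b (\<lambda>t. ev (ph i t) (st (u t) i) (Rx j)) (\<lambda>t. ev (ph i t) (st (u t) i) (dex (Rx j)))"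
      by (rule ev_acb[OF i wfx_Rx _ _ glob_cont]) (use j glob_st_deriv[OF i] glob_good in auto)
    have A: "acb 0 b (\<lambda>t. yr i j t + st (u t) i j + - ev (ph i t) (st (u t) i) (Rx j))
        (\<lambda>s. yr i (r i) s + st (gf s (u s) (w1 s)) i j + - ev (ph i s) (st (u s) i) (dex (Rx j)))"
      by (intro acb_add acb_minus 1 2 3)
    have eq: "yr i (r i) s + st (gf s (u s) (w1 s)) i j + - ev (ph i s) (st (u s) i) (dex (Rx j)) = G s" if "s \<ge> 0" for s
      using i j UI[OF that] by (simp add: gf_nth drift_def G_def j_def)
    obtain M where M: "ebd M 0 b (\<lambda>s. yr i (r i) s + st (gf s (u s) (w1 s)) i j + - ev (ph i s) (st (u s) i) (dex (Rx j)))"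
      using acbD(1)[OF A] by blast
    have "ebd M 0 b G"
    proof -
      have "G \<in> borel_measurable (lebesgue_on {0..b})"
        using M[unfolded ebd_def, THEN conjunct1]
        by (rule iffD1[OF measurable_cong, rotated]) (rule eq, simp add: space_restrict_space)
      moreover have "AE s in lebesgue_on {0..b}. norm (G s) \<le> M"
        using M[unfolded ebd_def, THEN conjunct2] AE_space
      proof eventually_elim
        case (elim s)
        then have "s \<ge> 0" by (simp add: space_restrict_space)
        then show ?case using elim(1) eq[of s] by simp
      qed
      ultimately show ?thesis by (simp add: ebd_def)
    qed
    moreover have "AE s in lebesgue_on {0..b}. yr i (r i) s + st (gf s (u s) (w1 s)) i j + - ev (ph i s) (st (u s) i) (dex (Rx j)) = G s"
      using eq by (intro AE_I2) (simp add: space_restrict_space)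
    ultimately have "acb 0 b (\<lambda>t. yr i j t + st (u t) i j + - ev (ph i t) (st (u t) i) (Rx j)) G" by (rule acb_AE_cong[OF A, rotated])
    then show "acb 0 b (nderiv (- h) (r i - 1) (\<lambda>\<sigma>. yg u \<sigma> $ i)) (\<lambda>t. (f1 S (d1 S t, w1 t) + GammaI S (d2 S t, w1 t) *v inputI S C (yg u) t) $ i)"
      unfolding G_def j_def[symmetric]
      by (rule acb_cong[where f="\<lambda>t. yr i j t + st (u t) i j + - ev (ph i t) (st (u t) i) (Rx j)"]) (use j h_nonneg in \<open>auto simp: nderiv_yg Yg_nonneg Yf_def\<close>)
  qed simp
  moreover have "\<exists>v. weak_deriv 0 \<infinity> (\<lambda>t. yg u t $ i) v" if i: "i \<notin> II" for i
  proof -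
    \<comment> \<open>The algebraic equation gives no derivative of the second block; weak
      differentiability is drawn from the global Lipschitz bound. The use of \<open>max t 0\<close>
      extends the function to all reals.\<close>
    obtain L where L: "\<forall>s\<in>{0..}. \<forall>t\<in>{0..}. norm (u t - u s) \<le> L * \<bar>t - s\<bar>"
      using osol_bounds(2)[of \<infinity> u] sol by auto
    have "\<bar>st (u (max t 0)) i 0 - st (u (max s 0)) i 0\<bar> \<le> \<bar>L\<bar> * \<bar>t - s\<bar>" for s t
    proof -
      have "\<bar>st (u (max t 0)) i 0 - st (u (max s 0)) i 0\<bar> \<le> norm (u (max t 0) - u (max s 0))"
        using st_le_norm[of "u (max t 0) - u (max s 0)" i 0] by simp
      also have "\<dots> \<le> L * \<bar>max t 0 - max s 0\<bar>" using L by simp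
      also have "\<dots> \<le> \<bar>L\<bar> * \<bar>t - s\<bar>" by (intro mult_mono) auto
      finally show ?thesis .
    qed
    then have "\<exists>f'. \<forall>a b. acb a b (\<lambda>t. st (u (max t 0)) i 0) f'"
      by (rule lipschitz_imp_acb[where f="\<lambda>t. st (u (max t 0)) i 0" and L="\<bar>L\<bar>"])
    then obtain f' where f': "\<forall>a b. acb a b (\<lambda>t. st (u (max t 0)) i 0) f'" by blast
    have "weak_deriv 0 \<infinity> (\<lambda>t. yg u t $ i) (\<lambda>t. yr i (Suc 0) t + f' t)"
    proof (rule acb_imp_weak_deriv)
      fix b :: real assume b: "0 \<le> b"
      have "acb 0 b (\<lambda>t. yr i 0 t + st (u (max t 0)) i 0) (\<lambda>t. yr i (Suc 0) t + f' t)"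
        by (intro acb_add yr_acb b f'[THEN spec, THEN spec]) (use i in simp)
      then show "acb 0 b (\<lambda>t. yg u t $ i) (\<lambda>t. yr i (Suc 0) t + f' t)"
        by (rule acb_cong[where f="\<lambda>t. yr i 0 t + st (u (max t 0)) i 0"]) (use i in \<open>auto simp: yg_def out_def Yg_nonneg Yf_def\<close>)
    qed simp
    then show ?thesis by blast
  qed
  moreover have "AE t in lebesgue_on (tdom 0 \<infinity>). 0 = f2 S (Ysig S (yg u) t) + f3 S (d3 S t, w2 t)
             + GammaII S (d4 S t, w2 t) *v inputI S C (yg u) t + f4 S (d5 S t, w2 t) *\<^sub>R inputII S C (yg u) t"
  proof (rule AE_I2)
    fix t assume "t \<in> space (lebesgue_on (tdom 0 \<infinity>))"
    then have t: "t \<ge> 0" by (simp add: space_restrict_space)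
    have Y: "Ysig S (yg u) t = Yf t (u t)" using Ysig_yg[of t] Yg_nonneg[OF t] t h_nonneg by simp
    have "f4 S (d5 S t, w2 t) *\<^sub>R inputII S C (yg u) t =
      - ((khat C * f4 S (d5 S t, w2 t) / (1 - (phiII C t)\<^sup>2 * (norm (EIIx (u t)))\<^sup>2)) *\<^sub>R EIIx (u t))"
      by (simp add: inputII_def gainII_def gain_denom_def errII_yg[OF t])
    then show "0 = f2 S (Ysig S (yg u) t) + f3 S (d3 S t, w2 t)
             + GammaII S (d4 S t, w2 t) *v inputI S C (yg u) t + f4 S (d5 S t, w2 t) *\<^sub>R inputII S C (yg u) t"
      using EIIlt[OF t] by (simp add: Y UI[OF t])
  qed
  ultimately show ?thesis unfolding solution_def by (intro conjI) (blast | simp)+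
qed

end

lemma solution_extends:
  assumes sol: "solution S C y0 \<omega> y"
  shows "\<exists>y'. solution S C y0 \<infinity> y' \<and> (\<forall>t\<in>tdom (-h) \<omega>. y' t = y t)"
proof -
  define u where "u t = Yvec S (\<lambda>i j. err C y i j t)" for t
  have w: "0 < \<omega>" using sol by (simp add: solution_def)
  note U = solution_csol[OF sol, folded u_def]
  obtain v where v: "\<forall>b\<ge>0. csol b v" "\<forall>t\<in>tdom 0 \<omega>. v t = u t" using csol_global_open[OF w U(1)] by blast
  have "yg v t = y t" if t: "t \<in> tdom (-h) \<omega>" for t
  proof -
    have "out (Ysig S y t) = y t" using ord_pos by (simp add: out_def Ysig_def vec_eq_iff Suc_le_eq)
    moreover have "Yg v t = Ysig S y t"
    proof (cases "t \<le> 0")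
      case True
      then show ?thesis using sol t by (auto simp: Yg_def Y0_def Ysig_def solution_def tdom_def intro!: Yvec_cong)
    next
      case False
      then have "t \<in> tdom 0 \<omega>" using t by (simp add: tdom_def)
      then show ?thesis using False v(2) U(2)[of t] by (simp add: Yg_def)
    qed
    ultimately show ?thesis by (simp add: yg_def)
  qed
  moreover have "solution S C y0 \<infinity> (yg v)" by (rule csol_solution) (use v in blast)
  ultimately show ?thesis by blast
qed

lemma solution_exists: "\<exists>\<omega> y. solution S C y0 \<omega> y"
  using csol_global[OF csol_0] csol_solution by blast

end

section \<open>Funnel statements and the final assembly\<close>

lemma funnel_uniform:
  fixes e :: "real \<Rightarrow> 'a::real_normed_vector"
  assumes Phi: "\<phi> \<in> Phi n" "n \<ge> 1" and \<epsilon>: "\<epsilon> > 0" and le: "\<And>t. t \<ge> 0 \<Longrightarrow> (\<phi> t)\<^sup>2 * (norm (e t))\<^sup>2 \<le> 1 - \<epsilon>"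
  shows "\<forall>t\<ge>0. (t, e t) \<in> funnel \<phi>" "\<exists>\<delta>>0. \<forall>t>0. norm (e t) \<le> inverse (\<phi> t) - \<delta>"
    "bounded ((\<lambda>t. 1 / gain_denom \<phi> e t) ` {0..})"
proof -
  have pos: "\<phi> t > 0" if "t > 0" for t using Phi_props(4)[OF Phi that] .
  have nn: "\<phi> t \<ge> 0" if "t \<ge> 0" for t using Phi_props(5)[OF Phi] pos[of t] that by (cases "t = 0") auto
  \<comment> \<open>From \<open>1 - \<epsilon> \<le> (1 - \<epsilon> / 2)\<^sup>2\<close>. Divided
    by \<open>\<phi> t\<close>, which is bounded above, this leaves a distance to the boundary
    independent of \<open>t\<close>.\<close>
  have s: "\<phi> t * norm (e t) \<le> 1 - \<epsilon> / 2" if t: "t \<ge> 0" for t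
  proof -
    have "0 \<le> (\<phi> t)\<^sup>2 * (norm (e t))\<^sup>2" by simp
    then have e1: "\<epsilon> \<le> 1" using le[OF t] by linarith
    have "(\<phi> t * norm (e t))\<^sup>2 \<le> 1 - \<epsilon>" using le[OF t] by (simp add: power_mult_distrib)
    also have "\<dots> \<le> (1 - \<epsilon> / 2)\<^sup>2" by (simp add: power2_eq_square algebra_simps)
    finally show ?thesis by (rule power2_le_imp_le) (use e1 in simp)
  qed
  show "\<forall>t\<ge>0. (t, e t) \<in> funnel \<phi>" using s \<epsilon> by (fastforce simp: funnel_def)
  obtain B where B: "B \<ge> 0" "\<forall>t\<ge>0. \<bar>\<phi> t\<bar> \<le> B" using Phi_props(3)[OF Phi, of 0] by auto
  show "\<exists>\<delta>>0. \<forall>t>0. norm (e t) \<le> inverse (\<phi> t) - \<delta>"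
  proof (intro exI[of _ "\<epsilon> / 2 / (B + 1)"] conjI allI impI)
    show "\<epsilon> / 2 / (B + 1) > 0" using \<epsilon> B by simp
    fix t :: real assume t: "t > 0"
    have "\<phi> t \<le> B + 1" using B(2)[THEN spec, of t] t by auto
    then have "\<epsilon> / 2 / (B + 1) \<le> \<epsilon> / 2 / \<phi> t" using \<epsilon> pos[OF t] B by (intro divide_left_mono) auto
    moreover have "norm (e t) \<le> (1 - \<epsilon> / 2) / \<phi> t" using s[of t] t pos[OF t] by (simp add: pos_le_divide_eq mult.commute)
    ultimately show "norm (e t) \<le> inverse (\<phi> t) - \<epsilon> / 2 / (B + 1)" by (simp add: diff_divide_distrib inverse_eq_divide)
  qed
  have "norm (1 / gain_denom \<phi> e t) \<le> 1 / \<epsilon>" if "t \<ge> 0" for t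
  proof -
    have "gain_denom \<phi> e t \<ge> \<epsilon>" using le[OF that] by (simp add: gain_denom_def)
    then show ?thesis using \<epsilon> by (simp add: frac_le)
  qed
  then show "bounded ((\<lambda>t. 1 / gain_denom \<phi> e t) ` {0..})" unfolding bounded_iff by auto
qed

context fdae_loop
begin

lemma global_solution_bounds:
  assumes sol: "solution S C y0 \<infinity> y"
  shows "\<exists>\<epsilon>>0. \<forall>t\<ge>0. (phiI C t)\<^sup>2 * (norm (errI S C y t))\<^sup>2 \<le> 1 - \<epsilon> \<and>
      (phiII C t)\<^sup>2 * (norm (errII S C y t))\<^sup>2 \<le> 1 - \<epsilon> \<and>
      (\<forall>i\<in>II. \<forall>j. j + 2 \<le> r i \<longrightarrow> (phi C i j t)\<^sup>2 * (norm (err C y i j t))\<^sup>2 \<le> 1 - \<epsilon>)"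
    and "bounded (errI S C y ` {0..})" "bounded (errII S C y ` {0..})"
proof -
  define u where "u t = Yvec S (\<lambda>i j. err C y i j t)" for t
  have U: "csol b u" if "b \<in> tdom 0 \<infinity>" for b using solution_csol(1)[OF sol] that unfolding u_def by blast
  have EI: "errI S C y t = EIx (u t)" "errII S C y t = EIIx (u t)" for t by (simp_all add: u_def EIx_Yvec EIIx_Yvec)
  have w: "0 < (\<infinity>::ereal)" by simp
  obtain \<epsilon> where \<epsilon>: "\<epsilon> > 0" "\<forall>t\<in>{0..}. goodeps \<epsilon> t (u t) \<and> (phiII C t)\<^sup>2 * (norm (EIIx (u t)))\<^sup>2 \<le> 1 - \<epsilon>"
    using osol_bounds(1)[OF w U] by auto
  have "(phi C i j t)\<^sup>2 * (norm (err C y i j t))\<^sup>2 \<le> 1 - \<epsilon>" if "t \<ge> 0" "i \<in> II" "j + 2 \<le> r i" for i j t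
  proof -
    have "goodR \<epsilon> t (u t)" using \<epsilon>(2) that by (simp add: goodeps_def)
    then have "(phi C i j t)\<^sup>2 * (st (u t) i j)\<^sup>2 \<le> 1 - \<epsilon>" using that unfolding goodR_def by blast
    moreover have "st (u t) i j = err C y i j t" using that by (simp add: u_def)
    ultimately show ?thesis by simp
  qed
  then show "\<exists>\<epsilon>>0. \<forall>t\<ge>0. (phiI C t)\<^sup>2 * (norm (errI S C y t))\<^sup>2 \<le> 1 - \<epsilon> \<and>
      (phiII C t)\<^sup>2 * (norm (errII S C y t))\<^sup>2 \<le> 1 - \<epsilon> \<and>
      (\<forall>i\<in>II. \<forall>j. j + 2 \<le> r i \<longrightarrow> (phi C i j t)\<^sup>2 * (norm (err C y i j t))\<^sup>2 \<le> 1 - \<epsilon>)"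
    using \<epsilon> by (intro exI[of _ \<epsilon>]) (auto simp: EI goodeps_def)
  obtain B where "\<forall>t\<in>{0..}. norm (u t) \<le> B" using osol_bounds(3)[OF w U] by auto
  then have "bounded (u ` {0..})" unfolding bounded_iff by auto
  from bounded_linear_image[OF this linear_maps(1)] bounded_linear_image[OF this linear_maps(2)]
  show "bounded (errI S C y ` {0..})" "bounded (errII S C y ` {0..})" by (simp_all add: EI image_image)
qed

end

theorem theorem4p3:
  fixes S :: "('m::finite, 's::finite, 'k::finite, 'n::finite) fdae"
    and C :: "'m funnel_controller"
    and \<alpha> :: real
    and y0 :: "'m \<Rightarrow> nat \<Rightarrow> real \<Rightarrow> real"
  assumes "fdae_format S"
    and "assmA1 S" and "assmA2 S" and "assmA3 S" and "assmA4 S \<alpha>" and "assmA5 S"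
    and "\<forall>i\<in>idxI S. Winf (rdeg S i) (\<lambda>t. yref C t $ i)"
    and "\<forall>i. i \<notin> idxI S \<longrightarrow> Winf 1 (\<lambda>t. yref C t $ i)"
    and "phiI C \<in> Phi 1" and "phiII C \<in> Phi 1"
    and "\<forall>i\<in>idxI S. \<forall>j. j + 2 \<le> rdeg S i \<longrightarrow> phi C i j \<in> Phi (rdeg S i - j)"
    and "khat C > 0"
    and "khat C > inverse \<alpha> * (SUP Z. jac2_norm S Z)"
    and "initial_data S y0"
    and "consistent S C y0"
    and "phiI C 0 * norm (errI S C (init_poly S y0) 0) < 1"
    and "phiII C 0 * norm (errII S C (init_poly S y0) 0) < 1"
    and "\<forall>i\<in>idxI S. \<forall>j. j + 2 \<le> rdeg S i \<longrightarrow>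
           phi C i j 0 * \<bar>err C (init_poly S y0) i j 0\<bar> < 1"
  shows "(\<exists>\<omega> y. solution S C y0 \<omega> y) \<and>
    (\<forall>\<omega> y. solution S C y0 \<omega> y \<longrightarrow>
       (\<exists>y'. solution S C y0 \<infinity> y' \<and> (\<forall>t\<in>tdom (- delay S) \<omega>. y' t = y t))) \<and>
    (\<forall>y. solution S C y0 \<infinity> y \<longrightarrow>
       (bounded ((\<lambda>t. inputI S C y t + inputII S C y t) ` {0..}) \<and>
        bounded (gainI S C y ` {0..}) \<and>
        bounded (gainII S C y ` {0..}) \<and>
        (\<forall>i\<in>idxI S. \<forall>j. j + 2 \<le> rdeg S i \<longrightarrow> bounded (gain C y i j ` {0..}))) \<and>
       ((\<forall>t\<ge>0. (t, errI S C y t) \<in> funnel (phiI C)) \<and>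
        (\<forall>t\<ge>0. (t, errII S C y t) \<in> funnel (phiII C)) \<and>
        (\<forall>i\<in>idxI S. \<forall>j. j + 2 \<le> rdeg S i \<longrightarrow> (\<forall>t\<ge>0. (t, err C y i j t) \<in> funnel (phi C i j)))) \<and>
       ((\<exists>\<epsilon>>0. \<forall>t>0. norm (errI S C y t) \<le> inverse (phiI C t) - \<epsilon>) \<and>
        (\<exists>\<epsilon>>0. \<forall>t>0. norm (errII S C y t) \<le> inverse (phiII C t) - \<epsilon>) \<and>
        (\<forall>i\<in>idxI S. \<forall>j. j + 2 \<le> rdeg S i \<longrightarrow>
           (\<exists>\<epsilon>>0. \<forall>t>0. \<bar>err C y i j t\<bar> \<le> inverse (phi C i j t) - \<epsilon>))) \<and>
       (\<forall>i\<in>idxI S. let \<phi> = (if rdeg S i = 1 then phiI C else phi C i 0) in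
          (\<forall>t\<ge>0. (t, y t $ i - yref C t $ i) \<in> funnel \<phi>) \<and>
          (\<exists>\<epsilon>>0. \<forall>t>0. \<bar>y t $ i - yref C t $ i\<bar> \<le> inverse (\<phi> t) - \<epsilon>)) \<and>
       (\<forall>i. i \<notin> idxI S \<longrightarrow>
          (\<forall>t\<ge>0. (t, y t $ i - yref C t $ i) \<in> funnel (phiII C)) \<and>
          (\<exists>\<epsilon>>0. \<forall>t>0. \<bar>y t $ i - yref C t $ i\<bar> \<le> inverse (phiII C t) - \<epsilon>)))"
proof -
  have "\<exists>G. G 0 = (\<lambda>t. yref C t $ i) \<and> (\<forall>j<ord S i. \<forall>b\<ge>0. acb 0 b (G j) (G (Suc j))) \<and>
    (\<forall>j<ord S i. continuous_on {0..} (G j) \<and> bounded (G j ` {0..})) \<and> (\<exists>M\<ge>0. \<forall>b. ebd M 0 b (G (ord S i)))" for i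
  proof (rule Winf_rep)
    show "Winf (ord S i) (\<lambda>t. yref C t $ i)" using assms(7,8) by (simp add: ord_def)
    show "ord S i \<ge> 1" using assms(1) by (simp add: ord_def fdae_format_def)
  qed
  then obtain yr where yr: "\<forall>i. yr i 0 = (\<lambda>t. yref C t $ i) \<and> (\<forall>j<ord S i. \<forall>b\<ge>0. acb 0 b (yr i j) (yr i (Suc j))) \<and>
    (\<forall>j<ord S i. continuous_on {0..} (yr i j) \<and> bounded (yr i j ` {0..})) \<and> (\<exists>M\<ge>0. \<forall>b. ebd M 0 b (yr i (ord S i)))"
    by metis
  interpret fdae_loop S C \<alpha> y0 yr
    by unfold_locales (use assms yr in auto)
  show ?thesis
  proof (intro conjI allI impI)
    fix y assume sol: "solution S C y0 \<infinity> y"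
    obtain \<epsilon> where \<epsilon>: "\<epsilon> > 0" and EI: "\<And>t. t \<ge> 0 \<Longrightarrow> (phiI C t)\<^sup>2 * (norm (errI S C y t))\<^sup>2 \<le> 1 - \<epsilon>"
      and EII: "\<And>t. t \<ge> 0 \<Longrightarrow> (phiII C t)\<^sup>2 * (norm (errII S C y t))\<^sup>2 \<le> 1 - \<epsilon>"
      and Ej: "\<And>i j t. t \<ge> 0 \<Longrightarrow> i \<in> idxI S \<Longrightarrow> j + 2 \<le> rdeg S i \<Longrightarrow> (phi C i j t)\<^sup>2 * (norm (err C y i j t))\<^sup>2 \<le> 1 - \<epsilon>"
      using global_solution_bounds(1)[OF sol] by auto
    note FI = funnel_uniform[OF phiI order_refl \<epsilon> EI] and FII = funnel_uniform[OF phiII order_refl \<epsilon> EII]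
    have Fj: "\<forall>t\<ge>0. (t, err C y i j t) \<in> funnel (phi C i j)" "\<exists>\<epsilon>>0. \<forall>t>0. \<bar>err C y i j t\<bar> \<le> inverse (phi C i j t) - \<epsilon>"
      "bounded (gain C y i j ` {0..})" if ij: "i \<in> idxI S" "j + 2 \<le> rdeg S i" for i j
    proof -
      have n: "1 \<le> rdeg S i - j" using ij(2) by simp
      note F = funnel_uniform[OF phi[OF ij] n \<epsilon> Ej[OF _ ij]]
      show "\<forall>t\<ge>0. (t, err C y i j t) \<in> funnel (phi C i j)" by (rule F(1))
      show "\<exists>\<epsilon>>0. \<forall>t>0. \<bar>err C y i j t\<bar> \<le> inverse (phi C i j t) - \<epsilon>" using F(2) by simp
      have "gain C y i j = (\<lambda>t. 1 / gain_denom (phi C i j) (err C y i j) t)" by (rule ext) (simp add: gain_def)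
      then show "bounded (gain C y i j ` {0..})" using F(3) by simp
    qed
    have gI: "gainI S C y = (\<lambda>t. 1 / gain_denom (phiI C) (errI S C y) t)" by (rule ext) (simp add: gainI_def)
    have gII: "gainII S C y = (\<lambda>t. khat C * (1 / gain_denom (phiII C) (errII S C y) t))" by (rule ext) (simp add: gainII_def)
    show bI: "bounded (gainI S C y ` {0..})" using FI(3) by (simp add: gI)
    show bII: "bounded (gainII S C y ` {0..})"
      using bounded_linear_image[OF FII(3) bounded_linear_mult_right[of "khat C"]] by (simp add: gII image_image)
    show "bounded ((\<lambda>t. inputI S C y t + inputII S C y t) ` {0..})"
    proof -
      obtain b1 b2 b3 b4 where b: "\<forall>t\<in>{0..}. \<bar>gainI S C y t\<bar> \<le> b1" "\<forall>t\<in>{0..}. \<bar>gainII S C y t\<bar> \<le> b2"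
        "\<forall>t\<in>{0..}. norm (errI S C y t) \<le> b3" "\<forall>t\<in>{0..}. norm (errII S C y t) \<le> b4"
        using bI bII global_solution_bounds(2,3)[OF sol] unfolding bounded_iff by auto
      have "norm (inputI S C y t + inputII S C y t) \<le> b1 * b3 + b2 * b4" if t: "t \<ge> 0" for t
      proof -
        have "norm (inputI S C y t) \<le> b1 * b3"
          using b(1,3) t order_trans[OF abs_ge_zero b(1)[THEN bspec, of t]] by (simp add: inputI_def mult_mono)
        moreover have "norm (inputII S C y t) \<le> b2 * b4"
          using b(2,4) t order_trans[OF abs_ge_zero b(2)[THEN bspec, of t]] by (simp add: inputII_def mult_mono)
        ultimately show ?thesis by (rule norm_triangle_mono)
      qed
      then show ?thesis unfolding bounded_iff by auto
    qed
    show "(t, errI S C y t) \<in> funnel (phiI C)" if "0 \<le> t" for t using FI(1) that by blast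
    show "\<exists>\<epsilon>>0. \<forall>t>0. norm (errI S C y t) \<le> inverse (phiI C t) - \<epsilon>"
      by (rule FI(2))
    show "(t, errII S C y t) \<in> funnel (phiII C)" if "0 \<le> t" for t using FII(1) that by blast
    show "\<exists>\<epsilon>>0. \<forall>t>0. norm (errII S C y t) \<le> inverse (phiII C t) - \<epsilon>"
      by (rule FII(2))
    show "\<forall>i\<in>idxI S. \<forall>j. j + 2 \<le> rdeg S i \<longrightarrow> bounded (gain C y i j ` {0..})"
      "\<forall>i\<in>idxI S. \<forall>j. j + 2 \<le> rdeg S i \<longrightarrow> (\<forall>t\<ge>0. (t, err C y i j t) \<in> funnel (phi C i j))"
      "\<forall>i\<in>idxI S. \<forall>j. j + 2 \<le> rdeg S i \<longrightarrow> (\<exists>\<epsilon>>0. \<forall>t>0. \<bar>err C y i j t\<bar> \<le> inverse (phi C i j t) - \<epsilon>)"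
      using Fj by blast+
    \<comment> \<open>A component is bounded by the whole vector, so scalar errors inherit the
      estimate of \<open>e\<^sub>I\<close> or \<open>e\<^sub>I\<^sub>I\<close>.\<close>
    have comp: "p\<^sup>2 * (norm (v $ i))\<^sup>2 \<le> 1 - \<epsilon>" if "p\<^sup>2 * (norm v)\<^sup>2 \<le> 1 - \<epsilon>" for p :: real and v :: "real ^ 'm" and i
    proof -
      have "(norm (v $ i))\<^sup>2 \<le> (norm v)\<^sup>2" using component_le_norm_cart[of v i] by (intro power_mono) auto
      from mult_left_mono[OF this, of "p\<^sup>2"] that show ?thesis by simp
    qed
    show "\<forall>i\<in>idxI S. let \<phi> = (if rdeg S i = 1 then phiI C else phi C i 0) in
        (\<forall>t\<ge>0. (t, y t $ i - yref C t $ i) \<in> funnel \<phi>) \<and>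
        (\<exists>\<epsilon>>0. \<forall>t>0. \<bar>y t $ i - yref C t $ i\<bar> \<le> inverse (\<phi> t) - \<epsilon>)"
    proof
      fix i assume i: "i \<in> idxI S"
      show "let \<phi> = (if rdeg S i = 1 then phiI C else phi C i 0) in
        (\<forall>t\<ge>0. (t, y t $ i - yref C t $ i) \<in> funnel \<phi>) \<and>
        (\<exists>\<epsilon>>0. \<forall>t>0. \<bar>y t $ i - yref C t $ i\<bar> \<le> inverse (\<phi> t) - \<epsilon>)"
      \<comment> \<open>A chain of length 1 consists of its last error only, which belongs to
        \<open>e\<^sub>I\<close>.\<close>
      proof (cases "rdeg S i = 1")
        case True
        have "(phiI C t)\<^sup>2 * (norm (y t $ i - yref C t $ i))\<^sup>2 \<le> 1 - \<epsilon>" if "t \<ge> 0" for t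
          using comp[OF EI[OF that], of i] True i by (simp add: errI_def err_def)
        from funnel_uniform(1,2)[OF phiI order_refl \<epsilon> this] show ?thesis using True by (simp add: Let_def)
      next
        case False
        then have "0 + 2 \<le> rdeg S i" using r_pos[OF i] by simp
        from Fj(1,2)[OF i this] show ?thesis using False by (simp add: Let_def err_def)
      qed
    qed
    fix i assume i: "i \<notin> idxI S"
    have "(phiII C t)\<^sup>2 * (norm (y t $ i - yref C t $ i))\<^sup>2 \<le> 1 - \<epsilon>" if "t \<ge> 0" for t
      using comp[OF EII[OF that], of i] i by (simp add: errII_def)
    note F = funnel_uniform(1,2)[OF phiII order_refl \<epsilon> this]
    show "(t, y t $ i - yref C t $ i) \<in> funnel (phiII C)" if "0 \<le> t" for t using F(1) that by blast
    show "\<exists>\<epsilon>>0. \<forall>t>0. \<bar>y t $ i - yref C t $ i\<bar> \<le> inverse (phiII C t) - \<epsilon>" using F(2) by simp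
  qed (use solution_exists solution_extends in blast)+
qed

end
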